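(* Let $T$ be a rooted plane tree of depth $n\ge1$ which is not a path. The reduced permutahedral velocity fan $\overline{\mathcal F}(\mathscr O(T))$ is a smooth flag triangulation of the reduced triangulated velocity fan $\overline{\mathcal F}(\Delta_T)$.
   Context: **Trees.** A rooted plane tree $T$ is a finite rooted tree with a total order on the set $\mathrm{ch}(u)$ of children of every vertex $u$. $V^k(T)$ is the set of vertices at distance $k$ from the root; the depth of $T$ is the largest $k$ with $V^k(T)\ne\emptyset$. $V^k(T)$ is totally ordered lexicographically (compare the sequences of child-positions along the paths from the root); $u^k_i$ is its $i$-th element. $T$ has depth $n\ge1$ and is not a path. **Brackets.** For $0\le k\le n$ a $k$-bracket of $T$ is $A=(A^0,\dots,A^k)$ with $A^i\subseteq V^i(T)$, $A^k\neq\emptyset$, such that the parent of every $u\in A^i$ ($i\ge 1$) lies in $A^{i-1}$, and for every $u\in A^{i-1}$ the set $A^i\cap\mathrm{ch}(u)$ is a (possibly empty) set of consecutive elements of $\mathrm{ch}(u)$. For $k$-brackets, $A\subseteq A'$ means $A^i\subseteq A'^i$ for all $i$. For $k\ge1$, $\pi(A)=(A^0,\dots,A^{k-1})$. The singleton $k$-bracket $A(u)$ of $u\in V^k(T)$ has $A(u)^i=\{\text{the depth-}i\text{ vertex on the path from the root to }u\}$; the maximum $k$-bracket is $(V^0(T),\dots,V^k(T))$. A bracket is nontrivial if it is neither singleton nor maximum. **$n$-bracketings.** An $n$-bracketing $\mathcal B$ of $T$ consists of sets $\mathcal B^k$ of $k$-brackets ($0\le k\le n$) and a strict partial order $<_{\mathcal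 B}$ on $\bigsqcup_k\mathcal B^k$ such that, writing $\mathcal B_A=\{A'\in\mathcal B^{k}:\pi(A')=A\}$ for $A\in\mathcal B^{k-1}$: (1) $\mathcal B^k$ contains the maximum and all singleton $k$-brackets; (2) $A\in\mathcal B^k$, $k\ge1$, implies $\pi(A)\in\mathcal B^{k-1}$; (3) if $A_1,A_2\in\mathcal B^k$ and $A_1^k\cap A_2^k\ne\emptyset$ then $A_1\subseteq A_2$ or $A_2\subseteq A_1$; (4a) for $A\in\mathcal B^{k-1}$, $1\le k\le n$: $\bigcup_{A'\in\mathcal B_A}A'^k=\bigcup_{u\in A^{k-1}}\mathrm{ch}(u)$; (4b) if $A_1,A_2\in\mathcal B_A$, $A_2\subsetneq A_1$, then every $u'\in A_1^k$ lies in $A_3^k$ for some $A_3\in\mathcal B_A$ with $A_3\subsetneq A_1$; (5a) distinct elements $A_1,A_2\in\mathcal B^k$ are comparable under $<_{\mathcal B}$ iff $\pi(A_1)=\pi(A_2)$ and $A_1^k\cap A_2^k=\emptyset$ (elements of different levels are incomparable); (5b) if $u_1$ precedes $u_2$ in $\mathrm{ch}(u)$ then $A(u_1)<_{\mathcal B}A(u_2)$; (5c) if $A,\tilde A\in\mathcal B^{k-1}$, $\tilde A\subseteq A$, $A_1\ne A_2\in\mathcal B_A$ are comparable, $\tilde A_1\ne\tilde A_2\in\mathcal B_{\tilde A}$ are comparable, and $\tilde A_i\subseteq A_i$ for $i=1,2$, then $A_1<_{\mathcal B}A_2\iff\tilde A_1<_{\mathcal B}\tilde A_2$. The categorical $n$-associahedron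 $\mathcal K(T)$ is the set of $n$-bracketings of $T$ ordered by: $\mathcal B_1\le\mathcal B_2$ iff $\mathcal B_1^k\subseteq\mathcal B_2^k$ for all $k$ and $<_{\mathcal B_1}$ is the restriction of $<_{\mathcal B_2}$. Its minimum $\mathcal B_{\min}$ has only singleton and maximum brackets. **Collisions.** A collision is an atom of $\mathcal K(T)$ (a minimal element of $\mathcal K(T)\setminus\{\mathcal B_{\min}\}$). The fusion bracket of a collision $\mathcal C$ is the (unique) nonsingleton bracket $E_0$ of $\mathcal C$ such that $\pi(E_0)$ is a singleton bracket and $E_0=\pi^{l}(A')$ for some nontrivial $A'$ in $\mathcal C$ and $l\ge0$. A bracket $E$ of $\mathcal C$ is essential if $E=\pi^l(A')$ for some nontrivial $A'$ in $\mathcal C$, $l\ge0$, and $\pi^j(E)=E_0$ for some $j\ge0$. **Contraction.** Let $E_0\in\mathcal C^{k_0}$, $\pi(E_0)=A(w)$, $W=E_0^{k_0}\subseteq\mathrm{ch}(w)$. The rooted plane tree $T/\mathcal C$ is obtained from $T$ by removing $W$ and all its descendants and inserting a depth-$k$ vertex $v_E$ for each essential $E\in\mathcal C^k$: $v_{E_0}$ is a child of $w$ taking the place of the consecutive set $W$; the children of $v_E$ are the $v_{E'}$ with $E'$ essential, $\pi(E')=E$, ordered by $<_{\mathcal C}$. The map $\psi:V(T)\to V(T/\mathcal C)$ fixes the remaining vertices and sends a depth-$k$ vertex $v$ in or below $W$ to $v_E$, where $E\in\mathcal C^k$ is the unique essential bracket with $v\in E^k$. **Ray generators.** Put $t_k=|V^k(T)|-1$,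 $m=\sum_{k=1}^nt_k$; vectors in $\mathbb R^m$ have coordinates $x^k_i$, $1\le k\le n$, $1\le i\le t_k$. For a collision $\mathcal C$, $\rho(\mathcal C)^k_i=d(\psi(u^k_i))-d(\psi(u^k_{i+1}))+1$, where $d(v)$ is the position of $v$ in the ordered set $V^k(T/\mathcal C)$. $\mathbf 1$ is the all-ones vector. **Relations and fans.** For collisions, $\mathcal C_1\to\mathcal C_2$ if they have a common upper bound in $\mathcal K(T)$ and every essential $k$-bracket of $\mathcal C_1$ is contained in an essential $k$-bracket of $\mathcal C_2$ (for every $k$; in particular $\mathcal C\to\mathcal C$); $\mathcal C_1\sim\mathcal C_2$ if no vertex of $T$ is a weak descendant (equal to or descended from) both of a top-level vertex of the fusion bracket of $\mathcal C_1$ and of a top-level vertex of that of $\mathcal C_2$ (top level of a $k$-bracket $A$ is $A^k$). $\Delta_T$ is the simplicial complex of sets of collisions that can be listed $\mathcal C_1,\dots,\mathcal C_r$ with $\mathcal C_i\sim\mathcal C_j$ or $\mathcal C_i\to\mathcal C_j$ for all $i<j$; for $Y\in\Delta_T$, $\tau(Y)=\mathrm{cone}\{\rho(\mathcal C):\mathcal C\in Y\}+\mathbb R\mathbf 1$, and $\overline{\mathcal F}(\Delta_T)=\{\tau(Y)/\mathbb R\mathbf 1:Y\in\Delta_T\}$ in $\mathbb R^m/\mathbb R\mathbf 1$. A generalized collision is a nonempty set $\mathcal D=\{\mathcal C_1,\dots,\mathcal C_r\}$ of collisions with $\mathcal C_i\sim\mathcal C_j$ for all $i<j$; $\rho(\mathcal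 D)=\sum_i\rho(\mathcal C_i)$. Order generalized collisions by $\mathcal D_1\le\mathcal D_2$ iff for each $\mathcal C_1\in\mathcal D_1$ there is $\mathcal C_2\in\mathcal D_2$ with $\mathcal C_1\to\mathcal C_2$. $\mathscr O(T)$ is the order complex (simplicial complex of chains) of this poset. For $Z\in\mathscr O(T)$, $\tau(Z)=\mathrm{cone}\{\rho(\mathcal D):\mathcal D\in Z\}+\mathbb R\mathbf 1$, and $\overline{\mathcal F}(\mathscr O(T))=\{\tau(Z)/\mathbb R\mathbf 1:Z\in\mathscr O(T)\}$. A triangulation of a fan $\mathcal F$ is a fan with the same support, all of whose cones are simplicial, such that every cone of $\mathcal F$ is a union of its cones. A simplicial fan is flag if its associated simplicial complex on the rays is a flag (clique) complex. It is smooth if every cone has ray generators extending to a basis of $\mathbb Z^m/\mathbb Z\mathbf 1$. *)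

theory Defs
  imports "HOL-Analysis.Analysis" "HOL-Analysis.Finite_Function_Topology"
begin

section \<open>Rooted plane trees\<close>

text \<open>The order on the children of a vertex is the order of the list \<open>ch T u\<close>.
  The value of \<open>ch T\<close> outside \<open>verts T\<close> is irrelevant.\<close>

record 'v ptree =
  verts :: "'v set"
  root :: 'v
  ch :: "'v \<Rightarrow> 'v list"

definition edges :: "'v ptree \<Rightarrow> ('v \<times> 'v) set" where
  "edges T = {(u, v). u \<in> verts T \<and> v \<in> set (ch T u)}"

definition rooted_plane_tree :: "'v ptree \<Rightarrow> bool" where
  "rooted_plane_tree T \<longleftrightarrow>
     finite (verts T) \<and> root T \<in> verts T \<and>
     (\<forall>u\<in>verts T. distinct (ch T u) \<and> set (ch T u) \<subseteq> verts T) \<and>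
     (\<forall>u. (u, root T) \<notin> edges T) \<and>
     (\<forall>v\<in>verts T. v \<noteq> root T \<longrightarrow> (\<exists>!u. (u, v) \<in> edges T)) \<and>
     (\<forall>v\<in>verts T. (root T, v) \<in> (edges T)\<^sup>*)"

definition parent :: "'v ptree \<Rightarrow> 'v \<Rightarrow> 'v" where
  "parent T v = (THE u. (u, v) \<in> edges T)"

definition weak_desc :: "'v ptree \<Rightarrow> 'v \<Rightarrow> 'v \<Rightarrow> bool" where
  "weak_desc T u v \<longleftrightarrow> (u, v) \<in> (edges T)\<^sup>*"

definition level :: "'v ptree \<Rightarrow> nat \<Rightarrow> 'v set" where
  "level T k = {v \<in> verts T. (root T, v) \<in> edges T ^^ k}"

definition vdepth :: "'v ptree \<Rightarrow> 'v \<Rightarrow> nat" where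
  "vdepth T v = (THE k. v \<in> level T k)"

definition depth :: "'v ptree \<Rightarrow> nat" where
  "depth T = Max {k. level T k \<noteq> {}}"

definition is_path_tree :: "'v ptree \<Rightarrow> bool" where
  "is_path_tree T \<longleftrightarrow> (\<forall>u\<in>verts T. length (ch T u) \<le> 1)"

text \<open>\<open>addr T p v\<close>: \<open>p\<close> is the sequence of (0-based) child positions along the path
  from the root to \<open>v\<close>.\<close>

inductive addr :: "'v ptree \<Rightarrow> nat list \<Rightarrow> 'v \<Rightarrow> bool" for T where
  addr_root: "addr T [] (root T)"
| addr_child: "addr T p u \<Longrightarrow> i < length (ch T u) \<Longrightarrow> addr T (p @ [i]) (ch T u ! i)"

definition lex_before :: "'v ptree \<Rightarrow> 'v \<Rightarrow> 'v \<Rightarrow> bool" where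
  "lex_before T u v \<longleftrightarrow> (\<exists>p q. addr T p u \<and> addr T q v \<and> (p, q) \<in> lexord less_than)"

text \<open>Positions are 1-based.\<close>

definition pos :: "'v ptree \<Rightarrow> 'v \<Rightarrow> nat" where
  "pos T v = Suc (card {u \<in> level T (vdepth T v). lex_before T u v})"

definition nth_vert :: "'v ptree \<Rightarrow> nat \<Rightarrow> nat \<Rightarrow> 'v" where
  "nth_vert T k i = (THE u. u \<in> level T k \<and> pos T u = i)"


section \<open>Brackets\<close>

text \<open>A \<open>k\<close>-bracket \<open>(A\<^sup>0, \<dots>, A\<^sup>k)\<close> is a list of length \<open>k + 1\<close>; hence \<open>A\<^sup>k\<close> is \<open>last A\<close>
  and the projection \<open>\<pi>\<close> is \<^const>\<open>butlast\<close>. Brackets of different levels have different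
  lengths, so a family of sets of \<open>k\<close>-brackets is kept as one set.\<close>

type_synonym 'v bracket = "'v set list"

definition consecutive :: "'a list \<Rightarrow> 'a set \<Rightarrow> bool" where
  "consecutive xs S \<longleftrightarrow> (\<exists>as bs cs. xs = as @ bs @ cs \<and> set bs = S)"

definition is_bracket :: "'v ptree \<Rightarrow> nat \<Rightarrow> 'v bracket \<Rightarrow> bool" where
  "is_bracket T k A \<longleftrightarrow>
     k \<le> depth T \<and> length A = Suc k \<and> (\<forall>i\<le>k. A ! i \<subseteq> level T i) \<and> A ! k \<noteq> {} \<and>
     (\<forall>i\<in>{1..k}. (\<forall>u\<in>A ! i. parent T u \<in> A ! (i - 1)) \<and>
        (\<forall>u\<in>A ! (i - 1). consecutive (ch T u) (A ! i \<inter> set (ch T u))))"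

definition bsub :: "'v bracket \<Rightarrow> 'v bracket \<Rightarrow> bool" where
  "bsub A A' \<longleftrightarrow> list_all2 (\<subseteq>) A A'"

definition sing_bracket :: "'v ptree \<Rightarrow> 'v \<Rightarrow> 'v bracket" where
  "sing_bracket T u = map (\<lambda>i. {w \<in> level T i. weak_desc T w u}) [0..<Suc (vdepth T u)]"

definition max_bracket :: "'v ptree \<Rightarrow> nat \<Rightarrow> 'v bracket" where
  "max_bracket T k = map (level T) [0..<Suc k]"

definition is_sing :: "'v ptree \<Rightarrow> 'v bracket \<Rightarrow> bool" where
  "is_sing T A \<longleftrightarrow> (\<exists>u\<in>verts T. A = sing_bracket T u)"

definition nontrivial :: "'v ptree \<Rightarrow> 'v bracket \<Rightarrow> bool" where
  "nontrivial T A \<longleftrightarrow> \<not> is_sing T A \<and> (\<forall>k\<le>depth T. A \<noteq> max_bracket T k)"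


section \<open>Bracketings and the categorical associahedron\<close>

record 'v bracketing =
  brs :: "'v bracket set"
  prec :: "('v bracket \<times> 'v bracket) set"

definition blevel :: "'v bracketing \<Rightarrow> nat \<Rightarrow> 'v bracket set" where
  "blevel B k = {A \<in> brs B. length A = Suc k}"

definition over :: "'v bracketing \<Rightarrow> 'v bracket \<Rightarrow> 'v bracket set" where
  "over B A = {A' \<in> blevel B (length A). butlast A' = A}"

definition comparable :: "'v bracketing \<Rightarrow> 'v bracket \<Rightarrow> 'v bracket \<Rightarrow> bool" where
  "comparable B A A' \<longleftrightarrow> (A, A') \<in> prec B \<or> (A', A) \<in> prec B"

definition is_bracketing :: "'v ptree \<Rightarrow> 'v bracketing \<Rightarrow> bool" where
  "is_bracketing T B \<longleftrightarrow>
     (\<forall>A\<in>brs B. \<exists>k\<le>depth T. is_bracket T k A) \<and>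
     prec B \<subseteq> brs B \<times> brs B \<and> irrefl (prec B) \<and> trans (prec B) \<and>
     (\<forall>k\<le>depth T. max_bracket T k \<in> brs B \<and> (\<forall>u\<in>level T k. sing_bracket T u \<in> brs B)) \<and>
     (\<forall>k\<in>{1..depth T}. \<forall>A\<in>blevel B k. butlast A \<in> blevel B (k - 1)) \<and>
     (\<forall>k\<le>depth T. \<forall>A1\<in>blevel B k. \<forall>A2\<in>blevel B k.
        last A1 \<inter> last A2 \<noteq> {} \<longrightarrow> bsub A1 A2 \<or> bsub A2 A1) \<and>
     (\<forall>k\<in>{1..depth T}. \<forall>A\<in>blevel B (k - 1).
        (\<Union>A'\<in>over B A. last A') = (\<Union>u\<in>last A. set (ch T u))) \<and>
     (\<forall>k\<in>{1..depth T}. \<forall>A\<in>blevel B (k - 1). \<forall>A1\<in>over B A. \<forall>A2\<in>over B A.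
        bsub A2 A1 \<and> A2 \<noteq> A1 \<longrightarrow>
        (\<forall>u\<in>last A1. \<exists>A3\<in>over B A. u \<in> last A3 \<and> bsub A3 A1 \<and> A3 \<noteq> A1)) \<and>
     (\<forall>k\<le>depth T. \<forall>A1\<in>blevel B k. \<forall>A2\<in>blevel B k. A1 \<noteq> A2 \<longrightarrow>
        (comparable B A1 A2 \<longleftrightarrow> butlast A1 = butlast A2 \<and> last A1 \<inter> last A2 = {})) \<and>
     (\<forall>(A1, A2)\<in>prec B. length A1 = length A2) \<and>
     (\<forall>u\<in>verts T. \<forall>i j. i < j \<and> j < length (ch T u) \<longrightarrow>
        (sing_bracket T (ch T u ! i), sing_bracket T (ch T u ! j)) \<in> prec B) \<and>
     (\<forall>k\<in>{1..depth T}. \<forall>A\<in>blevel B (k - 1). \<forall>A'\<in>blevel B (k - 1).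
        \<forall>A1\<in>over B A. \<forall>A2\<in>over B A. \<forall>A1'\<in>over B A'. \<forall>A2'\<in>over B A'.
        bsub A' A \<and> A1 \<noteq> A2 \<and> comparable B A1 A2 \<and> A1' \<noteq> A2' \<and> comparable B A1' A2' \<and>
        bsub A1' A1 \<and> bsub A2' A2 \<longrightarrow>
        ((A1, A2) \<in> prec B \<longleftrightarrow> (A1', A2') \<in> prec B))"

definition bracketings :: "'v ptree \<Rightarrow> 'v bracketing set" where
  "bracketings T = {B. is_bracketing T B}"

definition bracketing_le :: "'v bracketing \<Rightarrow> 'v bracketing \<Rightarrow> bool" where
  "bracketing_le B1 B2 \<longleftrightarrow>
     brs B1 \<subseteq> brs B2 \<and> prec B1 = prec B2 \<inter> (brs B1 \<times> brs B1)"

definition is_minimum :: "'v ptree \<Rightarrow> 'v bracketing \<Rightarrow> bool" where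
  "is_minimum T B \<longleftrightarrow> B \<in> bracketings T \<and> (\<forall>B'\<in>bracketings T. bracketing_le B B')"


section \<open>Collisions\<close>

definition collision :: "'v ptree \<Rightarrow> 'v bracketing \<Rightarrow> bool" where
  "collision T C \<longleftrightarrow> C \<in> bracketings T \<and> \<not> is_minimum T C \<and>
     (\<forall>B\<in>bracketings T. \<not> is_minimum T B \<and> bracketing_le B C \<longrightarrow> B = C)"

text \<open>A power of \<^const>\<open>butlast\<close> that exceeds the level yields the empty list, which is never a
  bracket, so the unbounded exponents here and in \<open>essential\<close> are harmless.\<close>

definition proj_of_nontrivial :: "'v ptree \<Rightarrow> 'v bracketing \<Rightarrow> 'v bracket \<Rightarrow> bool" where
  "proj_of_nontrivial T C E \<longleftrightarrow>
     E \<in> brs C \<and> (\<exists>A'\<in>brs C. \<exists>l. nontrivial T A' \<and> E = (butlast ^^ l) A')"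

definition fusion :: "'v ptree \<Rightarrow> 'v bracketing \<Rightarrow> 'v bracket" where
  "fusion T C = (THE E. \<not> is_sing T E \<and> is_sing T (butlast E) \<and> proj_of_nontrivial T C E)"

definition essential :: "'v ptree \<Rightarrow> 'v bracketing \<Rightarrow> 'v bracket set" where
  "essential T C =
     {E. proj_of_nontrivial T C E \<and> (\<exists>j. (butlast ^^ j) E = fusion T C)}"


section \<open>Contraction and ray generators\<close>

definition fused :: "'v ptree \<Rightarrow> 'v bracketing \<Rightarrow> 'v set" where
  "fused T C = last (fusion T C)"

definition fusion_base :: "'v ptree \<Rightarrow> 'v bracketing \<Rightarrow> 'v" where
  "fusion_base T C = (THE w. w \<in> verts T \<and> butlast (fusion T C) = sing_bracket T w)"

definition weakly_below :: "'v ptree \<Rightarrow> 'v set \<Rightarrow> 'v set" where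
  "weakly_below T W = {v. \<exists>w\<in>W. weak_desc T w v}"

text \<open>Surviving vertices \<open>v\<close> of \<open>T\<close> become \<open>Inl v\<close>; the new vertex \<open>v\<^sub>E\<close> of an
  essential bracket \<open>E\<close> is \<open>Inr E\<close>.\<close>

definition contract :: "'v ptree \<Rightarrow> 'v bracketing \<Rightarrow> ('v + 'v bracket) ptree" where
  "contract T C = \<lparr>
     verts = Inl ` (verts T - weakly_below T (fused T C)) \<union> Inr ` essential T C,
     root = Inl (root T),
     ch = (\<lambda>x. case x of
         Inl u \<Rightarrow>
           (if u = fusion_base T C
            then map Inl (takeWhile (\<lambda>v. v \<notin> fused T C) (ch T u)) @ [Inr (fusion T C)] @
                 map Inl (dropWhile (\<lambda>v. v \<in> fused T C)
                            (dropWhile (\<lambda>v. v \<notin> fused T C) (ch T u)))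
            else map Inl (ch T u))
       | Inr E \<Rightarrow>
           map Inr (THE Es. distinct Es \<and> set Es = {E' \<in> essential T C. butlast E' = E} \<and>
                            sorted_wrt (\<lambda>E1 E2. (E1, E2) \<in> prec C) Es)) \<rparr>"

definition psi :: "'v ptree \<Rightarrow> 'v bracketing \<Rightarrow> 'v \<Rightarrow> 'v + 'v bracket" where
  "psi T C v =
     (if v \<in> weakly_below T (fused T C)
      then Inr (THE E. E \<in> essential T C \<and> E \<in> blevel C (vdepth T v) \<and> v \<in> last E)
      else Inl v)"

text \<open>\<open>\<real>\<^sup>m\<close> consists of the finitely supported functions on index pairs \<open>(k, i)\<close>
  whose support lies in \<open>coords T\<close>.\<close>

type_synonym coordvec = "(nat \<times> nat) \<Rightarrow>\<^sub>0 real"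

definition coords :: "'v ptree \<Rightarrow> (nat \<times> nat) set" where
  "coords T = (SIGMA k:{1..depth T}. {1..card (level T k) - 1})"

definition Rm :: "'v ptree \<Rightarrow> coordvec set" where
  "Rm T = {x. Poly_Mapping.keys x \<subseteq> coords T}"

definition Zm :: "'v ptree \<Rightarrow> coordvec set" where
  "Zm T = {x \<in> Rm T. \<forall>p. Poly_Mapping.lookup x p \<in> \<int>}"

lift_definition mk_vec :: "'v ptree \<Rightarrow> (nat \<Rightarrow> nat \<Rightarrow> real) \<Rightarrow> coordvec" is
  "\<lambda>T f (k, i). if (k, i) \<in> coords T then f k i else 0"
proof -
  fix T :: "'v ptree" and f :: "nat \<Rightarrow> nat \<Rightarrow> real"
  have "finite (coords T)"
    by (simp add: coords_def)
  then show "finite {x. (case x of (k, i) \<Rightarrow> if (k, i) \<in> coords T then f k i else 0) \<noteq> 0}"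
    by (rule rev_finite_subset) (auto split: if_splits)
qed

definition ones :: "'v ptree \<Rightarrow> coordvec" where
  "ones T = mk_vec T (\<lambda>k i. 1)"

definition rho :: "'v ptree \<Rightarrow> 'v bracketing \<Rightarrow> coordvec" where
  "rho T C = mk_vec T (\<lambda>k i.
     real (pos (contract T C) (psi T C (nth_vert T k i)))
     - real (pos (contract T C) (psi T C (nth_vert T k (i + 1)))) + 1)"


section \<open>Relations between collisions, and the two families of cones\<close>

definition arrow :: "'v ptree \<Rightarrow> 'v bracketing \<Rightarrow> 'v bracketing \<Rightarrow> bool" where
  "arrow T C1 C2 \<longleftrightarrow>
     (\<exists>B\<in>bracketings T. bracketing_le C1 B \<and> bracketing_le C2 B) \<and>
     (\<forall>E1\<in>essential T C1. \<exists>E2\<in>essential T C2. bsub E1 E2)"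

definition separated :: "'v ptree \<Rightarrow> 'v bracketing \<Rightarrow> 'v bracketing \<Rightarrow> bool" where
  "separated T C1 C2 \<longleftrightarrow>
     (\<forall>v\<in>verts T. \<not> (v \<in> weakly_below T (fused T C1) \<and> v \<in> weakly_below T (fused T C2)))"

definition Delta :: "'v ptree \<Rightarrow> 'v bracketing set set" where
  "Delta T = {set Cs | Cs. distinct Cs \<and> (\<forall>C\<in>set Cs. collision T C) \<and>
     (\<forall>i j. i < j \<and> j < length Cs \<longrightarrow>
        separated T (Cs ! i) (Cs ! j) \<or> arrow T (Cs ! i) (Cs ! j))}"

definition gen_collision :: "'v ptree \<Rightarrow> 'v bracketing set \<Rightarrow> bool" where
  "gen_collision T D \<longleftrightarrow> D \<noteq> {} \<and> finite D \<and> (\<forall>C\<in>D. collision T C) \<and>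
     (\<forall>C1\<in>D. \<forall>C2\<in>D. C1 \<noteq> C2 \<longrightarrow> separated T C1 C2)"

definition rho_gen :: "'v ptree \<Rightarrow> 'v bracketing set \<Rightarrow> coordvec" where
  "rho_gen T D = (\<Sum>C\<in>D. rho T C)"

definition gen_le :: "'v ptree \<Rightarrow> 'v bracketing set \<Rightarrow> 'v bracketing set \<Rightarrow> bool" where
  "gen_le T D1 D2 \<longleftrightarrow> (\<forall>C1\<in>D1. \<exists>C2\<in>D2. arrow T C1 C2)"

definition Order_cplx :: "'v ptree \<Rightarrow> 'v bracketing set set set" where
  "Order_cplx T = {Z. finite Z \<and> (\<forall>D\<in>Z. gen_collision T D) \<and>
     (\<forall>D1\<in>Z. \<forall>D2\<in>Z. gen_le T D1 D2 \<or> gen_le T D2 D1)}"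

definition tau :: "'v ptree \<Rightarrow> coordvec set \<Rightarrow> coordvec set" where
  "tau T G = {x + c *\<^sub>R ones T | x c. x \<in> convex_cone hull G}"

text \<open>The quotient \<open>\<real>\<^sup>m / \<real>\<one>\<close> depends on the value \<open>T\<close>, so it cannot be a fixed type.
  It is represented by an arbitrary linear map \<open>q\<close> into a real vector space whose kernel on
  \<open>\<real>\<^sup>m\<close> is \<open>\<real>\<one>\<close>: the quotient space is \<open>q ` Rm T\<close>, the image \<open>\<tau> / \<real>\<one>\<close> of a cone is \<open>q ` \<tau>\<close>,
  and the lattice \<open>\<int>\<^sup>m / \<int>\<one>\<close> is \<open>q ` Zm T\<close>.\<close>

definition quotient_by_ones :: "'v ptree \<Rightarrow> (coordvec \<Rightarrow> 'q::real_vector) \<Rightarrow> bool" where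
  "quotient_by_ones T q \<longleftrightarrow>
     linear q \<and> {x \<in> Rm T. q x = 0} = range (\<lambda>c. c *\<^sub>R ones T)"

lemma lookup_scaleR:
  "Poly_Mapping.lookup (c *\<^sub>R x) p = c *\<^sub>R Poly_Mapping.lookup x p"
proof -
  have "finite {p. c *\<^sub>R Poly_Mapping.lookup x p \<noteq> 0}"
    by (rule rev_finite_subset[OF finite_lookup[of x]]) auto
  then show ?thesis
    by (simp add: scaleR_poly_mapping_def)
qed

lemma quotient_by_ones_exists: "\<exists>q :: coordvec \<Rightarrow> coordvec. quotient_by_ones T q"
proof (cases "coords T = {}")
  case True
  then have "ones T = 0" and "Rm T = {0}"
    by (auto simp: ones_def Rm_def mk_vec.rep_eq intro!: poly_mapping_eqI)
  then have "quotient_by_ones T (\<lambda>x. x)"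
    by (auto simp: quotient_by_ones_def intro: linear_ident)
  then show ?thesis
    by blast
next
  case False
  then obtain p where p: "p \<in> coords T"
    by blast
  have ones: "Poly_Mapping.lookup (ones T) r = (if r \<in> coords T then 1 else 0)" for r
    by (cases r) (simp add: ones_def mk_vec.rep_eq)
  define q where "q = (\<lambda>x. x - Poly_Mapping.lookup x p *\<^sub>R ones T)"
  have lin: "linear q"
    by (rule linearI) (simp_all add: q_def lookup_add lookup_scaleR algebra_simps)
  have "{x \<in> Rm T. q x = 0} = range (\<lambda>c. c *\<^sub>R ones T)"
  proof (intro set_eqI iffI)
    fix x assume "x \<in> {x \<in> Rm T. q x = 0}"
    then have "x = Poly_Mapping.lookup x p *\<^sub>R ones T"
      by (simp add: q_def)
    then show "x \<in> range (\<lambda>c. c *\<^sub>R ones T)"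
      by blast
  next
    fix x assume "x \<in> range (\<lambda>c. c *\<^sub>R ones T)"
    then obtain c where c: "x = c *\<^sub>R ones T"
      by blast
    have "Poly_Mapping.keys x \<subseteq> coords T"
      unfolding c by (auto simp: in_keys_iff ones lookup_scaleR split: if_splits)
    then show "x \<in> {x \<in> Rm T. q x = 0}"
      using p by (simp add: c q_def Rm_def ones lookup_scaleR)
  qed
  then show ?thesis
    using lin quotient_by_ones_def by blast
qed

definition permutahedral_fan :: "'v ptree \<Rightarrow> (coordvec \<Rightarrow> 'q::real_vector) \<Rightarrow> 'q set set" where
  "permutahedral_fan T q = {q ` tau T (rho_gen T ` Z) | Z. Z \<in> Order_cplx T}"

definition triangulated_velocity_fan :: "'v ptree \<Rightarrow> (coordvec \<Rightarrow> 'q::real_vector) \<Rightarrow> 'q set set" where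
  "triangulated_velocity_fan T q = {q ` tau T (rho T ` Y) | Y. Y \<in> Delta T}"


section \<open>Fans\<close>

definition polyhedral_cone :: "'a::real_vector set \<Rightarrow> bool" where
  "polyhedral_cone \<sigma> \<longleftrightarrow> (\<exists>G. finite G \<and> \<sigma> = convex_cone hull G)"

definition simplicial_cone :: "'a::real_vector set \<Rightarrow> bool" where
  "simplicial_cone \<sigma> \<longleftrightarrow> (\<exists>G. finite G \<and> independent G \<and> \<sigma> = convex_cone hull G)"

text \<open>\<^const>\<open>face_of\<close> counts the empty set as a face; faces of cones are nonempty.\<close>

definition is_fan :: "'a::real_vector set set \<Rightarrow> bool" where
  "is_fan F \<longleftrightarrow> finite F \<and> F \<noteq> {} \<and> (\<forall>\<sigma>\<in>F. polyhedral_cone \<sigma>) \<and>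
     (\<forall>\<sigma>\<in>F. \<forall>\<phi>. \<phi> face_of \<sigma> \<and> \<phi> \<noteq> {} \<longrightarrow> \<phi> \<in> F) \<and>
     (\<forall>\<sigma>\<in>F. \<forall>\<sigma>'\<in>F. \<sigma> \<inter> \<sigma>' face_of \<sigma> \<and> \<sigma> \<inter> \<sigma>' face_of \<sigma>')"

definition is_triangulation_of :: "'a::real_vector set set \<Rightarrow> 'a set set \<Rightarrow> bool" where
  "is_triangulation_of F' F \<longleftrightarrow> is_fan F \<and> is_fan F' \<and> \<Union>F' = \<Union>F \<and>
     (\<forall>\<sigma>\<in>F'. simplicial_cone \<sigma>) \<and> (\<forall>\<sigma>\<in>F. \<exists>S\<subseteq>F'. \<sigma> = \<Union>S)"

definition fan_rays :: "'a::real_vector set set \<Rightarrow> 'a set set" where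
  "fan_rays F = {r \<in> F. \<exists>g. g \<noteq> 0 \<and> r = convex_cone hull {g}}"

text \<open>A cone of a simplicial fan is recorded by the set of its one-dimensional faces.\<close>

definition fan_complex :: "'a::real_vector set set \<Rightarrow> 'a set set set" where
  "fan_complex F = {{r \<in> fan_rays F. r face_of \<sigma>} | \<sigma>. \<sigma> \<in> F}"

definition flag_complex :: "'b set \<Rightarrow> 'b set set \<Rightarrow> bool" where
  "flag_complex V K \<longleftrightarrow>
     (\<forall>S\<subseteq>V. finite S \<and> (\<forall>r\<in>S. \<forall>s\<in>S. {r, s} \<in> K) \<longrightarrow> S \<in> K)"

definition flag_fan :: "'a::real_vector set set \<Rightarrow> bool" where
  "flag_fan F \<longleftrightarrow> flag_complex (fan_rays F) (fan_complex F)"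

definition lattice_basis :: "'a::real_vector set \<Rightarrow> 'a set \<Rightarrow> bool" where
  "lattice_basis L B \<longleftrightarrow> finite B \<and>
     L = range (\<lambda>c::'a \<Rightarrow> int. \<Sum>b\<in>B. of_int (c b) *\<^sub>R b) \<and>
     (\<forall>c::'a \<Rightarrow> int. (\<Sum>b\<in>B. of_int (c b) *\<^sub>R b) = 0 \<longrightarrow> (\<forall>b\<in>B. c b = 0))"

text \<open>A generating set \<open>G\<close> contained in a basis of the lattice consists of exactly one primitive
  lattice generator for each ray of the cone.\<close>

definition smooth_fan :: "'a::real_vector set \<Rightarrow> 'a set set \<Rightarrow> bool" where
  "smooth_fan L F \<longleftrightarrow>
     (\<forall>\<sigma>\<in>F. \<exists>G B. \<sigma> = convex_cone hull G \<and> G \<subseteq> B \<and> lattice_basis L B)"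

end

theory Submission
  imports Defs
begin

text \<open>Contracting a collision (or a family of pairwise separated collisions) \<open>D\<close> numbers the vertices of
  each level by their positions in the contracted tree, and up to constants on levels the partial sums
  of the coordinates of \<open>rho D\<close> are the differences between the original positions and the new ones.
  A point of a cone of the permutahedral fan is thus a weighted sum of position functions along a chain
  of ever coarser contractions, whose order of the children of fused vertices never gets reversed.  Hence
  the finest contraction of the chain can be read off the sum level by level, starting at the root, and
  peeling it off shows that the representation is unique.  This gives all fan properties of the
  permutahedral cones at once.  Cones of the triangulated velocity fan inherit uniqueness, since peeling
  off maximal collisions turns a weighted forest of collisions into a weighted chain of antichains with
  the same sum.  For smoothness, consecutive members of a chain are distinguished by a pair of vertices
  that are adjacent in one contraction and merged in the next; the corresponding differences of partial
  sums form a unitriangular system of integral functionals.\<close>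

section \<open>Fans from systems of rays with unique positive representations\<close>

text \<open>Working modulo \<open>ones T\<close> hides one number. Adding a multiple of
  \<open>ones T\<close> changes every partial sum, up to a constant, by that multiple of the
  original position, so only the total weight plus this multiple is visible, and it must be pinned
  down before anything else is compared. Vertices merged by every member of a chain do this, since
  the weighted position functions agree there; for the empty chain two siblings serve, which exist
  because \<open>T\<close> is not a path. Signs on a level are meaningful only for vertices whose
  parents are already merged: a coarser contraction that merges the parents is free to reorder the
  children. Monotonicity along the tree decides the remaining pairs. Finally, \<open>arrow\<close>
  asks for a common upper bound besides containment, and such bounds do not visibly compose.
  Transitivity is therefore used for containment alone, and comparability inside a given chain or
  simplex restores the bound. The bound matters because the orders of both collisions are
  restrictions of its order, so that the compatibility axiom acts across the two.\<close>

lemma convex_cone_hull_image: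
  fixes r :: "'i \<Rightarrow> 'a::real_vector"
  assumes "finite Z"
  shows "convex_cone hull (r ` Z) = {\<Sum>i\<in>Z. a i *\<^sub>R r i | a. \<forall>i. 0 \<le> a i}" (is "_ = ?C")
proof (rule hull_unique)
  show "r ` Z \<subseteq> ?C"
  proof
    fix x assume "x \<in> r ` Z"
    then obtain j where j: "j \<in> Z" "x = r j" by blast
    have "(\<Sum>i\<in>Z. (if i = j then 1 else 0) *\<^sub>R r i) = (\<Sum>i\<in>Z. if i = j then r i else 0)"
      by (rule sum.cong) auto
    then have "x = (\<Sum>i\<in>Z. (if i = j then 1 else 0) *\<^sub>R r i)"
      using j assms by simp
    then show "x \<in> ?C"
      by (intro CollectI exI[of _ "\<lambda>i. if i = j then 1 else 0"]) auto
  qed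
  show "convex_cone ?C"
    unfolding convex_cone_iff
  proof (intro conjI ballI allI impI)
    show "0 \<in> ?C"
      by (intro CollectI exI[of _ "\<lambda>i. 0"]) auto
  next
    fix x y assume "x \<in> ?C" "y \<in> ?C"
    then obtain a b where "\<forall>i. 0 \<le> a i" "\<forall>i. 0 \<le> b i"
      "x = (\<Sum>i\<in>Z. a i *\<^sub>R r i)" "y = (\<Sum>i\<in>Z. b i *\<^sub>R r i)"
      by blast
    then show "x + y \<in> ?C"
      by (intro CollectI exI[of _ "\<lambda>i. a i + b i"]) (auto simp: scaleR_add_left sum.distrib)
  next
    fix x and c :: real assume "x \<in> ?C" "0 \<le> c"
    then obtain a where "\<forall>i. 0 \<le> a i" "x = (\<Sum>i\<in>Z. a i *\<^sub>R r i)"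
      by blast
    then show "c *\<^sub>R x \<in> ?C"
      using \<open>0 \<le> c\<close> by (intro CollectI exI[of _ "\<lambda>i. c * a i"]) (auto simp: scaleR_sum_right)
  qed
  fix t assume t: "r ` Z \<subseteq> t" "convex_cone t"
  have "(\<Sum>i\<in>Y. a i *\<^sub>R r i) \<in> t" if "\<forall>i. 0 \<le> a i" "Y \<subseteq> Z" for a Y
    using finite_subset[OF that(2) assms] that(2)
  proof (induction Y rule: finite_induct)
    case empty
    then show ?case using t(2) convex_cone_iff by auto
  next
    case (insert x F)
    have "r x \<in> t" using t(1) insert.prems by blast
    then have "a x *\<^sub>R r x \<in> t" using t(2) that(1) by (simp add: convex_cone_iff)
    then show ?case using insert t(2) by (simp add: convex_cone_iff)
  qed
  then show "?C \<subseteq> t" by blast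
qed

text \<open>If \<open>x\<close> lies in the face, then for \<open>c > 1\<close> it is interior to
  the segment from \<open>0\<close> to \<open>c *\<^sub>R x\<close>, so both ends lie in the face.
  Convexity with \<open>0\<close> covers the other factors.\<close>

lemma face_of_conic_is_convex_cone:
  assumes "convex_cone S" "\<phi> face_of S" "\<phi> \<noteq> {}"
  shows "convex_cone \<phi>"
proof -
  have S: "0 \<in> S" "\<And>x c. x \<in> S \<Longrightarrow> 0 \<le> c \<Longrightarrow> c *\<^sub>R x \<in> S"
    using assms(1) by (auto simp: convex_cone_iff)
  have sub: "\<phi> \<subseteq> S" and conv: "convex \<phi>"
    and fc: "\<And>a b x. a \<in> S \<Longrightarrow> b \<in> S \<Longrightarrow> x \<in> \<phi> \<Longrightarrow> x \<in> open_segment a b \<Longrightarrow> a \<in> \<phi> \<and> b \<in> \<phi>"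
    using assms(2) unfolding face_of_def by blast+
  have big: "c *\<^sub>R x \<in> \<phi> \<and> 0 \<in> \<phi>" if x: "x \<in> \<phi>" and c: "c > 1" for x c
  proof (cases "x = 0")
    case True
    then show ?thesis using x by simp
  next
    case False
    have "x = (1 - 1 / c) *\<^sub>R 0 + (1 / c) *\<^sub>R (c *\<^sub>R x)"
      using c by simp
    moreover have "0 < 1 / c" "1 / c < 1" "0 \<noteq> c *\<^sub>R x"
      using c False by auto
    ultimately have "x \<in> open_segment 0 (c *\<^sub>R x)"
      unfolding in_segment by (intro conjI exI[of _ "1 / c"]) auto
    moreover have "c *\<^sub>R x \<in> S"
      using S(2) c sub x by auto
    ultimately show ?thesis
      using fc[OF S(1)] x by blast
  qed
  obtain x0 where "x0 \<in> \<phi>" using assms(3) by blast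
  then have z: "0 \<in> \<phi>" using big[of x0 2] by simp
  have sc: "c *\<^sub>R x \<in> \<phi>" if "x \<in> \<phi>" "0 \<le> c" for x c
  proof (cases "c > 1")
    case True
    then show ?thesis using big that by blast
  next
    case False
    have "(1 - c) *\<^sub>R 0 + c *\<^sub>R x \<in> \<phi>"
      using conv z that False unfolding convex_def by (metis add.commute diff_add_cancel diff_ge_0_iff_ge not_le)
    then show ?thesis by simp
  qed
  show ?thesis
    using assms(3) conv sc unfolding convex_cone_def conic_def by blast
qed

text \<open>Coefficients are total functions whose support is a simplex, so representations in
  different simplices are compared as functions. This makes \<open>unique_rep\<close> yield both
  linear independence inside a simplex and the correct intersection of cones.\<close>

locale simplicial_rays =
  fixes K :: "'i set set" and r :: "'i \<Rightarrow> 'a::real_vector"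
  assumes finite_complex: "finite K" and empty_simplex: "{} \<in> K"
    and finite_simplex: "Z \<in> K \<Longrightarrow> finite Z"
    and simplex_subset: "Z \<in> K \<Longrightarrow> Z' \<subseteq> Z \<Longrightarrow> Z' \<in> K"
    and unique_rep: "\<lbrakk>\<forall>i. 0 \<le> a i; \<forall>i. 0 \<le> b i; {i. a i \<noteq> 0} \<in> K; {i. b i \<noteq> 0} \<in> K;
      (\<Sum>i | a i \<noteq> 0. a i *\<^sub>R r i) = (\<Sum>i | b i \<noteq> 0. b i *\<^sub>R r i)\<rbrakk> \<Longrightarrow> a = b"
begin

section \<open>Intersections, faces and independence in a system of rays\<close>

definition spanned :: "'i set \<Rightarrow> 'a set" where
  "spanned Z = convex_cone hull (r ` Z)"

definition fan :: "'a set set" where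
  "fan = spanned ` K"

lemma spannedE:
  assumes "Z \<in> K" "x \<in> spanned Z"
  obtains a where "\<forall>i. 0 \<le> a i" "\<forall>i. i \<notin> Z \<longrightarrow> a i = 0" "x = (\<Sum>i\<in>Z. a i *\<^sub>R r i)"
proof -
  obtain a where a: "\<forall>i. 0 \<le> a i" "x = (\<Sum>i\<in>Z. a i *\<^sub>R r i)"
    using assms(2) convex_cone_hull_image[OF finite_simplex[OF assms(1)], of r]
    unfolding spanned_def by blast
  show thesis
    by (rule that[of "\<lambda>i. if i \<in> Z then a i else 0"]) (use a in auto)
qed

lemma spannedI:
  assumes "Z \<in> K" "\<forall>i. 0 \<le> a i"
  shows "(\<Sum>i\<in>Z. a i *\<^sub>R r i) \<in> spanned Z"
  using convex_cone_hull_image[OF finite_simplex[OF assms(1)], of r] assms(2)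
  unfolding spanned_def by blast

text \<open>Coefficients may vanish on the simplex here: restricting to the support keeps the sum
  and stays in \<open>K\<close>.\<close>

lemma unique_rep_in:
  assumes "Z \<in> K" "Z' \<in> K" "\<forall>i. 0 \<le> a i" "\<forall>i. 0 \<le> b i"
    "\<forall>i. i \<notin> Z \<longrightarrow> a i = 0" "\<forall>i. i \<notin> Z' \<longrightarrow> b i = 0"
    "(\<Sum>i\<in>Z. a i *\<^sub>R r i) = (\<Sum>i\<in>Z'. b i *\<^sub>R r i)"
  shows "a = b"
proof -
  have "(\<Sum>i | c i \<noteq> 0. c i *\<^sub>R r i) = (\<Sum>i\<in>Y. c i *\<^sub>R r i)" "{i. c i \<noteq> 0} \<in> K"
    if "Y \<in> K" "\<forall>i. i \<notin> Y \<longrightarrow> c i = 0" for c :: "'i \<Rightarrow> real" and Y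
  proof -
    have sub: "{i. c i \<noteq> 0} \<subseteq> Y" using that(2) by auto
    show "(\<Sum>i | c i \<noteq> 0. c i *\<^sub>R r i) = (\<Sum>i\<in>Y. c i *\<^sub>R r i)"
      using sub by (intro sum.mono_neutral_left finite_simplex[OF that(1)]) auto
    show "{i. c i \<noteq> 0} \<in> K" using simplex_subset[OF that(1) sub] .
  qed
  then show ?thesis
    using assms by (intro unique_rep) auto
qed

lemma spanned_convex_cone: "convex_cone (spanned Z)"
  unfolding spanned_def by (rule convex_cone_convex_cone_hull)

lemma ray_in_spanned: "i \<in> Z \<Longrightarrow> r i \<in> spanned Z"
  unfolding spanned_def by (simp add: hull_inc)

lemma spanned_mono: "Z \<subseteq> Z' \<Longrightarrow> spanned Z \<subseteq> spanned Z'"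
  unfolding spanned_def by (intro hull_mono image_mono)

lemma simplex_sing: "Z \<in> K \<Longrightarrow> i \<in> Z \<Longrightarrow> {i} \<in> K"
  by (rule simplex_subset) auto

lemma ray_nonzero:
  assumes "{i} \<in> K"
  shows "r i \<noteq> 0"
proof
  assume "r i = 0"
  then have "(\<lambda>j. if j = i then 1 else 0 :: real) = (\<lambda>j. 0)"
    using assms empty_simplex by (intro unique_rep_in[of "{i}" "{}"]) auto
  then have "(1::real) = 0" by (metis (full_types))
  then show False by simp
qed

lemma ray_eq:
  assumes "{i} \<in> K" "{j} \<in> K" "c > 0" "d > 0" "c *\<^sub>R r i = d *\<^sub>R r j"
  shows "i = j"
proof -
  have "(\<lambda>k. if k = i then c else 0 :: real) = (\<lambda>k. if k = j then d else 0)"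
    using assms by (intro unique_rep_in[of "{i}" "{j}"]) auto
  then show ?thesis using assms(3) by (metis less_irrefl)
qed

lemma ray_in_spanned_iff:
  assumes "Z \<in> K" "{i} \<in> K"
  shows "r i \<in> spanned Z \<longleftrightarrow> i \<in> Z"
proof
  assume "r i \<in> spanned Z"
  then obtain a where a: "\<forall>j. 0 \<le> a j" "\<forall>j. j \<notin> Z \<longrightarrow> a j = 0" "r i = (\<Sum>j\<in>Z. a j *\<^sub>R r j)"
    by (rule spannedE[OF assms(1)])
  have "(\<lambda>j. if j = i then 1 else 0) = a"
    using a by (intro unique_rep_in[OF assms(2) assms(1)]) auto
  then have "a i = 1" by auto
  then show "i \<in> Z" using a(2) by auto
qed (rule ray_in_spanned)

lemma spanned_subset_iff:
  assumes "Z \<in> K" "Z' \<in> K"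
  shows "spanned Z \<subseteq> spanned Z' \<longleftrightarrow> Z \<subseteq> Z'"
  using assms ray_in_spanned_iff ray_in_spanned spanned_mono simplex_sing by (meson subset_iff)

text \<open>A common point has only one coefficient function, and that function vanishes outside
  either simplex.\<close>

lemma spanned_Int:
  assumes "Z \<in> K" "Z' \<in> K"
  shows "spanned Z \<inter> spanned Z' = spanned (Z \<inter> Z')"
proof
  show "spanned Z \<inter> spanned Z' \<subseteq> spanned (Z \<inter> Z')"
  proof
    fix x assume x: "x \<in> spanned Z \<inter> spanned Z'"
    obtain a where a: "\<forall>j. 0 \<le> a j" "\<forall>j. j \<notin> Z \<longrightarrow> a j = 0" "x = (\<Sum>j\<in>Z. a j *\<^sub>R r j)"
      using x spannedE[OF assms(1)] by blast
    obtain b where b: "\<forall>j. 0 \<le> b j" "\<forall>j. j \<notin> Z' \<longrightarrow> b j = 0" "x = (\<Sum>j\<in>Z'. b j *\<^sub>R r j)"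
      using x spannedE[OF assms(2)] by blast
    have ab: "a = b"
      using a b by (intro unique_rep_in[OF assms]) auto
    have "x = (\<Sum>j\<in>Z \<inter> Z'. a j *\<^sub>R r j)"
      unfolding a(3) using b(2) ab finite_simplex[OF assms(1)]
      by (intro sum.mono_neutral_right) auto
    then show "x \<in> spanned (Z \<inter> Z')"
      using spannedI[OF simplex_subset[OF assms(1), of "Z \<inter> Z'"]] a(1) by auto
  qed
qed (use spanned_mono in blast)

text \<open>The coefficients of an interior point of a segment are positive combinations of
  nonnegative numbers, so they vanish outside \<open>Z'\<close> only if those of both endpoints
  do.\<close>

lemma spanned_face:
  assumes "Z \<in> K" "Z' \<subseteq> Z"
  shows "spanned Z' face_of spanned Z"
  unfolding face_of_def
proof (intro conjI ballI impI)
  show "spanned Z' \<subseteq> spanned Z" using spanned_mono assms(2) .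
  show "convex (spanned Z')" using spanned_convex_cone[of Z'] unfolding convex_cone_def by blast
  have Z': "Z' \<in> K" using simplex_subset[OF assms] .
  fix x y z
  assume x: "x \<in> spanned Z" and y: "y \<in> spanned Z" and z: "z \<in> spanned Z'"
    and seg: "z \<in> open_segment x y"
  obtain u where u: "0 < u" "u < 1" "z = (1 - u) *\<^sub>R x + u *\<^sub>R y"
    using seg by (auto simp: in_segment)
  obtain a where a: "\<forall>j. 0 \<le> a j" "\<forall>j. j \<notin> Z \<longrightarrow> a j = 0" "x = (\<Sum>j\<in>Z. a j *\<^sub>R r j)"
    using spannedE[OF assms(1) x] by blast
  obtain b where b: "\<forall>j. 0 \<le> b j" "\<forall>j. j \<notin> Z \<longrightarrow> b j = 0" "y = (\<Sum>j\<in>Z. b j *\<^sub>R r j)"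
    using spannedE[OF assms(1) y] by blast
  obtain c where c: "\<forall>j. 0 \<le> c j" "\<forall>j. j \<notin> Z' \<longrightarrow> c j = 0" "z = (\<Sum>j\<in>Z'. c j *\<^sub>R r j)"
    using spannedE[OF Z' z] by blast
  have "(\<lambda>j. (1 - u) * a j + u * b j) = c"
  proof (rule unique_rep_in[OF assms(1) Z'])
    show "(\<Sum>i\<in>Z. ((1 - u) * a i + u * b i) *\<^sub>R r i) = (\<Sum>i\<in>Z'. c i *\<^sub>R r i)"
      using u(3) a(3) b(3) c(3)
      by (simp add: scaleR_add_left sum.distrib scaleR_sum_right)
  qed (use a b c u in auto)
  then have zero: "(1 - u) * a j + u * b j = 0" if "j \<notin> Z'" for j
    using c(2) that by (metis (no_types))
  have "a j = 0 \<and> b j = 0" if "j \<notin> Z'" for j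
  proof -
    have "0 \<le> (1 - u) * a j" "0 \<le> u * b j" using a b u by auto
    then have "(1 - u) * a j = 0" "u * b j = 0" using zero[OF that] by linarith+
    then show ?thesis using u by auto
  qed
  then have "x = (\<Sum>j\<in>Z'. a j *\<^sub>R r j)" "y = (\<Sum>j\<in>Z'. b j *\<^sub>R r j)"
    unfolding a(3) b(3) using finite_simplex[OF assms(1)] assms(2)
    by (intro sum.mono_neutral_right; auto)+
  then show "x \<in> spanned Z'" "y \<in> spanned Z'"
    using spannedI[OF Z'] a(1) b(1) by auto
qed

text \<open>The candidate is the set of rays inside the face. A ray occurring in a point of the face
  gives one of two summands of that point, and half the point is the midpoint of the summands, so
  both lie in the face.\<close>

lemma face_of_spanned:
  assumes "Z \<in> K" "\<phi> face_of spanned Z" "\<phi> \<noteq> {}"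
  shows "\<exists>Z'\<subseteq>Z. \<phi> = spanned Z'"
proof -
  define Z' where "Z' = {i \<in> Z. r i \<in> \<phi>}"
  have cc: "convex_cone \<phi>"
    using face_of_conic_is_convex_cone[OF spanned_convex_cone assms(2,3)] .
  have 1: "spanned Z' \<subseteq> \<phi>"
    unfolding spanned_def by (rule hull_minimal) (auto simp: Z'_def cc)
  have "\<phi> \<subseteq> spanned Z'"
  proof
    fix x assume x: "x \<in> \<phi>"
    then have xS: "x \<in> spanned Z" using assms(2) face_of_imp_subset by blast
    obtain a where a: "\<forall>j. 0 \<le> a j" "\<forall>j. j \<notin> Z \<longrightarrow> a j = 0" "x = (\<Sum>j\<in>Z. a j *\<^sub>R r j)"
      using spannedE[OF assms(1) xS] by blast
    have "r i \<in> \<phi>" if i: "i \<in> Z" "a i \<noteq> 0" for i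
    proof -
      have pos: "a i > 0" using a(1) i(2) by (simp add: order_less_le)
      define y where "y = (\<Sum>j\<in>Z - {i}. a j *\<^sub>R r j)"
      have xy: "x = a i *\<^sub>R r i + y"
        unfolding a(3) y_def using i finite_simplex[OF assms(1)] by (simp add: sum.remove)
      have "y \<in> spanned (Z - {i})"
        unfolding y_def using spannedI[OF simplex_subset[OF assms(1), of "Z - {i}"]] a(1) by auto
      then have yS: "y \<in> spanned Z" using spanned_mono[of "Z - {i}" Z] by blast
      have iS: "a i *\<^sub>R r i \<in> spanned Z"
        using ray_in_spanned[OF i(1)] spanned_convex_cone[of Z] pos by (simp add: convex_cone_iff)
      have half: "(1/2) *\<^sub>R x \<in> \<phi>"
        using x cc by (simp add: convex_cone_iff)
      have "a i *\<^sub>R r i \<in> \<phi>"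
      \<comment> \<open>The open segment between equal points is empty, so coinciding summands are
        treated apart.\<close>
      proof (cases "a i *\<^sub>R r i = y")
        case True
        then have "(1/2) *\<^sub>R x = a i *\<^sub>R r i"
          unfolding xy by (simp flip: scaleR_2)
        then show ?thesis using half by simp
      next
        case False
        have "(1/2) *\<^sub>R x = (1 - 1/2) *\<^sub>R (a i *\<^sub>R r i) + (1/2) *\<^sub>R y"
          unfolding xy by (simp add: scaleR_add_right)
        then have "(1/2) *\<^sub>R x \<in> open_segment (a i *\<^sub>R r i) y"
          unfolding in_segment using False by (intro conjI exI[of _ "1/2"]) auto
        then show ?thesis
          using assms(2) half iS yS unfolding face_of_def by blast
      qed
      moreover have "\<And>x c. x \<in> \<phi> \<Longrightarrow> 0 \<le> c \<Longrightarrow> c *\<^sub>R x \<in> \<phi>"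
        using cc unfolding convex_cone_iff by blast
      ultimately have "(1 / a i) *\<^sub>R (a i *\<^sub>R r i) \<in> \<phi>"
        using pos by (meson less_imp_le zero_le_divide_1_iff)
      then show ?thesis using pos by simp
    qed
    then have "x = (\<Sum>j\<in>Z'. a j *\<^sub>R r j)"
      unfolding a(3) using finite_simplex[OF assms(1)]
      by (intro sum.mono_neutral_right) (auto simp: Z'_def)
    then show "x \<in> spanned Z'"
      using spannedI[OF simplex_subset[OF assms(1), of Z']] a(1) by (auto simp: Z'_def)
  qed
  then show ?thesis using 1 by (intro exI[of _ Z']) (auto simp: Z'_def)
qed

lemma inj_on_rays:
  assumes "Z \<in> K"
  shows "inj_on r Z"
  using ray_eq[of _ _ 1 1] simplex_sing[OF assms] by (auto simp: inj_on_def)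

text \<open>The positive and the negative part of a linear relation are two nonnegative combinations
  with the same sum, so they coincide; having disjoint supports, both vanish.\<close>

lemma independent_rays:
  assumes "Z \<in> K"
  shows "independent (r ` Z)"
proof
  have fin: "finite Z" using finite_simplex[OF assms] .
  assume "dependent (r ` Z)"
  then obtain u v where u: "(\<Sum>v\<in>r ` Z. u v *\<^sub>R v) = 0" "v \<in> r ` Z" "u v \<noteq> 0"
    using dependent_finite[of "r ` Z"] fin by auto
  define a where "a i = (if i \<in> Z then max (u (r i)) 0 else 0)" for i
  define b where "b i = (if i \<in> Z then max (- u (r i)) 0 else 0)" for i
  have "(\<Sum>i\<in>Z. a i *\<^sub>R r i) - (\<Sum>i\<in>Z. b i *\<^sub>R r i) = (\<Sum>i\<in>Z. u (r i) *\<^sub>R r i)"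
    unfolding sum_subtractf[symmetric] scaleR_diff_left[symmetric]
    by (rule sum.cong) (auto simp: a_def b_def max_def)
  also have "\<dots> = 0"
    using u(1) by (simp add: sum.reindex[OF inj_on_rays[OF assms]])
  finally have "a = b"
    by (intro unique_rep_in[OF assms assms]) (auto simp: a_def b_def)
  obtain i where i: "i \<in> Z" "v = r i" using u(2) by blast
  have "a i = b i" using \<open>a = b\<close> by simp
  then show False using i u(3) by (auto simp: a_def b_def max_def split: if_splits)
qed

section \<open>Fan axioms, rays and flagness\<close>

lemma simplicial_fan:
  shows "is_fan fan" and "\<forall>\<sigma>\<in>fan. simplicial_cone \<sigma>"
proof -
  show "is_fan fan"
    unfolding is_fan_def
  proof (intro conjI ballI allI impI)
    show "finite fan" unfolding fan_def using finite_complex by simp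
    show "fan \<noteq> {}" unfolding fan_def using empty_simplex by blast
  next
    fix \<sigma> assume "\<sigma> \<in> fan"
    then show "polyhedral_cone \<sigma>"
      unfolding polyhedral_cone_def fan_def spanned_def using finite_simplex finite_imageI by fast
  next
    fix \<sigma> \<phi> assume "\<sigma> \<in> fan" and \<phi>: "\<phi> face_of \<sigma> \<and> \<phi> \<noteq> {}"
    then obtain Z where Z: "Z \<in> K" "\<sigma> = spanned Z" unfolding fan_def by blast
    then obtain Z' where "Z' \<subseteq> Z" "\<phi> = spanned Z'"
      using face_of_spanned[OF Z(1), of \<phi>] \<phi> by auto
    then show "\<phi> \<in> fan"
      unfolding fan_def using simplex_subset[OF Z(1)] by blast
  next
    fix \<sigma> \<sigma>' assume "\<sigma> \<in> fan" "\<sigma>' \<in> fan"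
    then obtain Z Z' where Z: "Z \<in> K" "Z' \<in> K" "\<sigma> = spanned Z" "\<sigma>' = spanned Z'"
      unfolding fan_def by blast
    show "\<sigma> \<inter> \<sigma>' face_of \<sigma>" "\<sigma> \<inter> \<sigma>' face_of \<sigma>'"
      unfolding Z(3,4) spanned_Int[OF Z(1,2)] using Z spanned_face by auto
  qed
  show "\<forall>\<sigma>\<in>fan. simplicial_cone \<sigma>"
    unfolding fan_def simplicial_cone_def spanned_def
    using finite_simplex independent_rays finite_imageI by fast
qed

text \<open>Two indices whose rays lie in a one-dimensional cone have proportional vectors with
  positive factors, so they are the same index.\<close>

lemma fan_rays_eq: "fan_rays fan = {spanned {i} | i. {i} \<in> K}"
proof (intro set_eqI iffI)
  fix \<rho> assume "\<rho> \<in> fan_rays fan"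
  then obtain Z g where Z: "Z \<in> K" "\<rho> = spanned Z" "g \<noteq> 0" "\<rho> = convex_cone hull {g}"
    unfolding fan_rays_def fan_def by blast
  have g: "convex_cone hull {g} = {c *\<^sub>R g | c. 0 \<le> c}"
    using convex_cone_hull_image[of "{g}" "\<lambda>x. x"] by auto
  have "Z \<noteq> {}"
  proof
    assume "Z = {}"
    then have "\<rho> = {0}"
      unfolding Z(2) spanned_def using convex_cone_hull_image[of "{}" r] by auto
    moreover have "g \<in> \<rho>" unfolding Z(4) by (simp add: hull_inc)
    ultimately show False using Z(3) by blast
  qed
  then obtain i where i: "i \<in> Z" by blast
  have pos: "\<exists>c>0. r j = c *\<^sub>R g" if "j \<in> Z" for j
  proof -
    have "r j \<in> \<rho>" unfolding Z(2) using ray_in_spanned[OF that] .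
    then obtain c where c: "0 \<le> c" "r j = c *\<^sub>R g" unfolding Z(4) g by blast
    moreover have "r j \<noteq> 0" using ray_nonzero[OF simplex_sing[OF Z(1) that]] .
    ultimately show ?thesis by (intro exI[of _ c]) (auto simp: order_less_le)
  qed
  have "j = i" if j: "j \<in> Z" for j
  proof -
    obtain c where c: "c > 0" "r j = c *\<^sub>R g" using pos[OF j] by blast
    obtain d where d: "d > 0" "r i = d *\<^sub>R g" using pos[OF i] by blast
    have "d *\<^sub>R r j = c *\<^sub>R r i" unfolding c d by (simp add: mult.commute)
    then show ?thesis
      using ray_eq[OF simplex_sing[OF Z(1) j] simplex_sing[OF Z(1) i] d(1) c(1)] by simp
  qed
  then have "Z = {i}" using i by blast
  then show "\<rho> \<in> {spanned {i} | i. {i} \<in> K}" using Z by blast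
next
  fix \<rho> assume "\<rho> \<in> {spanned {i} | i. {i} \<in> K}"
  then obtain i where i: "{i} \<in> K" "\<rho> = spanned {i}" by blast
  then show "\<rho> \<in> fan_rays fan"
    unfolding fan_rays_def fan_def using ray_nonzero[OF i(1)] i
    by (auto simp: spanned_def intro!: image_eqI[of _ _ "{i}"] exI[of _ "r i"])
qed

lemma fan_complex_eq: "fan_complex fan = {(\<lambda>i. spanned {i}) ` Z | Z. Z \<in> K}"
proof -
  have "{\<rho> \<in> fan_rays fan. \<rho> face_of spanned Z} = (\<lambda>i. spanned {i}) ` Z" if Z: "Z \<in> K" for Z
  proof (intro set_eqI iffI)
    fix \<rho> assume "\<rho> \<in> {\<rho> \<in> fan_rays fan. \<rho> face_of spanned Z}"
    then obtain i where i: "{i} \<in> K" "\<rho> = spanned {i}" "\<rho> face_of spanned Z"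
      unfolding fan_rays_eq by blast
    then have "spanned {i} \<subseteq> spanned Z" using face_of_imp_subset by blast
    then show "\<rho> \<in> (\<lambda>i. spanned {i}) ` Z"
      using spanned_subset_iff[OF i(1) Z] i(2) by blast
  next
    fix \<rho> assume "\<rho> \<in> (\<lambda>i. spanned {i}) ` Z"
    then show "\<rho> \<in> {\<rho> \<in> fan_rays fan. \<rho> face_of spanned Z}"
      unfolding fan_rays_eq using spanned_face[OF Z] simplex_sing[OF Z] by auto
  qed
  then have "(\<lambda>Z. {\<rho> \<in> fan_rays fan. \<rho> face_of spanned Z}) ` K = (\<lambda>Z. (\<lambda>i. spanned {i}) ` Z) ` K"
    by (intro image_cong) auto
  moreover have "fan_complex fan = (\<lambda>\<sigma>. {\<rho> \<in> fan_rays fan. \<rho> face_of \<sigma>}) ` fan"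
    unfolding fan_complex_def by blast
  moreover have "(\<lambda>\<sigma>. {\<rho> \<in> fan_rays fan. \<rho> face_of \<sigma>}) ` fan =
      (\<lambda>Z. {\<rho> \<in> fan_rays fan. \<rho> face_of spanned Z}) ` K"
    by (simp only: fan_def image_image)
  ultimately show ?thesis
    by (simp add: Setcompr_eq_image)
qed

text \<open>Different indices span different rays, so cliques of rays and cliques of indices
  correspond.\<close>

lemma flag_fanI:
  assumes flag: "\<And>X. finite X \<Longrightarrow> (\<And>i j. i \<in> X \<Longrightarrow> j \<in> X \<Longrightarrow> {i, j} \<in> K) \<Longrightarrow> X \<in> K"
  shows "flag_fan fan"
  unfolding flag_fan_def flag_complex_def
proof (intro allI impI)
  fix S assume S: "S \<subseteq> fan_rays fan"
    "finite S \<and> (\<forall>\<rho>\<in>S. \<forall>\<rho>'\<in>S. {\<rho>, \<rho>'} \<in> fan_complex fan)"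
  have eq: "i = j" if "{i} \<in> K" "{j} \<in> K" "spanned {i} = spanned {j}" for i j
    using spanned_subset_iff[OF that(1,2)] that(3) by simp
  define X where "X = {i. {i} \<in> K \<and> spanned {i} \<in> S}"
  have SX: "S = (\<lambda>i. spanned {i}) ` X"
    unfolding X_def using S(1) unfolding fan_rays_eq by blast
  have inj: "inj_on (\<lambda>i. spanned {i}) X"
    unfolding inj_on_def X_def using eq by blast
  have "finite X" using SX S(2) inj finite_imageD by blast
  moreover have "{i, j} \<in> K" if "i \<in> X" "j \<in> X" for i j
  proof -
    have "{spanned {i}, spanned {j}} \<in> fan_complex fan"
      using S(2) that unfolding X_def by blast
    then obtain Z where Z: "Z \<in> K" "{spanned {i}, spanned {j}} = (\<lambda>i. spanned {i}) ` Z"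
      unfolding fan_complex_eq by blast
    have "i \<in> Z"
    proof -
      obtain i' where i': "i' \<in> Z" "spanned {i} = spanned {i'}" using Z(2) by blast
      then have "i = i'" using eq[of i i'] simplex_sing[OF Z(1)] that(1) X_def by blast
      then show ?thesis using i' by simp
    qed
    moreover have "j \<in> Z"
    proof -
      obtain i' where i': "i' \<in> Z" "spanned {j} = spanned {i'}" using Z(2) by blast
      then have "j = i'" using eq[of j i'] simplex_sing[OF Z(1)] that(2) X_def by blast
      then show ?thesis using i' by simp
    qed
    ultimately show ?thesis using simplex_subset[OF Z(1), of "{i, j}"] by auto
  qed
  ultimately have "X \<in> K" by (rule flag)
  then show "S \<in> fan_complex fan"
    unfolding fan_complex_eq SX by blast
qed

end

section \<open>Extending a unitriangular system to a lattice basis\<close>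

definition int_comb :: "'a::real_vector set \<Rightarrow> ('a \<Rightarrow> int) \<Rightarrow> 'a" where
  "int_comb B c = (\<Sum>b\<in>B. of_int (c b) *\<^sub>R b)"

lemma lattice_basis_iff:
  "lattice_basis L B \<longleftrightarrow> finite B \<and> L = range (int_comb B) \<and>
     (\<forall>c. int_comb B c = 0 \<longrightarrow> (\<forall>b\<in>B. c b = 0))"
  unfolding lattice_basis_def int_comb_def by simp

lemma int_comb_add: "int_comb B c + int_comb B d = int_comb B (\<lambda>b. c b + d b)"
  unfolding int_comb_def by (simp add: scaleR_add_left sum.distrib)

lemma int_comb_scale: "of_int k *\<^sub>R int_comb B c = int_comb B (\<lambda>b. k * c b)"
  unfolding int_comb_def by (simp add: scaleR_sum_right)

lemma int_comb_indicator:
  "finite B \<Longrightarrow> b \<in> B \<Longrightarrow> int_comb B (\<lambda>x. if x = b then k else 0) = of_int k *\<^sub>R b"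
  unfolding int_comb_def by (subst sum.remove[of B b]) (auto intro!: sum.neutral)

lemma int_comb_insert:
  "finite B \<Longrightarrow> v \<notin> B \<Longrightarrow> int_comb (insert v B) c = of_int (c v) *\<^sub>R v + int_comb B c"
  unfolding int_comb_def by simp

lemma int_comb_remove:
  "finite B \<Longrightarrow> v \<in> B \<Longrightarrow> int_comb B c = of_int (c v) *\<^sub>R v + int_comb (B - {v}) c"
  unfolding int_comb_def by (simp add: sum.remove)

lemma int_comb_cong: "(\<And>b. b \<in> B \<Longrightarrow> c b = d b) \<Longrightarrow> int_comb B c = int_comb B d"
  unfolding int_comb_def by (rule sum.cong) auto

lemma linear_int_comb:
  "linear f \<Longrightarrow> f (int_comb B c) = (\<Sum>b\<in>B. of_int (c b) *\<^sub>R f b)"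
  unfolding int_comb_def by (simp add: linear_sum linear_scale)

text \<open>An elementary operation on the basis, undone by subtracting the same multiple of
  \<open>b'\<close> again.\<close>

lemma lattice_basis_exchange:
  fixes B :: "'a::real_vector set" and k :: int
  assumes L: "lattice_basis L B" and b: "b \<in> B" "b' \<in> B" "b \<noteq> b'"
  defines "e \<equiv> b + of_int k *\<^sub>R b'"
  shows "lattice_basis L (insert e (B - {b}))" and "e \<notin> B - {b}"
proof -
  have fin: "finite B" and Leq: "L = range (int_comb B)"
    and ind: "\<And>c x. int_comb B c = 0 \<Longrightarrow> x \<in> B \<Longrightarrow> c x = 0"
    using L unfolding lattice_basis_iff by blast+
  have e: "e = int_comb B (\<lambda>x. (if x = b then 1 else 0) + (if x = b' then k else 0))"
    unfolding e_def int_comb_add[symmetric] using fin b by (simp add: int_comb_indicator)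
  show new: "e \<notin> B - {b}"
  proof
    assume "e \<in> B - {b}"
    then have "int_comb B (\<lambda>x. if x = e then - 1 else 0) = - e"
      using int_comb_indicator[OF fin, of e "- 1"] by simp
    then have "int_comb B (\<lambda>x. ((if x = b then 1 else 0) + (if x = b' then k else 0)) + (if x = e then - 1 else 0)) = 0"
      unfolding int_comb_add[of B "\<lambda>x. (if x = b then 1 else 0) + (if x = b' then k else 0)", symmetric]
      by (simp only: e[symmetric] right_minus)
    from ind[OF this b(1)] show False
      using b \<open>e \<in> B - {b}\<close> by auto
  qed
  define B' where "B' = insert e (B - {b})"
  have finB': "finite B'" using fin unfolding B'_def by simp
  have expand: "int_comb B' c = int_comb B (\<lambda>x. if x = b then c e else if x = b' then c b' + k * c e else c x)" for c
  proof -
    have "int_comb B' c = of_int (c e) *\<^sub>R e + int_comb (B - {b}) c"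
      unfolding B'_def using new fin by (simp add: int_comb_insert)
    also have "int_comb (B - {b}) c = int_comb B (\<lambda>x. if x = b then 0 else c x)"
      using int_comb_remove[OF fin b(1), of "\<lambda>x. if x = b then 0 else c x"]
        int_comb_cong[of "B - {b}" "\<lambda>x. if x = b then 0 else c x" c] by auto
    also have "of_int (c e) *\<^sub>R e + \<dots> = int_comb B (\<lambda>x. if x = b then c e else if x = b' then c b' + k * c e else c x)"
      unfolding e int_comb_scale int_comb_add using b by (intro int_comb_cong) auto
    finally show ?thesis .
  qed
  have "range (int_comb B') = range (int_comb B)"
  proof (intro equalityI subsetI)
    fix x assume "x \<in> range (int_comb B')"
    then show "x \<in> range (int_comb B)" using expand by auto
  next
    fix x assume "x \<in> range (int_comb B)"
    then obtain c where c: "x = int_comb B c" by blast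
    define d where "d y = (if y = e then c b else if y = b' then c b' - k * c b else c y)" for y
    have "e \<noteq> b'" using new b by blast
    have "int_comb B' d = int_comb B c"
      unfolding expand using \<open>e \<noteq> b'\<close> new b by (intro int_comb_cong) (auto simp: d_def)
    then show "x \<in> range (int_comb B')" using c by (metis rangeI)
  qed
  moreover have "c x = 0" if c: "int_comb B' c = 0" and x: "x \<in> B'" for c x
  proof -
    define d where "d y = (if y = b then c e else if y = b' then c b' + k * c e else c y)" for y
    have "int_comb B d = 0" using c unfolding expand d_def .
    then have dz: "\<And>y. y \<in> B \<Longrightarrow> d y = 0" using ind by blast
    have "c e = 0" using dz[OF b(1)] by (simp add: d_def)
    then show ?thesis
      using dz[of x] x b by (auto simp: B'_def d_def split: if_splits)
  qed
  ultimately show "lattice_basis L (insert e (B - {b}))"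
    unfolding B'_def[symmetric] lattice_basis_iff using finB' Leq by auto
qed

text \<open>Euclid's algorithm on the values of the functional on a basis concentrates them in a
  single basis vector.\<close>

lemma lattice_basis_kernel:
  fixes f :: "'a::real_vector \<Rightarrow> real"
  assumes "lattice_basis L B" "linear f" "\<forall>x\<in>L. f x \<in> \<int>"
  shows "\<exists>B'. lattice_basis {x \<in> L. f x = 0} B'"
  using assms(1)
\<comment> \<open>The values on the lattice are integers, so the floor merely turns their absolute
  values into natural numbers for the measure.\<close>
proof (induction "\<Sum>b\<in>B. nat \<lfloor>\<bar>f b\<bar>\<rfloor>" arbitrary: B rule: less_induct)
  case less
  have fin: "finite B" and Leq: "L = range (int_comb B)"
    and ind: "\<And>c x. int_comb B c = 0 \<Longrightarrow> x \<in> B \<Longrightarrow> c x = 0"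
    using less.prems unfolding lattice_basis_iff by blast+
  have BL: "b \<in> L" if "b \<in> B" for b
    unfolding Leq using int_comb_indicator[OF fin that, of 1] by (metis of_int_1 rangeI scaleR_one)
  show ?case
  proof (cases "\<exists>b\<in>B. \<exists>b'\<in>B. b \<noteq> b' \<and> f b \<noteq> 0 \<and> f b' \<noteq> 0")
    case True
    then obtain b b' where b: "b \<in> B" "b' \<in> B" "b \<noteq> b'" "f b \<noteq> 0" "f b' \<noteq> 0" "\<bar>f b'\<bar> \<le> \<bar>f b\<bar>"
      by (metis linear)
    \<comment> \<open>A subtractive Euclidean step: the sign makes the smaller absolute value get
      subtracted from the larger one, while the values on all other basis vectors stay the
      same.\<close>
    define k :: int where "k = (if f b * f b' > 0 then - 1 else 1)"
    define e where "e = b + of_int k *\<^sub>R b'"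
    have ex: "lattice_basis L (insert e (B - {b}))" "e \<notin> B - {b}"
      using lattice_basis_exchange[OF less.prems b(1-3)] unfolding e_def by blast+
    have fe: "f e = f b + of_int k * f b'"
      unfolding e_def using assms(2) by (simp add: linear_add linear_scale)
    have "\<bar>f e\<bar> < \<bar>f b\<bar>"
    proof (cases "f b > 0")
      case True
      then show ?thesis unfolding fe k_def using b(4-6) by (auto simp: zero_less_mult_iff)
    next
      case False
      then show ?thesis unfolding fe k_def using b(4-6) by (auto simp: zero_less_mult_iff)
    qed
    moreover have "f e \<in> \<int>" "f b \<in> \<int>" using fe assms(3) BL b by auto
    ultimately have lt: "nat \<lfloor>\<bar>f e\<bar>\<rfloor> < nat \<lfloor>\<bar>f b\<bar>\<rfloor>"
      by (elim Ints_cases) (simp flip: of_int_abs)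
    have "(\<Sum>b\<in>insert e (B - {b}). nat \<lfloor>\<bar>f b\<bar>\<rfloor>) < (\<Sum>b\<in>B. nat \<lfloor>\<bar>f b\<bar>\<rfloor>)"
      using lt ex(2) fin b(1) by (simp add: sum.remove[of B b])
    from less.hyps[OF this ex(1)] show ?thesis .
  next
    case False
    \<comment> \<open>At most one basis vector has a nonzero value now, so the remaining ones span
      the kernel.\<close>
    define B' where "B' = {b \<in> B. f b = 0}"
    have finB': "finite B'" using fin B'_def by simp
    have ext: "int_comb B' c = int_comb B (\<lambda>x. if x \<in> B' then c x else 0)" for c
      unfolding int_comb_def using fin
      by (intro sum.mono_neutral_cong_left) (auto simp: B'_def)
    have "{x \<in> L. f x = 0} = range (int_comb B')"
    proof (intro equalityI subsetI)
      fix x assume "x \<in> {x \<in> L. f x = 0}"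
      then obtain c where c: "x = int_comb B c" "f x = 0" unfolding Leq by blast
      have "c b = 0" if b: "b \<in> B - B'" for b
      proof -
        have "f x = (\<Sum>b\<in>B. of_int (c b) *\<^sub>R f b)"
          unfolding c(1) by (rule linear_int_comb[OF assms(2)])
        also have "\<dots> = of_int (c b) *\<^sub>R f b"
        proof -
          have "f y = 0" if "y \<in> B - {b}" for y
            using False b that unfolding B'_def by blast
          then show ?thesis using b fin by (subst sum.remove[of B b]) auto
        qed
        finally show ?thesis using c(2) b unfolding B'_def by auto
      qed
      then have "int_comb B c = int_comb B' c"
        unfolding ext by (intro int_comb_cong) auto
      then show "x \<in> range (int_comb B')" using c by auto
    next
      fix x assume "x \<in> range (int_comb B')"
      then obtain c where c: "x = int_comb B' c" by blast
      have "f x = (\<Sum>b\<in>B'. of_int (c b) *\<^sub>R f b)"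
        unfolding c by (rule linear_int_comb[OF assms(2)])
      then have "f x = 0" by (simp add: B'_def)
      then show "x \<in> {x \<in> L. f x = 0}" unfolding Leq c ext by auto
    qed
    moreover have "c x = 0" if "int_comb B' c = 0" "x \<in> B'" for c x
      using ind[of "\<lambda>x. if x \<in> B' then c x else 0" x] that unfolding ext by (auto simp: B'_def)
    ultimately have "lattice_basis {x \<in> L. f x = 0} B'"
      unfolding lattice_basis_iff using finB' by blast
    then show ?thesis by blast
  qed
qed

text \<open>Subtracting \<open>f x\<close> copies of \<open>v\<close> moves any \<open>x\<close>
  into the kernel, so the lattice is the direct sum of the multiples of \<open>v\<close> and the
  kernel.\<close>

lemma lattice_basis_insert:
  fixes f :: "'a::real_vector \<Rightarrow> real"
  assumes L: "lattice_basis L B" and f: "linear f" "\<forall>x\<in>L. f x \<in> \<int>" "v \<in> L" "f v = 1"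
    and B': "lattice_basis {x \<in> L. f x = 0} B'"
  shows "lattice_basis L (insert v B')"
proof -
  have Leq: "L = range (int_comb B)" using L unfolding lattice_basis_iff by blast
  have finB': "finite B'" and ker: "{x \<in> L. f x = 0} = range (int_comb B')"
    and ind: "\<And>c x. int_comb B' c = 0 \<Longrightarrow> x \<in> B' \<Longrightarrow> c x = 0"
    using B' unfolding lattice_basis_iff by blast+
  have Lc: "x + of_int k *\<^sub>R y \<in> L" if "x \<in> L" "y \<in> L" for x y k
    using that unfolding Leq by (auto simp: int_comb_scale int_comb_add)
  have f0: "f (int_comb B' c) = 0" for c using ker by blast
  have v: "v \<notin> B'"
  proof
    assume "v \<in> B'"
    then have "v = int_comb B' (\<lambda>x. if x = v then 1 else 0)"
      using int_comb_indicator[OF finB', of v 1] by simp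
    then show False using f0 f(4) by (metis zero_neq_one)
  qed
  have "L = range (int_comb (insert v B'))"
  proof (intro equalityI subsetI)
    fix x assume x: "x \<in> L"
    then obtain k where k: "f x = of_int k" using f(2) Ints_cases by blast
    have "x + of_int (- k) *\<^sub>R v \<in> {x \<in> L. f x = 0}"
      using Lc[OF x f(3), of "- k"] k f(1,4) by (simp add: linear_diff linear_scale linear_add linear_neg)
    then obtain c where c: "x + of_int (- k) *\<^sub>R v = int_comb B' c" using ker by blast
    have "int_comb (insert v B') (c(v := k)) = of_int k *\<^sub>R v + int_comb B' c"
      unfolding int_comb_insert[OF finB' v] using v by (auto intro!: int_comb_cong)
    then have "x = int_comb (insert v B') (c(v := k))" using c by (simp add: algebra_simps)
    then show "x \<in> range (int_comb (insert v B'))" by blast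
  next
    fix x assume "x \<in> range (int_comb (insert v B'))"
    then obtain c where c: "x = of_int (c v) *\<^sub>R v + int_comb B' c"
      using int_comb_insert[OF finB' v] by auto
    have "int_comb B' c \<in> L" using ker by blast
    from Lc[OF this f(3), of "c v"] show "x \<in> L" unfolding c by (simp add: add.commute)
  qed
  moreover have "c x = 0" if c: "int_comb (insert v B') c = 0" "x \<in> insert v B'" for c x
  proof -
    have s: "of_int (c v) *\<^sub>R v + int_comb B' c = 0" using c(1) int_comb_insert[OF finB' v] by simp
    then have "f (of_int (c v) *\<^sub>R v + int_comb B' c) = 0" using f(1) by (simp add: linear_0)
    then have cv: "c v = 0" using f(1,4) f0 by (simp add: linear_add linear_scale)
    then have "int_comb B' c = 0" using s by simp
    then show ?thesis using ind cv c(2) by blast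
  qed
  ultimately show ?thesis
    unfolding lattice_basis_iff using finB' by blast
qed

text \<open>Evaluating the functionals on the vectors in order of insertion gives a triangular
  integer matrix with unit diagonal: each functional kills all earlier vectors and is unconstrained
  on later ones.\<close>

inductive unitriangular :: "'a::real_vector set \<Rightarrow> 'a set \<Rightarrow> bool" for L where
  empty: "unitriangular L {}"
| insert: "unitriangular L V \<Longrightarrow> v \<in> L \<Longrightarrow> linear (f :: 'a \<Rightarrow> real) \<Longrightarrow> \<forall>x\<in>L. f x \<in> \<int> \<Longrightarrow> f v = 1 \<Longrightarrow>
    \<forall>w\<in>V. f w = 0 \<Longrightarrow> unitriangular L (insert v V)"

lemma unitriangular_sublattice:
  assumes "unitriangular L V" "L' \<subseteq> L" "V \<subseteq> L'"
  shows "unitriangular L' V"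
  using assms by induction (auto intro!: unitriangular.intros)

lemma unitriangular_subset: "unitriangular L V \<Longrightarrow> V \<subseteq> L"
  by (induction rule: unitriangular.induct) auto

text \<open>The vector inserted last splits off by its functional. All others lie in the kernel,
  which is again a lattice with a basis, and the argument recurses there; hence the lattice varies
  in the induction.\<close>

lemma unitriangular_extends:
  assumes "unitriangular L V" "lattice_basis L B"
  shows "\<exists>B'. lattice_basis L B' \<and> V \<subseteq> B'"
proof -
  have "finite V" using assms(1) by induction auto
  then show ?thesis using assms
  proof (induction "card V" arbitrary: L V B)
    case 0
    then show ?case by auto
  next
    case (Suc n)
    from Suc.prems(2) show ?case
    proof cases
      case empty
      then show ?thesis using Suc.prems by auto
    next
      case (insert W v f)
      then have "v \<notin> W" by auto
      obtain B0 where B0: "lattice_basis {x \<in> L. f x = 0} B0"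
        using lattice_basis_kernel[OF Suc.prems(3)] insert by blast
      have "unitriangular {x \<in> L. f x = 0} W"
        using unitriangular_subset insert by (intro unitriangular_sublattice[OF insert(2)]) blast+
      moreover have "n = card W" "finite W"
        using Suc.hyps(2) Suc.prems(1) \<open>v \<notin> W\<close> insert(1) by auto
      ultimately obtain B' where B': "lattice_basis {x \<in> L. f x = 0} B'" "W \<subseteq> B'"
        using Suc.hyps(1)[of W "{x \<in> L. f x = 0}"] B0 by blast
      have "lattice_basis L (Set.insert v B')"
        using lattice_basis_insert[OF Suc.prems(3) insert(4,5,3,6) B'(1)] .
      then show ?thesis using B'(2) insert(1) by blast
    qed
  qed
qed

section \<open>Rooted plane trees\<close>

lemma lexord_snoc:
  "length p = length q \<Longrightarrow> (p @ [i], q @ [j]) \<in> lexord r \<longleftrightarrow> (p, q) \<in> lexord r \<or> p = q \<and> (i, j) \<in> r"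
  by (induction p q rule: list_induct2) auto

lemma consecutive_between:
  assumes "consecutive xs S" "distinct xs" "i < j" "j < l" "l < length xs" "xs ! i \<in> S" "xs ! l \<in> S"
  shows "xs ! j \<in> S"
proof -
  obtain as bs cs where xs: "xs = as @ bs @ cs" "set bs = S"
    using assms(1) unfolding consecutive_def by blast
  have in_iff: "xs ! k \<in> S \<longleftrightarrow> length as \<le> k \<and> k < length as + length bs" if "k < length xs" for k
  proof
    assume "xs ! k \<in> S"
    then obtain m where m: "m < length bs" "bs ! m = xs ! k"
      using xs(2) by (metis in_set_conv_nth)
    then have "xs ! (length as + m) = xs ! k" unfolding xs(1) by (simp add: nth_append)
    then have "length as + m = k"
      using assms(2) that m(1) xs(1) by (subst (asm) nth_eq_iff_index_eq) auto
    then show "length as \<le> k \<and> k < length as + length bs" using m(1) by auto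
  next
    assume "length as \<le> k \<and> k < length as + length bs"
    then show "xs ! k \<in> S" unfolding xs(1) using xs(2) by (auto simp: nth_append)
  qed
  show ?thesis using in_iff[of i] in_iff[of j] in_iff[of l] assms by auto
qed

section \<open>Levels, parents and descent\<close>

locale plane_tree =
  fixes T :: "'v ptree"
  assumes tree: "rooted_plane_tree T"
begin

lemma finite_verts: "finite (verts T)" and root_vert: "root T \<in> verts T"
  and distinct_ch: "u \<in> verts T \<Longrightarrow> distinct (ch T u)"
  and ch_verts: "u \<in> verts T \<Longrightarrow> v \<in> set (ch T u) \<Longrightarrow> v \<in> verts T"
  and no_edge_root: "(u, root T) \<notin> edges T"
  using tree unfolding rooted_plane_tree_def by blast+

lemma edge_verts: "(u, v) \<in> edges T \<Longrightarrow> u \<in> verts T \<and> v \<in> verts T \<and> v \<in> set (ch T u)"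
  unfolding edges_def using ch_verts by auto

lemma edgeI: "u \<in> verts T \<Longrightarrow> v \<in> set (ch T u) \<Longrightarrow> (u, v) \<in> edges T"
  unfolding edges_def by auto

lemma edge_unique:
  assumes "(u, v) \<in> edges T" "(u', v) \<in> edges T"
  shows "u = u'"
proof -
  have "v \<in> verts T" "v \<noteq> root T" using assms edge_verts no_edge_root by blast+
  then have "\<exists>!u. (u, v) \<in> edges T" using tree unfolding rooted_plane_tree_def by blast
  then show ?thesis using assms by blast
qed

lemma parent_eq: "(u, v) \<in> edges T \<Longrightarrow> parent T v = u"
  unfolding parent_def using edge_unique by blast

lemma parent_child: "u \<in> verts T \<Longrightarrow> v \<in> set (ch T u) \<Longrightarrow> parent T v = u"
  using parent_eq edgeI by blast

lemma level_verts: "v \<in> level T k \<Longrightarrow> v \<in> verts T"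
  unfolding level_def by auto

lemma finite_level: "finite (level T k)"
  using finite_verts level_verts finite_subset by (metis subsetI)

lemma level_0: "level T 0 = {root T}"
  unfolding level_def using root_vert by auto

lemma level_SucI: "u \<in> level T k \<Longrightarrow> v \<in> set (ch T u) \<Longrightarrow> v \<in> level T (Suc k)"
  unfolding level_def using edgeI ch_verts by auto

lemma level_SucD:
  assumes "v \<in> level T (Suc k)"
  shows "parent T v \<in> level T k" "v \<in> set (ch T (parent T v))" "(parent T v, v) \<in> edges T"
proof -
  obtain u where u: "(root T, u) \<in> edges T ^^ k" "(u, v) \<in> edges T"
    using assms unfolding level_def by auto
  have "parent T v = u" using parent_eq[OF u(2)] .
  then show "parent T v \<in> level T k" "v \<in> set (ch T (parent T v))" "(parent T v, v) \<in> edges T"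
    using u edge_verts[OF u(2)] unfolding level_def by auto
qed

lemma level_unique: "v \<in> level T j \<Longrightarrow> v \<in> level T k \<Longrightarrow> j = k"
proof (induction j arbitrary: k v)
  case 0
  then show ?case using level_0 level_SucD(3) no_edge_root by (cases k) auto
next
  case (Suc j)
  then show ?case using level_0 level_SucD no_edge_root
    by (cases k) (auto, metis+)
qed

lemma ex_level: "v \<in> verts T \<Longrightarrow> \<exists>k. v \<in> level T k"
  using tree unfolding rooted_plane_tree_def level_def by (simp add: rtrancl_power)

lemma vdepth_eq: "v \<in> level T k \<Longrightarrow> vdepth T v = k"
  unfolding vdepth_def using level_unique by blast

lemma vdepth_level: "v \<in> verts T \<Longrightarrow> v \<in> level T (vdepth T v)"
  using ex_level vdepth_eq by metis

lemma finite_levels: "finite {k. level T k \<noteq> {}}"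
proof (rule finite_subset)
  show "{k. level T k \<noteq> {}} \<subseteq> vdepth T ` verts T"
    using vdepth_eq level_verts by fastforce
qed (use finite_verts in simp)

lemma level_le_depth: "v \<in> level T k \<Longrightarrow> k \<le> depth T"
  unfolding depth_def using finite_levels by (intro Max_ge) auto

lemma parent_vert: "v \<in> level T (Suc k) \<Longrightarrow> parent T v \<in> verts T"
  using level_SucD(1) level_verts by blast

lemma weak_desc_refl: "weak_desc T v v"
  unfolding weak_desc_def by simp

lemma weak_desc_trans: "weak_desc T u v \<Longrightarrow> weak_desc T v w \<Longrightarrow> weak_desc T u w"
  unfolding weak_desc_def by simp

lemma weak_desc_parent:
  assumes "v \<in> level T (Suc k)"
  shows "weak_desc T w v \<longleftrightarrow> w = v \<or> weak_desc T w (parent T v)"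
proof
  assume "weak_desc T w v"
  then show "w = v \<or> weak_desc T w (parent T v)"
    unfolding weak_desc_def using parent_eq by (metis rtranclE)
next
  assume "w = v \<or> weak_desc T w (parent T v)"
  then show "weak_desc T w v"
    unfolding weak_desc_def using level_SucD(3)[OF assms] by (auto intro: rtrancl_into_rtrancl)
qed

lemma weak_desc_level:
  "weak_desc T w v \<Longrightarrow> w \<in> level T j \<Longrightarrow> v \<in> level T k \<Longrightarrow> j \<le> k \<and> (j = k \<longrightarrow> w = v)"
proof (induction k arbitrary: v)
  case 0
  then have "v = root T" using level_0 by auto
  then have "w = v" using 0(1) no_edge_root unfolding weak_desc_def by (metis rtranclE)
  then show ?case using 0 level_unique by blast
next
  case (Suc k)
  show ?case
  proof (cases "w = v")
    case True
    then show ?thesis using Suc.prems level_unique by blast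
  next
    case False
    then have "weak_desc T w (parent T v)" using weak_desc_parent[OF Suc.prems(3)] Suc.prems(1) by blast
    then have "j \<le> k" using Suc.IH[OF _ Suc.prems(2) level_SucD(1)[OF Suc.prems(3)]] by blast
    then show ?thesis by auto
  qed
qed

lemma ancestor_exists: "v \<in> level T k \<Longrightarrow> j \<le> k \<Longrightarrow> \<exists>w\<in>level T j. weak_desc T w v"
proof (induction k arbitrary: v)
  case 0
  then show ?case using weak_desc_refl by auto
next
  case (Suc k)
  show ?case
  proof (cases "j = Suc k")
    case True
    then show ?thesis using Suc.prems weak_desc_refl by blast
  next
    case False
    then show ?thesis
      using Suc.IH[of "parent T v"] Suc.prems weak_desc_parent level_SucD(1) by (metis le_SucE)
  qed
qed

text \<open>Left-to-right order among the children of one vertex; comparisons of positions are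
  reduced to it level by level.\<close>

definition sib :: "'v \<Rightarrow> 'v \<Rightarrow> bool" where
  "sib u v \<longleftrightarrow> (\<exists>p\<in>verts T. \<exists>i j. i < j \<and> j < length (ch T p) \<and> u = ch T p ! i \<and> v = ch T p ! j)"

lemma sibE:
  assumes "sib u v"
  obtains p i j where "p \<in> verts T" "i < j" "j < length (ch T p)" "u = ch T p ! i" "v = ch T p ! j"
    "u \<in> set (ch T p)" "v \<in> set (ch T p)" "parent T u = p" "parent T v = p" "u \<noteq> v"
proof -
  obtain p i j where p: "p \<in> verts T" "i < j" "j < length (ch T p)" "u = ch T p ! i" "v = ch T p ! j"
    using assms unfolding sib_def by blast
  moreover have uv: "u \<in> set (ch T p)" "v \<in> set (ch T p)" using p by auto
  moreover have "parent T u = p" "parent T v = p" using parent_child p(1) uv by auto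
  moreover have "u \<noteq> v" using p distinct_ch[OF p(1)] by (simp add: nth_eq_iff_index_eq)
  ultimately show thesis by (rule that)
qed

lemma sib_parent: "sib u v \<Longrightarrow> parent T u = parent T v"
  by (elim sibE) simp

lemma sib_index:
  assumes "p \<in> verts T" "i < length (ch T p)" "j < length (ch T p)"
  shows "sib (ch T p ! i) (ch T p ! j) \<longleftrightarrow> i < j"
proof
  assume "sib (ch T p ! i) (ch T p ! j)"
  then obtain p' i' j' where p': "p' \<in> verts T" "i' < j'" "j' < length (ch T p')"
    "ch T p ! i = ch T p' ! i'" "ch T p ! j = ch T p' ! j'" "parent T (ch T p ! i) = p'"
    by (elim sibE)
  have "p' = p" using p'(6) parent_child assms by auto
  then have "i = i'" "j = j'"
    using p' assms distinct_ch[OF assms(1)] by (auto simp: nth_eq_iff_index_eq)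
  then show "i < j" using p'(2) by simp
next
  assume "i < j"
  then show "sib (ch T p ! i) (ch T p ! j)" unfolding sib_def using assms by blast
qed

lemma sib_total:
  assumes "p \<in> verts T" "u \<in> set (ch T p)" "v \<in> set (ch T p)" "u \<noteq> v"
  shows "sib u v \<or> sib v u"
proof -
  obtain i j where "i < length (ch T p)" "u = ch T p ! i" "j < length (ch T p)" "v = ch T p ! j"
    using assms by (metis in_set_conv_nth)
  then show ?thesis using sib_index[OF assms(1)] assms(4) by (metis linorder_neqE_nat)
qed

lemma sib_irrefl: "\<not> sib u u"
  by (auto elim: sibE)

lemma sib_level: "sib u v \<Longrightarrow> u \<in> level T k \<longleftrightarrow> v \<in> level T k"
proof -
  have "v \<in> level T k" if "(p, u) \<in> edges T" "(p, v) \<in> edges T" "u \<in> level T k" for p u v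
  proof (cases k)
    case 0
    then show ?thesis using that no_edge_root level_0 by auto
  next
    case (Suc j)
    then have "parent T u \<in> level T j" using level_SucD(1) that(3) by blast
    then have "p \<in> level T j" using parent_eq[OF that(1)] by simp
    then show ?thesis using level_SucI edge_verts[OF that(2)] Suc by blast
  qed
  then show "sib u v \<Longrightarrow> u \<in> level T k \<longleftrightarrow> v \<in> level T k"
    by (elim sibE) (metis edgeI)
qed

lemma sib_trans: "sib u v \<Longrightarrow> sib v w \<Longrightarrow> sib u w"
proof -
  assume uv: "sib u v" and vw: "sib v w"
  obtain p i j where p: "p \<in> verts T" "i < j" "j < length (ch T p)" "u = ch T p ! i" "v = ch T p ! j"
    "parent T v = p"
    using uv by (elim sibE)
  have "w \<in> set (ch T p)" using vw p(6) by (elim sibE) auto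
  then obtain l where l: "l < length (ch T p)" "w = ch T p ! l" by (metis in_set_conv_nth)
  have "j < l" using vw sib_index[OF p(1,3) l(1)] p l by simp
  then show "sib u w" using p l sib_index[OF p(1) _ l(1), of i] by simp
qed

section \<open>Addresses and positions on a level\<close>

lemma addr_level: "addr T p u \<Longrightarrow> u \<in> level T (length p)"
  by (induction rule: addr.induct) (auto simp: level_0 intro: level_SucI)

lemma level_addr: "u \<in> level T k \<Longrightarrow> \<exists>p. addr T p u"
proof (induction k arbitrary: u)
  case 0
  then show ?case using level_0 addr_root by fastforce
next
  case (Suc k)
  then obtain p where "addr T p (parent T u)" using level_SucD(1) by blast
  then show ?case using level_SucD(2)[OF Suc.prems] addr_child by (metis in_set_conv_nth)
qed

lemma addr_snoc:
  assumes "addr T p u" "u \<in> level T (Suc k)"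
  obtains p' i where "p = p' @ [i]" "addr T p' (parent T u)" "i < length (ch T (parent T u))"
    "u = ch T (parent T u) ! i"
  using assms(1)
proof cases
  case addr_root
  then show ?thesis using assms(2) level_0 level_unique by blast
next
  case (addr_child p' u' i)
  have "u' \<in> verts T" using addr_level[OF addr_child(3)] level_verts by blast
  then have "parent T u = u'" using parent_child addr_child by auto
  then show ?thesis using that addr_child by blast
qed

lemma addr_unique: "addr T p u \<Longrightarrow> addr T q u \<Longrightarrow> p = q"
proof (induction p arbitrary: u q rule: rev_induct)
  case Nil
  then have "length q = 0" using addr_level level_unique by (metis list.size(3))
  then show ?case by simp
next
  case (snoc i p)
  have lev: "u \<in> level T (Suc (length p))" using addr_level[OF snoc.prems(1)] by simp
  obtain p1 i1 where 1: "p @ [i] = p1 @ [i1]" "addr T p1 (parent T u)" "i1 < length (ch T (parent T u))"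
    "u = ch T (parent T u) ! i1"
    using addr_snoc[OF snoc.prems(1) lev] .
  obtain q1 j1 where 2: "q = q1 @ [j1]" "addr T q1 (parent T u)" "j1 < length (ch T (parent T u))"
    "u = ch T (parent T u) ! j1"
    using addr_snoc[OF snoc.prems(2) lev] .
  have "i1 = j1"
    using 1 2 distinct_ch[OF parent_vert[OF lev]] by (metis nth_eq_iff_index_eq)
  then show ?case using 1 2 snoc.IH by auto
qed

lemma lex_before_root: "\<not> lex_before T (root T) (root T)"
proof
  assume "lex_before T (root T) (root T)"
  then obtain p q where pq: "addr T p (root T)" "addr T q (root T)" "(p, q) \<in> lexord less_than"
    unfolding lex_before_def by blast
  then have "p = [] \<and> q = []" using addr_unique addr_root by metis
  then show False using pq(3) by simp
qed

text \<open>Addresses on one level have equal length, so their lexicographic comparison is that of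
  the parents unless the parents coincide.\<close>

lemma lex_before_Suc:
  assumes "u \<in> level T (Suc k)" "v \<in> level T (Suc k)"
  shows "lex_before T u v \<longleftrightarrow>
    lex_before T (parent T u) (parent T v) \<or> parent T u = parent T v \<and> sib u v"
proof -
  obtain p q where p: "addr T p u" and q: "addr T q v" using level_addr assms by blast
  obtain p' i where p': "p = p' @ [i]" "addr T p' (parent T u)" "i < length (ch T (parent T u))"
    "u = ch T (parent T u) ! i"
    using addr_snoc[OF p assms(1)] .
  obtain q' j where q': "q = q' @ [j]" "addr T q' (parent T v)" "j < length (ch T (parent T v))"
    "v = ch T (parent T v) ! j"
    using addr_snoc[OF q assms(2)] .
  have len: "length p' = length q'"
    using addr_level[OF p'(2)] addr_level[OF q'(2)] level_SucD(1) assms level_unique by metis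
  have 1: "lex_before T u v \<longleftrightarrow> (p, q) \<in> lexord less_than"
    unfolding lex_before_def using p q addr_unique by metis
  have 2: "lex_before T (parent T u) (parent T v) \<longleftrightarrow> (p', q') \<in> lexord less_than"
    unfolding lex_before_def using p'(2) q'(2) addr_unique by metis
  \<comment> \<open>This needs the converse of \<open>addr_unique\<close> as well: an address
    determines its vertex.\<close>
  have 3: "p' = q' \<longleftrightarrow> parent T u = parent T v"
    using p'(2) q'(2) addr_unique
  proof -
    have "parent T u = parent T v" if "addr T r (parent T u)" "addr T r (parent T v)" for r
      using that
    proof -
      have "x = y" if "addr T r x" "addr T r y" for x y
        using that
      proof (induction r arbitrary: x y rule: rev_induct)
        case Nil
        then show ?case by (auto elim: addr.cases)
      next
        case (snoc a r)
        from snoc.prems(1) obtain x' where x': "addr T r x'" "x = ch T x' ! a"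
          by cases auto
        from snoc.prems(2) obtain y' where y': "addr T r y'" "y = ch T y' ! a"
          by cases auto
        show ?case using snoc.IH[OF x'(1) y'(1)] x' y' by simp
      qed
      then show ?thesis using that by blast
    qed
    then show ?thesis using p'(2) q'(2) addr_unique by metis
  qed
  have 4: "sib u v \<longleftrightarrow> i < j" if "parent T u = parent T v"
    using sib_index[OF parent_vert[OF assms(1)] p'(3), of j] that p'(4) q'(3,4) by metis
  show ?thesis
    unfolding 1 2 p'(1) q'(1) lexord_snoc[OF len] using 3 4 by auto
qed

lemma lex_before_irrefl: "u \<in> level T k \<Longrightarrow> \<not> lex_before T u u"
proof (induction k arbitrary: u)
  case 0
  then show ?case using lex_before_root level_0 by auto
next
  case (Suc k)
  then show ?case using lex_before_Suc[of u k u] level_SucD(1) sib_irrefl by blast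
qed

lemma lex_before_trans:
  "u \<in> level T k \<Longrightarrow> v \<in> level T k \<Longrightarrow> w \<in> level T k \<Longrightarrow> lex_before T u v \<Longrightarrow> lex_before T v w \<Longrightarrow> lex_before T u w"
proof (induction k arbitrary: u v w)
  case 0
  then show ?case using level_0 lex_before_root by auto
next
  case (Suc k)
  have p: "parent T u \<in> level T k" "parent T v \<in> level T k" "parent T w \<in> level T k"
    using level_SucD(1) Suc.prems by blast+
  show ?case
    using Suc.prems(4,5) Suc.IH[OF p] sib_trans[of u v w]
    unfolding lex_before_Suc[OF Suc.prems(1,2)] lex_before_Suc[OF Suc.prems(2,3)] lex_before_Suc[OF Suc.prems(1,3)]
    by auto
qed

lemma lex_before_total:
  "u \<in> level T k \<Longrightarrow> v \<in> level T k \<Longrightarrow> u \<noteq> v \<Longrightarrow> lex_before T u v \<or> lex_before T v u"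
proof (induction k arbitrary: u v)
  case 0
  then show ?case using level_0 by auto
next
  case (Suc k)
  have p: "parent T u \<in> level T k" "parent T v \<in> level T k"
    using level_SucD(1) Suc.prems by blast+
  show ?case
  proof (cases "parent T u = parent T v")
    case True
    then show ?thesis
      using sib_total[OF parent_vert[OF Suc.prems(1)], of u v] level_SucD(2)[OF Suc.prems(1)]
        level_SucD(2)[OF Suc.prems(2)] Suc.prems(3)
      unfolding lex_before_Suc[OF Suc.prems(1,2)] lex_before_Suc[OF Suc.prems(2,1)] by metis
  next
    case False
    then show ?thesis
      using Suc.IH[OF p] unfolding lex_before_Suc[OF Suc.prems(1,2)] lex_before_Suc[OF Suc.prems(2,1)]
      by blast
  qed
qed

lemma pos_eq: "u \<in> level T k \<Longrightarrow> pos T u = Suc (card {w \<in> level T k. lex_before T w u})"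
  unfolding pos_def using vdepth_eq by simp

lemma pos_mono:
  assumes "u \<in> level T k" "v \<in> level T k" "lex_before T u v"
  shows "pos T u < pos T v"
proof -
  have "{w \<in> level T k. lex_before T w u} \<subset> {w \<in> level T k. lex_before T w v}"
    using assms lex_before_trans lex_before_irrefl by blast
  then show ?thesis
    unfolding pos_eq[OF assms(1)] pos_eq[OF assms(2)] using finite_level by (simp add: psubset_card_mono)
qed

lemma pos_less_iff:
  assumes "u \<in> level T k" "v \<in> level T k"
  shows "pos T u < pos T v \<longleftrightarrow> lex_before T u v"
  using pos_mono assms lex_before_total by (metis less_imp_not_less less_irrefl)

lemma pos_inj:
  assumes "u \<in> level T k" "v \<in> level T k"
  shows "pos T u = pos T v \<longleftrightarrow> u = v"
  using pos_mono assms lex_before_total by (metis less_irrefl)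

text \<open>This recursion over levels replaces explicit addresses in all later arguments about
  positions.\<close>

lemma pos_less_Suc_iff:
  assumes "u \<in> level T (Suc k)" "v \<in> level T (Suc k)"
  shows "pos T u < pos T v \<longleftrightarrow>
    pos T (parent T u) < pos T (parent T v) \<or> parent T u = parent T v \<and> sib u v"
  using pos_less_iff[OF assms] lex_before_Suc[OF assms]
    pos_less_iff[OF level_SucD(1)[OF assms(1)] level_SucD(1)[OF assms(2)]] by simp

lemma pos_sib: "sib u v \<Longrightarrow> pos T u < pos T v"
proof -
  assume s: "sib u v"
  then have u: "u \<in> verts T" and v: "v \<in> verts T" using ch_verts by (auto elim!: sibE)
  obtain k where k: "u \<in> level T k" using ex_level u by blast
  then have v: "v \<in> level T k" using sib_level[OF s] by blast
  obtain j where "k = Suc j"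
  proof (cases k)
    case 0
    then show thesis using s k v level_0 by (auto elim!: sibE)
  qed (use that in blast)
  then show ?thesis using pos_less_Suc_iff[of u j v] k v s sib_parent[OF s] by blast
qed

lemma bij_pos: "bij_betw (pos T) (level T k) {1..card (level T k)}"
proof -
  have inj: "inj_on (pos T) (level T k)" using pos_inj unfolding inj_on_def by blast
  have "pos T ` level T k \<subseteq> {1..card (level T k)}"
  proof
    fix n assume "n \<in> pos T ` level T k"
    then obtain u where u: "u \<in> level T k" "n = pos T u" by blast
    have "{w \<in> level T k. lex_before T w u} \<subset> level T k"
      using u lex_before_irrefl by blast
    then have "card {w \<in> level T k. lex_before T w u} < card (level T k)"
      using finite_level psubset_card_mono by blast
    then show "n \<in> {1..card (level T k)}" unfolding u(2) pos_eq[OF u(1)] by auto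
  qed
  then have "pos T ` level T k = {1..card (level T k)}"
    by (intro card_subset_eq) (auto simp: card_image[OF inj])
  then show ?thesis using inj unfolding bij_betw_def by blast
qed

lemma nth_vert:
  assumes "1 \<le> i" "i \<le> card (level T k)"
  shows "nth_vert T k i \<in> level T k" "pos T (nth_vert T k i) = i"
proof -
  have "i \<in> pos T ` level T k" using bij_pos[of k] assms unfolding bij_betw_def by auto
  then have "\<exists>!u. u \<in> level T k \<and> pos T u = i" using pos_inj by (metis imageE)
  then have "nth_vert T k i \<in> level T k \<and> pos T (nth_vert T k i) = i"
    unfolding nth_vert_def by (rule theI')
  then show "nth_vert T k i \<in> level T k" "pos T (nth_vert T k i) = i" by auto
qed

lemma pos_range: "u \<in> level T k \<Longrightarrow> 1 \<le> pos T u \<and> pos T u \<le> card (level T k)"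
  using bij_pos[of k] unfolding bij_betw_def by auto

lemma nth_vert_pos: "u \<in> level T k \<Longrightarrow> nth_vert T k (pos T u) = u"
  using nth_vert pos_range pos_inj by metis

section \<open>Sets of weak descendants\<close>

lemma weakly_below_parent:
  assumes "v \<in> level T (Suc k)"
  shows "v \<in> weakly_below T W \<longleftrightarrow> v \<in> W \<or> parent T v \<in> weakly_below T W"
  unfolding weakly_below_def using weak_desc_parent[OF assms] by auto

lemma weakly_below_level_ge:
  "W \<subseteq> level T j \<Longrightarrow> v \<in> weakly_below T W \<Longrightarrow> v \<in> level T k \<Longrightarrow> j \<le> k"
  unfolding weakly_below_def using weak_desc_level by blast

lemma weakly_below_level_eq:
  "W \<subseteq> level T j \<Longrightarrow> v \<in> level T j \<Longrightarrow> v \<in> weakly_below T W \<longleftrightarrow> v \<in> W"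
  unfolding weakly_below_def using weak_desc_level weak_desc_refl by blast

text \<open>On the level of \<open>W\<close> this is consecutiveness among siblings. Further down, a
  vertex between two others has its parent weakly between theirs.\<close>

lemma weakly_below_interval:
  assumes p: "p \<in> verts T" "W \<subseteq> set (ch T p)" "consecutive (ch T p) W"
  shows "u \<in> level T k \<Longrightarrow> v \<in> level T k \<Longrightarrow> x \<in> level T k \<Longrightarrow> u \<in> weakly_below T W \<Longrightarrow>
    v \<in> weakly_below T W \<Longrightarrow> pos T u < pos T x \<Longrightarrow> pos T x < pos T v \<Longrightarrow> x \<in> weakly_below T W"
proof (induction k arbitrary: u v x)
  case 0
  then show ?case using level_0 by auto
next
  case (Suc k)
  define j where "j = vdepth T p"
  have Wj: "W \<subseteq> level T (Suc j)"
    using p(2) level_SucI vdepth_level[OF p(1)] unfolding j_def by blast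
  have par: "parent T u \<in> level T k" "parent T v \<in> level T k" "parent T x \<in> level T k"
    using level_SucD(1) Suc.prems by blast+
  have le: "pos T (parent T u) \<le> pos T (parent T x)" "pos T (parent T x) \<le> pos T (parent T v)"
    using Suc.prems(6,7) pos_less_Suc_iff Suc.prems(1-3) by fastforce+
  have jk: "Suc j \<le> Suc k" using weakly_below_level_ge[OF Wj Suc.prems(4,1)] .
  show ?case
  proof (cases "j = k")
    case True
    then have uv: "u \<in> W" "v \<in> W" using weakly_below_level_eq[OF Wj] Suc.prems by auto
    then have pp: "parent T u = p" "parent T v = p" using p(1,2) parent_child by auto
    have "pos T (parent T x) = pos T (parent T u)" using le pp by simp
    then have px: "parent T x = p" using pos_inj[OF par(3) par(1)] pp by simp
    have s: "sib u x" "sib x v"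
      using pos_less_Suc_iff[OF Suc.prems(1,3)] pos_less_Suc_iff[OF Suc.prems(3,2)] Suc.prems(6,7) pp px
      by simp_all
    have ch: "u \<in> set (ch T p)" "v \<in> set (ch T p)" using uv p(2) by auto
    obtain i where i: "i < length (ch T p)" "u = ch T p ! i" using ch(1) by (metis in_set_conv_nth)
    obtain l where l: "l < length (ch T p)" "v = ch T p ! l" using ch(2) by (metis in_set_conv_nth)
    obtain m where m: "m < length (ch T p)" "x = ch T p ! m"
      using level_SucD(2)[OF Suc.prems(3)] px by (metis in_set_conv_nth)
    have "i < m" "m < l" using s i l m sib_index[OF p(1)] by auto
    then have "x \<in> W"
      using consecutive_between[OF p(3) distinct_ch[OF p(1)]] i l m uv by blast
    then show ?thesis unfolding weakly_below_def using weak_desc_refl by blast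
  next
    case False
    then have "u \<notin> W" "v \<notin> W" using Wj Suc.prems level_unique jk by blast+
    then have "parent T u \<in> weakly_below T W" "parent T v \<in> weakly_below T W"
      using weakly_below_parent Suc.prems by blast+
    then have "parent T x \<in> weakly_below T W"
      using Suc.IH[OF par] le pos_inj par by (metis le_neq_implies_less)
    then show ?thesis using weakly_below_parent Suc.prems by blast
  qed
qed

end

section \<open>Brackets and bracketings\<close>

lemma bsub_iff: "bsub A A' \<longleftrightarrow> length A = length A' \<and> (\<forall>i<length A. A ! i \<subseteq> A' ! i)"
  unfolding bsub_def by (simp add: list_all2_conv_all_nth)

lemma bsub_refl: "bsub A A"
  by (simp add: bsub_iff)

lemma bsub_trans: "bsub A B \<Longrightarrow> bsub B C \<Longrightarrow> bsub A C"
  unfolding bsub_iff by (metis subset_trans)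

lemma bsub_antisym: "bsub A B \<Longrightarrow> bsub B A \<Longrightarrow> A = B"
  by (auto simp: bsub_iff intro!: nth_equalityI)

lemma bsub_length: "bsub A B \<Longrightarrow> length A = length B"
  by (simp add: bsub_iff)

lemma bsub_last: "bsub A B \<Longrightarrow> A \<noteq> [] \<Longrightarrow> last A \<subseteq> last B"
proof -
  assume b: "bsub A B" and A: "A \<noteq> []"
  then have "B \<noteq> []" using bsub_length[OF b] by auto
  moreover have "length A = length B" using bsub_length[OF b] .
  moreover have "A ! i \<subseteq> B ! i" if "i < length A" for i
    using b that unfolding bsub_iff by blast
  then have "A ! (length A - 1) \<subseteq> B ! (length A - 1)" using A by simp
  ultimately show "last A \<subseteq> last B" using A by (simp add: last_conv_nth)
qed

lemma snoc_eqI: "A \<noteq> [] \<Longrightarrow> B \<noteq> [] \<Longrightarrow> butlast A = butlast B \<Longrightarrow> last A = last B \<Longrightarrow> A = B"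
  by (metis append_butlast_last_id)

lemma length_eq_Suc_butlast: "A \<noteq> [] \<Longrightarrow> length A = Suc (length (butlast A))"
  by simp

lemma over_iff: "A' \<in> over B A \<longleftrightarrow> A' \<in> brs B \<and> A' \<noteq> [] \<and> butlast A' = A"
  unfolding over_def blevel_def by (cases A' rule: rev_cases) auto

lemma length_funpow_butlast: "length ((butlast ^^ l) A) = length A - l"
  by (induction l) auto

lemma bracket_length: "is_bracket T k A \<Longrightarrow> length A = Suc k"
  by (simp add: is_bracket_def)

lemma bracket_nonempty: "is_bracket T k A \<Longrightarrow> A \<noteq> []"
  by (auto simp: is_bracket_def)

lemma bracket_last: "is_bracket T k A \<Longrightarrow> last A = A ! k"
  by (metis bracket_length bracket_nonempty diff_Suc_1 last_conv_nth)

lemma bracket_step: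
  assumes "is_bracket T k A" "i < k"
  shows "\<forall>u\<in>A ! Suc i. parent T u \<in> A ! i" "\<forall>u\<in>A ! i. consecutive (ch T u) (A ! Suc i \<inter> set (ch T u))"
proof -
  have "Suc i \<in> {1..k}" using assms(2) by simp
  then have "(\<forall>u\<in>A ! Suc i. parent T u \<in> A ! (Suc i - 1)) \<and>
      (\<forall>u\<in>A ! (Suc i - 1). consecutive (ch T u) (A ! Suc i \<inter> set (ch T u)))"
    using assms(1) unfolding is_bracket_def by blast
  then show "\<forall>u\<in>A ! Suc i. parent T u \<in> A ! i" "\<forall>u\<in>A ! i. consecutive (ch T u) (A ! Suc i \<inter> set (ch T u))"
    by simp_all
qed

lemma bracket_last_level: "is_bracket T k A \<Longrightarrow> last A \<subseteq> level T k"
  by (simp add: bracket_last) (simp add: is_bracket_def)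

lemma bracket_last_nonempty: "is_bracket T k A \<Longrightarrow> last A \<noteq> {}"
  by (simp add: bracket_last) (simp add: is_bracket_def)

lemma bracket_parent:
  assumes "is_bracket T (Suc k) A" "v \<in> last A"
  shows "parent T v \<in> last (butlast A)"
proof -
  have "last (butlast A) = A ! k"
    using bracket_length[OF assms(1)] by (subst last_conv_nth) (auto simp: nth_butlast simp flip: length_greater_0_conv)
  then show ?thesis using assms bracket_last[OF assms(1)] bracket_step[OF assms(1), of k] by simp
qed

lemma bracket_consecutive:
  assumes "is_bracket T (Suc k) A" "u \<in> last (butlast A)"
  shows "consecutive (ch T u) (last A \<inter> set (ch T u))"
proof -
  have "last (butlast A) = A ! k"
    using bracket_length[OF assms(1)] by (subst last_conv_nth) (auto simp: nth_butlast simp flip: length_greater_0_conv)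
  then show ?thesis using assms bracket_last[OF assms(1)] bracket_step[OF assms(1), of k] by simp
qed

lemma length_max_bracket: "length (max_bracket T k) = Suc k"
  by (simp add: max_bracket_def)

lemma last_max_bracket: "last (max_bracket T k) = level T k"
  by (simp add: max_bracket_def)

lemma butlast_max_bracket: "butlast (max_bracket T (Suc k)) = max_bracket T k"
  by (simp add: max_bracket_def butlast_append)

lemma max_bracket_nonempty: "max_bracket T k \<noteq> []"
  by (simp add: max_bracket_def)

lemma bracket_bsub_max: "is_bracket T k A \<Longrightarrow> bsub A (max_bracket T k)"
  unfolding bsub_iff
  by (simp add: bracket_length length_max_bracket) (auto simp: max_bracket_def is_bracket_def nth_append less_Suc_eq simp del: upt_Suc)

context plane_tree
begin

lemma sing_bracket_level:
  "u \<in> level T k \<Longrightarrow> sing_bracket T u = map (\<lambda>i. {w \<in> level T i. weak_desc T w u}) [0..<Suc k]"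
  unfolding sing_bracket_def by (simp add: vdepth_eq)

lemma length_sing_bracket: "u \<in> level T k \<Longrightarrow> length (sing_bracket T u) = Suc k"
  by (simp add: sing_bracket_level)

lemma last_sing_bracket: "u \<in> verts T \<Longrightarrow> last (sing_bracket T u) = {u}"
proof -
  assume "u \<in> verts T"
  then obtain k where k: "u \<in> level T k" using ex_level by blast
  have "{w \<in> level T k. weak_desc T w u} = {u}"
    using k weak_desc_level weak_desc_refl by blast
  then show ?thesis using sing_bracket_level[OF k] by simp
qed

lemma sing_bracket_nonempty: "sing_bracket T u \<noteq> []"
  by (simp add: sing_bracket_def)

lemma butlast_sing_bracket:
  assumes "u \<in> level T (Suc k)"
  shows "butlast (sing_bracket T u) = sing_bracket T (parent T u)"
proof -
  have p: "parent T u \<in> level T k" using level_SucD(1) assms by blast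
  have "{w \<in> level T i. weak_desc T w u} = {w \<in> level T i. weak_desc T w (parent T u)}" if "i < Suc k" for i
    using weak_desc_parent[OF assms] level_unique[OF assms, of i] that by auto
  then show ?thesis
    unfolding sing_bracket_level[OF assms] sing_bracket_level[OF p] by (simp add: butlast_append)
qed

lemma butlast_sing_root: "butlast (sing_bracket T (root T)) = []"
  using sing_bracket_level[of "root T" 0] level_0 by simp

lemma sing_bracket_inj: "u \<in> verts T \<Longrightarrow> v \<in> verts T \<Longrightarrow> sing_bracket T u = sing_bracket T v \<Longrightarrow> u = v"
  using last_sing_bracket by (metis singleton_inject)

lemma is_sing_butlast:
  assumes "is_sing T A" "length A \<noteq> 1"
  shows "is_sing T (butlast A)"
proof -
  obtain u where u: "u \<in> verts T" "A = sing_bracket T u" using assms(1) unfolding is_sing_def by blast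
  obtain k where k: "u \<in> level T k" using ex_level u by blast
  then obtain j where "k = Suc j" using assms(2) u(2) length_sing_bracket[OF k] by (cases k) auto
  then show ?thesis
    unfolding is_sing_def u(2) using butlast_sing_bracket parent_vert k by blast
qed

lemma is_sing_length_1: "is_bracket T 0 A \<Longrightarrow> is_sing T A"
proof -
  assume A: "is_bracket T 0 A"
  then have "last A = {root T}" using bracket_last_level bracket_last_nonempty level_0 by (metis subset_singletonD)
  moreover have "length (butlast A) = 0" using bracket_length[OF A] by simp
  then have "butlast A = []" by blast
  ultimately have "A = sing_bracket T (root T)"
    using snoc_eqI[OF bracket_nonempty[OF A] sing_bracket_nonempty] butlast_sing_root
      last_sing_bracket[OF root_vert] by simp
  then show ?thesis unfolding is_sing_def using root_vert by blast
qed

lemma bracket_over_sing: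
  assumes A: "is_bracket T (Suc k) A" and p: "p \<in> verts T" "butlast A = sing_bracket T p"
  shows "last A \<subseteq> set (ch T p)" "last A = {v} \<Longrightarrow> A = sing_bracket T v"
proof -
  have par: "parent T v = p" if "v \<in> last A" for v
    using bracket_parent[OF A that] p last_sing_bracket by simp
  show "last A \<subseteq> set (ch T p)"
    using par level_SucD(2) bracket_last_level[OF A] by blast
  assume v: "last A = {v}"
  then have "v \<in> level T (Suc k)" using bracket_last_level[OF A] by blast
  then have b: "butlast A = butlast (sing_bracket T v)" "last A = last (sing_bracket T v)"
    using butlast_sing_bracket par v p last_sing_bracket level_verts by auto
  show "A = sing_bracket T v"
    by (rule snoc_eqI[OF bracket_nonempty[OF A] sing_bracket_nonempty b])
qed

text \<open>A bracket is closed under taking parents, so it contains all ancestors of a top-level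
  vertex.\<close>

lemma sing_bsub:
  assumes A: "is_bracket T k A" and v: "v \<in> last A"
  shows "bsub (sing_bracket T v) A"
proof -
  have vk: "v \<in> level T k" using bracket_last_level[OF A] v by blast
  have up: "w \<in> A ! i" if "i \<le> j" "j \<le> k" "u \<in> A ! j" "w \<in> level T i" "weak_desc T w u" for i j u w
    using that
  proof (induction j arbitrary: u)
    case 0
    then have "u \<in> level T 0" using A by (auto simp: is_bracket_def)
    then show ?case using 0 weak_desc_level by blast
  next
    case (Suc j)
    have u: "u \<in> level T (Suc j)" using A Suc.prems(2,3) unfolding is_bracket_def by blast
    show ?case
    proof (cases "i = Suc j")
      case True
      then show ?thesis using Suc.prems u weak_desc_level by blast
    next
      case False
      then have "w \<noteq> u" using u Suc.prems(4) level_unique by blast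
      then have "weak_desc T w (parent T u)" using weak_desc_parent[OF u] Suc.prems(5) by blast
      moreover have "parent T u \<in> A ! j"
        using bracket_step(1)[OF A, of j] Suc.prems(2,3) by simp
      ultimately show ?thesis using Suc.IH False Suc.prems by simp
    qed
  qed
  show ?thesis
    unfolding bsub_iff length_sing_bracket[OF vk] bracket_length[OF A]
  proof (intro conjI allI impI)
    fix i assume i: "i < Suc k"
    have "sing_bracket T v ! i = {w \<in> level T i. weak_desc T w v}"
      unfolding sing_bracket_level[OF vk] using i by (simp del: upt_Suc)
    then show "sing_bracket T v ! i \<subseteq> A ! i"
      using up[of i k v] i v bracket_last[OF A] by auto
  qed simp
qed

text \<open>Every bracketing is forced to contain these, and a minimum bracketing contains no
  others.\<close>

definition trivial_brackets :: "'v bracket set" where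
  "trivial_brackets = sing_bracket T ` verts T \<union> max_bracket T ` {..depth T}"

lemma nontrivial_iff: "nontrivial T A \<longleftrightarrow> A \<notin> trivial_brackets"
  unfolding nontrivial_def is_sing_def trivial_brackets_def by auto

end

section \<open>Bracketings, and smaller bracketings cut out of them\<close>

locale tree_bracketing = plane_tree T for T :: "'v ptree" +
  fixes B :: "'v bracketing"
  assumes bracketing: "is_bracketing T B"
begin

lemmas axioms_conj = bracketing[unfolded is_bracketing_def]
lemmas ax_bracket = axioms_conj[THEN conjunct1]
lemmas ax_prec = axioms_conj[THEN conjunct2, THEN conjunct1]
lemmas ax_irrefl = axioms_conj[THEN conjunct2, THEN conjunct2, THEN conjunct1]
lemmas ax_trans = axioms_conj[THEN conjunct2, THEN conjunct2, THEN conjunct2, THEN conjunct1]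
lemmas ax_trivial = axioms_conj[THEN conjunct2, THEN conjunct2, THEN conjunct2, THEN conjunct2, THEN conjunct1]
lemmas ax_butlast = axioms_conj[THEN conjunct2, THEN conjunct2, THEN conjunct2, THEN conjunct2, THEN conjunct2, THEN conjunct1]
lemmas ax_nested = axioms_conj[THEN conjunct2, THEN conjunct2, THEN conjunct2, THEN conjunct2, THEN conjunct2, THEN conjunct2, THEN conjunct1]
lemmas ax_cover = axioms_conj[THEN conjunct2, THEN conjunct2, THEN conjunct2, THEN conjunct2, THEN conjunct2, THEN conjunct2, THEN conjunct2, THEN conjunct1]
lemmas ax_refine = axioms_conj[THEN conjunct2, THEN conjunct2, THEN conjunct2, THEN conjunct2, THEN conjunct2, THEN conjunct2, THEN conjunct2, THEN conjunct2, THEN conjunct1]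
lemmas ax_comparable = axioms_conj[THEN conjunct2, THEN conjunct2, THEN conjunct2, THEN conjunct2, THEN conjunct2, THEN conjunct2, THEN conjunct2, THEN conjunct2, THEN conjunct2, THEN conjunct1]
lemmas ax_length = axioms_conj[THEN conjunct2, THEN conjunct2, THEN conjunct2, THEN conjunct2, THEN conjunct2, THEN conjunct2, THEN conjunct2, THEN conjunct2, THEN conjunct2, THEN conjunct2, THEN conjunct1]
lemmas ax_sib = axioms_conj[THEN conjunct2, THEN conjunct2, THEN conjunct2, THEN conjunct2, THEN conjunct2, THEN conjunct2, THEN conjunct2, THEN conjunct2, THEN conjunct2, THEN conjunct2, THEN conjunct2, THEN conjunct1]
lemmas ax_compatible = axioms_conj[THEN conjunct2, THEN conjunct2, THEN conjunct2, THEN conjunct2, THEN conjunct2, THEN conjunct2, THEN conjunct2, THEN conjunct2, THEN conjunct2, THEN conjunct2, THEN conjunct2, THEN conjunct2]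

lemma bracket: "A \<in> brs B \<Longrightarrow> \<exists>k\<le>depth T. is_bracket T k A"
  using ax_bracket by blast

lemma bracket_at: "A \<in> brs B \<Longrightarrow> length A = Suc k \<Longrightarrow> is_bracket T k A \<and> k \<le> depth T"
  using bracket bracket_length by fastforce

lemma nonempty: "A \<in> brs B \<Longrightarrow> A \<noteq> []"
  using bracket bracket_nonempty by blast

lemma last_nonempty: "A \<in> brs B \<Longrightarrow> last A \<noteq> {}"
  using bracket bracket_last_nonempty by blast

lemma prec_brs: "(A1, A2) \<in> prec B \<Longrightarrow> A1 \<in> brs B \<and> A2 \<in> brs B"
  using ax_prec by blast

lemma prec_irrefl: "(A, A) \<notin> prec B"
  using ax_irrefl unfolding irrefl_def by blast

lemma prec_trans: "(A1, A2) \<in> prec B \<Longrightarrow> (A2, A3) \<in> prec B \<Longrightarrow> (A1, A3) \<in> prec B"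
  using ax_trans unfolding trans_def by blast

lemma prec_length: "(A1, A2) \<in> prec B \<Longrightarrow> length A1 = length A2"
  using ax_length by blast

lemma max_in: "k \<le> depth T \<Longrightarrow> max_bracket T k \<in> brs B"
  using ax_trivial by blast

lemma sing_in: "u \<in> verts T \<Longrightarrow> sing_bracket T u \<in> brs B"
proof -
  assume "u \<in> verts T"
  then obtain k where "u \<in> level T k" using ex_level by blast
  moreover then have "k \<le> depth T" using level_le_depth by blast
  ultimately show ?thesis using ax_trivial by blast
qed

lemma trivial_in: "trivial_brackets \<subseteq> brs B"
  unfolding trivial_brackets_def using sing_in max_in by blast

lemma butlast_in:
  assumes "A \<in> brs B" "length A \<noteq> 1"
  shows "butlast A \<in> brs B"
proof -
  have "length A \<noteq> 0" using nonempty[OF assms(1)] by simp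
  then obtain k where k: "length A = Suc (Suc k)"
    using assms(2) by (metis One_nat_def not0_implies_Suc)
  have "A \<in> blevel B (Suc k)" "Suc k \<in> {1..depth T}"
    using assms k bracket_at[OF assms(1) k] by (auto simp: blevel_def)
  then have "butlast A \<in> blevel B (Suc k - 1)"
    using ax_butlast by blast
  then show ?thesis by (simp add: blevel_def)
qed

lemma nested:
  assumes "A1 \<in> brs B" "A2 \<in> brs B" "length A1 = length A2" "last A1 \<inter> last A2 \<noteq> {}"
  shows "bsub A1 A2 \<or> bsub A2 A1"
proof -
  obtain k where k: "k \<le> depth T" "is_bracket T k A1" using bracket assms by blast
  have "A1 \<in> blevel B k" "A2 \<in> blevel B k"
    using assms bracket_length[OF k(2)] by (auto simp: blevel_def)
  then show ?thesis using ax_nested k(1) assms(4) by blast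
qed

lemma over_parent:
  assumes "A' \<in> over B A" "v \<in> last A'" "A \<noteq> []"
  shows "parent T v \<in> last A" "v \<in> set (ch T (parent T v))" "v \<in> level T (length A)"
proof -
  have A': "A' \<in> brs B" "butlast A' = A" "A' \<noteq> []" using assms(1) by (auto simp: over_iff)
  then have "length A' = Suc (length A)" by auto
  moreover obtain j where j: "length A = Suc j" using assms(3) by (cases A) auto
  ultimately have br: "is_bracket T (Suc j) A'" using bracket_at A'(1) by simp
  show "parent T v \<in> last A" using bracket_parent[OF br assms(2)] A'(2) by simp
  have "v \<in> level T (Suc j)" using bracket_last_level[OF br] assms(2) by blast
  then show "v \<in> set (ch T (parent T v))" "v \<in> level T (length A)"
    using level_SucD(2) j by auto
qed

lemma cover:
  assumes "A \<in> brs B" "u \<in> last A" "v \<in> set (ch T u)"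
  shows "\<exists>A'\<in>over B A. v \<in> last A'"
proof -
  obtain k where k: "k \<le> depth T" "is_bracket T k A" using bracket assms by blast
  have "v \<in> level T (Suc k)" using level_SucI bracket_last_level[OF k(2)] assms by blast
  then have "Suc k \<in> {1..depth T}" using level_le_depth by auto
  moreover have "A \<in> blevel B (Suc k - 1)" using assms(1) bracket_length[OF k(2)] by (simp add: blevel_def)
  ultimately have "(\<Union>A'\<in>over B A. last A') = (\<Union>u\<in>last A. set (ch T u))"
    using ax_cover by blast
  then show ?thesis using assms by blast
qed

lemma refine:
  assumes "A \<in> brs B" "A1 \<in> over B A" "A2 \<in> over B A" "bsub A2 A1" "A2 \<noteq> A1" "u \<in> last A1"
  shows "\<exists>A3\<in>over B A. u \<in> last A3 \<and> bsub A3 A1 \<and> A3 \<noteq> A1"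
proof -
  obtain k where k: "k \<le> depth T" "is_bracket T k A" using bracket assms by blast
  have "length A1 = Suc (Suc k)" "A1 \<in> brs B"
    using assms(2) bracket_length[OF k(2)] unfolding over_def blevel_def by auto
  then have "Suc k \<in> {1..depth T}" using bracket_at by auto
  moreover have "A \<in> blevel B (Suc k - 1)" using assms(1) bracket_length[OF k(2)] by (simp add: blevel_def)
  ultimately show ?thesis
    using ax_refine assms(2-6) by blast
qed

lemma comparable_iff:
  assumes "A1 \<in> brs B" "A2 \<in> brs B" "A1 \<noteq> A2" "length A1 = length A2"
  shows "comparable B A1 A2 \<longleftrightarrow> butlast A1 = butlast A2 \<and> last A1 \<inter> last A2 = {}"
proof -
  obtain k where k: "k \<le> depth T" "is_bracket T k A1" using bracket assms by blast
  have "A1 \<in> blevel B k" "A2 \<in> blevel B k"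
    using assms bracket_length[OF k(2)] by (auto simp: blevel_def)
  then show ?thesis using ax_comparable k(1) assms(3) by blast
qed

lemma comparableD:
  assumes "comparable B A1 A2"
  shows "A1 \<in> brs B" "A2 \<in> brs B" "A1 \<noteq> A2" "length A1 = length A2" "butlast A1 = butlast A2"
    "last A1 \<inter> last A2 = {}"
proof -
  show 1: "A1 \<in> brs B" "A2 \<in> brs B" "A1 \<noteq> A2" "length A1 = length A2"
    using assms prec_brs prec_irrefl prec_length unfolding comparable_def by metis+
  show "butlast A1 = butlast A2" "last A1 \<inter> last A2 = {}"
    using comparable_iff[OF 1] assms by auto
qed

lemma prec_asym: "(A1, A2) \<in> prec B \<Longrightarrow> (A2, A1) \<notin> prec B"
  using prec_trans prec_irrefl by blast

lemma prec_sib: "sib u v \<Longrightarrow> (sing_bracket T u, sing_bracket T v) \<in> prec B"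
  using ax_sib unfolding sib_def by blast

lemma prec_compatible:
  assumes "A \<in> brs B" "A' \<in> brs B" "A1 \<in> over B A" "A2 \<in> over B A" "A1' \<in> over B A'" "A2' \<in> over B A'"
    "bsub A' A" "comparable B A1 A2" "comparable B A1' A2'" "bsub A1' A1" "bsub A2' A2"
  shows "(A1, A2) \<in> prec B \<longleftrightarrow> (A1', A2') \<in> prec B"
proof -
  obtain k where k: "k \<le> depth T" "is_bracket T k A" using bracket assms by blast
  have "length A1 = Suc (Suc k)" "A1 \<in> brs B"
    using assms(3) bracket_length[OF k(2)] unfolding over_def blevel_def by auto
  then have "Suc k \<in> {1..depth T}" using bracket_at by auto
  moreover have "A \<in> blevel B (Suc k - 1)" "A' \<in> blevel B (Suc k - 1)"
    using assms(1,2) bsub_length[OF assms(7)] bracket_length[OF k(2)] by (auto simp: blevel_def)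
  ultimately have "bsub A' A \<and> A1 \<noteq> A2 \<and> comparable B A1 A2 \<and> A1' \<noteq> A2' \<and> comparable B A1' A2' \<and>
        bsub A1' A1 \<and> bsub A2' A2 \<longrightarrow>
        ((A1, A2) \<in> prec B \<longleftrightarrow> (A1', A2') \<in> prec B)"
    using ax_compatible assms(3-6) by blast
  then show ?thesis using assms comparableD(3) by blast
qed

lemma prec_sing_iff:
  assumes u: "u \<in> verts T" and v: "v \<in> verts T"
  shows "(sing_bracket T u, sing_bracket T v) \<in> prec B \<longleftrightarrow> sib u v"
proof
  assume p: "(sing_bracket T u, sing_bracket T v) \<in> prec B"
  then have cmp: "comparable B (sing_bracket T u) (sing_bracket T v)" unfolding comparable_def by blast
  obtain k where k: "u \<in> level T k" using ex_level u by blast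
  obtain j where j: "v \<in> level T j" using ex_level v by blast
  have jk: "j = k" using comparableD(4)[OF cmp] length_sing_bracket k j by auto
  have uv: "u \<noteq> v" using comparableD(3)[OF cmp] by blast
  then obtain l where l: "k = Suc l" using k j jk level_0 by (cases k) auto
  have "sing_bracket T (parent T u) = sing_bracket T (parent T v)"
    using comparableD(5)[OF cmp] butlast_sing_bracket k j jk l by auto
  then have "parent T u = parent T v"
    using sing_bracket_inj parent_vert k j jk l by blast
  then have "sib u v \<or> sib v u"
    using sib_total[OF _ _ _ uv, of "parent T u"] parent_vert level_SucD(2) k j jk l by metis
  then show "sib u v" using p prec_sib prec_asym by blast
qed (rule prec_sib)

lemma last_max_meets: "A \<in> brs B \<Longrightarrow> length A = Suc k \<Longrightarrow> last A \<inter> last (max_bracket T k) \<noteq> {}"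
  using bracket_at bracket_last_level last_nonempty last_max_bracket by (metis inf.absorb_iff1)

lemma comparable_not_max:
  assumes "comparable B A1 A2"
  shows "A1 \<noteq> max_bracket T k"
proof
  assume "A1 = max_bracket T k"
  then show False
    using comparableD[OF assms] last_max_meets[of A2 k] length_max_bracket[of T k] by (auto simp: Int_commute)
qed

lemma comparable_sym: "comparable B A1 A2 \<Longrightarrow> comparable B A2 A1"
  unfolding comparable_def by blast

text \<open>A maximum bracket meets every bracket of its level and is comparable to none, and
  singletons compare as siblings. So the order on trivial brackets is the same in every
  bracketing.\<close>

lemma prec_trivial_iff:
  assumes "A1 \<in> trivial_brackets" "A2 \<in> trivial_brackets"
  shows "(A1, A2) \<in> prec B \<longleftrightarrow>
    (\<exists>u\<in>verts T. \<exists>v\<in>verts T. A1 = sing_bracket T u \<and> A2 = sing_bracket T v \<and> sib u v)"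
proof
  assume p: "(A1, A2) \<in> prec B"
  then have cmp: "comparable B A1 A2" unfolding comparable_def by blast
  obtain u v where "u \<in> verts T" "A1 = sing_bracket T u" "v \<in> verts T" "A2 = sing_bracket T v"
    using assms comparable_not_max[OF cmp] comparable_not_max[OF comparable_sym[OF cmp]]
    unfolding trivial_brackets_def by blast
  then show "\<exists>u\<in>verts T. \<exists>v\<in>verts T. A1 = sing_bracket T u \<and> A2 = sing_bracket T v \<and> sib u v"
    using p prec_sing_iff by blast
qed (use prec_sib in blast)

lemma minimum_if_trivial:
  assumes "brs B \<subseteq> trivial_brackets"
  shows "is_minimum T B"
  unfolding is_minimum_def
proof (intro conjI ballI)
  show "B \<in> bracketings T" using bracketing unfolding bracketings_def by blast
  fix B' assume "B' \<in> bracketings T"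
  then interpret B': tree_bracketing T B' by unfold_locales (simp add: bracketings_def)
  have eq: "brs B = trivial_brackets" using assms trivial_in by blast
  have "prec B \<subseteq> brs B \<times> brs B" using prec_brs by auto
  then show "bracketing_le B B'"
    unfolding bracketing_le_def using B'.trivial_in eq
    by (auto simp: prec_trivial_iff B'.prec_trivial_iff)
qed

definition sub_bracketing :: "'v bracket set \<Rightarrow> 'v bracketing" where
  "sub_bracketing S = \<lparr>brs = trivial_brackets \<union> S,
     prec = prec B \<inter> ((trivial_brackets \<union> S) \<times> (trivial_brackets \<union> S))\<rparr>"

text \<open>Closure under projection and covering makes \<open>S\<close> admissible. The last
  hypothesis forbids nested pairs in \<open>S\<close> over a member of \<open>S\<close>, so the
  refinement axiom only concerns brackets over a singleton, refined by singletons, and maximum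
  brackets, refined by members of \<open>S\<close>.\<close>

lemma sub_bracketing:
  assumes sub: "S \<subseteq> brs B"
    and down: "\<And>E. E \<in> S \<Longrightarrow> butlast E \<in> S \<or> is_sing T (butlast E)"
    and cov: "\<And>E u v. E \<in> S \<Longrightarrow> u \<in> last E \<Longrightarrow> v \<in> set (ch T u) \<Longrightarrow> \<exists>E'\<in>S. E' \<in> over B E \<and> v \<in> last E'"
    and minimal: "\<And>E1 E2. E1 \<in> S \<Longrightarrow> E2 \<in> S \<Longrightarrow> butlast E1 \<in> S \<Longrightarrow> butlast E1 = butlast E2 \<Longrightarrow> bsub E2 E1 \<Longrightarrow> E1 = E2"
  shows "is_bracketing T (sub_bracketing S)"
proof -
  define B' where "B' = sub_bracketing S"
  have brs': "brs B' = trivial_brackets \<union> S" and prec': "prec B' = prec B \<inter> (brs B' \<times> brs B')"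
    unfolding B'_def sub_bracketing_def by auto
  have sub': "brs B' \<subseteq> brs B" unfolding brs' using trivial_in sub by blast
  have over': "over B' A = over B A \<inter> brs B'" for A
    using sub' by (auto simp: over_iff)
  have cases: "A \<in> S \<or> is_sing T A \<or> (\<exists>k\<le>depth T. A = max_bracket T k)" if "A \<in> brs B'" for A
    using that unfolding brs' trivial_brackets_def is_sing_def by auto
  have sing': "sing_bracket T u \<in> brs B'" if "u \<in> verts T" for u
    using that unfolding brs' trivial_brackets_def by blast
  have max': "max_bracket T k \<in> brs B'" if "k \<le> depth T" for k
    using that unfolding brs' trivial_brackets_def by blast
  have cmp': "comparable B' A1 A2 \<longleftrightarrow> comparable B A1 A2" if "A1 \<in> brs B'" "A2 \<in> brs B'" for A1 A2
    unfolding comparable_def prec' using that by blast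
  have blevel': "A \<in> brs B \<and> A \<in> brs B' \<and> length A = Suc k" if "A \<in> blevel B' k" for A k
    using that sub' unfolding blevel_def by auto
  have "\<forall>A\<in>brs B'. \<exists>k\<le>depth T. is_bracket T k A" using bracket sub' by blast
  moreover have "prec B' \<subseteq> brs B' \<times> brs B'" unfolding prec' by blast
  moreover have "irrefl (prec B')" unfolding prec' irrefl_def using prec_irrefl by blast
  moreover have "trans (prec B')" unfolding prec' trans_def using prec_trans by blast
  moreover have "\<forall>k\<le>depth T. max_bracket T k \<in> brs B' \<and> (\<forall>u\<in>level T k. sing_bracket T u \<in> brs B')"
    using sing' max' level_verts by blast
  moreover have "\<forall>k\<in>{1..depth T}. \<forall>A\<in>blevel B' k. butlast A \<in> blevel B' (k - 1)"
  proof (intro ballI)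
    fix k A assume k: "k \<in> {1..depth T}" and A: "A \<in> blevel B' k"
    have len: "length (butlast A) = Suc (k - 1)" "length A \<noteq> 1" using blevel'[OF A] k by auto
    have "butlast A \<in> brs B'"
      using cases[of A, OF conjunct1[OF conjunct2[OF blevel'[OF A]]]]
    proof (elim disjE exE conjE)
      assume "A \<in> S"
      then show ?thesis using down[of A] unfolding brs' trivial_brackets_def is_sing_def by auto
    next
      assume "is_sing T A"
      then show ?thesis using is_sing_butlast[OF _ len(2)] sing' unfolding is_sing_def by auto
    next
      fix j assume "j \<le> depth T" "A = max_bracket T j"
      moreover have "length A = Suc k" using blevel'[OF A] by blast
      ultimately show ?thesis using butlast_max_bracket[of T "k - 1"] max' k by (auto simp: length_max_bracket)
    qed
    then show "butlast A \<in> blevel B' (k - 1)" using len unfolding blevel_def by auto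
  qed
  moreover have "\<forall>k\<le>depth T. \<forall>A1\<in>blevel B' k. \<forall>A2\<in>blevel B' k.
        last A1 \<inter> last A2 \<noteq> {} \<longrightarrow> bsub A1 A2 \<or> bsub A2 A1"
    using nested blevel' by metis
  moreover have "\<forall>k\<in>{1..depth T}. \<forall>A\<in>blevel B' (k - 1).
        (\<Union>A'\<in>over B' A. last A') = (\<Union>u\<in>last A. set (ch T u))"
  proof (intro ballI equalityI subsetI)
    fix k A v assume A: "A \<in> blevel B' (k - 1)" and "v \<in> (\<Union>A'\<in>over B' A. last A')"
    then obtain A' where A': "A' \<in> over B A" "v \<in> last A'" unfolding over' by blast
    have "A \<noteq> []" using nonempty blevel'[OF A] by blast
    then show "v \<in> (\<Union>u\<in>last A. set (ch T u))"
      using over_parent(1,2)[OF A'] by blast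
  next
    fix k A v assume k: "k \<in> {1..depth T}" and A: "A \<in> blevel B' (k - 1)" and v: "v \<in> (\<Union>u\<in>last A. set (ch T u))"
    then obtain u where u: "u \<in> last A" "v \<in> set (ch T u)" by blast
    have len: "length A = k" "A \<in> brs B" "A \<in> brs B'" using blevel'[OF A] k by auto
    have u': "u \<in> level T (k - 1)" using bracket_last_level[OF conjunct1[OF bracket_at[OF len(2), of "k - 1"]]] u(1) len(1) k by auto
    have v': "v \<in> level T k" using level_SucI[OF u' u(2)] k by auto
    have pv: "parent T v = u" using parent_child u(2) level_verts[OF u'] by blast
    have vs: "v \<in> level T (Suc (k - 1))" using v' k by auto
    show "v \<in> (\<Union>A'\<in>over B' A. last A')"
      using cases[OF len(3)]
    proof (elim disjE exE conjE)
      assume "A \<in> S"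
      then show ?thesis using cov[OF _ u] unfolding over' brs' by blast
    next
      assume "is_sing T A"
      then have "A = sing_bracket T u"
        using u(1) last_sing_bracket unfolding is_sing_def by auto
      then have "butlast (sing_bracket T v) = A"
        using butlast_sing_bracket[OF vs] pv by simp
      then have "sing_bracket T v \<in> over B' A"
        using sing' level_verts[OF v'] sing_bracket_nonempty unfolding over_iff by blast
      then show ?thesis using last_sing_bracket[OF level_verts[OF v']] by blast
    next
      fix j assume j: "j \<le> depth T" "A = max_bracket T j"
      then have jk: "k = Suc j" using len(1) length_max_bracket[of T j] by simp
      then have "max_bracket T k \<in> over B' A"
        using max'[of k] k max_bracket_nonempty[of T k] j unfolding over_iff by (simp add: butlast_max_bracket)
      then show ?thesis using v' by (intro UN_I[of "max_bracket T k"]) (simp_all add: last_max_bracket)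
    qed
  qed
  moreover have "\<forall>k\<in>{1..depth T}. \<forall>A\<in>blevel B' (k - 1). \<forall>A1\<in>over B' A. \<forall>A2\<in>over B' A.
        bsub A2 A1 \<and> A2 \<noteq> A1 \<longrightarrow>
        (\<forall>u\<in>last A1. \<exists>A3\<in>over B' A. u \<in> last A3 \<and> bsub A3 A1 \<and> A3 \<noteq> A1)"
  proof (intro ballI impI)
    fix k A A1 A2 u
    assume k: "k \<in> {1..depth T}" and A: "A \<in> blevel B' (k - 1)" and A1: "A1 \<in> over B' A" and A2: "A2 \<in> over B' A"
      and b: "bsub A2 A1 \<and> A2 \<noteq> A1" and u: "u \<in> last A1"
    have len: "length A = k" "A \<in> brs B" "A \<in> brs B'" using blevel'[OF A] k by auto
    have A1': "A1 \<in> brs B'" "A1 \<noteq> []" "butlast A1 = A" and A2': "A2 \<in> brs B'" "A2 \<noteq> []" "butlast A2 = A"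
      using A1 A2 by (auto simp: over_iff)
    have A1l: "length A1 = Suc k" and A2l: "length A2 = Suc k"
      using length_eq_Suc_butlast[OF A1'(2)] length_eq_Suc_butlast[OF A2'(2)] A1'(3) A2'(3) len(1) by auto
    have A1b: "is_bracket T k A1" and A2b: "is_bracket T k A2"
      using bracket_at A1'(1) A2'(1) A1l A2l sub' by blast+
    have u': "u \<in> level T k" using bracket_last_level[OF A1b] u by blast
    have us: "u \<in> level T (Suc (k - 1))" using u' k by auto
    have A1b': "is_bracket T (Suc (k - 1)) A1" and A2b': "is_bracket T (Suc (k - 1)) A2" using A1b A2b k by auto
    show "\<exists>A3\<in>over B' A. u \<in> last A3 \<and> bsub A3 A1 \<and> A3 \<noteq> A1"
    proof (cases "is_sing T A")
      case True
      then obtain p where p: "p \<in> verts T" "A = sing_bracket T p" unfolding is_sing_def by blast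
      have "parent T u = p" using bracket_parent[OF A1b' u] A1'(3) p last_sing_bracket by simp
      then have "sing_bracket T u \<in> over B' A"
        using butlast_sing_bracket[OF us] p sing' level_verts[OF u'] sing_bracket_nonempty unfolding over_iff by simp
      moreover have "sing_bracket T u \<noteq> A1"
      proof
        assume s: "sing_bracket T u = A1"
        have "last A2 \<subseteq> last A1" using bsub_last b A2'(2) by blast
        then have "last A2 \<subseteq> {u}" using s last_sing_bracket[OF level_verts[OF u']] by simp
        then have "last A2 = {u}" using bracket_last_nonempty[OF A2b] by blast
        then have "A2 = A1" using bracket_over_sing(2)[OF A2b' p(1)] A2'(3) p(2) s by simp
        then show False using b by blast
      qed
      moreover have "u \<in> last (sing_bracket T u)" using last_sing_bracket level_verts[OF u'] by blast
      ultimately show ?thesis using sing_bsub[OF A1b u] by blast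
    next
      \<comment> \<open>Here \<open>A2\<close> lies in \<open>S\<close>, so minimality keeps
        \<open>A1\<close> out of \<open>S\<close>. Only a maximum bracket is left for
        \<open>A1\<close>, and a covering member of \<open>S\<close> refines it.\<close>
      case False
      have "length A1 \<noteq> 1" "length A2 \<noteq> 1" using A1l A2l k by auto
      then have ns: "\<not> is_sing T A1" "\<not> is_sing T A2"
        using is_sing_butlast[of A1] is_sing_butlast[of A2] A1'(3) A2'(3) False by auto
      have A2m: "A2 \<noteq> max_bracket T j" for j
      proof
        assume "A2 = max_bracket T j"
        then have "bsub A1 A2" using bracket_bsub_max[OF A1b] A2l length_max_bracket[of T j] by simp
        then show False using b bsub_antisym by blast
      qed
      then have A2S: "A2 \<in> S" using cases[OF A2'(1)] ns by blast
      then have AS: "A \<in> S" using down A2'(3) False by blast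
      have notS: "A1 \<notin> S" using minimal[of A1 A2] A2S AS A1'(3) A2'(3) b by auto
      obtain w where w: "w \<in> last A" "u \<in> set (ch T w)"
        using bracket_parent[OF A1b' u] level_SucD(2)[OF us] A1'(3) by blast
      obtain A3 where A3: "A3 \<in> S" "A3 \<in> over B A" "u \<in> last A3" using cov[OF AS w] by blast
      obtain j where "A1 = max_bracket T j" using cases[OF A1'(1)] ns notS by blast
      then have "A1 = max_bracket T k" using A1l length_max_bracket[of T j] by simp
      moreover have "length A3 = Suc k" using A3(2) len(1) length_eq_Suc_butlast[of A3] unfolding over_iff by auto
      ultimately have "bsub A3 A1" using bracket_bsub_max[of T k A3] bracket_at[of A3 k] A3(1) sub by auto
      then show ?thesis using A3 notS unfolding over' brs' by blast
    qed
  qed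
  moreover have "\<forall>k\<le>depth T. \<forall>A1\<in>blevel B' k. \<forall>A2\<in>blevel B' k. A1 \<noteq> A2 \<longrightarrow>
        (comparable B' A1 A2 \<longleftrightarrow> butlast A1 = butlast A2 \<and> last A1 \<inter> last A2 = {})"
    using comparable_iff cmp' blevel' by metis
  moreover have "\<forall>(A1, A2)\<in>prec B'. length A1 = length A2"
    unfolding prec' using prec_length by blast
  moreover have "\<forall>u\<in>verts T. \<forall>i j. i < j \<and> j < length (ch T u) \<longrightarrow>
        (sing_bracket T (ch T u ! i), sing_bracket T (ch T u ! j)) \<in> prec B'"
  proof (intro ballI allI impI)
    fix u i j assume u: "u \<in> verts T" and ij: "i < j \<and> j < length (ch T u)"
    then have "ch T u ! i \<in> verts T" "ch T u ! j \<in> verts T" using ch_verts by auto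
    then show "(sing_bracket T (ch T u ! i), sing_bracket T (ch T u ! j)) \<in> prec B'"
      unfolding prec' using prec_sib[of "ch T u ! i" "ch T u ! j"] sib_index[OF u] ij sing' by auto
  qed
  moreover have "\<forall>k\<in>{1..depth T}. \<forall>A\<in>blevel B' (k - 1). \<forall>A'\<in>blevel B' (k - 1).
        \<forall>A1\<in>over B' A. \<forall>A2\<in>over B' A. \<forall>A1'\<in>over B' A'. \<forall>A2'\<in>over B' A'.
        bsub A' A \<and> A1 \<noteq> A2 \<and> comparable B' A1 A2 \<and> A1' \<noteq> A2' \<and> comparable B' A1' A2' \<and>
        bsub A1' A1 \<and> bsub A2' A2 \<longrightarrow>
        ((A1, A2) \<in> prec B' \<longleftrightarrow> (A1', A2') \<in> prec B')"
  proof (intro ballI impI)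
    fix k A A' A1 A2 A1' A2'
    assume "A \<in> blevel B' (k - 1)" "A' \<in> blevel B' (k - 1)"
      and o: "A1 \<in> over B' A" "A2 \<in> over B' A" "A1' \<in> over B' A'" "A2' \<in> over B' A'"
      and h: "bsub A' A \<and> A1 \<noteq> A2 \<and> comparable B' A1 A2 \<and> A1' \<noteq> A2' \<and> comparable B' A1' A2' \<and>
        bsub A1' A1 \<and> bsub A2' A2"
    then have "A \<in> brs B" "A' \<in> brs B" using blevel' by blast+
    moreover have m: "A1 \<in> brs B'" "A2 \<in> brs B'" "A1' \<in> brs B'" "A2' \<in> brs B'" using o by (auto simp: over_iff)
    moreover have "A1 \<in> over B A" "A2 \<in> over B A" "A1' \<in> over B A'" "A2' \<in> over B A'" using o over' by blast+
    ultimately have "(A1, A2) \<in> prec B \<longleftrightarrow> (A1', A2') \<in> prec B"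
      using prec_compatible[of A A' A1 A2 A1' A2'] h cmp'[OF m(1,2)] cmp'[OF m(3,4)] by simp
    then show "(A1, A2) \<in> prec B' \<longleftrightarrow> (A1', A2') \<in> prec B'" unfolding prec' using m by blast
  qed
  ultimately show ?thesis
    unfolding is_bracketing_def B'_def[symmetric] by (intro conjI) assumption+
qed

text \<open>With no extra brackets, \<open>sub_bracketing\<close> yields a bracketing made of
  trivial brackets only, and a minimum would have to lie below it.\<close>

lemma not_minimum:
  assumes "A \<in> brs B" "nontrivial T A"
  shows "\<not> is_minimum T B"
proof
  assume "is_minimum T B"
  moreover have "sub_bracketing {} \<in> bracketings T"
    unfolding bracketings_def using sub_bracketing[of "{}"] by simp
  ultimately have "bracketing_le B (sub_bracketing {})" unfolding is_minimum_def by blast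
  then have "A \<in> trivial_brackets"
    using assms(1) unfolding bracketing_le_def sub_bracketing_def by auto
  then show False using assms(2) nontrivial_iff by blast
qed

end

section \<open>The structure of collisions\<close>

text \<open>What the covering axiom forces above \<open>E0\<close> when only brackets minimal over
  their projection are taken. Minimality is what will make the tops on a level disjoint.\<close>

inductive_set generated :: "'v bracketing \<Rightarrow> 'v bracket \<Rightarrow> 'v bracket set" for B E0 where
  base: "E0 \<in> generated B E0"
| step: "E \<in> generated B E0 \<Longrightarrow> A \<in> over B E \<Longrightarrow>
    (\<And>A'. A' \<in> over B E \<Longrightarrow> bsub A' A \<Longrightarrow> A' = A) \<Longrightarrow> A \<in> generated B E0"

section \<open>Brackets generated from a fusion bracket\<close>

lemma over_length: "A \<in> over B E \<Longrightarrow> length A = Suc (length E)"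
  unfolding over_def blevel_def by simp

lemma generated_length: "E \<in> generated B E0 \<Longrightarrow> E = E0 \<or> length E0 < length E"
proof (induction rule: generated.induct)
  case (step E A)
  then show ?case using over_length[OF step(2)] by auto
qed simp

lemma generated_projection: "E \<in> generated B E0 \<Longrightarrow> \<exists>j. (butlast ^^ j) E = E0"
proof (induction rule: generated.induct)
  case base
  show ?case by (rule exI[of _ 0]) simp
next
  case (step E A)
  then obtain j where "(butlast ^^ j) E = E0" by blast
  then have "(butlast ^^ Suc j) A = E0" using step(2) unfolding funpow_Suc_right by (simp add: over_iff)
  then show ?case by blast
qed

text \<open>\<open>E0\<close> is a place where projections turn from nonsingleton to singleton: a
  possible fusion bracket, before it is known that a collision has only one.\<close>

locale fusing = tree_bracketing T B for T :: "'v ptree" and B +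
  fixes E0 :: "'v bracket"
  assumes E0: "E0 \<in> brs B" "\<not> is_sing T E0" "is_sing T (butlast E0)"
begin

abbreviation "S \<equiv> generated B E0"

lemma generated_sub: "S \<subseteq> brs B"
proof
  fix E assume "E \<in> S"
  then show "E \<in> brs B" by induction (auto simp: E0 over_iff)
qed

lemma E0_length: "length E0 \<noteq> 1"
proof
  assume "length E0 = 1"
  then have "is_sing T E0" using is_sing_length_1 bracket_at[OF E0(1), of 0] by simp
  then show False using E0(2) by blast
qed

lemma generated_length_1: "E \<in> S \<Longrightarrow> length E \<noteq> 1"
proof -
  assume "E \<in> S"
  then consider "E = E0" | "length E0 < length E" using generated_length by blast
  then show ?thesis
  proof cases
    case 1
    then show ?thesis using E0_length by simp
  next
    case 2
    have "length E0 \<noteq> 0" using nonempty[OF E0(1)] by simp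
    then show ?thesis using 2 by linarith
  qed
qed

lemma generated_not_sing: "E \<in> S \<Longrightarrow> \<not> is_sing T E"
proof (induction rule: generated.induct)
  case (step E A)
  have "A \<in> S" using generated.step[OF step(1-3)] .
  then show ?case using is_sing_butlast[of A] generated_length_1 step by (auto simp: over_iff)
qed (rule E0(2))

lemma generated_cases:
  assumes "E \<in> S"
  shows "E = E0 \<or> butlast E \<in> S \<and> E \<in> over B (butlast E) \<and>
    (\<forall>A'\<in>over B (butlast E). bsub A' E \<longrightarrow> A' = E)"
  using assms by cases (auto simp: over_iff)

lemma generated_down: "E \<in> S \<Longrightarrow> butlast E \<in> S \<or> is_sing T (butlast E)"
  using generated_cases E0(3) by blast

lemma finite_last: "A \<in> brs B \<Longrightarrow> finite (last A)"
  using bracket bracket_last_level finite_level finite_subset by metis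

text \<open>Among the brackets over \<open>E\<close> that cover \<open>v\<close>, one with fewest
  top vertices is minimal; otherwise the refinement axiom would give a smaller one still covering
  \<open>v\<close>.\<close>

lemma generated_cover:
  assumes "E \<in> S" "u \<in> last E" "v \<in> set (ch T u)"
  shows "\<exists>E'\<in>S. E' \<in> over B E \<and> v \<in> last E' \<and> (\<forall>A'\<in>over B E. bsub A' E' \<longrightarrow> A' = E')"
proof -
  have EB: "E \<in> brs B" using generated_sub assms(1) by blast
  define P where "P A \<longleftrightarrow> A \<in> over B E \<and> v \<in> last A" for A
  have "\<exists>A. P A" using cover[OF EB assms(2,3)] unfolding P_def by blast
  then obtain A where A: "P A" and least: "\<And>A'. P A' \<Longrightarrow> card (last A) \<le> card (last A')"
    using ex_has_least_nat[of P _ "\<lambda>A. card (last A)"] by blast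
  have min: "A' = A" if A': "A' \<in> over B E" "bsub A' A" for A'
  proof (rule ccontr)
    assume "A' \<noteq> A"
    then obtain A3 where A3: "A3 \<in> over B E" "v \<in> last A3" "bsub A3 A" "A3 \<noteq> A"
      using refine[OF EB _ A'(1,2), of v] A unfolding P_def by blast
    have ne: "A3 \<noteq> []" "A \<noteq> []" "butlast A3 = butlast A" "A \<in> brs B"
      using A3(1) A unfolding P_def by (auto simp: over_iff)
    then have "last A3 \<noteq> last A" using snoc_eqI A3(4) by blast
    then have "last A3 \<subset> last A" using bsub_last[OF A3(3) ne(1)] by blast
    then have "card (last A3) < card (last A)" using finite_last[OF ne(4)] by (simp add: psubset_card_mono)
    then show False using least[of A3] A3 unfolding P_def by simp
  qed
  then have "A \<in> S" using generated.step[OF assms(1)] A unfolding P_def by blast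
  then show ?thesis using A min unfolding P_def by blast
qed

text \<open>Brackets with meeting tops have projections with meeting tops, which agree by induction.
  Over the same bracket, nestedness and minimality finish.\<close>

lemma generated_unique:
  "E1 \<in> S \<Longrightarrow> E2 \<in> S \<Longrightarrow> length E1 = length E2 \<Longrightarrow> last E1 \<inter> last E2 \<noteq> {} \<Longrightarrow> E1 = E2"
proof (induction arbitrary: E2 rule: generated.induct)
  case base
  then show ?case using generated_length by fastforce
next
  case (step E A)
  have AS: "A \<in> S" using generated.step[OF step(1-3)] .
  have AB: "A \<in> brs B" "butlast A = E" "A \<noteq> []" using step(2) by (auto simp: over_iff)
  have "length E0 < length A"
    using generated_length[OF step(1)] AB(2) step(2) unfolding over_def blevel_def by auto
  then have "E2 \<noteq> E0" using step.prems(2) by auto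
  then have E2: "butlast E2 \<in> S" "E2 \<in> over B (butlast E2)" "\<forall>A'\<in>over B (butlast E2). bsub A' E2 \<longrightarrow> A' = E2"
    using generated_cases step.prems(1) by blast+
  obtain v where v: "v \<in> last A" "v \<in> last E2" using step.prems(3) by blast
  have "E \<noteq> []" "butlast E2 \<noteq> []" using step(1) E2(1) generated_sub nonempty by blast+
  then have "parent T v \<in> last E" "parent T v \<in> last (butlast E2)"
    using over_parent(1)[OF step(2) v(1)] over_parent(1)[OF E2(2) v(2)] by auto
  moreover have "length E = length (butlast E2)" using AB(2) step.prems(2) by auto
  ultimately have Eq: "E = butlast E2" using step.IH[OF E2(1)] by blast
  have "bsub A E2 \<or> bsub E2 A"
    using nested[OF AB(1) _ step.prems(2,3)] generated_sub step.prems(1) by blast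
  then show ?case using step(2,3) E2(2,3) Eq by blast
qed

lemma generated_minimal:
  assumes "E1 \<in> S" "E2 \<in> S" "butlast E1 \<in> S" "butlast E1 = butlast E2" "bsub E2 E1"
  shows "E1 = E2"
proof -
  have "E2 \<noteq> []" using generated_sub nonempty assms(2) by blast
  then have "last E1 \<inter> last E2 \<noteq> {}"
    using bsub_last[OF assms(5)] last_nonempty generated_sub assms(2) by blast
  then show ?thesis using generated_unique assms(1,2) bsub_length[OF assms(5)] by simp
qed

lemma generated_bracketing: "is_bracketing T (sub_bracketing S)"
proof (rule sub_bracketing[OF generated_sub generated_down])
  fix E u v assume "E \<in> S" "u \<in> last E" "v \<in> set (ch T u)"
  then show "\<exists>E'\<in>S. E' \<in> over B E \<and> v \<in> last E'" using generated_cover by blast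
qed (use generated_minimal in auto)

text \<open>Were all generated brackets trivial, they would be maximum brackets and hence the only
  brackets over their projections. Climbing from \<open>E0\<close> to \<open>A\<close> would then
  never leave the generated set, so \<open>A\<close> would be generated and trivial.\<close>

lemma generated_nontrivial:
  assumes A: "A \<in> brs B" "nontrivial T A" "E0 = (butlast ^^ l) A"
  shows "\<exists>X\<in>S. nontrivial T X"
proof (rule ccontr)
  assume neg: "\<not> (\<exists>X\<in>S. nontrivial T X)"
  then have "X \<in> trivial_brackets" if "X \<in> S" for X using that nontrivial_iff by blast
  then have max: "\<exists>j. X = max_bracket T j" if "X \<in> S" for X
    using that generated_not_sing[OF that] unfolding trivial_brackets_def is_sing_def by blast
  have lenE0: "length E0 \<ge> 1" using nonempty[OF E0(1)] by (cases E0) auto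
  have inB: "(butlast ^^ j) A \<in> brs B" if "j \<le> l" for j
    using that
  proof (induction j)
    case 0
    then show ?case using A by simp
  next
    case (Suc j)
    have "length ((butlast ^^ j) A) \<noteq> 1"
      using lenE0 Suc.prems unfolding A(3) length_funpow_butlast by linarith
    then show ?case using butlast_in Suc by simp
  qed
  \<comment> \<open>The projections of \<open>A\<close> are visited upwards, from \<open>E0\<close>
    at \<open>j = 0\<close> to \<open>A\<close> itself at \<open>j = l\<close>.\<close>
  have "(butlast ^^ (l - j)) A \<in> S" if "j \<le> l" for j
    using that
  proof (induction j)
    case 0
    then show ?case using A(3) generated.base by simp
  next
    case (Suc j)
    define P where "P = (butlast ^^ (l - Suc j)) A"
    define Q where "Q = (butlast ^^ (l - j)) A"
    have QS: "Q \<in> S" using Suc unfolding Q_def by simp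
    have PB: "P \<in> brs B" using inB unfolding P_def by simp
    have "l - j = Suc (l - Suc j)" using Suc.prems by simp
    then have bl: "butlast P = Q" unfolding P_def Q_def by simp
    have PQ: "P \<in> over B Q" using PB bl nonempty by (simp add: over_iff)
    have "A'' = P" if A'': "A'' \<in> over B Q" "bsub A'' P" for A''
    proof -
      have A''B: "A'' \<in> brs B" "A'' \<noteq> []" "butlast A'' = Q" using A''(1) by (auto simp: over_iff)
      obtain v where v: "v \<in> last A''" using last_nonempty A''B(1) by blast
      have "Q \<noteq> []" using QS generated_sub nonempty by blast
      \<comment> \<open>A generated bracket whose top meets that of \<open>A''\<close>: it lies
        inside \<open>A''\<close> by minimality and contains it because it is a maximum
        bracket.\<close>
      then obtain A3 where A3: "A3 \<in> S" "A3 \<in> over B Q" "v \<in> last A3" "\<forall>A'\<in>over B Q. bsub A' A3 \<longrightarrow> A' = A3"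
        using generated_cover[OF QS] over_parent[OF A''(1) v] by blast
      have A3B: "A3 \<in> brs B" "A3 \<noteq> []" "butlast A3 = Q" using A3(2) by (auto simp: over_iff)
      have len: "length A3 = length A''" "length A'' = length P"
        using length_eq_Suc_butlast[OF A''B(2)] length_eq_Suc_butlast[OF A3B(2)] A''B(3) A3B(3)
          bsub_length[OF A''(2)] by auto
      have "bsub A3 A'' \<or> bsub A'' A3" using nested[OF A3B(1) A''B(1) len(1)] v A3(3) by blast
      then have "bsub A3 A''" using A3(4) A''(1) bsub_refl by blast
      then have "bsub A3 P" using A''(2) bsub_trans by blast
      moreover obtain i where i: "A3 = max_bracket T i" using max A3(1) by blast
      moreover have "is_bracket T i P" "is_bracket T i A''"
        using bracket_at PB A''B(1) len i length_max_bracket[of T i] by auto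
      ultimately have "A3 = P" "A3 = A''"
        using bracket_bsub_max bsub_antisym \<open>bsub A3 A''\<close> by blast+
      then show ?thesis by simp
    qed
    then show ?case using generated.step[OF QS PQ] unfolding P_def by blast
  qed
  from this[of l] have "A \<in> S" by simp
  then show False using neg A(2) by blast
qed

end

section \<open>Collisions: fusion bracket, essential brackets and block\<close>

locale tree_collision = plane_tree T for T :: "'v ptree" +
  fixes C :: "'v bracketing"
  assumes collision: "collision T C"

sublocale tree_collision \<subseteq> tree_bracketing T C
  using collision unfolding collision_def bracketings_def by unfold_locales simp

context tree_collision
begin

lemma ex_nontrivial: "\<exists>A\<in>brs C. nontrivial T A"
proof -
  have "\<not> is_minimum T C" using collision unfolding collision_def by blast
  then have "\<not> brs C \<subseteq> trivial_brackets" using minimum_if_trivial by blast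
  then obtain A where "A \<in> brs C" "A \<notin> trivial_brackets" by blast
  then show ?thesis using nontrivial_iff by blast
qed

text \<open>Projections end in a singleton on level 0 and start from the nonsingleton
  \<open>A\<close>, so the change happens somewhere in between.\<close>

lemma ex_fusing:
  assumes A: "A \<in> brs C" "nontrivial T A"
  shows "\<exists>l. fusing T C ((butlast ^^ l) A)"
proof -
  obtain k where k: "is_bracket T k A" using bracket A(1) by blast
  have inC: "(butlast ^^ j) A \<in> brs C" if "j \<le> k" for j
    using that
  proof (induction j)
    case (Suc j)
    have "length ((butlast ^^ j) A) \<noteq> 1"
      using Suc.prems bracket_length[OF k] unfolding length_funpow_butlast by linarith
    then show ?case using butlast_in Suc by simp
  qed (use A in simp)
  have "length ((butlast ^^ k) A) = Suc 0" using bracket_length[OF k] unfolding length_funpow_butlast by simp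
  then have "is_sing T ((butlast ^^ k) A)" using is_sing_length_1 bracket_at[OF inC[of k]] by simp
  moreover have "\<not> is_sing T ((butlast ^^ 0) A)" using A(2) unfolding nontrivial_def by simp
  ultimately have "\<exists>l<k. (\<forall>i\<le>l. \<not> is_sing T ((butlast ^^ i) A)) \<and> is_sing T ((butlast ^^ Suc l) A)"
    by (intro ex_least_nat_less)
  then obtain l where l: "l < k" "\<not> is_sing T ((butlast ^^ l) A)" "is_sing T ((butlast ^^ Suc l) A)"
    by blast
  then have "fusing T C ((butlast ^^ l) A)"
    using inC[of l] by unfold_locales auto
  then show ?thesis by blast
qed

text \<open>What a fusion bracket generates is itself a nonminimal bracketing below the collision, hence all
  of it.\<close>

lemma brs_generated:
  assumes "fusing T C E0" "A \<in> brs C" "nontrivial T A" "E0 = (butlast ^^ l) A"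
  shows "brs C = trivial_brackets \<union> generated C E0"
proof -
  interpret fusing T C E0 by fact
  define C' where "C' = sub_bracketing (generated C E0)"
  have C': "brs C' = trivial_brackets \<union> generated C E0" "prec C' = prec C \<inter> (brs C' \<times> brs C')"
    unfolding C'_def sub_bracketing_def by auto
  have "brs C' \<subseteq> brs C" using C'(1) trivial_in generated_sub by blast
  then have le: "bracketing_le C' C" unfolding bracketing_le_def using C'(2) by simp
  have br: "is_bracketing T C'" unfolding C'_def by (rule generated_bracketing)
  interpret C': tree_bracketing T C' by unfold_locales (rule br)
  have "\<not> is_minimum T C'"
    using generated_nontrivial[OF assms(2-4)] C'.not_minimum C'(1) by blast
  then have "C' = C" using collision le br unfolding collision_def bracketings_def by blast
  then show ?thesis using C'(1) by simp
qed

lemma sing_projection: "is_sing T A \<Longrightarrow> (butlast ^^ l) A = [] \<or> is_sing T ((butlast ^^ l) A)"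
proof (induction l)
  case (Suc l)
  then show ?case using is_sing_butlast[of "(butlast ^^ l) A"]
    by (cases "length ((butlast ^^ l) A) = 1") (auto simp: length_Suc_conv)
qed simp

text \<open>Each nontrivial bracket is generated from a single fusion bracket, which settles
  uniqueness. The delicate point is that a generated bracket may be a maximum one and must still be
  exhibited as a projection of a nontrivial bracket.\<close>

lemma anatomy:
  shows "fusing T C (fusion T C)" and "essential T C = generated C (fusion T C)"
    and "brs C = trivial_brackets \<union> essential T C" and "\<exists>X\<in>essential T C. nontrivial T X"
proof -
  obtain A where A: "A \<in> brs C" "nontrivial T A" using ex_nontrivial by blast
  obtain l where fus: "fusing T C ((butlast ^^ l) A)" using ex_fusing[OF A] by blast
  define E0 where "E0 = (butlast ^^ l) A"
  interpret fusing T C E0 using fus E0_def by simp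
  have brs: "brs C = trivial_brackets \<union> S"
    using brs_generated[OF _ A E0_def] fus E0_def by simp
  \<comment> \<open>A nontrivial generated bracket, kept as the witness for maximum brackets in the
    generated set.\<close>
  obtain X where X: "X \<in> S" "nontrivial T X" using generated_nontrivial[OF A E0_def] by blast
  have down: "(butlast ^^ j) E \<in> S \<or> (butlast ^^ j) E = [] \<or> is_sing T ((butlast ^^ j) E)" if "E \<in> S" for E j
  proof (induction j)
    case (Suc j)
    then show ?case
    proof (elim disjE)
      assume "(butlast ^^ j) E \<in> S"
      then show ?case using generated_down[of "(butlast ^^ j) E"] by auto
    next
      assume "is_sing T ((butlast ^^ j) E)"
      then show ?case using sing_projection[of "(butlast ^^ j) E" 1] by simp
    qed simp
  qed (use that in simp)
  have proj_S: "E \<in> S" if E: "proj_of_nontrivial T C E" "\<not> is_sing T E" for E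
  proof -
    obtain A' j where "E \<in> brs C" "A' \<in> brs C" "nontrivial T A'" "E = (butlast ^^ j) A'"
      using E(1) unfolding proj_of_nontrivial_def by blast
    moreover have "A' \<in> S" using calculation(2,3) brs nontrivial_iff by blast
    ultimately show ?thesis using down[of A' j] nonempty[of E] E(2) by auto
  qed
  have E0S: "E0 \<in> S" by (rule generated.base)
  have X_down: "(butlast ^^ j) X \<in> S" if "length E0 \<le> length X - j" for j
    using that
  proof (induction j)
    case (Suc j)
    then have "(butlast ^^ j) X \<in> S" by simp
    moreover have "(butlast ^^ j) X \<noteq> E0"
    proof
      assume "(butlast ^^ j) X = E0"
      then have "length X - j = length E0" using length_funpow_butlast by metis
      moreover have "length E0 > 0" using nonempty[OF E0(1)] by simp
      ultimately show False using Suc.prems by linarith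
    qed
    ultimately show ?case using generated_cases by auto
  qed (use X in simp)
  have S_proj: "proj_of_nontrivial T C E" if E: "E \<in> S" for E
  proof (cases "nontrivial T E")
    case True
    then show ?thesis
      unfolding proj_of_nontrivial_def using E generated_sub by (auto intro!: bexI[of _ E] exI[of _ 0])
  next
    case False
    then obtain k where k: "k \<le> depth T" "E = max_bracket T k"
      using nontrivial_iff generated_not_sing[OF E] unfolding trivial_brackets_def is_sing_def by blast
    have XB: "X \<in> brs C" and EB: "E \<in> brs C" using X E generated_sub by blast+
    \<comment> \<open>Generated brackets of one level with meeting tops are equal. If
      \<open>X\<close> is at least as long as \<open>E\<close>, its projection to the level of
      \<open>E\<close> is therefore \<open>E\<close>; if it is shorter, the projection of
      \<open>E\<close> to the level of \<open>X\<close>, again a maximum bracket, would equal the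
      nontrivial \<open>X\<close>.\<close>
    show ?thesis
    proof (cases "length E \<le> length X")
      case True
      define P where "P = (butlast ^^ (length X - length E)) X"
      have "length E0 \<le> length E" using generated_length[OF E] by auto
      then have PS: "P \<in> S" unfolding P_def using X_down True by simp
      have lenP: "length P = length E" unfolding P_def length_funpow_butlast using True by simp
      then have "last P \<inter> last E \<noteq> {}"
        using last_max_meets[of P k] PS generated_sub k(2) length_max_bracket[of T k] by auto
      then have "P = E" using generated_unique[OF PS E lenP] by blast
      then show ?thesis
        unfolding proj_of_nontrivial_def using EB XB X(2) P_def by blast
    next
      case False
      define Q where "Q = (butlast ^^ (length E - length X)) E"
      have XE0: "length E0 \<le> length X" using generated_length[OF X(1)] by auto
      have maxd: "(butlast ^^ j) E = max_bracket T (k - j)" if "j \<le> k" for j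
        using that
      proof (induction j)
        case (Suc j)
        then have "k - j = Suc (k - Suc j)" by simp
        then show ?case using Suc by (simp add: butlast_max_bracket)
      qed (use k in simp)
      have lE: "length E = Suc k" using k length_max_bracket by metis
      obtain i where i: "length X = Suc i" using nonempty[OF XB] by (cases X) auto
      have Q: "Q = max_bracket T i" unfolding Q_def using maxd[of "length E - length X"] lE i False by simp
      have "(butlast ^^ j) E \<in> S" if "length E0 \<le> length E - j" for j
        using that
      proof (induction j)
        case (Suc j)
        then have "(butlast ^^ j) E \<in> S" by simp
        moreover have "(butlast ^^ j) E \<noteq> E0"
        proof
          assume "(butlast ^^ j) E = E0"
          then have "length E - j = length E0" using length_funpow_butlast by metis
          moreover have "length E0 > 0" using nonempty[OF E0(1)] by simp
          ultimately show False using Suc.prems by linarith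
        qed
        ultimately show ?case using generated_cases by auto
      qed (use E in simp)
      then have "Q \<in> S" unfolding Q_def using XE0 False by simp
      moreover have "length X = length Q" using Q i length_max_bracket[of T i] by simp
      ultimately have "X = Q"
        using generated_unique[OF X(1)] last_max_meets[OF XB i] Q by simp
      then show ?thesis using X(2) Q bracket_at[OF XB i] unfolding nontrivial_def by simp
    qed
  qed
  have fusE: "fusion T C = E0"
    unfolding fusion_def
  proof (rule the_equality)
    show "\<not> is_sing T E0 \<and> is_sing T (butlast E0) \<and> proj_of_nontrivial T C E0"
      using E0 S_proj[OF E0S] by blast
    fix E assume E: "\<not> is_sing T E \<and> is_sing T (butlast E) \<and> proj_of_nontrivial T C E"
    then have "E \<in> S" using proj_S by blast
    then show "E = E0" using generated_cases E generated_not_sing by blast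
  qed
  have ess: "essential T C = S"
  proof (intro equalityI subsetI)
    fix E assume "E \<in> essential T C"
    then have E: "proj_of_nontrivial T C E" "\<exists>j. (butlast ^^ j) E = E0"
      unfolding essential_def fusE by blast+
    have "\<not> is_sing T E" using E(2) sing_projection E0(2) nonempty[OF E0(1)] by metis
    then show "E \<in> S" using proj_S E(1) by blast
  next
    fix E assume "E \<in> S"
    then show "E \<in> essential T C"
      unfolding essential_def fusE using S_proj generated_projection by blast
  qed
  show "fusing T C (fusion T C)" using fus E0_def fusE by simp
  show "essential T C = generated C (fusion T C)" using ess fusE by simp
  show "brs C = trivial_brackets \<union> essential T C" using brs ess by simp
  show "\<exists>X\<in>essential T C. nontrivial T X" using X ess by blast
qed

end

sublocale tree_collision \<subseteq> fusing T C "fusion T C"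
  by (rule anatomy(1))

context tree_collision
begin

abbreviation "ess \<equiv> essential T C"
abbreviation "W \<equiv> fused T C"
abbreviation "w \<equiv> fusion_base T C"
abbreviation "block \<equiv> weakly_below T W"

lemma fusion_essential: "fusion T C \<in> ess"
  unfolding anatomy(2) by (rule generated.base)

lemma essential_brs: "E \<in> ess \<Longrightarrow> E \<in> brs C"
  using anatomy(3) by blast

lemma essential_nonempty: "E \<in> ess \<Longrightarrow> E \<noteq> []"
  using essential_brs nonempty by blast

lemma essential_not_sing: "E \<in> ess \<Longrightarrow> \<not> is_sing T E"
  using generated_not_sing anatomy(2) by simp

lemma essential_cases: "E \<in> ess \<Longrightarrow> E = fusion T C \<or> butlast E \<in> ess"
  using generated_cases anatomy(2) by auto

lemma essential_unique:
  "E1 \<in> ess \<Longrightarrow> E2 \<in> ess \<Longrightarrow> length E1 = length E2 \<Longrightarrow> v \<in> last E1 \<Longrightarrow> v \<in> last E2 \<Longrightarrow> E1 = E2"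
  using generated_unique anatomy(2) by blast

lemma essential_cover:
  assumes "E \<in> ess" "u \<in> last E" "v \<in> set (ch T u)"
  shows "\<exists>E'\<in>ess. butlast E' = E \<and> length E' = Suc (length E) \<and> v \<in> last E'"
proof -
  obtain E' where "E' \<in> ess" "E' \<in> over C E" "v \<in> last E'"
    using generated_cover assms anatomy(2) by blast
  then show ?thesis unfolding over_def blevel_def by auto
qed

lemma fusion_base: "w \<in> verts T" "butlast (fusion T C) = sing_bracket T w"
proof -
  obtain p where p: "p \<in> verts T" "butlast (fusion T C) = sing_bracket T p"
    using E0(3) unfolding is_sing_def by blast
  have "w = p"
    unfolding fusion_base_def using p sing_bracket_inj by (intro the_equality) auto
  then show "w \<in> verts T" "butlast (fusion T C) = sing_bracket T w" using p by auto
qed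

lemma fusion_bracket: "is_bracket T (Suc (vdepth T w)) (fusion T C)"
proof -
  have "length (fusion T C) = Suc (length (butlast (fusion T C)))"
    using nonempty[OF E0(1)] by simp
  also have "\<dots> = Suc (Suc (vdepth T w))"
    unfolding fusion_base(2) using length_sing_bracket vdepth_level fusion_base(1) by simp
  finally show ?thesis using bracket_at[OF E0(1)] by blast
qed

lemma fused_children: "W \<subseteq> set (ch T w)"
  unfolding fused_def using bracket_over_sing(1)[OF fusion_bracket fusion_base] .

lemma fused_level: "W \<subseteq> level T (Suc (vdepth T w))"
  using fused_children level_SucI vdepth_level fusion_base(1) by blast

lemma fused_verts: "W \<subseteq> verts T"
  using fused_level level_verts by blast

lemma fused_consecutive: "consecutive (ch T w) W"
proof -
  have "w \<in> last (butlast (fusion T C))"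
    unfolding fusion_base(2) using last_sing_bracket fusion_base(1) by simp
  then have "consecutive (ch T w) (last (fusion T C) \<inter> set (ch T w))"
    using bracket_consecutive[OF fusion_bracket] by blast
  then show ?thesis using fused_children unfolding fused_def by (simp add: Int_absorb2)
qed

lemma fused_nonempty: "W \<noteq> {}"
  unfolding fused_def using last_nonempty[OF E0(1)] .

lemma fused_two: "\<exists>u\<in>W. \<exists>v\<in>W. sib u v"
proof -
  obtain u where u: "u \<in> W" using fused_nonempty by blast
  have "W \<noteq> {u}"
  proof
    assume "W = {u}"
    then have "fusion T C = sing_bracket T u"
      using bracket_over_sing(2)[OF fusion_bracket fusion_base] unfolding fused_def by blast
    then show False using E0(2) u fused_verts unfolding is_sing_def by blast
  qed
  then obtain v where "v \<in> W" "v \<noteq> u" using u by blast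
  then show ?thesis using sib_total[OF fusion_base(1), of u v] u fused_children by blast
qed

lemma length_fusion: "length (fusion T C) = Suc (Suc (vdepth T w))"
  using bracket_length[OF fusion_bracket] .

text \<open>Going down, covering yields an essential bracket around each child. Going up,
  projections contain the parents until the fusion bracket is reached, whose top is
  \<open>W\<close>.\<close>

lemma block_iff:
  "v \<in> level T k \<Longrightarrow> v \<in> block \<longleftrightarrow> (\<exists>E\<in>ess. length E = Suc k \<and> v \<in> last E)"
proof (induction k arbitrary: v)
  case 0
  have "v \<notin> block" using weakly_below_level_ge[OF fused_level _ 0] by auto
  moreover have "length E \<noteq> Suc 0" if "E \<in> ess" for E
    using generated_length_1 that anatomy(2) by simp
  ultimately show ?case by blast
next
  case (Suc k)
  show ?case
  proof
    assume "v \<in> block"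
    then consider "v \<in> W" | "parent T v \<in> block" using weakly_below_parent[OF Suc.prems] by blast
    then show "\<exists>E\<in>ess. length E = Suc (Suc k) \<and> v \<in> last E"
    proof cases
      case 1
      then have "Suc (vdepth T w) = Suc k" using fused_level Suc.prems level_unique by blast
      then show ?thesis using 1 fusion_essential length_fusion unfolding fused_def by auto
    next
      case 2
      then obtain E where "E \<in> ess" "length E = Suc k" "parent T v \<in> last E"
        using Suc.IH level_SucD(1) Suc.prems by blast
      then show ?thesis using essential_cover[of E "parent T v" v] level_SucD(2)[OF Suc.prems] by auto
    qed
  next
    assume "\<exists>E\<in>ess. length E = Suc (Suc k) \<and> v \<in> last E"
    then obtain E where E: "E \<in> ess" "length E = Suc (Suc k)" "v \<in> last E" by blast
    show "v \<in> block"
    proof (cases "E = fusion T C")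
      case True
      then show ?thesis using E(3) weak_desc_refl unfolding fused_def weakly_below_def by blast
    next
      case False
      then have b: "butlast E \<in> ess" using essential_cases E(1) by blast
      have "is_bracket T (Suc k) E" using bracket_at essential_brs E by blast
      then have "parent T v \<in> last (butlast E)" using bracket_parent E(3) by metis
      then have "parent T v \<in> block"
        using Suc.IH[OF level_SucD(1)[OF Suc.prems]] b E(2) by auto
      then show ?thesis using weakly_below_parent[OF Suc.prems] by blast
    qed
  qed
qed

lemma essential_level: "E \<in> ess \<Longrightarrow> length E = Suc k \<Longrightarrow> last E \<subseteq> level T k"
  using bracket_at bracket_last_level essential_brs by blast

lemma essential_block: "E \<in> ess \<Longrightarrow> v \<in> last E \<Longrightarrow> v \<in> block"
proof -
  assume E: "E \<in> ess" "v \<in> last E"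
  obtain k where k: "is_bracket T k E" using bracket essential_brs E(1) by blast
  then have "v \<in> level T k" using bracket_last_level E(2) by blast
  then show ?thesis using block_iff bracket_length[OF k] E by blast
qed

lemma essential_parent:
  assumes "E \<in> ess" "length E = Suc (Suc k)" "v \<in> last E" "parent T v \<in> block"
  shows "butlast E \<in> ess" "parent T v \<in> last (butlast E)"
proof -
  have br: "is_bracket T (Suc k) E" using bracket_at essential_brs assms by blast
  show par: "parent T v \<in> last (butlast E)" using bracket_parent[OF br assms(3)] .
  have lev: "parent T v \<in> level T k" using essential_level[OF assms(1,2)] level_SucD(1) assms(3) by blast
  have "E \<noteq> fusion T C"
  proof
    assume eq: "E = fusion T C"
    then have "vdepth T w = k" using assms(2) length_fusion by simp
    then have "Suc k \<le> k" using weakly_below_level_ge[OF fused_level assms(4) lev] by simp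
    then show False by simp
  qed
  then show "butlast E \<in> ess" using essential_cases assms(1) by blast
qed

lemma essential_prec_total:
  assumes "E1 \<in> ess" "E2 \<in> ess" "butlast E1 = butlast E2" "E1 \<noteq> E2"
  shows "comparable C E1 E2"
proof -
  have len: "length E1 = length E2"
    using length_eq_Suc_butlast essential_nonempty assms(1-3) by metis
  then have "last E1 \<inter> last E2 = {}" using essential_unique assms(1,2,4) by blast
  then show ?thesis using comparable_iff[OF _ _ assms(4) len] essential_brs assms by blast
qed

text \<open>The singletons of \<open>u\<close> and \<open>v\<close> sit inside the two brackets, so
  the compatibility axiom transfers the sibling order to them.\<close>

lemma prec_sib_iff:
  assumes "A1 \<in> brs C" "A2 \<in> brs C" "butlast A1 = butlast A2" "last A1 \<inter> last A2 = {}"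
    "u \<in> last A1" "v \<in> last A2" "parent T u = parent T v" "length A1 = Suc (Suc k)"
  shows "(A1, A2) \<in> prec C \<longleftrightarrow> sib u v"
proof -
  have "Suc (length (butlast A1)) = Suc (length (butlast A2))" using assms(3) by (simp only:)
  then have len: "length A1 = length A2"
    by (rule trans[OF trans[OF length_eq_Suc_butlast[OF nonempty[OF assms(1)]]]
          length_eq_Suc_butlast[OF nonempty[OF assms(2)], symmetric]])
  have br: "is_bracket T (Suc k) A1" "is_bracket T (Suc k) A2"
    using bracket_at[OF assms(1,8)] bracket_at[OF assms(2), of "Suc k"] len assms(8) by simp_all
  have u: "u \<in> level T (Suc k)" and v: "v \<in> level T (Suc k)"
    using subsetD[OF bracket_last_level[OF br(1)] assms(5)] subsetD[OF bracket_last_level[OF br(2)] assms(6)] .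
  have ne: "u \<noteq> v" "A1 \<noteq> A2" using assms(4-6) by blast+
  define A where "A = butlast A1"
  have A: "A \<in> brs C" unfolding A_def using butlast_in assms(1,8) by simp
  have o: "A1 \<in> over C A" "A2 \<in> over C A" unfolding A_def over_iff using assms(1-3) nonempty by simp_all
  define p where "p = parent T u"
  have p: "p \<in> verts T" "p \<in> last A" using parent_vert[OF u] bracket_parent[OF br(1) assms(5)] unfolding p_def A_def .
  have brA: "is_bracket T k A" using bracket_at[OF A] assms(8) unfolding A_def by simp
  have s: "sing_bracket T u \<in> over C (sing_bracket T p)" "sing_bracket T v \<in> over C (sing_bracket T p)"
    using butlast_sing_bracket[OF u] butlast_sing_bracket[OF v] assms(7) sing_in[OF level_verts[OF u]]
      sing_in[OF level_verts[OF v]] sing_bracket_nonempty unfolding p_def over_iff by simp_all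
  have "sib u v \<or> sib v u"
    using sib_total[OF p(1), of u v] level_SucD(2) u v assms(7) ne(1) unfolding p_def by metis
  then have cs: "comparable C (sing_bracket T u) (sing_bracket T v)"
    unfolding comparable_def using prec_sib by blast
  have "(A1, A2) \<in> prec C \<longleftrightarrow> (sing_bracket T u, sing_bracket T v) \<in> prec C"
    using prec_compatible[OF A sing_in[OF p(1)] o s sing_bsub[OF brA p(2)] _ cs
        sing_bsub[OF br(1) assms(5)] sing_bsub[OF br(2) assms(6)]]
      comparable_iff[OF assms(1,2) ne(2) len] assms(3,4) by blast
  then show ?thesis using prec_sing_iff level_verts u v by blast
qed

end

text \<open>A comparable pair that is not entirely essential includes a singleton. Both brackets
  then lie over one singleton, where the sibling order decides; only the order of essential pairs is
  a free choice.\<close>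

lemma collision_eqI:
  fixes C C' :: "'v bracketing"
  assumes "rooted_plane_tree T" "collision T C" "collision T C'"
    and ess: "essential T C = essential T C'" and fus: "fusion T C = fusion T C'"
    and prec_eq: "\<And>E1 E2. E1 \<in> essential T C \<Longrightarrow> E2 \<in> essential T C \<Longrightarrow> butlast E1 = butlast E2 \<Longrightarrow>
      (E1, E2) \<in> prec C \<longleftrightarrow> (E1, E2) \<in> prec C'"
  shows "C = C'"
proof -
  have "prec C1 \<subseteq> prec C2" if C1: "collision T C1" and C2: "collision T C2"
    and ess: "essential T C1 = essential T C2" and fus: "fusion T C1 = fusion T C2"
    and prec_eq: "\<And>E1 E2. E1 \<in> essential T C1 \<Longrightarrow> E2 \<in> essential T C1 \<Longrightarrow> butlast E1 = butlast E2 \<Longrightarrow>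
      (E1, E2) \<in> prec C1 \<longleftrightarrow> (E1, E2) \<in> prec C2" for C1 C2 :: "'v bracketing"
  proof -
    interpret C1: tree_collision T C1 by unfold_locales fact+
    interpret C2: tree_collision T C2 by unfold_locales fact+
    have brs: "brs C1 = brs C2" using C1.anatomy(3) C2.anatomy(3) ess by simp
    show ?thesis
    proof (rule subrelI)
      fix A1 A2 assume p: "(A1, A2) \<in> prec C1"
      then have cmp: "comparable C1 A1 A2" unfolding comparable_def by blast
      note cD = C1.comparableD[OF cmp]
      show "(A1, A2) \<in> prec C2"
      proof (cases "A1 \<in> essential T C1 \<and> A2 \<in> essential T C1")
        case True
        then show ?thesis using prec_eq cD(5) p by blast
      next
        case False
        note nmax = C1.comparable_not_max[OF cmp] C1.comparable_not_max[OF C1.comparable_sym[OF cmp]]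
        have "is_sing T A1 \<or> is_sing T A2"
          using False cD(1,2) nmax C1.anatomy(3) unfolding C1.trivial_brackets_def is_sing_def by blast
        have len1: "length A1 \<noteq> 1"
        proof
          assume "length A1 = 1"
          then have "is_bracket T 0 A1" "is_bracket T 0 A2" using C1.bracket_at cD(1,2,4) by auto
          then have "last A1 = {root T}" "last A2 = {root T}"
            using bracket_last_level bracket_last_nonempty C1.level_0 by (metis subset_singletonD)+
          then show False using cD(6) by simp
        qed
        then obtain k where k: "length A1 = Suc (Suc k)"
          using C1.nonempty[OF cD(1)] by (metis One_nat_def length_0_conv not0_implies_Suc)
        have sb: "is_sing T (butlast A1)"
          using \<open>is_sing T A1 \<or> is_sing T A2\<close> C1.is_sing_butlast len1 cD(4,5) by metis
        then obtain p where p': "p \<in> verts T" "butlast A1 = sing_bracket T p" unfolding is_sing_def by blast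
        obtain u where u: "u \<in> last A1" using C1.last_nonempty cD(1) by blast
        obtain v where v: "v \<in> last A2" using C1.last_nonempty cD(2) by blast
        have "is_bracket T (Suc k) A1" "is_bracket T (Suc k) A2" using C1.bracket_at cD(1,2,4) k by auto
        then have "parent T u = p" "parent T v = p"
          using bracket_parent u v p' cD(5) C1.last_sing_bracket by (metis singletonD)+
        then show ?thesis
          using C1.prec_sib_iff[OF cD(1,2,5,6) u v _ k] C2.prec_sib_iff[OF _ _ cD(5,6) u v _ k] cD(1,2) brs p
          by simp
      qed
    qed
  qed
  from this[OF assms(2-5) prec_eq] this[OF assms(3,2) ess[symmetric] fus[symmetric]] prec_eq ess
  have "prec C = prec C'" by blast
  moreover have "brs C = brs C'"
  proof -
    interpret C1: tree_collision T C by unfold_locales fact+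
    interpret C2: tree_collision T C' by unfold_locales fact+
    show ?thesis using C1.anatomy(3) C2.anatomy(3) ess by simp
  qed
  ultimately show ?thesis by (simp add: bracketing.equality)
qed

section \<open>Contractions\<close>

text \<open>\<open>contract\<close> takes the ordered list of children by definite description, so
  uniqueness is required besides existence.\<close>

lemma ex1_sorted_list:
  assumes "finite A" and tr: "\<And>x y z. R x y \<Longrightarrow> R y z \<Longrightarrow> R x z" and irr: "\<And>x. \<not> R x x"
    and tot: "\<And>x y. x \<in> A \<Longrightarrow> y \<in> A \<Longrightarrow> x \<noteq> y \<Longrightarrow> R x y \<or> R y x"
  shows "\<exists>!xs. distinct xs \<and> set xs = A \<and> sorted_wrt R xs"
  using assms(1) tot
proof (induction A rule: finite_psubset_induct)
  case (psubset A)
  show ?case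
  proof (cases "A = {}")
    case True
    then show ?thesis by auto
  next
    case False
    have "\<exists>m\<in>A. \<forall>x\<in>A. x \<noteq> m \<longrightarrow> R m x"
      using psubset(1) False psubset.prems
    proof (induction rule: finite_ne_induct)
      case (insert a F)
      then obtain m where m: "m \<in> F" "\<forall>x\<in>F. x \<noteq> m \<longrightarrow> R m x" by blast
      show ?case
      proof (cases "R a m")
        case True
        then have "R a x" if "x \<in> F" for x using m that tr by (cases "x = m") blast+
        then show ?thesis by blast
      next
        case False
        then have "R m a" using insert.prems[of a m] insert.hyps m(1) by auto
        then show ?thesis using m by blast
      qed
    qed simp
    then obtain m where m: "m \<in> A" "\<And>x. x \<in> A \<Longrightarrow> x \<noteq> m \<Longrightarrow> R m x" by blast
    define Q where "Q xs \<longleftrightarrow> distinct xs \<and> set xs = A - {m} \<and> sorted_wrt R xs" for xs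
    have "\<exists>!xs. Q xs"
      unfolding Q_def
      by (rule psubset.IH) (use psubset.prems m(1) in auto)
    then obtain ys where ys: "Q ys" and uniq: "\<And>zs. Q zs \<Longrightarrow> zs = ys" by blast
    show ?thesis
    proof (rule ex1I[of _ "m # ys"])
      show "distinct (m # ys) \<and> set (m # ys) = A \<and> sorted_wrt R (m # ys)"
        using ys m unfolding Q_def by auto
      fix xs assume xs: "distinct xs \<and> set xs = A \<and> sorted_wrt R xs"
      then obtain x zs where x: "xs = x # zs" using m(1) by (cases xs) auto
      have "x = m"
      proof (rule ccontr)
        assume "x \<noteq> m"
        then have "R x m" using xs x m(1) by auto
        moreover have "R m x" using m(2)[of x] xs x \<open>x \<noteq> m\<close> by auto
        ultimately show False using tr irr by blast
      qed
      then show "xs = m # ys" using uniq[of zs] xs x unfolding Q_def by auto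
    qed
  qed
qed

lemma sorted_wrt_nth: "sorted_wrt R xs \<Longrightarrow> i < j \<Longrightarrow> j < length xs \<Longrightarrow> R (xs ! i) (xs ! j)"
  by (simp add: sorted_wrt_nth_less)

lemma (in plane_tree) sorted_children: "u \<in> verts T \<Longrightarrow> sorted_wrt sib (ch T u)"
  unfolding sorted_wrt_iff_nth_less using sib_index by auto

section \<open>The contracted tree\<close>

context tree_collision
begin

abbreviation "K \<equiv> contract T C"

lemma finite_essential: "finite ess"
proof (rule inj_on_finite)
  show "inj_on last ess"
  proof (rule inj_onI)
    fix E1 E2 assume E: "E1 \<in> ess" "E2 \<in> ess" "last E1 = last E2"
    obtain v where v: "v \<in> last E1" using last_nonempty essential_brs E(1) by blast
    obtain k1 where k1: "is_bracket T k1 E1" using bracket essential_brs E(1) by blast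
    obtain k2 where k2: "is_bracket T k2 E2" using bracket essential_brs E(2) by blast
    have "v \<in> level T k1" "v \<in> level T k2"
      using subsetD[OF bracket_last_level[OF k1] v] subsetD[OF bracket_last_level[OF k2]] v E(3) by auto
    then have "k1 = k2" by (rule level_unique)
    then show "E1 = E2" using essential_unique[OF E(1,2) _ v] v E(3) bracket_length[OF k1] bracket_length[OF k2] by simp
  qed
  show "last ` ess \<subseteq> Pow (verts T)"
  proof
    fix X assume "X \<in> last ` ess"
    then obtain E where E: "E \<in> ess" "X = last E" by blast
    obtain k where k: "is_bracket T k E" using bracket essential_brs E(1) by blast
    show "X \<in> Pow (verts T)" using bracket_last_level[OF k] level_verts E(2) by blast
  qed
  show "finite (Pow (verts T))" using finite_verts by simp
qed

lemma verts_K: "verts K = Inl ` (verts T - block) \<union> Inr ` ess"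
  by (simp add: contract_def)

lemma root_K: "root K = Inl (root T)"
  by (simp add: contract_def)

lemma base_not_block: "w \<notin> block"
  using weakly_below_level_ge[OF fused_level _ vdepth_level[OF fusion_base(1)]] by auto

lemma ch_K_Inl: "u \<noteq> w \<Longrightarrow> ch K (Inl u) = map Inl (ch T u)"
  by (simp add: contract_def)

text \<open>Since \<open>W\<close> is consecutive, cutting the list of children where
  \<open>W\<close> begins and where it ends leaves exactly the surviving children.\<close>

lemma ch_K_base:
  obtains as bs cs where "ch T w = as @ bs @ cs" "set bs = W"
    "ch K (Inl w) = map Inl as @ [Inr (fusion T C)] @ map Inl cs" "set as \<inter> W = {}" "set cs \<inter> W = {}"
proof -
  obtain as bs cs where d: "ch T w = as @ bs @ cs" "set bs = W"
    using fused_consecutive unfolding consecutive_def by blast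
  have dist: "distinct (as @ bs @ cs)" using distinct_ch[OF fusion_base(1)] d(1) by simp
  then have disj: "set as \<inter> W = {}" "set cs \<inter> W = {}" using d(2) by auto
  have "bs \<noteq> []" using d(2) fused_nonempty by auto
  have tw: "takeWhile (\<lambda>v. v \<notin> W) (as @ bs @ cs) = as"
    using disj(1) \<open>bs \<noteq> []\<close> d(2) by (subst takeWhile_append2) (auto simp: neq_Nil_conv)
  have "dropWhile (\<lambda>v. v \<notin> W) (as @ bs @ cs) = bs @ cs"
    using disj(1) \<open>bs \<noteq> []\<close> d(2) by (subst dropWhile_append2) (auto simp: neq_Nil_conv)
  moreover have "dropWhile (\<lambda>v. v \<in> W) (bs @ cs) = cs"
    using disj(2) d(2) by (subst dropWhile_append2) (cases cs; auto)+
  ultimately have "ch K (Inl w) = map Inl as @ [Inr (fusion T C)] @ map Inl cs"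
    unfolding contract_def using tw d(1) by simp
  then show thesis using that d disj by blast
qed

lemma prec_total_on:
  assumes "E1 \<in> {E' \<in> ess. butlast E' = E}" "E2 \<in> {E' \<in> ess. butlast E' = E}" "E1 \<noteq> E2"
  shows "(E1, E2) \<in> prec C \<or> (E2, E1) \<in> prec C"
  using essential_prec_total[of E1 E2] assms unfolding comparable_def by auto

lemma ch_K_Inr:
  obtains Es where "ch K (Inr E) = map Inr Es" "distinct Es" "set Es = {E' \<in> ess. butlast E' = E}"
    "sorted_wrt (\<lambda>E1 E2. (E1, E2) \<in> prec C) Es"
proof -
  define P where "P Es \<longleftrightarrow> distinct Es \<and> set Es = {E' \<in> ess. butlast E' = E} \<and>
    sorted_wrt (\<lambda>E1 E2. (E1, E2) \<in> prec C) Es" for Es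
  have "\<exists>!Es. P Es"
    unfolding P_def
  proof (rule ex1_sorted_list)
    show "finite {E' \<in> ess. butlast E' = E}" using finite_essential by simp
  qed (use prec_trans prec_irrefl prec_total_on in blast)+
  then have "P (THE Es. P Es)" by (rule theI')
  then show thesis
    using that[of "THE Es. P Es"] unfolding P_def contract_def by simp
qed

text \<open>Explicit parents in the contracted tree; \<open>edges_K\<close> matches them with its
  edges, which gives unique parents at once.\<close>

fun parK :: "'v + 'v bracket \<Rightarrow> 'v + 'v bracket" where
  "parK (Inl v) = Inl (parent T v)"
| "parK (Inr E) = (if E = fusion T C then Inl w else Inr (butlast E))"

lemma set_ch_K_Inl: "set (ch K (Inl u)) =
  (if u = w then Inl ` (set (ch T w) - W) \<union> {Inr (fusion T C)} else Inl ` set (ch T u))"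
proof (cases "u = w")
  case True
  obtain as bs cs where d: "ch T w = as @ bs @ cs" "set bs = W"
    "ch K (Inl w) = map Inl as @ [Inr (fusion T C)] @ map Inl cs" "set as \<inter> W = {}" "set cs \<inter> W = {}"
    by (rule ch_K_base)
  have "set (ch T w) - W = set as \<union> set cs" unfolding d(1) using d(2,4,5) by auto
  then show ?thesis using True d(3) by auto
next
  case False
  then show ?thesis using ch_K_Inl by simp
qed

lemma set_ch_K_Inr: "set (ch K (Inr E)) = Inr ` {E' \<in> ess. butlast E' = E}"
proof -
  obtain Es where "ch K (Inr E) = map Inr Es" "set Es = {E' \<in> ess. butlast E' = E}"
    by (rule ch_K_Inr)
  then show ?thesis by simp
qed

lemma child_level: "u \<in> verts T \<Longrightarrow> v \<in> set (ch T u) \<Longrightarrow> v \<in> level T (Suc (vdepth T u))"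
  using level_SucI vdepth_level by blast

lemma child_block:
  assumes "u \<in> verts T" "v \<in> set (ch T u)"
  shows "v \<in> block \<longleftrightarrow> v \<in> W \<or> u \<in> block"
  using weakly_below_parent[OF child_level[OF assms]] parent_child[OF assms] by simp

lemma fused_child: "v \<in> W \<Longrightarrow> parent T v = w"
  using parent_child fusion_base(1) fused_children by blast

lemma fusion_not_over: "butlast (fusion T C) \<notin> ess"
  using essential_not_sing E0(3) by blast

lemma edges_K: "(x, y) \<in> edges K \<longleftrightarrow> y \<in> verts K \<and> y \<noteq> Inl (root T) \<and> x = parK y"
proof
  assume "(x, y) \<in> edges K"
  then have x: "x \<in> verts K" and y: "y \<in> set (ch K x)" unfolding edges_def by auto
  show "y \<in> verts K \<and> y \<noteq> Inl (root T) \<and> x = parK y"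
  proof (cases x)
    case (Inl u)
    then have u: "u \<in> verts T" "u \<notin> block" using x unfolding verts_K by auto
    show ?thesis
    proof (cases "y = Inr (fusion T C)")
      case True
      then have "u = w" using y unfolding Inl set_ch_K_Inl by (auto split: if_splits)
      then show ?thesis using True Inl fusion_essential unfolding verts_K by auto
    next
      case False
      then obtain v where v: "y = Inl v" "v \<in> set (ch T u)" "v \<notin> W \<or> u \<noteq> w"
        using y unfolding Inl set_ch_K_Inl by (auto split: if_splits)
      have par: "parent T v = u" using parent_child[OF u(1) v(2)] .
      then have "v \<notin> W" using v(3) fused_child by blast
      then have "v \<notin> block" using child_block[OF u(1) v(2)] u(2) by blast
      moreover have "v \<in> verts T" "v \<noteq> root T"
        using ch_verts[OF u(1) v(2)] no_edge_root edgeI[OF u(1) v(2)] by blast+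
      ultimately show ?thesis using v(1) par Inl unfolding verts_K by auto
    qed
  next
    case (Inr E)
    then have E: "E \<in> ess" using x unfolding verts_K by auto
    obtain E' where E': "y = Inr E'" "E' \<in> ess" "butlast E' = E" using y unfolding Inr set_ch_K_Inr by auto
    have "E' \<noteq> fusion T C" using E'(3) E fusion_not_over by blast
    then show ?thesis using E' Inr unfolding verts_K by auto
  qed
next
  assume h: "y \<in> verts K \<and> y \<noteq> Inl (root T) \<and> x = parK y"
  show "(x, y) \<in> edges K"
  proof (cases y)
    case (Inl v)
    then have v: "v \<in> verts T" "v \<notin> block" "v \<noteq> root T" using h unfolding verts_K by auto
    obtain k where k: "v \<in> level T k" using ex_level v(1) by blast
    then obtain j where j: "v \<in> level T (Suc j)" using v(3) level_0 by (cases k) auto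
    have p: "parent T v \<in> verts T" "v \<in> set (ch T (parent T v))"
      using parent_vert level_SucD(2) j by auto
    have "v \<notin> W" "parent T v \<notin> block" using child_block[OF p] v(2) by blast+
    moreover have "x = Inl (parent T v)" using h Inl by simp
    ultimately have "x \<in> verts K" "y \<in> set (ch K x)"
      using p Inl by (auto simp: verts_K set_ch_K_Inl)
    then show ?thesis unfolding edges_def by blast
  next
    case (Inr E)
    then have E: "E \<in> ess" using h unfolding verts_K by auto
    show ?thesis
    proof (cases "E = fusion T C")
      case True
      then have "x = Inl w" using h Inr by simp
      then have "x \<in> verts K" "y \<in> set (ch K x)"
        using Inr True fusion_base(1) base_not_block by (auto simp: verts_K set_ch_K_Inl)
      then show ?thesis unfolding edges_def by blast
    next
      case False
      then have "x = Inr (butlast E)" "butlast E \<in> ess" using h Inr essential_cases[OF E] by auto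
      then have "x \<in> verts K" "y \<in> set (ch K x)"
        using Inr E by (auto simp: verts_K set_ch_K_Inr)
      then show ?thesis unfolding edges_def by blast
    qed
  qed
qed

text \<open>The subtraction of 1 reflects that a \<open>k\<close>-bracket is a list of length
  \<open>k + 1\<close>.\<close>

fun levK :: "'v + 'v bracket \<Rightarrow> nat" where
  "levK (Inl v) = vdepth T v"
| "levK (Inr E) = length E - 1"

lemma relpow_K: "y \<in> verts K \<Longrightarrow> levK y = n \<Longrightarrow> (Inl (root T), y) \<in> edges K ^^ n"
proof (induction n arbitrary: y)
  case 0
  show ?case
  proof (cases y)
    case (Inl v)
    then have "v \<in> level T 0" using 0 vdepth_level[of v] unfolding verts_K by auto
    then show ?thesis using Inl level_0 by auto
  next
    case (Inr E)
    then have E: "E \<in> ess" using 0 unfolding verts_K by auto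
    then have "length E \<noteq> 1" "length E \<noteq> 0" using generated_length_1 anatomy(2) essential_nonempty by auto
    then have "1 < length E" by arith
    then show ?thesis using 0 Inr by simp
  qed
next
  case (Suc n)
  have nr: "y \<noteq> Inl (root T)"
  proof
    assume "y = Inl (root T)"
    then show False using Suc.prems(2) vdepth_eq[of "root T" 0] level_0 by simp
  qed
  then have e: "(parK y, y) \<in> edges K" using edges_K Suc.prems(1) by blast
  then have "parK y \<in> verts K" unfolding edges_def by blast
  moreover have "levK (parK y) = n"
  proof (cases y)
    case (Inl v)
    then have "v \<in> level T (Suc n)" using Suc.prems vdepth_level[of v] unfolding verts_K by auto
    then show ?thesis using Inl vdepth_eq level_SucD(1) by auto
  next
    case (Inr E)
    show ?thesis
      using Inr Suc.prems length_fusion by auto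
  qed
  ultimately have "(Inl (root T), parK y) \<in> edges K ^^ n" using Suc.IH by blast
  then show ?case using e by auto
qed

lemma contract_tree: "rooted_plane_tree K"
  unfolding rooted_plane_tree_def
proof (intro conjI ballI allI impI)
  show "finite (verts K)" unfolding verts_K using finite_verts finite_essential by simp
  have "root T \<notin> block"
    using weakly_below_level_ge[OF fused_level, of "root T" 0] level_0 by auto
  then show "root K \<in> verts K" unfolding verts_K root_K using root_vert by auto
next
  fix x assume x: "x \<in> verts K"
  show "set (ch K x) \<subseteq> verts K" using edges_K x unfolding edges_def by blast
  show "distinct (ch K x)"
  proof (cases x)
    case (Inl u)
    then have u: "u \<in> verts T" using x unfolding verts_K by auto
    show ?thesis
    proof (cases "u = w")
      case True
      obtain as bs cs where d: "ch T w = as @ bs @ cs" "set bs = W"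
        "ch K (Inl w) = map Inl as @ [Inr (fusion T C)] @ map Inl cs" "set as \<inter> W = {}" "set cs \<inter> W = {}"
        by (rule ch_K_base)
      have "distinct (as @ bs @ cs)" using distinct_ch[OF fusion_base(1)] d(1) by simp
      then show ?thesis unfolding Inl True d(3) by (auto simp: distinct_map)
    next
      case False
      then show ?thesis unfolding Inl ch_K_Inl[OF False] using distinct_ch[OF u] by (simp add: distinct_map)
    qed
  next
    case (Inr E)
    obtain Es where "ch K (Inr E) = map Inr Es" "distinct Es" by (rule ch_K_Inr)
    then show ?thesis unfolding Inr by (simp add: distinct_map)
  qed
next
  fix x show "(x, root K) \<notin> edges K" unfolding edges_K root_K by blast
next
  fix y assume "y \<in> verts K" "y \<noteq> root K"
  then show "\<exists>!x. (x, y) \<in> edges K" unfolding edges_K root_K by blast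
next
  fix y assume "y \<in> verts K"
  then show "(root K, y) \<in> (edges K)\<^sup>*"
    unfolding root_K using relpow_K[of y "levK y"] by (simp add: relpow_imp_rtrancl)
qed

end

sublocale tree_collision \<subseteq> K: plane_tree "contract T C"
  by unfold_locales (rule contract_tree)

section \<open>Levels and positions after contraction\<close>

context tree_collision
begin

lemma level_K_iff: "y \<in> level K k \<longleftrightarrow> y \<in> verts K \<and> levK y = k"
proof
  assume y: "y \<in> level K k"
  then have v: "y \<in> verts K" using K.level_verts by blast
  then have "y \<in> level K (levK y)" unfolding level_def root_K using relpow_K by simp
  then show "y \<in> verts K \<and> levK y = k" using y v K.level_unique by blast
next
  assume "y \<in> verts K \<and> levK y = k"
  then show "y \<in> level K k" unfolding level_def root_K using relpow_K by simp
qed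

definition essk :: "nat \<Rightarrow> 'v bracket set" where
  "essk k = {E \<in> ess. length E = Suc k}"

lemma level_K: "level K k = Inl ` (level T k - block) \<union> Inr ` essk k"
proof (intro set_eqI iffI)
  fix y assume "y \<in> level K k"
  then have y: "y \<in> verts K" "levK y = k" using level_K_iff by auto
  show "y \<in> Inl ` (level T k - block) \<union> Inr ` essk k"
  proof (cases y)
    case (Inl v)
    then show ?thesis using y vdepth_level[of v] unfolding verts_K by auto
  next
    case (Inr E)
    then have "E \<in> ess" using y unfolding verts_K by auto
    then have "length E \<noteq> 0" using essential_nonempty by simp
    then show ?thesis using Inr y \<open>E \<in> ess\<close> unfolding essk_def by auto
  qed
next
  fix y assume "y \<in> Inl ` (level T k - block) \<union> Inr ` essk k"
  then show "y \<in> level K k"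
    unfolding level_K_iff verts_K essk_def using level_verts vdepth_eq by auto
qed

lemma parent_K: "y \<in> level K (Suc k) \<Longrightarrow> parent K y = parK y"
  using K.level_SucD(3) edges_K by blast

lemma psi_Inl: "v \<notin> block \<Longrightarrow> psi T C v = Inl v"
  by (simp add: psi_def)

lemma psi_Inr:
  assumes "E \<in> essk k" "v \<in> last E"
  shows "psi T C v = Inr E"
proof -
  have E: "E \<in> ess" "length E = Suc k" using assms(1) unfolding essk_def by auto
  have "v \<in> level T k" using essential_level[OF E] assms(2) by blast
  then have "(THE E. E \<in> ess \<and> E \<in> blevel C (vdepth T v) \<and> v \<in> last E) = E"
    using E assms(2) essential_unique essential_brs unfolding blevel_def
    by (intro the_equality) (auto simp: vdepth_eq)
  then show ?thesis using essential_block[OF E(1) assms(2)] by (simp add: psi_def)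
qed

lemma block_essk: "v \<in> level T k \<Longrightarrow> v \<in> block \<longleftrightarrow> (\<exists>E\<in>essk k. v \<in> last E)"
  using block_iff unfolding essk_def by auto

lemma essk_last: "E \<in> essk k \<Longrightarrow> \<exists>v\<in>level T k. v \<in> last E \<and> v \<in> block"
  using essential_level last_nonempty essential_brs essential_block unfolding essk_def by blast

lemma psi_level: "v \<in> level T k \<Longrightarrow> psi T C v \<in> level K k"
proof (cases "v \<in> block")
  case True
  assume v: "v \<in> level T k"
  then obtain E where "E \<in> essk k" "v \<in> last E" using True block_essk by blast
  then show ?thesis using psi_Inr level_K by auto
qed (auto simp: psi_Inl level_K)

text \<open>The bracket around \<open>v\<close> projects to the bracket around its parent, except at
  the top of the block, where the fusion bracket hangs below the surviving vertex
  \<open>w\<close>.\<close>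

lemma parent_psi:
  assumes v: "v \<in> level T (Suc k)"
  shows "parent K (psi T C v) = psi T C (parent T v)"
proof (cases "v \<in> block")
  case False
  then have "parent T v \<notin> block" using weakly_below_parent[OF v] by blast
  then show ?thesis using parent_K[OF psi_level[OF v]] False by (simp add: psi_Inl)
next
  case True
  then obtain E where E: "E \<in> essk (Suc k)" "v \<in> last E" using block_essk v by blast
  then have E': "E \<in> ess" "length E = Suc (Suc k)" unfolding essk_def by auto
  show ?thesis
  proof (cases "parent T v \<in> block")
    case True
    have b: "butlast E \<in> ess" "parent T v \<in> last (butlast E)" using essential_parent[OF E' E(2) True] .
    then have "butlast E \<in> essk k" using E'(2) unfolding essk_def by simp
    then have "psi T C (parent T v) = Inr (butlast E)" using psi_Inr b(2) by blast
    moreover have "E \<noteq> fusion T C" using b(1) fusion_not_over by blast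
    ultimately show ?thesis using parent_K[OF psi_level[OF v]] psi_Inr[OF E] by simp
  next
    case False
    then have vW: "v \<in> W" using True weakly_below_parent[OF v] by blast
    then have "Suc (vdepth T w) = Suc k" using fused_level v level_unique by blast
    then have "E = fusion T C"
      using essential_unique[OF E'(1) fusion_essential _ E(2)] E'(2) length_fusion vW unfolding fused_def by simp
    then show ?thesis
      using parent_K[OF psi_level[OF v]] psi_Inr[OF E] fused_child[OF vW] psi_Inl[OF base_not_block] by simp
  qed
qed

definition d :: "'v \<Rightarrow> nat" where
  "d v = pos K (psi T C v)"

lemma d_eq_iff:
  assumes "u \<in> level T k" "v \<in> level T k"
  shows "d u = d v \<longleftrightarrow> u = v \<or> (\<exists>E\<in>essk k. u \<in> last E \<and> v \<in> last E)"
proof -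
  have "d u = d v \<longleftrightarrow> psi T C u = psi T C v"
    unfolding d_def using K.pos_inj psi_level assms by blast
  also have "\<dots> \<longleftrightarrow> u = v \<or> (\<exists>E\<in>essk k. u \<in> last E \<and> v \<in> last E)"
  proof
    assume eq: "psi T C u = psi T C v"
    show "u = v \<or> (\<exists>E\<in>essk k. u \<in> last E \<and> v \<in> last E)"
    proof (cases "u \<in> block")
      case True
      then obtain E where E: "E \<in> essk k" "u \<in> last E" using block_essk assms(1) by blast
      have "v \<in> block"
      proof (rule ccontr)
        assume "v \<notin> block"
        then show False using eq psi_Inr[OF E] psi_Inl[of v] by simp
      qed
      then obtain E' where E': "E' \<in> essk k" "v \<in> last E'" using block_essk assms(2) by blast
      then have "E = E'" using eq psi_Inr[OF E] psi_Inr[OF E'] by simp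
      then show ?thesis using E E' by blast
    next
      case False
      then have "psi T C v = Inl u" using eq psi_Inl by simp
      then have "v \<notin> block" using block_essk[OF assms(2)] psi_Inr by force
      then show ?thesis using psi_Inl \<open>psi T C v = Inl u\<close> by simp
    qed
  next
    assume "u = v \<or> (\<exists>E\<in>essk k. u \<in> last E \<and> v \<in> last E)"
    then show "psi T C u = psi T C v" using psi_Inr by auto
  qed
  finally show ?thesis .
qed

lemma d_less_Suc_iff:
  assumes "u \<in> level T (Suc k)" "v \<in> level T (Suc k)"
  shows "d u < d v \<longleftrightarrow> d (parent T u) < d (parent T v) \<or>
    d (parent T u) = d (parent T v) \<and> K.sib (psi T C u) (psi T C v)"
proof -
  have "psi T C (parent T u) = psi T C (parent T v) \<longleftrightarrow> d (parent T u) = d (parent T v)"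
    unfolding d_def using K.pos_inj psi_level level_SucD(1) assms by metis
  then show ?thesis
    unfolding d_def using K.pos_less_Suc_iff[OF psi_level[OF assms(1)] psi_level[OF assms(2)]]
      parent_psi assms by simp
qed

lemma d_parent: "u \<in> level T (Suc k) \<Longrightarrow> v \<in> level T (Suc k) \<Longrightarrow> d (parent T u) < d (parent T v) \<Longrightarrow> d u < d v"
  using d_less_Suc_iff by blast

text \<open>Necessary conditions for being siblings in this order after contraction, phrased in
  \<open>T\<close>. The fusion bracket stands for all of \<open>W\<close>, hence the quantifiers; no
  other bracket has a surviving vertex as a sibling.\<close>

fun before :: "'v + 'v bracket \<Rightarrow> 'v + 'v bracket \<Rightarrow> bool" where
  "before (Inl u) (Inl v) \<longleftrightarrow> sib u v"
| "before (Inl u) (Inr E) \<longleftrightarrow> (\<forall>x\<in>W. sib u x)"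
| "before (Inr E) (Inl v) \<longleftrightarrow> (\<forall>x\<in>W. sib x v)"
| "before (Inr E1) (Inr E2) \<longleftrightarrow> (E1, E2) \<in> prec C"

lemma before_sib_K: "K.sib x y \<Longrightarrow> before x y"
proof -
  assume "K.sib x y"
  then obtain p i j where p: "p \<in> verts K" "i < j" "j < length (ch K p)" "x = ch K p ! i" "y = ch K p ! j"
    unfolding K.sib_def by blast
  have "sorted_wrt before (ch K p)"
  proof (cases p)
    case (Inl u)
    then have u: "u \<in> verts T" using p(1) unfolding verts_K by auto
    show ?thesis
    proof (cases "u = w")
      case True
      obtain as bs cs where dd: "ch T w = as @ bs @ cs" "set bs = W"
        "ch K (Inl w) = map Inl as @ [Inr (fusion T C)] @ map Inl cs" "set as \<inter> W = {}" "set cs \<inter> W = {}"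
        by (rule ch_K_base)
      have "sorted_wrt sib (as @ bs @ cs)" using sorted_children[OF u] True dd(1) by simp
      then show ?thesis
        unfolding Inl True dd(3) using dd(2) by (auto simp: sorted_wrt_append sorted_wrt_map)
    next
      case False
      then show ?thesis unfolding Inl ch_K_Inl[OF False] using sorted_children[OF u] by (simp add: sorted_wrt_map)
    qed
  next
    case (Inr E)
    obtain Es where "ch K (Inr E) = map Inr Es" "sorted_wrt (\<lambda>E1 E2. (E1, E2) \<in> prec C) Es" by (rule ch_K_Inr)
    then show ?thesis unfolding Inr by (simp add: sorted_wrt_map)
  qed
  then show "before x y" using sorted_wrt_nth p by blast
qed

lemma sib_asym: "sib u v \<Longrightarrow> \<not> sib v u"
  using sib_trans sib_irrefl by blast

text \<open>Either the parents already decide, or the two vertices are siblings below a surviving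
  vertex, and the block can meet them only in \<open>W\<close>, which contracts to one vertex at its
  own place.\<close>

lemma d_outside_mono:
  "u \<in> level T k \<Longrightarrow> v \<in> level T k \<Longrightarrow> \<not> (u \<in> block \<and> v \<in> block) \<Longrightarrow> pos T u < pos T v \<Longrightarrow> d u < d v"
proof (induction k arbitrary: u v)
  case 0
  then show ?case using level_0 by auto
next
  case (Suc k)
  have par: "parent T u \<in> level T k" "parent T v \<in> level T k" using level_SucD(1) Suc.prems by blast+
  have nb: "\<not> (parent T u \<in> block \<and> parent T v \<in> block)"
    using weakly_below_parent Suc.prems by blast
  consider "pos T (parent T u) < pos T (parent T v)" | "parent T u = parent T v" "sib u v"
    using pos_less_Suc_iff[OF Suc.prems(1,2)] Suc.prems(4) by blast
  then show ?case
  proof cases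
    case 1
    then show ?thesis using Suc.IH[OF par nb] d_parent Suc.prems by blast
  next
    case 2
    then have pnb: "parent T v \<notin> block" using nb by simp
    have uW: "u \<in> block \<longleftrightarrow> u \<in> W" and vW: "v \<in> block \<longleftrightarrow> v \<in> W"
      using weakly_below_parent[OF Suc.prems(1)] weakly_below_parent[OF Suc.prems(2)] pnb 2(1) by auto
    have ne: "psi T C u \<noteq> psi T C v"
    proof
      assume "psi T C u = psi T C v"
      then have "d u = d v" unfolding d_def by simp
      moreover have "u \<noteq> v" using 2(2) sib_irrefl by blast
      ultimately show False
        using d_eq_iff[OF Suc.prems(1,2)] Suc.prems(3) essential_block unfolding essk_def by blast
    qed
    have x: "psi T C u \<in> level K (Suc k)" "psi T C v \<in> level K (Suc k)" using psi_level Suc.prems by auto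
    have same: "parent K (psi T C u) = parent K (psi T C v)" using parent_psi Suc.prems 2(1) by simp
    \<comment> \<open>The images are distinct children of one vertex, so one of the two orders
      holds; the wrong one would reverse the sibling order of \<open>T\<close>.\<close>
    have "K.sib (psi T C u) (psi T C v) \<or> K.sib (psi T C v) (psi T C u)"
      using K.sib_total[OF K.parent_vert[OF x(1)] K.level_SucD(2)[OF x(1)] _ ne]
        K.level_SucD(2)[OF x(2)] same by simp
    moreover have "\<not> K.sib (psi T C v) (psi T C u)"
    proof
      assume "K.sib (psi T C v) (psi T C u)"
      then have b: "before (psi T C v) (psi T C u)" by (rule before_sib_K)
      show False
      proof (cases "u \<in> block")
        case True
        then have "v \<notin> block" using Suc.prems(3) by blast
        moreover obtain E where "psi T C u = Inr E" using True block_essk[OF Suc.prems(1)] psi_Inr by blast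
        ultimately show False using b psi_Inl 2(2) sib_asym True uW by auto
      next
        case False
        show False
        proof (cases "v \<in> block")
          case True
          moreover obtain E where "psi T C v = Inr E" using True block_essk[OF Suc.prems(2)] psi_Inr by blast
          ultimately show False using b False psi_Inl 2(2) sib_asym vW by auto
        next
          case False
          then show False using b \<open>u \<notin> block\<close> psi_Inl 2(2) sib_asym by auto
        qed
      qed
    qed
    ultimately have "K.sib (psi T C u) (psi T C v)" by blast
    then show ?thesis using d_less_Suc_iff[OF Suc.prems(1,2)] 2(1) by simp
  qed
qed

lemma d_outside_iff:
  assumes "u \<in> level T k" "v \<in> level T k" "\<not> (u \<in> block \<and> v \<in> block)"
  shows "d u < d v \<longleftrightarrow> pos T u < pos T v"
proof
  assume du: "d u < d v"
  show "pos T u < pos T v"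
  proof (rule ccontr)
    assume "\<not> pos T u < pos T v"
    then consider "pos T u = pos T v" | "pos T v < pos T u" by linarith
    then show False
    proof cases
      case 1
      then show False using pos_inj[OF assms(1,2)] du by simp
    next
      case 2
      then show False using d_outside_mono[OF assms(2,1)] assms(3) du by auto
    qed
  qed
qed (use d_outside_mono assms in blast)

text \<open>New vertices of brackets over one essential bracket are siblings, listed in the order of
  the collision.\<close>

lemma d_essential_iff:
  assumes E: "E1 \<in> essk (Suc k)" "E2 \<in> essk (Suc k)" "butlast E1 = butlast E2" "butlast E1 \<in> ess"
    and uv: "u \<in> last E1" "v \<in> last E2"
  shows "d u < d v \<longleftrightarrow> (E1, E2) \<in> prec C"
proof -
  have E': "E1 \<in> ess" "E2 \<in> ess" "length E1 = Suc (Suc k)" "length E2 = Suc (Suc k)"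
    using E(1,2) unfolding essk_def by auto
  have lev: "u \<in> level T (Suc k)" "v \<in> level T (Suc k)" using essential_level E' uv by blast+
  have br: "is_bracket T (Suc k) E1" "is_bracket T (Suc k) E2" using bracket_at essential_brs E' by blast+
  have "butlast E1 \<in> essk k" using E(4) E'(3) unfolding essk_def by simp
  then have same: "d (parent T u) = d (parent T v)"
    using d_eq_iff[OF level_SucD(1)[OF lev(1)] level_SucD(1)[OF lev(2)]]
      bracket_parent[OF br(1) uv(1)] bracket_parent[OF br(2) uv(2)] E(3) by auto
  have psi: "psi T C u = Inr E1" "psi T C v = Inr E2" using psi_Inr E uv by auto
  have iff: "d u < d v \<longleftrightarrow> K.sib (Inr E1) (Inr E2)"
    using d_less_Suc_iff[OF lev] same psi by simp
  have iff': "d v < d u \<longleftrightarrow> K.sib (Inr E2) (Inr E1)"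
    using d_less_Suc_iff[OF lev(2,1)] same psi by simp
  show ?thesis
  proof
    assume "d u < d v"
    then show "(E1, E2) \<in> prec C" using iff before_sib_K by fastforce
  next
    assume p: "(E1, E2) \<in> prec C"
    then have "\<not> d v < d u" using iff' before_sib_K[of "Inr E2" "Inr E1"] prec_asym by auto
    moreover have "d u \<noteq> d v"
    proof
      assume "d u = d v"
      then have "psi T C u = psi T C v"
        unfolding d_def using K.pos_inj[OF psi_level[OF lev(1)] psi_level[OF lev(2)]] by simp
      then show False using psi p prec_irrefl by auto
    qed
    ultimately show "d u < d v" by linarith
  qed
qed

text \<open>Two siblings in the block are either fused, or lie in brackets over one essential
  bracket, and then the compatibility axiom imposes the sibling order on these brackets.\<close>

lemma d_sib:
  assumes "sib u v"
  shows "d u \<le> d v"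
proof -
  obtain p where p: "p \<in> verts T" "u \<in> set (ch T p)" "v \<in> set (ch T p)" "parent T u = p" "parent T v = p"
    using assms by (elim sibE) blast
  define k where "k = vdepth T p"
  have lev: "u \<in> level T (Suc k)" "v \<in> level T (Suc k)" unfolding k_def using child_level p by blast+
  show ?thesis
  proof (cases "u \<in> block \<and> v \<in> block")
    case False
    then show ?thesis using d_outside_mono[OF lev] pos_sib[OF assms] by simp
  next
    case True
    obtain E1 where E1: "E1 \<in> essk (Suc k)" "u \<in> last E1" using block_essk[OF lev(1)] True by blast
    obtain E2 where E2: "E2 \<in> essk (Suc k)" "v \<in> last E2" using block_essk[OF lev(2)] True by blast
    have E': "E1 \<in> ess" "E2 \<in> ess" "length E1 = Suc (Suc k)" "length E2 = Suc (Suc k)"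
      using E1 E2 unfolding essk_def by auto
    show ?thesis
    proof (cases "E1 = E2")
      case True
      then show ?thesis using d_eq_iff[OF lev] E1 E2 by auto
    next
      case False
      \<comment> \<open>Block vertices just below a surviving vertex belong to \<open>W\<close>, and
        the fusion bracket would contain both.\<close>
      have pb: "p \<in> block"
      proof (rule ccontr)
        assume "p \<notin> block"
        then have W: "u \<in> W" "v \<in> W" using True child_block[OF p(1)] p(2,3) by blast+
        then have "Suc (vdepth T w) = Suc k" using fused_level lev level_unique by blast
        then have "fusion T C \<in> essk (Suc k)" using fusion_essential length_fusion unfolding essk_def by simp
        then have "E1 = fusion T C" "E2 = fusion T C"
          using essential_unique E1 E2 W unfolding essk_def fused_def by auto
        then show False using False by simp
      qed
      have b: "butlast E1 \<in> ess" "p \<in> last (butlast E1)" "butlast E2 \<in> ess" "p \<in> last (butlast E2)"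
        using essential_parent[OF E'(1,3) E1(2)] essential_parent[OF E'(2,4) E2(2)] p(4,5) pb by auto
      then have eq: "butlast E1 = butlast E2"
        using essential_unique[OF b(1,3) _ b(2,4)] E'(3,4) by simp
      have "last E1 \<inter> last E2 = {}" using essential_unique[OF E'(1,2)] E'(3,4) False by auto
      then have "(E1, E2) \<in> prec C"
        using prec_sib_iff[OF essential_brs[OF E'(1)] essential_brs[OF E'(2)] eq _ E1(2) E2(2) _ E'(3)]
          p(4,5) assms by simp
      then show ?thesis using d_essential_iff[OF E1(1) E2(1) eq b(1) E1(2) E2(2)] by simp
    qed
  qed
qed

text \<open>Each vertex of the block that lies before \<open>v\<close> is traded for an essential bracket.\<close>

lemma d_shift:
  assumes v: "v \<in> level T k"
  shows "d v + card {x \<in> level T k \<inter> block. pos T x < pos T v} =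
    pos T v + card {E \<in> essk k. pos K (Inr E) < d v}"
proof -
  have fin: "finite (level T k)" by (rule finite_level)
  have fk: "finite (essk k)" unfolding essk_def using finite_essential by simp
  have "pos T v = Suc (card {x \<in> level T k. pos T x < pos T v})"
    using pos_eq[OF v] pos_less_iff[OF _ v] by (metis (mono_tags, lifting) Collect_cong)
  also have "{x \<in> level T k. pos T x < pos T v} =
      {x \<in> level T k - block. pos T x < pos T v} \<union> {x \<in> level T k \<inter> block. pos T x < pos T v}" by blast
  also have "card \<dots> = card {x \<in> level T k - block. pos T x < pos T v} +
      card {x \<in> level T k \<inter> block. pos T x < pos T v}"
    using fin by (intro card_Un_disjoint) auto
  finally have 1: "pos T v = Suc (card {x \<in> level T k - block. pos T x < pos T v} +
      card {x \<in> level T k \<inter> block. pos T x < pos T v})" .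
  have "d v = Suc (card {y \<in> level K k. pos K y < d v})"
    unfolding d_def using K.pos_eq[OF psi_level[OF v]] K.pos_less_iff[OF _ psi_level[OF v]]
    by (metis (mono_tags, lifting) Collect_cong)
  also have "{y \<in> level K k. pos K y < d v} =
      Inl ` {x \<in> level T k - block. pos T x < pos T v} \<union> Inr ` {E \<in> essk k. pos K (Inr E) < d v}"
  proof -
    have "pos K (Inl x) < d v \<longleftrightarrow> pos T x < pos T v" if "x \<in> level T k - block" for x
      using d_outside_iff[of x k v] that v psi_Inl[of x] by (simp add: d_def)
    then show ?thesis unfolding level_K by auto
  qed
  also have "card \<dots> = card {x \<in> level T k - block. pos T x < pos T v} + card {E \<in> essk k. pos K (Inr E) < d v}"
    using fin fk by (subst card_Un_disjoint) (auto simp: card_image)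
  finally show ?thesis using 1 by linarith
qed

end

section \<open>Families of separated collisions\<close>

context plane_tree
begin

lemma tree_collisionI: "collision T C \<Longrightarrow> tree_collision T C"
  by unfold_locales

abbreviation dC :: "'v bracketing \<Rightarrow> 'v \<Rightarrow> nat" where
  "dC C \<equiv> tree_collision.d T C"

abbreviation blk :: "'v bracketing \<Rightarrow> 'v set" where
  "blk C \<equiv> weakly_below T (fused T C)"

abbreviation es :: "'v bracketing \<Rightarrow> nat \<Rightarrow> 'v bracket set" where
  "es C k \<equiv> tree_collision.essk T C k"

definition lt :: "nat \<Rightarrow> 'v \<Rightarrow> 'v set" where
  "lt k v = {x \<in> level T k. pos T x < pos T v}"

text \<open>Counterpart of \<open>lt\<close> for the new vertices: contraction trades the block
  vertices left of \<open>v\<close> for these brackets.\<close>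

definition passed :: "'v bracketing \<Rightarrow> nat \<Rightarrow> 'v \<Rightarrow> 'v bracket set" where
  "passed C k v = {E \<in> es C k. pos (contract T C) (Inr E) < dC C v}"

lemma es_iff: "collision T C \<Longrightarrow> E \<in> es C k \<longleftrightarrow> E \<in> essential T C \<and> length E = Suc k"
  using tree_collision.essk_def[OF tree_collisionI] by blast

lemma finite_es: "collision T C \<Longrightarrow> finite (es C k)"
  using tree_collision.essk_def[OF tree_collisionI] tree_collision.finite_essential[OF tree_collisionI] by simp

lemma blk_es: "collision T C \<Longrightarrow> v \<in> level T k \<Longrightarrow> v \<in> blk C \<longleftrightarrow> (\<exists>E\<in>es C k. v \<in> last E)"
  using tree_collision.block_essk[OF tree_collisionI] .

lemma es_blk:
  assumes "collision T C" "E \<in> es C k" "v \<in> last E"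
  shows "v \<in> level T k" "v \<in> blk C"
proof -
  interpret tree_collision T C by (rule tree_collisionI) fact
  have E: "E \<in> ess" "length E = Suc k" using assms(2) es_iff[OF assms(1)] by auto
  show "v \<in> level T k" using essential_level[OF E] assms(3) by blast
  show "v \<in> blk C" using essential_block[OF E(1) assms(3)] .
qed

lemma es_last: "collision T C \<Longrightarrow> E \<in> es C k \<Longrightarrow> \<exists>v. v \<in> last E"
  using tree_collision.essk_last[OF tree_collisionI] by blast

lemma es_unique:
  assumes "collision T C" "E1 \<in> es C k" "E2 \<in> es C k" "v \<in> last E1" "v \<in> last E2"
  shows "E1 = E2"
  using tree_collision.essential_unique[OF tree_collisionI[OF assms(1)] _ _ _ assms(4,5)] assms es_iff by simp

lemma dC_eq_iff: "collision T C \<Longrightarrow> u \<in> level T k \<Longrightarrow> v \<in> level T k \<Longrightarrow>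
    dC C u = dC C v \<longleftrightarrow> u = v \<or> (\<exists>E\<in>es C k. u \<in> last E \<and> v \<in> last E)"
  using tree_collision.d_eq_iff[OF tree_collisionI] .

lemma dC_parent: "collision T C \<Longrightarrow> u \<in> level T (Suc k) \<Longrightarrow> v \<in> level T (Suc k) \<Longrightarrow>
    dC C (parent T u) < dC C (parent T v) \<Longrightarrow> dC C u < dC C v"
  using tree_collision.d_parent[OF tree_collisionI] .

lemma dC_sib: "collision T C \<Longrightarrow> sib u v \<Longrightarrow> dC C u \<le> dC C v"
  using tree_collision.d_sib[OF tree_collisionI] .

lemma dC_outside_iff: "collision T C \<Longrightarrow> u \<in> level T k \<Longrightarrow> v \<in> level T k \<Longrightarrow>
    \<not> (u \<in> blk C \<and> v \<in> blk C) \<Longrightarrow> dC C u < dC C v \<longleftrightarrow> pos T u < pos T v"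
  using tree_collision.d_outside_iff[OF tree_collisionI] .

lemma dC_shift: "collision T C \<Longrightarrow> v \<in> level T k \<Longrightarrow>
    dC C v + card (lt k v \<inter> blk C) = pos T v + card (passed C k v)"
proof -
  assume h: "collision T C" "v \<in> level T k"
  have "{x \<in> level T k \<inter> blk C. pos T x < pos T v} = lt k v \<inter> blk C" unfolding lt_def by blast
  then show ?thesis
    using tree_collision.d_shift[OF tree_collisionI[OF h(1)] h(2)] unfolding passed_def by simp
qed

lemma passed_iff:
  assumes "collision T C" "E \<in> es C k" "x \<in> last E"
  shows "E \<in> passed C k v \<longleftrightarrow> dC C x < dC C v"
proof -
  interpret tree_collision T C by (rule tree_collisionI) fact
  show ?thesis unfolding passed_def using assms(2) psi_Inr[OF assms(2,3)] unfolding d_def by simp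
qed

lemma finite_passed: "collision T C \<Longrightarrow> finite (passed C k v)"
  unfolding passed_def using finite_es by simp

lemma finite_lt: "finite (lt k v)"
  unfolding lt_def using finite_level by simp

lemma pos_lt: "v \<in> level T k \<Longrightarrow> pos T v = Suc (card (lt k v))"
proof -
  assume v: "v \<in> level T k"
  then have "lt k v = {x \<in> level T k. lex_before T x v}" unfolding lt_def using pos_less_iff by blast
  then show ?thesis using pos_eq[OF v] by simp
qed

lemma blk_interval:
  assumes "collision T C" "u \<in> level T k" "v \<in> level T k" "x \<in> level T k" "u \<in> blk C" "v \<in> blk C"
    "pos T u < pos T x" "pos T x < pos T v"
  shows "x \<in> blk C"
proof -
  interpret tree_collision T C by (rule tree_collisionI) fact
  show ?thesis
    using weakly_below_interval[OF fusion_base(1) fused_children fused_consecutive] assms by blast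
qed

lemma blk_parent: "v \<in> level T (Suc k) \<Longrightarrow> v \<in> blk C \<longleftrightarrow> v \<in> fused T C \<or> parent T v \<in> blk C"
  using weakly_below_parent .

text \<open>The topmost level of a block consists of siblings; on deeper levels the parents are
  still in the block.\<close>

lemma blk_siblings:
  assumes "collision T C" "u \<in> level T (Suc k)" "v \<in> level T (Suc k)" "u \<in> blk C" "v \<in> blk C"
  shows "parent T u = parent T v \<or> parent T u \<in> blk C \<and> parent T v \<in> blk C"
proof -
  interpret tree_collision T C by (rule tree_collisionI) fact
  have *: "parent T y = w" if "x \<in> W" "x \<in> level T (Suc k)" "y \<in> level T (Suc k)" "y \<in> blk C" for x y
  proof -
    have "Suc (vdepth T w) = Suc k" using fused_level that(1,2) level_unique by blast
    then have "y \<in> W" using weakly_below_level_eq[OF fused_level] that(3,4) by simp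
    then show ?thesis using fused_child by blast
  qed
  show ?thesis using * assms blk_parent by metis
qed

end

text \<open>Projections stay essential until the fusion bracket is reached, and on levels closer to
  the root the block is empty.\<close>

lemma (in tree_collision) essential_component:
  assumes "E \<in> ess" "length E = Suc n" "j \<le> n" "a \<in> E ! j" "a \<in> block"
  shows "\<exists>E'\<in>ess. length E' = Suc j \<and> last E' = E ! j"
  using assms
proof (induction n arbitrary: E)
  case 0
  then show ?case by (metis generated_length_1 One_nat_def anatomy(2))
next
  case (Suc n)
  show ?case
  proof (cases "j = Suc n")
    case True
    then have "last E = E ! j" using Suc.prems(2) essential_nonempty[OF Suc.prems(1)] by (simp add: last_conv_nth)
    then show ?thesis using Suc.prems True by auto
  next
    case False
    then have jn: "j \<le> n" using Suc.prems(3) by simp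
    have "E \<noteq> fusion T C"
    proof
      assume eq: "E = fusion T C"
      then have "n = vdepth T w" using Suc.prems(2) length_fusion by simp
      moreover have "a \<in> level T j"
        using fusion_bracket eq Suc.prems(3,4) calculation unfolding is_bracket_def by auto
      ultimately show False using weakly_below_level_ge[OF fused_level Suc.prems(5)] jn by fastforce
    qed
    then have b: "butlast E \<in> ess" using essential_cases Suc.prems(1) by blast
    have "butlast E ! j = E ! j" using jn Suc.prems(2) by (simp add: nth_butlast)
    then show ?thesis using Suc.IH[OF b _ jn] Suc.prems(2,4,5) by simp
  qed
qed

section \<open>Joint positions after separated collisions\<close>

locale separated_family = plane_tree T for T :: "'v ptree" +
  fixes D :: "'v bracketing set"
  assumes finite_family: "finite D" and collisions: "C \<in> D \<Longrightarrow> collision T C"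
    and separated: "C1 \<in> D \<Longrightarrow> C2 \<in> D \<Longrightarrow> C1 \<noteq> C2 \<Longrightarrow> separated T C1 C2"
begin

lemma blk_disjoint: "C1 \<in> D \<Longrightarrow> C2 \<in> D \<Longrightarrow> v \<in> verts T \<Longrightarrow> v \<in> blk C1 \<Longrightarrow> v \<in> blk C2 \<Longrightarrow> C1 = C2"
  using separated unfolding separated_def by blast

text \<open>The shifts of positions caused by separated collisions add up, as their vectors do in
  \<open>rho_gen\<close>.\<close>

definition dD :: "'v \<Rightarrow> int" where
  "dD v = int (pos T v) - (\<Sum>C\<in>D. int (pos T v) - int (dC C v))"

text \<open>By \<open>dC_shift\<close> this is how far contracting \<open>C\<close> moves
  \<open>v\<close> to the left.\<close>

definition shift :: "'v bracketing \<Rightarrow> nat \<Rightarrow> 'v \<Rightarrow> int" where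
  "shift C k v = int (card (lt k v \<inter> blk C)) - int (card (passed C k v))"

lemma dD_shift: "v \<in> level T k \<Longrightarrow> dD v = int (pos T v) - (\<Sum>C\<in>D. shift C k v)"
proof -
  assume v: "v \<in> level T k"
  have "int (pos T v) - int (dC C v) = shift C k v" if "C \<in> D" for C
    using dC_shift[OF collisions[OF that] v] unfolding shift_def by linarith
  then show ?thesis unfolding dD_def by simp
qed

text \<open>A block is an interval on each level, so no vertex of another block lies between
  \<open>u\<close> and \<open>v\<close>, and the other collision displaces both equally.\<close>

lemma shift_within:
  assumes C: "C \<in> D" "C' \<in> D" "C' \<noteq> C" and uv: "u \<in> level T k" "v \<in> level T k" "u \<in> blk C" "v \<in> blk C"
    "pos T u < pos T v"
  shows "shift C' k u = shift C' k v"
proof -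
  have nb: "u \<notin> blk C'" "v \<notin> blk C'" using blk_disjoint C uv level_verts by blast+
  have between: "x \<notin> blk C'" if "x \<in> level T k" "pos T u \<le> pos T x" "pos T x < pos T v" for x
  proof -
    have "x \<in> blk C"
      using blk_interval[OF collisions[OF C(1)] uv(1,2) that(1) uv(3,4)] pos_inj[OF uv(1) that(1)] that(2,3) uv(3)
      by (metis le_neq_implies_less)
    then show ?thesis using blk_disjoint C that(1) level_verts by blast
  qed
  have "lt k u \<inter> blk C' = lt k v \<inter> blk C'"
    unfolding lt_def using between uv(5) by fastforce
  moreover have "passed C' k u = passed C' k v"
  proof -
    have "E \<in> passed C' k u \<longleftrightarrow> E \<in> passed C' k v" if E: "E \<in> es C' k" for E
    proof -
      obtain x where x: "x \<in> last E" using es_last collisions C(2) E by blast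
      have xl: "x \<in> level T k" "x \<in> blk C'" using es_blk[OF collisions[OF C(2)] E x] by auto
      have "dC C' x < dC C' u \<longleftrightarrow> pos T x < pos T u" "dC C' x < dC C' v \<longleftrightarrow> pos T x < pos T v"
        using dC_outside_iff[OF collisions[OF C(2)] xl(1)] uv nb by blast+
      moreover have "pos T x < pos T u \<longleftrightarrow> pos T x < pos T v"
        using between[OF xl(1)] xl(2) uv(5) by fastforce
      ultimately show ?thesis using passed_iff[OF collisions[OF C(2)] E x] by simp
    qed
    then show ?thesis unfolding passed_def by blast
  qed
  ultimately show ?thesis unfolding shift_def by simp
qed

lemma dD_within:
  assumes C: "C \<in> D" and uv: "u \<in> level T k" "v \<in> level T k" "u \<in> blk C" "v \<in> blk C"
  shows "dD u - dD v = int (dC C u) - int (dC C v)"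
proof -
  have *: "dD u - dD v = int (dC C u) - int (dC C v)"
    if uv: "u \<in> level T k" "v \<in> level T k" "u \<in> blk C" "v \<in> blk C" "pos T u < pos T v" for u v
  proof -
    have "(\<Sum>C\<in>D - {C}. shift C k u) = (\<Sum>C\<in>D - {C}. shift C k v)"
      using shift_within[OF C _ _ uv] by (intro sum.cong) auto
    moreover have "(\<Sum>C\<in>D. shift C k x) = shift C k x + (\<Sum>C\<in>D - {C}. shift C k x)" for x
      using finite_family C by (simp add: sum.remove)
    ultimately have "dD u - dD v = (int (pos T u) - shift C k u) - (int (pos T v) - shift C k v)"
      using dD_shift[OF uv(1)] dD_shift[OF uv(2)] by simp
    moreover have "int (pos T x) - shift C k x = int (dC C x)" if "x \<in> level T k" for x
      using dC_shift[OF collisions[OF C] that] unfolding shift_def by linarith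
    ultimately show ?thesis using uv by simp
  qed
  consider "pos T u < pos T v" | "u = v" | "pos T v < pos T u"
    using pos_inj[OF uv(1,2)] by linarith
  then show ?thesis
    using *[OF uv] *[OF uv(2,1,4,3)] by cases auto
qed

text \<open>Count the vertices from \<open>u\<close> up to but excluding \<open>v\<close>. The
  blocks occupy disjoint parts of this stretch, so the displacements gained along it add up to at
  most its length; strictness comes from \<open>u\<close> itself.\<close>

lemma dD_outside:
  assumes uv: "u \<in> level T k" "v \<in> level T k" "\<not> (\<exists>C\<in>D. u \<in> blk C \<and> v \<in> blk C)" "pos T u < pos T v"
  shows "dD u < dD v"
proof -
  define I where "I = lt k v - lt k u"
  have finI: "finite I" unfolding I_def using finite_lt by simp
  have sub: "lt k u \<subseteq> lt k v" unfolding lt_def using uv(4) by auto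
  have uI: "u \<in> I" unfolding I_def lt_def using uv by auto
  have cardI: "int (card I) = int (pos T v) - int (pos T u)"
    unfolding pos_lt[OF uv(1)] pos_lt[OF uv(2)] I_def
    using card_Diff_subset[OF finite_lt sub] card_mono[OF finite_lt sub] by simp
  have nb: "\<not> (u \<in> blk C \<and> v \<in> blk C)" if "C \<in> D" for C using uv(3) that by blast
  have lessd: "dC C u < dC C v" if "C \<in> D" for C
    using dC_outside_iff[OF collisions[OF that] uv(1,2) nb[OF that]] uv(4) by blast
  have sub': "passed C k u \<subseteq> passed C k v" if "C \<in> D" for C
    unfolding passed_def using lessd[OF that] by auto
  have diff: "shift C k v - shift C k u = int (card (I \<inter> blk C)) - int (card (passed C k v - passed C k u))" if "C \<in> D" for C
  proof -
    have "lt k v \<inter> blk C = (lt k u \<inter> blk C) \<union> (I \<inter> blk C)" unfolding I_def using sub by blast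
    moreover have "card ((lt k u \<inter> blk C) \<union> (I \<inter> blk C)) = card (lt k u \<inter> blk C) + card (I \<inter> blk C)"
      using finite_lt finI unfolding I_def by (intro card_Un_disjoint) auto
    moreover have "card (passed C k v) = card (passed C k u) + card (passed C k v - passed C k u)"
      using sub'[OF that] finite_passed[OF collisions[OF that]]
      by (metis card_Diff_subset card_mono finite_subset le_add_diff_inverse)
    ultimately show ?thesis unfolding shift_def by simp
  qed
  have disj: "(\<Sum>C\<in>D. card (I \<inter> blk C)) = card (\<Union>C\<in>D. I \<inter> blk C)"
  proof (rule card_UN_disjoint[symmetric])
    show "\<forall>i\<in>D. \<forall>j\<in>D. i \<noteq> j \<longrightarrow> (I \<inter> blk i) \<inter> (I \<inter> blk j) = {}"
      using blk_disjoint level_verts unfolding I_def lt_def by blast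
  qed (use finite_family finI in auto)
  have "(\<Sum>C\<in>D. shift C k v - shift C k u) < int (card I)"
  \<comment> \<open>If \<open>u\<close> lies in a block, its essential bracket is newly passed on
    the way to \<open>v\<close> and offsets one vertex; if not, \<open>u\<close> is a vertex of the
    stretch in no block.\<close>
  proof (cases "\<exists>C\<in>D. u \<in> blk C")
    case True
    then obtain C where C: "C \<in> D" "u \<in> blk C" by blast
    obtain E where E: "E \<in> es C k" "u \<in> last E" using blk_es[OF collisions[OF C(1)] uv(1)] C(2) by blast
    have "E \<in> passed C k v - passed C k u"
      using passed_iff[OF collisions[OF C(1)] E] lessd[OF C(1)] by simp
    then have "card (passed C k v - passed C k u) > 0"
      using finite_passed[OF collisions[OF C(1)]] by (metis card_gt_0_iff empty_iff finite_Diff)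
    then have "(\<Sum>C\<in>D. shift C k v - shift C k u) < (\<Sum>C\<in>D. int (card (I \<inter> blk C)))"
      using diff finite_family C(1) by (intro sum_strict_mono_ex1) auto
    also have "\<dots> = int (card (\<Union>C\<in>D. I \<inter> blk C))" using disj by (simp flip: of_nat_sum)
    also have "\<dots> \<le> int (card I)" using finI by (intro of_nat_mono card_mono) auto
    finally show ?thesis .
  next
    case False
    have "(\<Sum>C\<in>D. shift C k v - shift C k u) \<le> (\<Sum>C\<in>D. int (card (I \<inter> blk C)))"
      using diff by (intro sum_mono) auto
    also have "\<dots> = int (card (\<Union>C\<in>D. I \<inter> blk C))" using disj by (simp flip: of_nat_sum)
    also have "\<dots> < int (card I)"
      using finI uI False by (intro of_nat_less_iff[THEN iffD2] psubset_card_mono) auto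
    finally show ?thesis .
  qed
  then show ?thesis
    unfolding dD_shift[OF uv(1)] dD_shift[OF uv(2)] using cardI by (simp add: sum_subtractf)
qed

definition same :: "nat \<Rightarrow> 'v \<Rightarrow> 'v \<Rightarrow> bool" where
  "same k u v \<longleftrightarrow> (\<exists>C\<in>D. \<exists>E\<in>es C k. u \<in> last E \<and> v \<in> last E)"

lemma dD_eq_iff:
  assumes uv: "u \<in> level T k" "v \<in> level T k"
  shows "dD u = dD v \<longleftrightarrow> u = v \<or> same k u v"
proof (cases "\<exists>C\<in>D. u \<in> blk C \<and> v \<in> blk C")
  case True
  then obtain C where C: "C \<in> D" "u \<in> blk C" "v \<in> blk C" by blast
  have "dD u = dD v \<longleftrightarrow> dC C u = dC C v" using dD_within[OF C(1) uv C(2,3)] by auto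
  also have "\<dots> \<longleftrightarrow> u = v \<or> (\<exists>E\<in>es C k. u \<in> last E \<and> v \<in> last E)"
    using dC_eq_iff[OF collisions[OF C(1)] uv] .
  also have "\<dots> \<longleftrightarrow> u = v \<or> same k u v"
  proof -
    have "C' = C" if "C' \<in> D" "E \<in> es C' k" "u \<in> last E" for C' E
      using blk_disjoint[OF that(1) C(1) level_verts[OF uv(1)]] es_blk[OF collisions[OF that(1)] that(2,3)] C(2) by blast
    then show ?thesis unfolding same_def using C(1) by blast
  qed
  finally show ?thesis .
next
  case False
  have "\<not> same k u v" unfolding same_def using False es_blk collisions by blast
  moreover have "u = v" if "dD u = dD v"
    using dD_outside[OF uv False] dD_outside[OF uv(2,1)] False that pos_inj[OF uv]
    by (metis less_irrefl linorder_neqE_nat)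
  ultimately show ?thesis by blast
qed

lemma dD_outside_iff:
  assumes uv: "u \<in> level T k" "v \<in> level T k" "\<not> (\<exists>C\<in>D. u \<in> blk C \<and> v \<in> blk C)"
  shows "dD u < dD v \<longleftrightarrow> pos T u < pos T v"
  using dD_outside[OF uv] dD_outside[OF uv(2,1)] uv(3) pos_inj[OF uv(1,2)]
  by (metis linorder_neqE_nat order_less_asym order_less_irrefl)

text \<open>A block containing both parents contains both vertices, and its contraction decides.
  Without such a block no block contains both vertices, and the original positions decide.\<close>

lemma dD_parent:
  assumes uv: "u \<in> level T (Suc k)" "v \<in> level T (Suc k)" and less: "dD (parent T u) < dD (parent T v)"
  shows "dD u < dD v"
proof -
  have par: "parent T u \<in> level T k" "parent T v \<in> level T k" using level_SucD(1) uv by auto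
  show ?thesis
  proof (cases "\<exists>C\<in>D. parent T u \<in> blk C \<and> parent T v \<in> blk C")
    case True
    then obtain C where C: "C \<in> D" "parent T u \<in> blk C" "parent T v \<in> blk C" by blast
    have b: "u \<in> blk C" "v \<in> blk C" using blk_parent uv C by blast+
    have "dC C (parent T u) < dC C (parent T v)" using dD_within[OF C(1) par C(2,3)] less by simp
    then have "dC C u < dC C v" using dC_parent[OF collisions[OF C(1)] uv] by blast
    then show ?thesis using dD_within[OF C(1) uv b] by simp
  next
    case False
    then have p: "pos T (parent T u) < pos T (parent T v)" using dD_outside_iff[OF par] less by blast
    have "\<not> (\<exists>C\<in>D. u \<in> blk C \<and> v \<in> blk C)"
      using blk_siblings collisions uv False less by (metis less_irrefl)
    moreover have "pos T u < pos T v" using pos_less_Suc_iff[OF uv] p by blast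
    ultimately show ?thesis using dD_outside[OF uv] by blast
  qed
qed

lemma dD_sib:
  assumes "sib u v" "u \<in> level T k" "v \<in> level T k"
  shows "dD u \<le> dD v"
proof (cases "\<exists>C\<in>D. u \<in> blk C \<and> v \<in> blk C")
  case True
  then obtain C where C: "C \<in> D" "u \<in> blk C" "v \<in> blk C" by blast
  then show ?thesis using dD_within[OF C(1) assms(2,3) C(2,3)] dC_sib[OF collisions[OF C(1)] assms(1)] by simp
next
  case False
  then show ?thesis using dD_outside[OF assms(2,3)] pos_sib[OF assms(1)] by simp
qed

text \<open>Blocks of the family are disjoint, so only one collision can fuse \<open>u\<close> with
  anything.\<close>

lemma dD_class:
  assumes C: "C \<in> D" and E: "E \<in> es C k" "u \<in> last E" and x: "x \<in> level T k"
  shows "dD x = dD u \<longleftrightarrow> x \<in> last E"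
proof -
  have u: "u \<in> level T k" "u \<in> blk C" using es_blk[OF collisions[OF C] E] by auto
  have "x \<in> last E" if "same k x u"
  proof -
    obtain C' E' where C': "C' \<in> D" "E' \<in> es C' k" "x \<in> last E'" "u \<in> last E'"
      using \<open>same k x u\<close> unfolding same_def by blast
    have "C' = C" using blk_disjoint[OF C'(1) C level_verts[OF u(1)] _ u(2)] es_blk[OF collisions[OF C'(1)] C'(2,4)] by blast
    then show ?thesis using es_unique[OF collisions[OF C] _ E(1) C'(4) E(2)] C'(2,3) by blast
  qed
  moreover have "same k x u" if "x \<in> last E" unfolding same_def using C E that by blast
  ultimately show ?thesis using dD_eq_iff[OF x u(1)] E(2) by blast
qed

text \<open>One element for each class to the left of \<open>v\<close>: the unfused vertices, and
  the fused classes tagged by their collision.\<close>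

definition passed_classes :: "nat \<Rightarrow> 'v \<Rightarrow> ('v + 'v bracketing \<times> 'v bracket) set" where
  "passed_classes k v = Inl ` (lt k v - (\<Union>C\<in>D. blk C)) \<union> Inr ` (SIGMA C:D. passed C k v)"

lemma finite_passed_classes: "finite (passed_classes k v)"
  unfolding passed_classes_def using finite_lt finite_family finite_passed collisions by auto

text \<open>The summed displacements amount to the position among the classes of the joint
  contraction, which is why the values turn out to be free of gaps.\<close>

lemma dD_card: "v \<in> level T k \<Longrightarrow> dD v = 1 + int (card (passed_classes k v))"
proof -
  assume v: "v \<in> level T k"
  have "card (passed_classes k v) = card (lt k v - (\<Union>C\<in>D. blk C)) + card (SIGMA C:D. passed C k v)"
    unfolding passed_classes_def using finite_lt finite_family finite_passed collisions
    by (subst card_Un_disjoint) (auto simp: card_image)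
  also have "card (SIGMA C:D. passed C k v) = (\<Sum>C\<in>D. card (passed C k v))"
    using finite_family finite_passed collisions by (intro card_SigmaI) auto
  finally have 1: "card (passed_classes k v) = card (lt k v - (\<Union>C\<in>D. blk C)) + (\<Sum>C\<in>D. card (passed C k v))" .
  have "lt k v = (lt k v - (\<Union>C\<in>D. blk C)) \<union> (\<Union>C\<in>D. lt k v \<inter> blk C)" by blast
  then have "card (lt k v) = card (lt k v - (\<Union>C\<in>D. blk C)) + card (\<Union>C\<in>D. lt k v \<inter> blk C)"
    using finite_lt finite_family card_Un_disjoint[of "lt k v - (\<Union>C\<in>D. blk C)" "\<Union>C\<in>D. lt k v \<inter> blk C"] by auto
  also have "card (\<Union>C\<in>D. lt k v \<inter> blk C) = (\<Sum>C\<in>D. card (lt k v \<inter> blk C))"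
  proof (rule card_UN_disjoint)
    show "\<forall>i\<in>D. \<forall>j\<in>D. i \<noteq> j \<longrightarrow> (lt k v \<inter> blk i) \<inter> (lt k v \<inter> blk j) = {}"
      using blk_disjoint level_verts unfolding lt_def by blast
  qed (use finite_family finite_lt in auto)
  finally have 2: "card (lt k v) = card (lt k v - (\<Union>C\<in>D. blk C)) + (\<Sum>C\<in>D. card (lt k v \<inter> blk C))" .
  have "dD v = int (pos T v) - ((\<Sum>C\<in>D. int (card (lt k v \<inter> blk C))) - (\<Sum>C\<in>D. int (card (passed C k v))))"
    unfolding dD_shift[OF v] shift_def by (simp add: sum_subtractf)
  then show ?thesis using 1 2 pos_lt[OF v] by simp
qed

text \<open>Let \<open>v\<close> have the least value above that of \<open>u\<close>. Every class
  passed by \<open>v\<close> is then passed by \<open>u\<close> as well, except possibly the class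
  of \<open>u\<close>.\<close>

lemma dD_gap_free:
  assumes u: "u \<in> level T k" and v0: "v0 \<in> level T k" "dD u < dD v0"
  shows "\<exists>v\<in>level T k. dD v = dD u + 1"
proof -
  obtain v where v: "v \<in> level T k" "dD u < dD v" and least: "\<And>x. x \<in> level T k \<Longrightarrow> dD u < dD x \<Longrightarrow> dD v \<le> dD x"
  proof -
    define R where "R = {x \<in> level T k. dD u < dD x}"
    have R: "finite R" "R \<noteq> {}" unfolding R_def using finite_level v0 by auto
    then have "Min (dD ` R) \<in> dD ` R" by (intro Min_in) auto
    then obtain v where v: "v \<in> R" "dD v = Min (dD ` R)" by auto
    then have "dD v \<le> dD x" if "x \<in> R" for x using R that by simp
    then show thesis using that v(1) unfolding R_def by blast
  qed
  have below: "x = u \<or> same k x u \<or> dD x < dD u" if "x \<in> level T k" "dD x < dD v" for x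
    using least[OF that(1)] that dD_eq_iff[OF that(1) u] by (metis linorder_neqE_linordered_idom not_less)
  have Inl_case: "x = u \<or> x \<in> lt k u" if "x \<in> lt k v" "x \<notin> (\<Union>C\<in>D. blk C)" for x
  proof -
    have xl: "x \<in> level T k" "pos T x < pos T v" using that(1) unfolding lt_def by auto
    have nb: "\<not> (\<exists>C\<in>D. x \<in> blk C \<and> y \<in> blk C)" for y using that(2) by blast
    have "dD x < dD v" using dD_outside[OF xl(1) v(1) nb xl(2)] .
    moreover have "\<not> same k x u" unfolding same_def using nb es_blk collisions by blast
    ultimately have "x = u \<or> dD x < dD u" using below xl(1) by blast
    then show ?thesis unfolding lt_def using dD_outside_iff[OF xl(1) u nb] xl(1) by blast
  qed
  have Inr_case: "u \<in> last E \<or> E \<in> passed C k u" if C: "C \<in> D" and E: "E \<in> passed C k v" for C E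
  proof -
    have Ee: "E \<in> es C k" using E unfolding passed_def by blast
    obtain x where x: "x \<in> last E" using es_last[OF collisions[OF C] Ee] by blast
    have xl: "x \<in> level T k" "x \<in> blk C" using es_blk[OF collisions[OF C] Ee x] by auto
    have only: "C' = C" if "C' \<in> D" "x \<in> blk C'" for C'
      using blk_disjoint[OF that(1) C level_verts[OF xl(1)] that(2) xl(2)] .
    have less: "dD x < dD y \<longleftrightarrow> dC C x < dC C y" if y: "y \<in> level T k" for y
    proof (cases "y \<in> blk C")
      case True
      then show ?thesis using dD_within[OF C xl(1) y xl(2)] by auto
    next
      case False
      then have "\<not> (\<exists>C\<in>D. x \<in> blk C \<and> y \<in> blk C)" using only by blast
      then show ?thesis
        using dD_outside_iff[OF xl(1) y] dC_outside_iff[OF collisions[OF C] xl(1) y] False by blast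
    qed
    have "dD x < dD v" using passed_iff[OF collisions[OF C] Ee x] E less[OF v(1)] by blast
    then consider "x = u" | "same k x u" | "dD x < dD u" using below xl(1) by blast
    then show ?thesis
    proof cases
      case 1
      then show ?thesis using x by blast
    next
      case 2
      then obtain C' E' where C': "C' \<in> D" "E' \<in> es C' k" "x \<in> last E'" "u \<in> last E'" unfolding same_def by blast
      have "C' = C" using only[OF C'(1)] es_blk[OF collisions[OF C'(1)] C'(2,3)] by blast
      then show ?thesis using es_unique[OF collisions[OF C] Ee _ x C'(3)] C'(2,4) by blast
    next
      case 3
      then show ?thesis using less[OF u] passed_iff[OF collisions[OF C] Ee x] by blast
    qed
  qed
  have "\<exists>c. passed_classes k v \<subseteq> insert c (passed_classes k u)"
  proof (cases "\<exists>C\<in>D. u \<in> blk C")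
    case True
    then obtain C where C: "C \<in> D" "u \<in> blk C" by blast
    obtain E where E: "E \<in> es C k" "u \<in> last E" using blk_es[OF collisions[OF C(1)] u] C(2) by blast
    have "C' = C \<and> E' = E" if "C' \<in> D" "E' \<in> passed C' k v" "u \<in> last E'" for C' E'
    proof -
      have E': "E' \<in> es C' k" using that(2) unfolding passed_def by blast
      have "C' = C" using blk_disjoint[OF that(1) C(1) level_verts[OF u] _ C(2)] es_blk[OF collisions[OF that(1)] E' that(3)] by blast
      then show ?thesis using es_unique[OF collisions[OF C(1)] _ E(1) that(3) E(2)] E' by blast
    qed
    then have "passed_classes k v \<subseteq> insert (Inr (C, E)) (passed_classes k u)"
      unfolding passed_classes_def using Inl_case Inr_case C by blast
    then show ?thesis by blast
  next
    case False
    have "u \<notin> last E" if "C \<in> D" "E \<in> passed C k v" for C E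
      using False es_blk[OF collisions[OF that(1)]] that unfolding passed_def by blast
    then have "passed_classes k v \<subseteq> insert (Inl u) (passed_classes k u)"
      unfolding passed_classes_def using Inl_case Inr_case by blast
    then show ?thesis by blast
  qed
  then obtain c where "passed_classes k v \<subseteq> insert c (passed_classes k u)" by blast
  then have "card (passed_classes k v) \<le> card (insert c (passed_classes k u))"
    using finite_passed_classes by (intro card_mono) auto
  also have "\<dots> \<le> Suc (card (passed_classes k u))" by (rule card_insert_le_m1) (simp_all add: card_insert_le_m1)
  finally have "dD v \<le> dD u + 1" using dD_card[OF u] dD_card[OF v(1)] by simp
  then show ?thesis using v by (intro bexI[of _ v]) auto
qed

text \<open>A nontrivial essential bracket misses a vertex \<open>v\<close> on some level
  \<open>j\<close>. If \<open>v\<close> were merged with a suitable vertex \<open>a\<close> of its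
  \<open>j\<close>-th component, the class of \<open>a\<close> would be this component, which misses
  \<open>v\<close>. This is what tells a nonempty chain from the empty one.\<close>

lemma dD_nonconstant:
  assumes "D \<noteq> {}"
  shows "\<exists>k. \<exists>u\<in>level T k. \<exists>v\<in>level T k. dD u \<noteq> dD v"
proof -
  obtain C where C: "C \<in> D" using assms by blast
  interpret C: tree_collision T C using tree_collisionI[OF collisions[OF C]] .
  obtain X where X: "X \<in> essential T C" "nontrivial T X" using C.anatomy(4) by blast
  obtain n where n: "is_bracket T n X" "n \<le> depth T" using C.bracket C.essential_brs X(1) by blast
  have "X \<noteq> max_bracket T n" using X(2) n(2) unfolding nontrivial_def by blast
  then obtain j where j: "j \<le> n" "X ! j \<noteq> level T j"
  proof -
    have "\<exists>j<Suc n. X ! j \<noteq> max_bracket T n ! j"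
    proof (rule ccontr)
      assume "\<not> (\<exists>j<Suc n. X ! j \<noteq> max_bracket T n ! j)"
      then have "X = max_bracket T n"
        using bracket_length[OF n(1)] length_max_bracket[of T n] by (intro nth_equalityI) auto
      then show False using \<open>X \<noteq> max_bracket T n\<close> by blast
    qed
    then obtain j where "j < Suc n" "X ! j \<noteq> max_bracket T n ! j" by blast
    moreover have "max_bracket T n ! j = level T j" if "j < Suc n" for j
      unfolding max_bracket_def using that by (simp del: upt_Suc)
    ultimately show thesis using that[of j] by simp
  qed
  have sub: "X ! j \<subseteq> level T j" using n(1) j(1) unfolding is_bracket_def by blast
  then obtain v where v: "v \<in> level T j" "v \<notin> X ! j" using j(2) by blast
  obtain x where x: "x \<in> last X" using bracket_last_nonempty[OF n(1)] by blast
  have xl: "x \<in> level T n" using bracket_last_level[OF n(1)] x by blast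
  \<comment> \<open>An ancestor of a top vertex is chosen so that \<open>a\<close> has a descendant
    in the block of \<open>C\<close>.\<close>
  obtain a where a: "a \<in> level T j" "weak_desc T a x" using ancestor_exists[OF xl j(1)] by blast
  have "sing_bracket T x ! j = {w \<in> level T j. weak_desc T w x}"
    unfolding sing_bracket_level[OF xl] using j(1) by (simp del: upt_Suc)
  then have aX: "a \<in> X ! j"
    using sing_bsub[OF n(1) x] a j(1) length_sing_bracket[OF xl] unfolding bsub_iff
    by (metis (mono_tags, lifting) le_imp_less_Suc mem_Collect_eq subsetD)
  have "dD a \<noteq> dD v"
  proof
    assume "dD a = dD v"
    moreover have "a \<noteq> v" using aX v(2) by blast
    ultimately have "same j a v" using dD_eq_iff[OF a(1) v(1)] by blast
    then obtain C' E' where C': "C' \<in> D" "E' \<in> es C' j" "a \<in> last E'" "v \<in> last E'" unfolding same_def by blast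
    \<comment> \<open>The fusing collision can only be \<open>C\<close>: the descendant
      \<open>x\<close> of \<open>a\<close> lies in both blocks, and blocks of different members are
      disjoint.\<close>
    have aC': "a \<in> blk C'" using es_blk[OF collisions[OF C'(1)] C'(2,3)] by blast
    then have "x \<in> blk C'" unfolding weakly_below_def using weak_desc_trans a(2) by blast
    moreover have "x \<in> blk C" using C.essential_block[OF X(1) x] .
    ultimately have CC: "C' = C" using blk_disjoint C'(1) C level_verts[OF xl] by blast
    obtain E where E: "E \<in> essential T C" "length E = Suc j" "last E = X ! j"
      using C.essential_component[OF X(1) bracket_length[OF n(1)] j(1) aX] aC' CC by blast
    have "E \<in> es C j" using es_iff[OF collisions[OF C]] E by blast
    then have "E = E'" using es_unique[OF collisions[OF C] _ _ _ C'(3)] C'(2) CC aX E(3) by blast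
    then show False using C'(4) E(3) v(2) by blast
  qed
  then have "\<exists>u\<in>level T j. dD u \<noteq> dD v" using a(1) by blast
  then show ?thesis using v(1) by blast
qed

end

section \<open>Comparing generalized collisions\<close>

text \<open>The half of \<open>arrow\<close> that is transitive by its form. The common upper bounds
  in the other half are never composed.\<close>

definition contained :: "'v ptree \<Rightarrow> 'v bracketing \<Rightarrow> 'v bracketing \<Rightarrow> bool" where
  "contained T C1 C2 \<longleftrightarrow> (\<forall>E1\<in>essential T C1. \<exists>E2\<in>essential T C2. bsub E1 E2)"

lemma contained_trans: "contained T C1 C2 \<Longrightarrow> contained T C2 C3 \<Longrightarrow> contained T C1 C3"
  unfolding contained_def using bsub_trans by blast

lemma arrow_contained: "arrow T C1 C2 \<Longrightarrow> contained T C1 C2"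
  unfolding arrow_def contained_def by blast

section \<open>Positions along arrows\<close>

context plane_tree
begin

lemma arrow_essential:
  assumes C: "collision T C1" "collision T C2" and le: "arrow T C1 C2" and E: "E1 \<in> es C1 k"
  shows "\<exists>E2\<in>es C2 k. bsub E1 E2 \<and> last E1 \<subseteq> last E2"
proof -
  have E1: "E1 \<in> essential T C1" "length E1 = Suc k" using es_iff[OF C(1)] E by auto
  then obtain E2 where E2: "E2 \<in> essential T C2" "bsub E1 E2" using le unfolding arrow_def by blast
  then have "E2 \<in> es C2 k" using es_iff[OF C(2)] bsub_length E1(2) by metis
  moreover have "E1 \<noteq> []" using E1(2) by auto
  ultimately show ?thesis using E2(2) bsub_last by blast
qed

lemma contained_blk:
  assumes "collision T C1" "collision T C2" "contained T C1 C2"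
  shows "blk C1 \<subseteq> blk C2"
proof -
  interpret C1: tree_collision T C1 using tree_collisionI assms(1) .
  interpret C2: tree_collision T C2 using tree_collisionI assms(2) .
  obtain E2 where E2: "E2 \<in> essential T C2" "bsub (fusion T C1) E2"
    using assms(3) C1.fusion_essential unfolding contained_def by blast
  then have "fused T C1 \<subseteq> last E2"
    unfolding fused_def using bsub_last C1.essential_nonempty[OF C1.fusion_essential] by blast
  then have "fused T C1 \<subseteq> blk C2" using C2.essential_block[OF E2(1)] by blast
  then show ?thesis unfolding weakly_below_def using weak_desc_trans by blast
qed

text \<open>Both collisions carry restrictions of the order of a common upper bound. There the
  compatibility axiom passes the order of the two brackets over \<open>E\<close> on to the larger
  brackets of \<open>C2\<close> around them.\<close>

lemma arrow_preserves_order: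
  assumes C: "collision T C1" "collision T C2" and le: "arrow T C1 C2"
    and uv: "u \<in> level T (Suc k)" "v \<in> level T (Suc k)"
    and E: "E \<in> es C1 k" "parent T u \<in> last E" "parent T v \<in> last E" and less: "dC C1 u < dC C1 v"
  shows "dC C2 u \<le> dC C2 v"
proof -
  interpret C1: tree_collision T C1 using tree_collisionI C(1) .
  interpret C2: tree_collision T C2 using tree_collisionI C(2) .
  obtain B where B: "B \<in> bracketings T" "bracketing_le C1 B" "bracketing_le C2 B"
    using le unfolding arrow_def by blast
  interpret B: tree_bracketing T B using B(1) by unfold_locales (simp add: bracketings_def)
  have sub: "brs C1 \<subseteq> brs B" "brs C2 \<subseteq> brs B" "prec C1 \<subseteq> prec B"
    and prec2: "prec C2 = prec B \<inter> (brs C2 \<times> brs C2)"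
    using B(2,3) unfolding bracketing_le_def by auto
  have E': "E \<in> essential T C1" "length E = Suc k" using es_iff[OF C(1)] E(1) by auto
  obtain E1 where E1: "E1 \<in> essential T C1" "butlast E1 = E" "length E1 = Suc (Suc k)" "u \<in> last E1"
    using C1.essential_cover[OF E'(1) E(2) level_SucD(2)[OF uv(1)]] E'(2) by auto
  obtain E2 where E2: "E2 \<in> essential T C1" "butlast E2 = E" "length E2 = Suc (Suc k)" "v \<in> last E2"
    using C1.essential_cover[OF E'(1) E(3) level_SucD(2)[OF uv(2)]] E'(2) by auto
  have es1: "E1 \<in> es C1 (Suc k)" "E2 \<in> es C1 (Suc k)" using es_iff[OF C(1)] E1 E2 by auto
  have p12: "(E1, E2) \<in> prec C1"
    using C1.d_essential_iff[OF es1 _ _ E1(4) E2(4)] less E1(2) E2(2) E'(1) by simp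
  obtain F where F: "F \<in> es C2 k" "bsub E F" "last E \<subseteq> last F" using arrow_essential[OF C le E(1)] by blast
  obtain F1 where F1: "F1 \<in> es C2 (Suc k)" "bsub E1 F1" "last E1 \<subseteq> last F1" using arrow_essential[OF C le es1(1)] by blast
  obtain F2 where F2: "F2 \<in> es C2 (Suc k)" "bsub E2 F2" "last E2 \<subseteq> last F2" using arrow_essential[OF C le es1(2)] by blast
  have Fe: "F \<in> essential T C2" "length F = Suc k"
    and F1e: "F1 \<in> essential T C2" "length F1 = Suc (Suc k)"
    and F2e: "F2 \<in> essential T C2" "length F2 = Suc (Suc k)"
    using es_iff[OF C(2)] F(1) F1(1) F2(1) by auto
  have uF1: "u \<in> last F1" and vF2: "v \<in> last F2" using F1(3) F2(3) E1(4) E2(4) by auto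
  have pF: "parent T u \<in> last F" "parent T v \<in> last F" using F(3) E(2,3) by auto
  have pb: "parent T u \<in> blk C2" "parent T v \<in> blk C2" using es_blk[OF C(2) F(1)] pF by auto
  have b1: "butlast F1 \<in> essential T C2" "parent T u \<in> last (butlast F1)"
    using C2.essential_parent[OF F1e uF1 pb(1)] by auto
  have b2: "butlast F2 \<in> essential T C2" "parent T v \<in> last (butlast F2)"
    using C2.essential_parent[OF F2e vF2 pb(2)] by auto
  have bF1: "butlast F1 = F"
    using C2.essential_unique[OF b1(1) Fe(1) _ b1(2) pF(1)] F1e(2) Fe(2) by simp
  have bF2: "butlast F2 = F"
    using C2.essential_unique[OF b2(1) Fe(1) _ b2(2) pF(2)] F2e(2) Fe(2) by simp
  show ?thesis
  proof (cases "F1 = F2")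
    case True
    then have "dC C2 u = dC C2 v"
      using dC_eq_iff[OF C(2) uv] F1(1) uF1 vF2 by auto
    then show ?thesis by simp
  next
    case False
    have cF: "comparable C2 F1 F2" using C2.essential_prec_total[OF F1e(1) F2e(1) _ False] bF1 bF2 by simp
    have cB: "comparable B F1 F2" using cF prec2 unfolding comparable_def by blast
    have cE: "comparable B E1 E2" using p12 sub(3) unfolding comparable_def by blast
    have inB: "F \<in> brs B" "E \<in> brs B" "F1 \<in> brs B" "F2 \<in> brs B" "E1 \<in> brs B" "E2 \<in> brs B"
      using sub(1,2) C1.essential_brs[OF E'(1)] C1.essential_brs[OF E1(1)] C1.essential_brs[OF E2(1)]
        C2.essential_brs[OF Fe(1)] C2.essential_brs[OF F1e(1)] C2.essential_brs[OF F2e(1)] by blast+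
    have ne: "F1 \<noteq> []" "F2 \<noteq> []" "E1 \<noteq> []" "E2 \<noteq> []" using F1e(2) F2e(2) E1(3) E2(3) by auto
    have "F1 \<in> over B F" "F2 \<in> over B F" "E1 \<in> over B E" "E2 \<in> over B E"
      using inB ne bF1 bF2 E1(2) E2(2) by (auto simp: over_iff)
    then have "(F1, F2) \<in> prec B \<longleftrightarrow> (E1, E2) \<in> prec B"
      using B.prec_compatible[OF inB(1,2) _ _ _ _ F(2) cB cE F1(2) F2(2)] by blast
    then have "(F1, F2) \<in> prec B" using p12 sub(3) by blast
    then have "(F1, F2) \<in> prec C2"
      unfolding prec2 using C2.essential_brs[OF F1e(1)] C2.essential_brs[OF F2e(1)] by blast
    then show ?thesis
      using C2.d_essential_iff[OF F1(1) F2(1) _ b1(1) uF1 vF2] bF1 bF2 by simp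
  qed
qed

abbreviation pD :: "'v bracketing set \<Rightarrow> 'v \<Rightarrow> int" where
  "pD D \<equiv> separated_family.dD T D"

lemma gen_separated: "gen_collision T D \<Longrightarrow> separated_family T D"
  unfolding gen_collision_def by unfold_locales blast+

lemma empty_separated: "separated_family T {}"
  by unfold_locales auto

lemma pD_coarsens:
  assumes "separated_family T D1" "separated_family T D2" "gen_le T D1 D2"
    and uv: "u \<in> level T k" "v \<in> level T k" and eq: "pD D1 u = pD D1 v"
  shows "pD D2 u = pD D2 v"
proof -
  interpret D1: separated_family T D1 by fact
  interpret D2: separated_family T D2 by fact
  show ?thesis
  proof (cases "u = v")
    case False
    then have "D1.same k u v" using D1.dD_eq_iff[OF uv] eq by blast
    then obtain C E where C: "C \<in> D1" "E \<in> es C k" "u \<in> last E" "v \<in> last E" unfolding D1.same_def by blast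
    obtain C2 where C2: "C2 \<in> D2" "arrow T C C2" using assms(3) C(1) unfolding gen_le_def by blast
    obtain E2 where "E2 \<in> es C2 k" "last E \<subseteq> last E2"
      using arrow_essential[OF D1.collisions[OF C(1)] D2.collisions[OF C2(1)] C2(2) C(2)] by blast
    then have "D2.same k u v" unfolding D2.same_def using C2(1) C(3,4) by blast
    then show ?thesis using D2.dD_eq_iff[OF uv] by blast
  qed simp
qed

text \<open>Distinct merged parents share an essential bracket of one collision, and the arrow
  leaving it preserves the order of the children. A common parent leaves siblings, which no
  contraction reverses.\<close>

lemma pD_monotone:
  assumes "separated_family T D1" "separated_family T D2" "gen_le T D1 D2"
    and uv: "u \<in> level T (Suc k)" "v \<in> level T (Suc k)" and par: "pD D1 (parent T u) = pD D1 (parent T v)"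
    and less: "pD D1 u < pD D1 v"
  shows "pD D2 u \<le> pD D2 v"
proof -
  interpret D1: separated_family T D1 by fact
  interpret D2: separated_family T D2 by fact
  have p: "parent T u \<in> level T k" "parent T v \<in> level T k" using level_SucD(1) uv by auto
  show ?thesis
  proof (cases "parent T u = parent T v")
    case True
    have "u \<noteq> v" using less by blast
    then have "sib u v \<or> sib v u"
      using sib_total[OF parent_vert[OF uv(1)] level_SucD(2)[OF uv(1)]] level_SucD(2)[OF uv(2)] True by simp
    then show ?thesis using D1.dD_sib[OF _ uv(2,1)] D2.dD_sib[OF _ uv] less by force
  next
    case False
    then have "D1.same k (parent T u) (parent T v)" using D1.dD_eq_iff[OF p] par by blast
    then obtain C E where C: "C \<in> D1" "E \<in> es C k" "parent T u \<in> last E" "parent T v \<in> last E"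
      unfolding D1.same_def by blast
    have colC: "collision T C" using D1.collisions C(1) .
    obtain C2 where C2: "C2 \<in> D2" "arrow T C C2" using assms(3) C(1) unfolding gen_le_def by blast
    have colC2: "collision T C2" using D2.collisions C2(1) .
    have pb: "parent T u \<in> blk C" "parent T v \<in> blk C" using es_blk[OF colC C(2)] C(3,4) by auto
    have b: "u \<in> blk C" "v \<in> blk C" using blk_parent uv pb by blast+
    then have b2: "u \<in> blk C2" "v \<in> blk C2" using contained_blk[OF colC colC2 arrow_contained[OF C2(2)]] by auto
    have "dC C u < dC C v" using D1.dD_within[OF C(1) uv b] less by simp
    then have "dC C2 u \<le> dC C2 v"
      using arrow_preserves_order[OF colC colC2 C2(2) uv C(2-4)] by blast
    then show ?thesis using D2.dD_within[OF C2(1) uv b2] by simp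
  qed
qed

text \<open>Signs of differences determine the classes on each level and their order. Two fused
  siblings identify a partner \<open>C'\<close> for \<open>C\<close>; equality of classes spreads
  from the fusion bracket to all essential brackets, and equality of order follows.\<close>

lemma pD_determines_sub:
  assumes "separated_family T D1" "separated_family T D2"
    and sign: "\<And>k u v. u \<in> level T k \<Longrightarrow> v \<in> level T k \<Longrightarrow> pD D1 u < pD D1 v \<longleftrightarrow> pD D2 u < pD D2 v"
  shows "D1 \<subseteq> D2"
proof
  fix C assume C: "C \<in> D1"
  interpret D1: separated_family T D1 by fact
  interpret D2: separated_family T D2 by fact
  have eq: "pD D1 u = pD D1 v \<longleftrightarrow> pD D2 u = pD D2 v" if "u \<in> level T k" "v \<in> level T k" for k u v
    using sign[OF that] sign[OF that(2,1)] by linarith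
  interpret C: tree_collision T C using tree_collisionI D1.collisions[OF C] .
  define k where "k = vdepth T (fusion_base T C)"
  obtain u v where uv: "u \<in> fused T C" "v \<in> fused T C" "sib u v" using C.fused_two by blast
  have lev: "fused T C \<subseteq> level T (Suc k)" unfolding k_def using C.fused_level .
  then have ul: "u \<in> level T (Suc k)" and vl: "v \<in> level T (Suc k)" using uv by auto
  have fusC: "fusion T C \<in> es C (Suc k)"
    using es_iff[OF D1.collisions[OF C]] C.fusion_essential C.length_fusion unfolding k_def by simp
  have ufus: "u \<in> last (fusion T C)" using uv(1) unfolding fused_def .
  have "pD D1 v = pD D1 u" using D1.dD_class[OF C fusC ufus vl] uv(2) unfolding fused_def by simp
  then have "pD D2 u = pD D2 v" using eq[OF vl ul] by simp
  moreover have "u \<noteq> v" using uv(3) sib_irrefl by blast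
  ultimately obtain C' E' where C': "C' \<in> D2" "E' \<in> es C' (Suc k)" "u \<in> last E'" "v \<in> last E'"
    using D2.dD_eq_iff[OF ul vl] unfolding D2.same_def by blast
  interpret C': tree_collision T C' using tree_collisionI D2.collisions[OF C'(1)] .
  have uC: "u \<in> blk C" and uC': "u \<in> blk C'"
    using es_blk[OF D1.collisions[OF C] fusC ufus] es_blk[OF D2.collisions[OF C'(1)] C'(2,3)] by auto
  have pu: "parent T u = fusion_base T C" using C.fused_child uv(1) by blast
  \<comment> \<open>Otherwise a weak ancestor \<open>w1\<close> of the base would be fused by
    \<open>C'\<close>, hence merged with another vertex also in \<open>D1\<close>. The collision
    responsible for that would have the fused siblings in its block, so it would be
    \<open>C\<close>, whose block omits its own base.\<close>
  have "fusion_base T C \<notin> blk C'"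
  proof
    assume "fusion_base T C \<in> blk C'"
    then obtain w1 where w1: "w1 \<in> fused T C'" "weak_desc T w1 (fusion_base T C)"
      unfolding weakly_below_def by blast
    obtain x y where xy: "x \<in> fused T C'" "y \<in> fused T C'" "sib x y" using C'.fused_two by blast
    have "x \<noteq> y" using xy(3) sib_irrefl by blast
    then obtain w2 where w2: "w2 \<in> fused T C'" "w2 \<noteq> w1" using xy by metis
    define m where "m = Suc (vdepth T (fusion_base T C'))"
    have lev': "w1 \<in> level T m" "w2 \<in> level T m" using C'.fused_level w1(1) w2(1) unfolding m_def by auto
    have fm: "fusion T C' \<in> es C' m"
      using es_iff[OF D2.collisions[OF C'(1)]] C'.fusion_essential C'.length_fusion unfolding m_def by simp
    have "pD D2 w1 = pD D2 w2"
      using D2.dD_class[OF C'(1) fm _ lev'(1), of w2] w1(1) w2(1) unfolding fused_def by simp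
    then have "pD D1 w1 = pD D1 w2" using eq[OF lev'] by simp
    then obtain C'' E'' where C'': "C'' \<in> D1" "E'' \<in> es C'' m" "w1 \<in> last E''"
      using D1.dD_eq_iff[OF lev'] w2(2) unfolding D1.same_def by blast
    have "w1 \<in> blk C''" using es_blk[OF D1.collisions[OF C''(1)] C''(2,3)] by blast
    then have b: "fusion_base T C \<in> blk C''" unfolding weakly_below_def using w1(2) weak_desc_trans by blast
    then have "u \<in> blk C''" using blk_parent[OF ul] pu by simp
    then have "C'' = C" using D1.blk_disjoint[OF C''(1) C level_verts[OF ul] _ uC] by blast
    then show False using b C.base_not_block by blast
  qed
  then have uW': "u \<in> fused T C'" using blk_parent[OF ul] uC' pu by simp
  then have base: "fusion_base T C' = fusion_base T C" using C'.fused_child pu by simp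
  have fusC': "fusion T C' \<in> es C' (Suc k)"
    using es_iff[OF D2.collisions[OF C'(1)]] C'.fusion_essential C'.length_fusion base unfolding k_def by simp
  have ufus': "u \<in> last (fusion T C')" using uW' unfolding fused_def .
  have classes: "last E1 = last E2"
    if "E1 \<in> es C j" "E2 \<in> es C' j" "x \<in> last E1" "x \<in> last E2" for E1 E2 j x
  proof -
    have x: "x \<in> level T j" using es_blk(1)[OF D1.collisions[OF C] that(1,3)] .
    have l: "last E1 \<subseteq> level T j" "last E2 \<subseteq> level T j"
      using es_blk(1)[OF D1.collisions[OF C] that(1)] es_blk(1)[OF D2.collisions[OF C'(1)] that(2)] by blast+
    have "y \<in> last E1 \<longleftrightarrow> y \<in> last E2" if y: "y \<in> level T j" for y
      using D1.dD_class[OF C \<open>E1 \<in> es C j\<close> \<open>x \<in> last E1\<close> y]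
        D2.dD_class[OF C'(1) \<open>E2 \<in> es C' j\<close> \<open>x \<in> last E2\<close> y] eq[OF y x] by simp
    then show ?thesis using l by blast
  qed
  have "last (fusion T C) = last (fusion T C')" using classes[OF fusC fusC' ufus ufus'] .
  then have fus: "fusion T C = fusion T C'"
    using snoc_eqI C.fusion_base(2) C'.fusion_base(2) base C.essential_nonempty[OF C.fusion_essential]
      C'.essential_nonempty[OF C'.fusion_essential] by metis
  \<comment> \<open>Kept general in the two collisions because it is applied in both
    directions.\<close>
  have transfer: "E \<in> essential T C2"
    if h: "tree_collision T C1" "tree_collision T C2" "fusion T C1 = fusion T C2"
      and cl: "\<And>E1 E2 j x. E1 \<in> es C1 j \<Longrightarrow> E2 \<in> es C2 j \<Longrightarrow> x \<in> last E1 \<Longrightarrow> x \<in> last E2 \<Longrightarrow> last E1 = last E2"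
      and E: "E \<in> essential T C1" for C1 C2 E
    using E
  proof (induction "length E" arbitrary: E)
    case 0
    then show ?case using tree_collision.essential_nonempty[OF h(1)] by auto
  next
    case (Suc n)
    interpret C1: tree_collision T C1 by fact
    interpret C2: tree_collision T C2 by fact
    show ?case
    proof (cases "E = fusion T C1")
      case True
      then show ?thesis using h(3) C2.fusion_essential by simp
    next
      case False
      then have b: "butlast E \<in> essential T C1" using C1.essential_cases Suc.prems by blast
      then have b2: "butlast E \<in> essential T C2" using Suc.hyps(1)[of "butlast E"] Suc.hyps(2) by simp
      have "length (butlast E) = n" using Suc.hyps(2) by simp
      then have "n \<noteq> 0" using C1.essential_nonempty[OF b] by (metis length_0_conv)
      then obtain j where j: "n = Suc j" by (cases n) auto
      then have lenE: "length E = Suc (Suc j)" using Suc.hyps(2) by simp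
      obtain x where x: "x \<in> last E" using C1.last_nonempty C1.essential_brs Suc.prems by blast
      have br: "is_bracket T (Suc j) E" using C1.bracket_at C1.essential_brs Suc.prems lenE by blast
      have xl: "x \<in> level T (Suc j)" using bracket_last_level[OF br] x by blast
      have "parent T x \<in> last (butlast E)" using bracket_parent[OF br x] .
      then obtain E2 where E2: "E2 \<in> essential T C2" "butlast E2 = butlast E" "length E2 = Suc (Suc j)" "x \<in> last E2"
        using C2.essential_cover[OF b2 _ level_SucD(2)[OF xl]] lenE by auto
      have "E \<in> es C1 (Suc j)" "E2 \<in> es C2 (Suc j)"
        using es_iff[OF C1.collision] es_iff[OF C2.collision] Suc.prems lenE E2(1,3) by auto
      then have "last E = last E2" using cl x E2(4) by blast
      then have "E = E2"
        using snoc_eqI[OF C1.essential_nonempty[OF Suc.prems] C2.essential_nonempty[OF E2(1)]] E2(2) by simp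
      then show ?thesis using E2(1) by simp
    qed
  qed
  have ess: "essential T C = essential T C'"
  proof (intro equalityI subsetI)
    fix E assume E: "E \<in> essential T C"
    show "E \<in> essential T C'"
      by (rule transfer[OF C.tree_collision_axioms C'.tree_collision_axioms fus _ E]) (rule classes; assumption)
  next
    fix E assume E: "E \<in> essential T C'"
    show "E \<in> essential T C"
      by (rule transfer[OF C'.tree_collision_axioms C.tree_collision_axioms fus[symmetric] _ E])
        (rule classes[symmetric]; assumption)
  qed
  have "C = C'"
  proof (rule collision_eqI[OF tree D1.collisions[OF C] D2.collisions[OF C'(1)] ess fus])
    fix E1 E2 assume E: "E1 \<in> essential T C" "E2 \<in> essential T C" "butlast E1 = butlast E2"
    show "(E1, E2) \<in> prec C \<longleftrightarrow> (E1, E2) \<in> prec C'"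
    proof (cases "butlast E1 \<in> essential T C")
      \<comment> \<open>Only the fusion bracket has an inessential projection, so both brackets are
        the fusion bracket.\<close>
      case False
      then have "E1 = E2" using C.essential_cases E by metis
      then show ?thesis using C.prec_irrefl C'.prec_irrefl by blast
    next
      case True
      have "length (butlast E1) \<noteq> 0" using C.essential_nonempty[OF True] by (metis length_0_conv)
      then obtain j where j: "length (butlast E1) = Suc j" using not0_implies_Suc by blast
      then have j2: "length (butlast E2) = Suc j" using E(3) by (simp only:)
      have len: "length E1 = Suc (Suc j)" "length E2 = Suc (Suc j)"
        using trans[OF length_eq_Suc_butlast[OF C.essential_nonempty[OF E(1)]] arg_cong[OF j, of Suc]]
          trans[OF length_eq_Suc_butlast[OF C.essential_nonempty[OF E(2)]] arg_cong[OF j2, of Suc]] .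
      have es1: "E1 \<in> es C (Suc j)" "E2 \<in> es C (Suc j)" using es_iff[OF D1.collisions[OF C]] E len by auto
      have es2: "E1 \<in> es C' (Suc j)" "E2 \<in> es C' (Suc j)" using es_iff[OF D2.collisions[OF C'(1)]] E len ess by auto
      obtain x where x: "x \<in> last E1" using es_last[OF D1.collisions[OF C] es1(1)] by blast
      obtain y where y: "y \<in> last E2" using es_last[OF D1.collisions[OF C] es1(2)] by blast
      have xl: "x \<in> level T (Suc j)" "x \<in> blk C" using es_blk[OF D1.collisions[OF C] es1(1) x] by auto
      have yl: "y \<in> level T (Suc j)" "y \<in> blk C" using es_blk[OF D1.collisions[OF C] es1(2) y] by auto
      have xl': "x \<in> blk C'" using es_blk[OF D2.collisions[OF C'(1)] es2(1) x] by auto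
      have yl': "y \<in> blk C'" using es_blk[OF D2.collisions[OF C'(1)] es2(2) y] by auto
      have "(E1, E2) \<in> prec C \<longleftrightarrow> dC C x < dC C y" using C.d_essential_iff[OF es1 E(3) True x y] by simp
      also have "\<dots> \<longleftrightarrow> pD D1 x < pD D1 y" using D1.dD_within[OF C xl(1) yl(1) xl(2) yl(2)] by auto
      also have "\<dots> \<longleftrightarrow> pD D2 x < pD D2 y" using sign[OF xl(1) yl(1)] .
      also have "\<dots> \<longleftrightarrow> dC C' x < dC C' y" using D2.dD_within[OF C'(1) xl(1) yl(1) xl' yl'] by auto
      also have "\<dots> \<longleftrightarrow> (E1, E2) \<in> prec C'" using C'.d_essential_iff[OF es2 E(3) _ x y] True ess by simp
      finally show ?thesis .
    qed
  qed
  then show "C \<in> D2" using C'(1) by simp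
qed

lemma pD_determines:
  assumes "separated_family T D1" "separated_family T D2"
    and "\<And>k u v. u \<in> level T k \<Longrightarrow> v \<in> level T k \<Longrightarrow> pD D1 u < pD D1 v \<longleftrightarrow> pD D2 u < pD D2 v"
  shows "D1 = D2"
proof
  show "D1 \<subseteq> D2" by (rule pD_determines_sub[OF assms(1,2)]) (rule assms(3))
  show "D2 \<subseteq> D1" by (rule pD_determines_sub[OF assms(2,1)]) (simp add: assms(3))
qed

section \<open>Functions monotone along the tree\<close>

definition tree_monotone :: "('v \<Rightarrow> int) \<Rightarrow> bool" where
  "tree_monotone f \<longleftrightarrow> (\<forall>k. \<forall>u\<in>level T (Suc k). \<forall>v\<in>level T (Suc k). f (parent T u) < f (parent T v) \<longrightarrow> f u < f v)"

text \<open>\<open>f\<close> is the position function of the finest contraction in a weighted chain, and \<open>F\<close> the weighted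
  sum of the position functions along the chain.\<close>

definition leads :: "('v \<Rightarrow> int) \<Rightarrow> ('v \<Rightarrow> real) \<Rightarrow> bool" where
  "leads f F \<longleftrightarrow> tree_monotone f \<and>
     (\<forall>k. \<forall>u\<in>level T k. \<forall>v\<in>level T k. f u = f v \<longrightarrow> F u = F v) \<and>
     (\<forall>k. \<forall>u\<in>level T (Suc k). \<forall>v\<in>level T (Suc k). f (parent T u) = f (parent T v) \<longrightarrow> f u < f v \<longrightarrow> F u < F v)"

text \<open>If the parents are separated, their sign decides by monotonicity and is known by
  induction. If they are merged, the sign for \<open>f\<close> is that of the difference of
  \<open>F\<close>, which \<open>F'\<close> shares.\<close>

lemma leads_determines_sign:
  assumes f: "leads f F" and f': "leads f' F'"
    and diff: "\<And>k u v. u \<in> level T k \<Longrightarrow> v \<in> level T k \<Longrightarrow> F u - F v = F' u - F' v"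
  shows "u \<in> level T k \<Longrightarrow> v \<in> level T k \<Longrightarrow> f u < f v \<longleftrightarrow> f' u < f' v"
proof (induction k arbitrary: u v)
  case 0
  then show ?case using level_0 by auto
next
  case (Suc k)
  have p: "parent T u \<in> level T k" "parent T v \<in> level T k" using level_SucD(1) Suc.prems by auto
  have lt: "f (parent T u) < f (parent T v) \<longleftrightarrow> f' (parent T u) < f' (parent T v)"
    "f (parent T v) < f (parent T u) \<longleftrightarrow> f' (parent T v) < f' (parent T u)"
    using Suc.IH[OF p] Suc.IH[OF p(2,1)] by auto
  have mono: "f (parent T x) < f (parent T y) \<Longrightarrow> f x < f y" "f' (parent T x) < f' (parent T y) \<Longrightarrow> f' x < f' y"
    if "x \<in> level T (Suc k)" "y \<in> level T (Suc k)" for x y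
    using f f' that unfolding leads_def tree_monotone_def by blast+
  show ?case
  proof (cases "f (parent T u) = f (parent T v)")
    case True
    then have True': "f' (parent T u) = f' (parent T v)" using lt by linarith
    have 1: "f x < f y \<Longrightarrow> F x < F y" "f x = f y \<Longrightarrow> F x = F y" "f' x < f' y \<Longrightarrow> F' x < F' y" "f' x = f' y \<Longrightarrow> F' x = F' y"
      if "x \<in> level T (Suc k)" "y \<in> level T (Suc k)" "f (parent T x) = f (parent T y)" "f' (parent T x) = f' (parent T y)" for x y
      using f f' that unfolding leads_def by blast+
    note a = 1[OF Suc.prems True True'] and b = 1[OF Suc.prems(2,1) True[symmetric] True'[symmetric]]
    show ?thesis
    proof
      assume "f u < f v"
      then have "F' u < F' v" using a(1) diff[OF Suc.prems] by linarith
      then show "f' u < f' v" using a(4) b(3) by (cases "f' u" "f' v" rule: linorder_cases) auto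
    next
      assume "f' u < f' v"
      then have "F u < F v" using a(3) diff[OF Suc.prems] by linarith
      then show "f u < f v" using a(2) b(1) by (cases "f u" "f v" rule: linorder_cases) auto
    qed
  next
    case False
    then show ?thesis
      using lt mono[OF Suc.prems] mono[OF Suc.prems(2,1)] by (metis linorder_neqE_linordered_idom order_less_asym)
  qed
qed

text \<open>The order condition is limited to vertices whose parents \<open>f\<close> merges,
  because a coarser contraction may reorder the children of vertices that it newly merges.\<close>

definition coarsens :: "('v \<Rightarrow> int) \<Rightarrow> ('v \<Rightarrow> int) \<Rightarrow> bool" where
  "coarsens f f' \<longleftrightarrow>
     (\<forall>k. \<forall>u\<in>level T k. \<forall>v\<in>level T k. f u = f v \<longrightarrow> f' u = f' v) \<and>
     (\<forall>k. \<forall>u\<in>level T (Suc k). \<forall>v\<in>level T (Suc k). f (parent T u) = f (parent T v) \<longrightarrow> f u < f v \<longrightarrow> f' u \<le> f' v)"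

lemma tree_monotoneD:
  "tree_monotone f \<Longrightarrow> u \<in> level T (Suc k) \<Longrightarrow> v \<in> level T (Suc k) \<Longrightarrow> f (parent T u) < f (parent T v) \<Longrightarrow> f u < f v"
  unfolding tree_monotone_def by blast

lemma coarsensD:
  assumes "coarsens f f'"
  shows "u \<in> level T k \<Longrightarrow> v \<in> level T k \<Longrightarrow> f u = f v \<Longrightarrow> f' u = f' v"
    and "u \<in> level T (Suc k) \<Longrightarrow> v \<in> level T (Suc k) \<Longrightarrow> f (parent T u) = f (parent T v) \<Longrightarrow> f u < f v \<Longrightarrow> f' u \<le> f' v"
  using assms unfolding coarsens_def by blast+

text \<open>On the least level where \<open>f'\<close> merges what \<open>f\<close> separates, the
  parents are merged by \<open>f\<close> already. The class next to that of \<open>u\<close> is then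
  squeezed by \<open>f'\<close> between two equal values. The difference of exactly 1 supplies the
  unit diagonal entries needed for smoothness.\<close>

lemma adjacent_merged_pair:
  assumes mono: "tree_monotone f"
    and gap: "\<And>k u v. u \<in> level T k \<Longrightarrow> v \<in> level T k \<Longrightarrow> f u < f v \<Longrightarrow> \<exists>x\<in>level T k. f x = f u + 1"
    and co: "coarsens f f'"
    and ex: "\<exists>k. \<exists>u\<in>level T k. \<exists>v\<in>level T k. f' u = f' v \<and> f u \<noteq> f v" and mono': "tree_monotone f'"
  shows "\<exists>k. \<exists>u\<in>level T (Suc k). \<exists>v\<in>level T (Suc k). f v = f u + 1 \<and> f' u = f' v"
proof -
  define P where "P k \<longleftrightarrow> (\<exists>u\<in>level T k. \<exists>v\<in>level T k. f' u = f' v \<and> f u \<noteq> f v)" for k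
  have "\<exists>k. P k" using ex unfolding P_def .
  then obtain n where n: "P n" "\<And>m. m < n \<Longrightarrow> \<not> P m" using exists_least_iff[of P] by blast
  have "n \<noteq> 0" using n(1) level_0 unfolding P_def by (metis singletonD)
  then obtain k where k: "n = Suc k" using not0_implies_Suc by blast
  obtain u v where uv: "u \<in> level T (Suc k)" "v \<in> level T (Suc k)" "f' u = f' v" "f u < f v"
    using n(1) unfolding P_def k by (metis linorder_neqE_linordered_idom)
  have p: "parent T u \<in> level T k" "parent T v \<in> level T k" using level_SucD(1) uv by auto
  \<comment> \<open>Monotonicity makes \<open>f'\<close> merge the parents, and by the choice of the
    level \<open>f\<close> merges them too.\<close>
  have "f' (parent T u) = f' (parent T v)"
    using tree_monotoneD[OF mono' uv(1,2)] tree_monotoneD[OF mono' uv(2,1)] uv(3) by linarith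
  then have fp: "f (parent T u) = f (parent T v)" using n(2)[of k] p unfolding P_def k by blast
  obtain x where x: "x \<in> level T (Suc k)" "f x = f u + 1" using gap[OF uv(1,2,4)] by blast
  have px: "parent T x \<in> level T k" using level_SucD(1) x by auto
  have "\<not> f (parent T x) < f (parent T u)" "\<not> f (parent T v) < f (parent T x)"
    using tree_monotoneD[OF mono x(1) uv(1)] tree_monotoneD[OF mono uv(2) x(1)] x(2) uv(4) by auto
  then have fpx: "f (parent T x) = f (parent T u)" using fp by simp
  have "f' u \<le> f' x" using coarsensD(2)[OF co uv(1) x(1)] fpx x(2) by simp
  moreover have "f' x \<le> f' v"
  proof (cases "f x = f v")
    case True
    then show ?thesis using coarsensD(1)[OF co x(1) uv(2)] by simp
  next
    case False
    then have "f x < f v" using x(2) uv(4) by linarith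
    then show ?thesis using coarsensD(2)[OF co x(1) uv(2)] fpx fp by simp
  qed
  ultimately show ?thesis using uv x by (intro exI[of _ k] bexI[of _ u] bexI[of _ x]) auto
qed

text \<open>When nothing new is merged, the weak inequalities below merged parents become strict,
  and monotonicity settles all other pairs.\<close>

lemma coarsens_same_sign:
  assumes mono: "tree_monotone f" "tree_monotone f'" and co: "coarsens f f'"
    and inj: "\<And>k u v. u \<in> level T k \<Longrightarrow> v \<in> level T k \<Longrightarrow> f' u = f' v \<Longrightarrow> f u = f v"
  shows "u \<in> level T k \<Longrightarrow> v \<in> level T k \<Longrightarrow> f u < f v \<longleftrightarrow> f' u < f' v"
proof (induction k arbitrary: u v)
  case 0
  then show ?case using level_0 by auto
next
  case (Suc k)
  have p: "parent T u \<in> level T k" "parent T v \<in> level T k" using level_SucD(1) Suc.prems by auto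
  have m: "f (parent T x) < f (parent T y) \<Longrightarrow> f x < f y" "f' (parent T x) < f' (parent T y) \<Longrightarrow> f' x < f' y"
    if "x \<in> level T (Suc k)" "y \<in> level T (Suc k)" for x y
    using tree_monotoneD[OF mono(1) that] tree_monotoneD[OF mono(2) that] by blast+
  have c: "f (parent T x) = f (parent T y) \<Longrightarrow> f x < f y \<Longrightarrow> f' x < f' y"
    if "x \<in> level T (Suc k)" "y \<in> level T (Suc k)" for x y
    using coarsensD(2)[OF co that] inj[OF that] by fastforce
  have e: "f u = f v \<longleftrightarrow> f' u = f' v" "f (parent T u) = f (parent T v) \<longleftrightarrow> f' (parent T u) = f' (parent T v)"
    using inj[OF Suc.prems] inj[OF p] coarsensD(1)[OF co Suc.prems] coarsensD(1)[OF co p] by blast+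
  show ?case
    using Suc.IH[OF p] Suc.IH[OF p(2,1)] m[OF Suc.prems] m[OF Suc.prems(2,1)] c[OF Suc.prems] c[OF Suc.prems(2,1)] e
    by (cases "f u" "f v" rule: linorder_cases; cases "f (parent T u)" "f (parent T v)" rule: linorder_cases) auto
qed

lemma pD_tree_monotone: "separated_family T D \<Longrightarrow> tree_monotone (pD D)"
  unfolding tree_monotone_def by (intro allI ballI impI) (rule separated_family.dD_parent)

lemma pD_coarsens_le:
  assumes "separated_family T D1" "separated_family T D2" "gen_le T D1 D2"
  shows "coarsens (pD D1) (pD D2)"
  unfolding coarsens_def
proof (intro conjI allI ballI impI)
  fix k u v assume "u \<in> level T k" "v \<in> level T k" "pD D1 u = pD D1 v"
  then show "pD D2 u = pD D2 v" by (rule pD_coarsens[OF assms])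
next
  fix k u v assume "u \<in> level T (Suc k)" "v \<in> level T (Suc k)"
    "pD D1 (parent T u) = pD D1 (parent T v)" "pD D1 u < pD D1 v"
  then show "pD D2 u \<le> pD D2 v" by (rule pD_monotone[OF assms])
qed

lemma coarsens_constant: "coarsens f (\<lambda>_. c)"
  unfolding coarsens_def by simp

lemma pD_merged_pair:
  assumes "separated_family T D1" "separated_family T D2" "gen_le T D1 D2" "D1 \<noteq> D2"
  shows "\<exists>k. \<exists>u\<in>level T (Suc k). \<exists>v\<in>level T (Suc k). pD D1 v = pD D1 u + 1 \<and> pD D2 u = pD D2 v"
proof (rule adjacent_merged_pair[OF pD_tree_monotone[OF assms(1)]])
  show "\<exists>k. \<exists>u\<in>level T k. \<exists>v\<in>level T k. pD D2 u = pD D2 v \<and> pD D1 u \<noteq> pD D1 v"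
  proof (rule ccontr)
    assume "\<not> ?thesis"
    then have inj: "\<And>k u v. u \<in> level T k \<Longrightarrow> v \<in> level T k \<Longrightarrow> pD D2 u = pD D2 v \<Longrightarrow> pD D1 u = pD D1 v" by blast
    have "D1 = D2"
      by (rule pD_determines[OF assms(1,2)])
        (rule coarsens_same_sign[OF pD_tree_monotone[OF assms(1)] pD_tree_monotone[OF assms(2)]
            pD_coarsens_le[OF assms(1-3)] inj])
    then show False using assms(4) by blast
  qed
qed (use separated_family.dD_gap_free[OF assms(1)] pD_coarsens_le[OF assms(1-3)] pD_tree_monotone[OF assms(2)] in blast)+

text \<open>The constant function plays the part of a contraction merging whole levels, so the
  coarsest member of a chain gets an adjacent pair as well.\<close>

lemma pD_merged_pair_top:
  assumes "separated_family T D" "\<exists>k. \<exists>u\<in>level T k. \<exists>v\<in>level T k. pD D u \<noteq> pD D v"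
  shows "\<exists>k. \<exists>u\<in>level T (Suc k). \<exists>v\<in>level T (Suc k). pD D v = pD D u + 1"
proof -
  have "\<exists>k. \<exists>u\<in>level T (Suc k). \<exists>v\<in>level T (Suc k). pD D v = pD D u + 1 \<and> (0::int) = 0"
    by (rule adjacent_merged_pair[OF pD_tree_monotone[OF assms(1)], of "\<lambda>_. 0"])
      (use separated_family.dD_gap_free[OF assms(1)] coarsens_constant assms(2) in \<open>auto simp: tree_monotone_def\<close>)
  then show ?thesis by blast
qed

end

section \<open>Chains of generalized collisions\<close>

definition gen_contained :: "'v ptree \<Rightarrow> 'v bracketing set \<Rightarrow> 'v bracketing set \<Rightarrow> bool" where
  "gen_contained T D1 D2 \<longleftrightarrow> (\<forall>C1\<in>D1. \<exists>C2\<in>D2. contained T C1 C2)"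

lemma gen_contained_trans: "gen_contained T D1 D2 \<Longrightarrow> gen_contained T D2 D3 \<Longrightarrow> gen_contained T D1 D3"
  unfolding gen_contained_def using contained_trans by blast

lemma gen_le_contained: "gen_le T D1 D2 \<Longrightarrow> gen_contained T D1 D2"
  unfolding gen_le_def gen_contained_def using arrow_contained by blast

lemma separated_sym: "separated T C1 C2 \<Longrightarrow> separated T C2 C1"
  unfolding separated_def by blast

section \<open>Antisymmetry and least elements\<close>

context plane_tree
begin

lemma fused_in_blk: "collision T C \<Longrightarrow> \<exists>v\<in>verts T. v \<in> blk C"
proof -
  assume "collision T C"
  then interpret tree_collision T C by (rule tree_collisionI)
  obtain v where "v \<in> W" using fused_nonempty by blast
  then show ?thesis using fused_verts weak_desc_refl unfolding weakly_below_def by blast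
qed

lemma contained_not_separated:
  assumes "collision T C1" "collision T C2" "contained T C1 C2"
  shows "\<not> separated T C1 C2"
  using contained_blk[OF assms] fused_in_blk[OF assms(1)] unfolding separated_def by blast

lemma contained_separated:
  assumes "collision T C1" "collision T C2" "contained T C1 C2" "separated T C2 C3"
  shows "separated T C1 C3"
  using contained_blk[OF assms(1-3)] assms(4) unfolding separated_def by blast

lemma arrow_refl:
  assumes "collision T C"
  shows "arrow T C C"
proof -
  interpret tree_collision T C using tree_collisionI assms .
  have "bracketing_le C C" unfolding bracketing_le_def using prec_brs by auto
  then show ?thesis
    unfolding arrow_def using assms bsub_refl unfolding collision_def by blast
qed

text \<open>A bracket squeezed between essential brackets of one collision equals them, so both
  collisions have the same brackets, and the common upper bound forces the same order. One arrow
  supplies the bound; containment suffices on the way back.\<close>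

lemma arrow_antisym:
  assumes C: "collision T C1" "collision T C2" and le: "arrow T C1 C2" "contained T C2 C1"
  shows "C1 = C2"
proof -
  interpret C1: tree_collision T C1 using tree_collisionI C(1) .
  interpret C2: tree_collision T C2 using tree_collisionI C(2) .
  have fix_point: "E = E2"
    if h: "tree_collision T C" "E \<in> essential T C" "bsub E E2" "E' \<in> essential T C" "bsub E2 E'" for C E E2 E'
  proof -
    interpret C: tree_collision T C by fact
    have b: "bsub E E'" using bsub_trans h(3,5) .
    obtain v where v: "v \<in> last E" using C.last_nonempty C.essential_brs h(2) by blast
    then have "v \<in> last E'" using bsub_last[OF b C.essential_nonempty[OF h(2)]] by blast
    then have "E = E'" using C.essential_unique[OF h(2,4) bsub_length[OF b] v] by blast
    then show ?thesis using bsub_antisym h(3,5) by blast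
  qed
  have c12: "contained T C1 C2" using arrow_contained le(1) .
  have ess: "essential T C1 = essential T C2"
  proof (intro equalityI subsetI)
    fix E assume E: "E \<in> essential T C1"
    obtain E2 where E2: "E2 \<in> essential T C2" "bsub E E2" using c12 E unfolding contained_def by blast
    obtain E' where E': "E' \<in> essential T C1" "bsub E2 E'" using le(2) E2(1) unfolding contained_def by blast
    show "E \<in> essential T C2"
      using fix_point[OF C1.tree_collision_axioms E E2(2) E'] E2(1) by simp
  next
    fix E assume E: "E \<in> essential T C2"
    obtain E2 where E2: "E2 \<in> essential T C1" "bsub E E2" using le(2) E unfolding contained_def by blast
    obtain E' where E': "E' \<in> essential T C2" "bsub E2 E'" using c12 E2(1) unfolding contained_def by blast
    show "E \<in> essential T C1"
      using fix_point[OF C2.tree_collision_axioms E E2(2) E'] E2(1) by simp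
  qed
  have "fusion T C1 \<in> essential T C2" using ess C1.fusion_essential by simp
  moreover have "butlast (fusion T C1) \<notin> essential T C2" using C1.fusion_not_over ess by simp
  ultimately have fus: "fusion T C1 = fusion T C2" using C2.essential_cases by blast
  obtain B where "bracketing_le C1 B" "bracketing_le C2 B" using le(1) unfolding arrow_def by blast
  then have p: "prec C1 = prec B \<inter> (brs C1 \<times> brs C1)" "prec C2 = prec B \<inter> (brs C2 \<times> brs C2)"
    unfolding bracketing_le_def by auto
  have "brs C1 = brs C2" using C1.anatomy(3) C2.anatomy(3) ess by simp
  then have "prec C1 = prec C2" using p by simp
  then show ?thesis using collision_eqI[OF tree C ess fus] by simp
qed

lemma gen_collisionD: "gen_collision T D \<Longrightarrow> C \<in> D \<Longrightarrow> collision T C"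
  unfolding gen_collision_def by blast

lemma gen_nonempty: "gen_collision T D \<Longrightarrow> D \<noteq> {}"
  by (simp add: gen_collision_def)

lemma gen_le_refl: "gen_collision T D \<Longrightarrow> gen_le T D D"
  unfolding gen_le_def using arrow_refl gen_collisionD by metis

lemma gen_not_separated:
  assumes "gen_collision T D" "C1 \<in> D" "C2 \<in> D" "contained T C1 C2"
  shows "C1 = C2"
  using contained_not_separated[OF gen_collisionD[OF assms(1,2)] gen_collisionD[OF assms(1,3)] assms(4)] assms(1-3)
  unfolding gen_collision_def by blast

text \<open>Members of a generalized collision are pairwise separated, so going up and back returns
  to the collision one started from.\<close>

lemma gen_le_antisym:
  assumes D: "gen_collision T D1" "gen_collision T D2" and le: "gen_le T D1 D2" "gen_contained T D2 D1"
  shows "D1 = D2"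
proof (intro equalityI subsetI)
  fix C1 assume C1: "C1 \<in> D1"
  obtain C2 where C2: "C2 \<in> D2" "arrow T C1 C2" using le(1) C1 unfolding gen_le_def by blast
  obtain C1' where C1': "C1' \<in> D1" "contained T C2 C1'" using le(2) C2(1) unfolding gen_contained_def by blast
  have "contained T C1 C1'" using contained_trans[OF arrow_contained[OF C2(2)] C1'(2)] .
  then have "C1 = C1'" using gen_not_separated[OF D(1) C1 C1'(1)] by blast
  then have "C1 = C2"
    using arrow_antisym[OF gen_collisionD[OF D(1) C1] gen_collisionD[OF D(2) C2(1)] C2(2)] C1'(2) by simp
  then show "C1 \<in> D2" using C2(1) by simp
next
  fix C2 assume C2: "C2 \<in> D2"
  obtain C1 where C1: "C1 \<in> D1" "contained T C2 C1" using le(2) C2 unfolding gen_contained_def by blast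
  obtain C2' where C2': "C2' \<in> D2" "arrow T C1 C2'" using le(1) C1(1) unfolding gen_le_def by blast
  have "contained T C2 C2'" using contained_trans[OF C1(2) arrow_contained[OF C2'(2)]] .
  then have "C2 = C2'" using gen_not_separated[OF D(2) C2 C2'(1)] by blast
  then have "C1 = C2"
    using arrow_antisym[OF gen_collisionD[OF D(1) C1(1)] gen_collisionD[OF D(2) C2] _ C1(2)] C2'(2) by simp
  then show "C2 \<in> D1" using C1(1) by simp
qed

lemma Order_subset: "Z \<in> Order_cplx T \<Longrightarrow> Z' \<subseteq> Z \<Longrightarrow> Z' \<in> Order_cplx T"
  unfolding Order_cplx_def using finite_subset by blast

lemma Order_gen: "Z \<in> Order_cplx T \<Longrightarrow> D \<in> Z \<Longrightarrow> gen_collision T D"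
  unfolding Order_cplx_def by blast

lemma Order_finite: "Z \<in> Order_cplx T \<Longrightarrow> finite Z"
  unfolding Order_cplx_def by blast

lemma Order_linear: "Z \<in> Order_cplx T \<Longrightarrow> D \<in> Z \<Longrightarrow> D' \<in> Z \<Longrightarrow> gen_le T D D' \<or> gen_le T D' D"
  unfolding Order_cplx_def by blast

text \<open>In place of transitivity of \<open>gen_le\<close>, a new element below the current least
  one is compared with each other member directly. If a pair is ordered the wrong way, containment
  closes a cycle and antisymmetry identifies the two.\<close>

lemma Order_least:
  assumes "Z \<in> Order_cplx T" "Z \<noteq> {}"
  shows "\<exists>D\<in>Z. \<forall>D'\<in>Z. gen_le T D D'"
  using Order_finite[OF assms(1)] assms(2,1)
proof (induction rule: finite_ne_induct)
  case (singleton D)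
  then show ?case using Order_linear by blast
next
  case (insert D0 F)
  have FO: "F \<in> Order_cplx T" by (rule Order_subset[OF insert.prems]) blast
  then obtain m where m: "m \<in> F" "\<forall>D'\<in>F. gen_le T m D'" using insert.IH by blast
  note gen = Order_gen[OF insert.prems]
  show ?case
  proof (cases "gen_le T m D0")
    case True
    then show ?thesis using m by blast
  next
    case False
    then have 0: "gen_le T D0 m" using Order_linear[OF insert.prems, of m D0] m(1) by blast
    have "gen_le T D0 D'" if D': "D' \<in> F" for D'
    proof (rule ccontr)
      assume not: "\<not> gen_le T D0 D'"
      then have "gen_le T D' D0" using Order_linear[OF insert.prems, of D0 D'] D' by blast
      moreover have "gen_contained T D0 D'"
        using gen_contained_trans[OF gen_le_contained[OF 0] gen_le_contained] m(2) D' by blast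
      ultimately have "D' = D0" using gen_le_antisym gen D' by blast
      then show False using insert.hyps D' by simp
    qed
    moreover have "gen_le T D0 D0" using gen_le_refl gen by blast
    ultimately show ?thesis by blast
  qed
qed

section \<open>Coordinates\<close>

lemma Rm_iff: "x \<in> Rm T \<longleftrightarrow> (\<forall>p. p \<notin> coords T \<longrightarrow> Poly_Mapping.lookup x p = 0)"
  unfolding Rm_def by (auto simp: in_keys_iff)

lemma subspace_Rm: "subspace (Rm T)"
  unfolding subspace_def by (auto simp: Rm_iff lookup_add lookup_scaleR)

lemma lookup_mk_vec: "Poly_Mapping.lookup (mk_vec T f) (k, i) = (if (k, i) \<in> coords T then f k i else 0)"
  by (simp add: mk_vec.rep_eq)

lemma mk_vec_Rm: "mk_vec T f \<in> Rm T"
  unfolding Rm_iff by (auto simp: lookup_mk_vec)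

lemma rho_Rm: "rho T C \<in> Rm T" and ones_Rm: "ones T \<in> Rm T"
  unfolding rho_def ones_def using mk_vec_Rm by auto

lemma rho_gen_Rm: "rho_gen T D \<in> Rm T"
  unfolding rho_gen_def by (rule subspace_sum[OF subspace_Rm rho_Rm])

text \<open>Summation undoes the differences of consecutive positions that make up
  \<open>rho\<close>; what matters are differences of these sums within a level.\<close>

definition gsum :: "nat \<Rightarrow> 'v \<Rightarrow> coordvec \<Rightarrow> real" where
  "gsum k v x = (\<Sum>i\<in>{1..<pos T v}. Poly_Mapping.lookup x (k, i))"

lemma linear_gsum: "linear (gsum k v)"
  by (rule linearI) (simp_all add: gsum_def lookup_add lookup_scaleR sum.distrib sum_distrib_left)

lemma coords_level:
  assumes "v \<in> level T k" "1 \<le> k" "i \<in> {1..<pos T v}"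
  shows "(k, i) \<in> coords T" "i + 1 \<le> card (level T k)"
  using level_le_depth[OF assms(1)] pos_range[OF assms(1)] assms(2,3) unfolding coords_def by auto

lemma telescope:
  fixes a :: "nat \<Rightarrow> real"
  assumes "1 \<le> p"
  shows "(\<Sum>i\<in>{1..<p}. a i - a (i + 1) + 1) = a 1 - a p + real p - 1"
  using assms by (induction p rule: dec_induct) auto

text \<open>The sum telescopes; the position of the image of the first vertex survives as a constant
  of the level.\<close>

lemma gsum_rho:
  assumes C: "collision T C" and v: "v \<in> level T k" "1 \<le> k"
  shows "gsum k v (rho T C) = real (dC C (nth_vert T k 1)) - real (dC C v) + real (pos T v) - 1"
proof -
  interpret tree_collision T C using tree_collisionI C .
  have "gsum k v (rho T C) = (\<Sum>i\<in>{1..<pos T v}. real (dC C (nth_vert T k i)) - real (dC C (nth_vert T k (i + 1))) + 1)"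
    unfolding gsum_def
    using coords_level[OF v] by (intro sum.cong) (auto simp: rho_def lookup_mk_vec d_def)
  also have "\<dots> = real (dC C (nth_vert T k 1)) - real (dC C (nth_vert T k (pos T v))) + real (pos T v) - 1"
    using telescope[of "pos T v" "\<lambda>i. real (dC C (nth_vert T k i))"] pos_range[OF v(1)] by simp
  finally show ?thesis using nth_vert_pos[OF v(1)] by simp
qed

lemma gsum_ones:
  assumes v: "v \<in> level T k" "1 \<le> k"
  shows "gsum k v (ones T) = real (pos T v) - 1"
proof -
  have "gsum k v (ones T) = (\<Sum>i\<in>{1..<pos T v}. 1)"
    unfolding gsum_def using coords_level(1)[OF v] by (intro sum.cong) (auto simp: ones_def lookup_mk_vec)
  then show ?thesis using pos_range[OF v(1)] by simp
qed

lemma gsum_diff_ones: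
  assumes "u \<in> level T k" "v \<in> level T k"
  shows "gsum k u (ones T) - gsum k v (ones T) = real (pos T u) - real (pos T v)"
proof (cases "k = 0")
  \<comment> \<open>Level 0 has no coordinates, but also only one vertex, so the claim is trivial
    there.\<close>
  case True
  then show ?thesis using assms level_0 by auto
next
  case False
  then show ?thesis using gsum_ones assms by simp
qed

lemma gsum_diff_rho_gen:
  assumes D: "separated_family T D" and uv: "u \<in> level T k" "v \<in> level T k"
  shows "gsum k u (rho_gen T D) - gsum k v (rho_gen T D) =
    (real (pos T u) - real_of_int (pD D u)) - (real (pos T v) - real_of_int (pD D v))"
proof (cases "k = 0")
  case True
  then show ?thesis using uv level_0 by auto
next
  case False
  interpret separated_family T D by fact
  have "gsum k u (rho_gen T D) - gsum k v (rho_gen T D) = (\<Sum>C\<in>D. gsum k u (rho T C) - gsum k v (rho T C))"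
    unfolding rho_gen_def linear_sum[OF linear_gsum] by (simp add: sum_subtractf)
  also have "\<dots> = (\<Sum>C\<in>D. (real (pos T u) - real (dC C u)) - (real (pos T v) - real (dC C v)))"
    using gsum_rho[OF collisions uv(1)] gsum_rho[OF collisions uv(2)] False by (intro sum.cong) auto
  also have "\<dots> = (\<Sum>C\<in>D. real (pos T u) - real (dC C u)) - (\<Sum>C\<in>D. real (pos T v) - real (dC C v))"
    by (rule sum_subtractf)
  finally have "gsum k u (rho_gen T D) - gsum k v (rho_gen T D) =
      (\<Sum>C\<in>D. real (pos T u) - real (dC C u)) - (\<Sum>C\<in>D. real (pos T v) - real (dC C v))" .
  moreover have "(\<Sum>C\<in>D. real (pos T x) - real (dC C x)) = real (pos T x) - real_of_int (pD D x)" for x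
    unfolding dD_def by simp
  ultimately show ?thesis by simp
qed

section \<open>Weighted sums along a chain\<close>

definition combined :: "'v bracketing set set \<Rightarrow> ('v bracketing set \<Rightarrow> real) \<Rightarrow> 'v \<Rightarrow> real" where
  "combined Z a u = (\<Sum>D\<in>Z. a D * real_of_int (pD D u))"

text \<open>Each \<open>rho_gen\<close> contributes original minus contracted positions and
  \<open>ones T\<close> the original positions alone, so the original positions appear with the
  total weight plus \<open>c\<close>.\<close>

lemma gsum_diff_combined:
  assumes Z: "Z \<in> Order_cplx T" and uv: "u \<in> level T k" "v \<in> level T k"
    and x: "x = (\<Sum>D\<in>Z. a D *\<^sub>R rho_gen T D) + c *\<^sub>R ones T"
  shows "gsum k u x - gsum k v x =
    ((\<Sum>D\<in>Z. a D) + c) * (real (pos T u) - real (pos T v)) - (combined Z a u - combined Z a v)"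
proof -
  have lin: "gsum k y x = (\<Sum>D\<in>Z. a D * gsum k y (rho_gen T D)) + c * gsum k y (ones T)" for y
    unfolding x linear_add[OF linear_gsum] linear_sum[OF linear_gsum] linear_scale[OF linear_gsum] by simp
  have "gsum k u x - gsum k v x = (\<Sum>D\<in>Z. a D * (gsum k u (rho_gen T D) - gsum k v (rho_gen T D))) +
      c * (gsum k u (ones T) - gsum k v (ones T))"
    unfolding lin by (simp add: sum_subtractf algebra_simps)
  also have "(\<Sum>D\<in>Z. a D * (gsum k u (rho_gen T D) - gsum k v (rho_gen T D))) =
      (\<Sum>D\<in>Z. a D * (real (pos T u) - real (pos T v)) - (a D * real_of_int (pD D u) - a D * real_of_int (pD D v)))"
  proof (rule sum.cong)
    fix D assume "D \<in> Z"
    from gsum_diff_rho_gen[OF gen_separated[OF Order_gen[OF Z this]] uv]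
    show "a D * (gsum k u (rho_gen T D) - gsum k v (rho_gen T D)) =
        a D * (real (pos T u) - real (pos T v)) - (a D * real_of_int (pD D u) - a D * real_of_int (pD D v))"
      by (simp only:) (simp add: algebra_simps)
  qed simp
  also have "\<dots> = (\<Sum>D\<in>Z. a D) * (real (pos T u) - real (pos T v)) - (combined Z a u - combined Z a v)"
    unfolding combined_def by (simp add: sum_subtractf sum_distrib_right)
  finally show ?thesis using gsum_diff_ones[OF uv] by (simp add: algebra_simps)
qed

lemma combined_sib:
  assumes Z: "Z \<in> Order_cplx T" "\<forall>D\<in>Z. 0 < a D" and s: "sib u v" "u \<in> level T k" "v \<in> level T k"
  shows "combined Z a u \<le> combined Z a v"
  unfolding combined_def
proof (rule sum_mono)
  fix D assume D: "D \<in> Z"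
  then have "pD D u \<le> pD D v"
    using separated_family.dD_sib[OF gen_separated[OF Order_gen[OF Z(1) D]] s] by simp
  then show "a D * real_of_int (pD D u) \<le> a D * real_of_int (pD D v)"
    using Z(2) D by (intro mult_left_mono) auto
qed

lemma fused_siblings:
  assumes "gen_collision T D"
  shows "\<exists>k u v. u \<in> level T k \<and> v \<in> level T k \<and> sib u v \<and> pD D u = pD D v"
proof -
  interpret separated_family T D using gen_separated assms .
  obtain C where C: "C \<in> D" using gen_nonempty[OF assms] by blast
  interpret C: tree_collision T C using tree_collisionI collisions C .
  obtain u v where uv: "u \<in> fused T C" "v \<in> fused T C" "sib u v" using C.fused_two by blast
  define k where "k = Suc (vdepth T (fusion_base T C))"
  have lev: "u \<in> level T k" "v \<in> level T k" using C.fused_level uv unfolding k_def by auto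
  have "fusion T C \<in> es C k"
    using es_iff[OF collisions[OF C]] C.fusion_essential C.length_fusion unfolding k_def by simp
  then have "pD D v = pD D u" using dD_class[OF C _ _ lev(2)] uv unfolding fused_def by blast
  then show ?thesis using lev uv(3) by metis
qed

text \<open>The finest member contributes the strict inequality; below parents that it merges, the
  coarser members may merge vertices but cannot reverse them.\<close>

lemma leads_combined:
  assumes Z: "Z \<in> Order_cplx T" "\<forall>D\<in>Z. 0 < a D" and D: "D \<in> Z" "\<forall>D'\<in>Z. gen_le T D D'"
  shows "leads (pD D) (combined Z a)"
  unfolding leads_def
proof (intro conjI allI ballI impI)
  note sep = gen_separated[OF Order_gen[OF Z(1)]]
  show "tree_monotone (pD D)" using pD_tree_monotone sep D(1) by blast
  fix k u v
  {
    assume uv: "u \<in> level T k" "v \<in> level T k" "pD D u = pD D v"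
    have "pD D' u = pD D' v" if "D' \<in> Z" for D'
      using pD_coarsens[OF sep[OF D(1)] sep[OF that] _ uv] D(2) that by blast
    then show "combined Z a u = combined Z a v" unfolding combined_def by simp
  next
    assume uv: "u \<in> level T (Suc k)" "v \<in> level T (Suc k)" "pD D (parent T u) = pD D (parent T v)" "pD D u < pD D v"
    show "combined Z a u < combined Z a v"
      unfolding combined_def
    proof (rule sum_strict_mono_ex1)
      show "\<forall>D'\<in>Z. a D' * real_of_int (pD D' u) \<le> a D' * real_of_int (pD D' v)"
      proof
        fix D' assume D': "D' \<in> Z"
        have "pD D' u \<le> pD D' v"
          using pD_monotone[OF sep[OF D(1)] sep[OF D'] _ uv] D(2) D' by blast
        then show "a D' * real_of_int (pD D' u) \<le> a D' * real_of_int (pD D' v)"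
          using Z(2) D' by (intro mult_left_mono) auto
      qed
      show "\<exists>D'\<in>Z. a D' * real_of_int (pD D' u) < a D' * real_of_int (pD D' v)"
        using D(1) Z(2) uv(4) by (intro bexI[of _ D]) auto
    qed (rule Order_finite[OF Z(1)])
  }
qed

text \<open>The finest member of a chain can be read off the weighted sum: the total weight is fixed by
  siblings that are fused from the start, and then the signs of all position differences of the
  finest member follow from those of the sum.\<close>

lemma Order_unique:
  assumes np: "\<not> is_path_tree T"
  shows "Z \<in> Order_cplx T \<Longrightarrow> Z' \<in> Order_cplx T \<Longrightarrow> \<forall>D\<in>Z. 0 < a D \<Longrightarrow> \<forall>D\<in>Z'. 0 < b D \<Longrightarrow>
    (\<Sum>D\<in>Z. a D *\<^sub>R rho_gen T D) + c *\<^sub>R ones T = (\<Sum>D\<in>Z'. b D *\<^sub>R rho_gen T D) + c' *\<^sub>R ones T \<Longrightarrow>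
    Z = Z' \<and> (\<forall>D\<in>Z. a D = b D)"
\<comment> \<open>Each round lowers the weight of a common least member until at least one chain
  loses it.\<close>
proof (induction "card Z + card Z'" arbitrary: Z Z' a b rule: less_induct)
  case less
  note Z = less.prems(1) and Z' = less.prems(2) and a = less.prems(3) and b = less.prems(4)
  define x where "x = (\<Sum>D\<in>Z. a D *\<^sub>R rho_gen T D) + c *\<^sub>R ones T"
  have x': "x = (\<Sum>D\<in>Z'. b D *\<^sub>R rho_gen T D) + c' *\<^sub>R ones T" using less.prems(5) x_def by simp
  \<comment> \<open>The empty chain is treated alongside the others: the zero function leads the
    zero sum, and a branching vertex supplies the siblings.\<close>
  have first: "\<exists>f. leads f (combined Y e) \<and>
      (\<exists>k u v. u \<in> level T k \<and> v \<in> level T k \<and> sib u v \<and> f u = f v) \<and>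
      (Y = {} \<and> f = (\<lambda>_. 0) \<or> (\<exists>D\<in>Y. f = pD D))"
    if Y: "Y \<in> Order_cplx T" "\<forall>D\<in>Y. 0 < e D" for Y and e :: "'v bracketing set \<Rightarrow> real"
  proof (cases "Y = {}")
    case True
    obtain u where u: "u \<in> verts T" "\<not> length (ch T u) \<le> 1" using np unfolding is_path_tree_def by blast
    then have "sib (ch T u ! 0) (ch T u ! 1)" using sib_index[OF u(1), of 0 1] u(2) by fastforce
    moreover have "ch T u ! 0 \<in> level T (Suc (vdepth T u))" "ch T u ! 1 \<in> level T (Suc (vdepth T u))"
      using level_SucI[OF vdepth_level[OF u(1)] nth_mem, of 0] level_SucI[OF vdepth_level[OF u(1)] nth_mem, of 1] u(2)
      by fastforce+
    moreover have "leads (\<lambda>_. 0) (combined Y e)"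
      unfolding leads_def tree_monotone_def combined_def using True by simp
    ultimately show ?thesis using True by blast
  next
    case False
    then obtain D where D: "D \<in> Y" "\<forall>D'\<in>Y. gen_le T D D'" using Order_least Y(1) by blast
    have "leads (pD D) (combined Y e)" using leads_combined[OF Y D] .
    then show ?thesis using fused_siblings[OF Order_gen[OF Y(1) D(1)]] D(1) by blast
  qed
  obtain f where f: "leads f (combined Z a)"
    "\<exists>k u v. u \<in> level T k \<and> v \<in> level T k \<and> sib u v \<and> f u = f v"
    "Z = {} \<and> f = (\<lambda>_. 0) \<or> (\<exists>D\<in>Z. f = pD D)" using first[OF Z a] by blast
  obtain f' where f': "leads f' (combined Z' b)"
    "\<exists>k u v. u \<in> level T k \<and> v \<in> level T k \<and> sib u v \<and> f' u = f' v"
    "Z' = {} \<and> f' = (\<lambda>_. 0) \<or> (\<exists>D\<in>Z'. f' = pD D)" using first[OF Z' b] by blast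
  define M where "M = (\<Sum>D\<in>Z. a D) + c"
  define M' where "M' = (\<Sum>D\<in>Z'. b D) + c'"
  have g: "M * (real (pos T u) - real (pos T v)) - (combined Z a u - combined Z a v) =
      M' * (real (pos T u) - real (pos T v)) - (combined Z' b u - combined Z' b v)"
    if "u \<in> level T k" "v \<in> level T k" for k u v
    using gsum_diff_combined[OF Z that x_def] gsum_diff_combined[OF Z' that x'] unfolding M_def M'_def by simp
  \<comment> \<open>On siblings merged by \<open>f\<close> the sum over \<open>Z\<close> has
    difference zero, while the sum over \<open>Z'\<close> does not reverse them. Dividing by their
    distance compares the two totals.\<close>
  have "M' \<ge> M"
  proof -
    obtain k u v where uv: "u \<in> level T k" "v \<in> level T k" "sib u v" "f u = f v" using f(2) by blast
    have "combined Z a u = combined Z a v" using f(1) uv unfolding leads_def by blast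
    moreover have "combined Z' b u \<le> combined Z' b v" using combined_sib[OF Z' b uv(3,1,2)] .
    ultimately have "M * (real (pos T v) - real (pos T u)) \<le> M' * (real (pos T v) - real (pos T u))"
      using g[OF uv(1,2)] by (simp add: algebra_simps)
    then show ?thesis using pos_sib[OF uv(3)] by simp
  qed
  moreover have "M \<ge> M'"
  proof -
    obtain k u v where uv: "u \<in> level T k" "v \<in> level T k" "sib u v" "f' u = f' v" using f'(2) by blast
    have "combined Z' b u = combined Z' b v" using f'(1) uv unfolding leads_def by blast
    moreover have "combined Z a u \<le> combined Z a v" using combined_sib[OF Z a uv(3,1,2)] .
    ultimately have "M' * (real (pos T v) - real (pos T u)) \<le> M * (real (pos T v) - real (pos T u))"
      using g[OF uv(1,2)] by (simp add: algebra_simps)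
    then show ?thesis using pos_sib[OF uv(3)] by simp
  qed
  ultimately have MM: "M = M'" by simp
  have diff: "combined Z a u - combined Z a v = combined Z' b u - combined Z' b v"
    if "u \<in> level T k" "v \<in> level T k" for k u v
    using g[OF that] MM by simp
  have sign: "f u < f v \<longleftrightarrow> f' u < f' v" if "u \<in> level T k" "v \<in> level T k" for k u v
    by (rule leads_determines_sign[OF f(1) f'(1) _ that]) (rule diff)
  \<comment> \<open>Excludes that one chain is empty and the other is not, since the function
    leading an empty chain is constant.\<close>
  have nonconst: False if D: "gen_collision T D"
    and const: "\<And>k u v. u \<in> level T k \<Longrightarrow> v \<in> level T k \<Longrightarrow> \<not> pD D u < pD D v" for D
  proof -
    obtain k u v where uv: "u \<in> level T k" "v \<in> level T k" "pD D u \<noteq> pD D v"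
      using separated_family.dD_nonconstant[OF gen_separated[OF D] gen_nonempty[OF D]] by blast
    show False using const[OF uv(1,2)] const[OF uv(2,1)] uv(3) by linarith
  qed
  consider "Z = {}" "Z' = {}" | D where "Z = {}" "f = (\<lambda>_. 0)" "D \<in> Z'" "f' = pD D"
    | D where "Z' = {}" "f' = (\<lambda>_. 0)" "D \<in> Z" "f = pD D"
    | D D' where "D \<in> Z" "f = pD D" "D' \<in> Z'" "f' = pD D'"
    using f(3) f'(3) by blast
  then show ?case
  proof cases
    case 1
    then show ?thesis by simp
  next
    case (2 D)
    have "\<not> pD D u < pD D v" if "u \<in> level T k" "v \<in> level T k" for k u v
      using sign[OF that] 2 by simp
    then show ?thesis using nonconst[OF Order_gen[OF Z' 2(3)]] by blast
  next
    case (3 D)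
    have "\<not> pD D u < pD D v" if "u \<in> level T k" "v \<in> level T k" for k u v
      using sign[OF that] 3 by simp
    then show ?thesis using nonconst[OF Order_gen[OF Z 3(3)]] by blast
  next
    case (4 D D')
    have sgn: "pD D u < pD D v \<longleftrightarrow> pD D' u < pD D' v" if "u \<in> level T k" "v \<in> level T k" for k u v
      using sign[OF that] 4 by simp
    have DD: "D = D'"
      by (rule pD_determines[OF gen_separated[OF Order_gen[OF Z 4(1)]] gen_separated[OF Order_gen[OF Z' 4(3)]]])
        (rule sgn)
    have DZ: "D \<in> Z" "D \<in> Z'" using 4 DD by auto
    \<comment> \<open>The largest weight of \<open>D\<close> removable from both representations; at
      least one of them loses \<open>D\<close> altogether.\<close>
    define m where "m = min (a D) (b D)"
    have mpos: "m > 0" using a b DZ unfolding m_def by simp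
    define cut where "cut Y e = (if e D = m then Y - {D} else Y)" for Y and e :: "'v bracketing set \<Rightarrow> real"
    define red where "red e = e(D := e D - m)" for e :: "'v bracketing set \<Rightarrow> real"
    have cut: "cut Y e \<in> Order_cplx T" "\<forall>D'\<in>cut Y e. 0 < red e D'"
      "(\<Sum>D\<in>cut Y e. red e D *\<^sub>R rho_gen T D) = (\<Sum>D\<in>Y. e D *\<^sub>R rho_gen T D) - m *\<^sub>R rho_gen T D"
      "card (cut Y e) \<le> card Y" "e D = m \<Longrightarrow> card (cut Y e) < card Y"
      if Y: "Y \<in> Order_cplx T" "\<forall>D\<in>Y. 0 < e D" "D \<in> Y" "m \<le> e D" for Y and e :: "'v bracketing set \<Rightarrow> real"
    proof -
      have fin: "finite Y" using Order_finite Y(1) .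
      show "cut Y e \<in> Order_cplx T" by (rule Order_subset[OF Y(1)]) (auto simp: cut_def)
      show "\<forall>D'\<in>cut Y e. 0 < red e D'" using Y unfolding cut_def red_def by auto
      have "(\<Sum>D\<in>cut Y e. red e D *\<^sub>R rho_gen T D) = (\<Sum>D\<in>Y. red e D *\<^sub>R rho_gen T D)"
        using fin by (intro sum.mono_neutral_left) (auto simp: cut_def red_def split: if_splits)
      also have "\<dots> = (e D - m) *\<^sub>R rho_gen T D + (\<Sum>D\<in>Y - {D}. e D *\<^sub>R rho_gen T D)"
        using fin Y(3) by (simp add: sum.remove red_def)
      also have "\<dots> = (\<Sum>D\<in>Y. e D *\<^sub>R rho_gen T D) - m *\<^sub>R rho_gen T D"
        using fin Y(3) by (simp add: sum.remove scaleR_diff_left)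
      finally show "(\<Sum>D\<in>cut Y e. red e D *\<^sub>R rho_gen T D) = (\<Sum>D\<in>Y. e D *\<^sub>R rho_gen T D) - m *\<^sub>R rho_gen T D" .
      show "card (cut Y e) \<le> card Y" using fin unfolding cut_def by (auto intro: card_mono)
      show "e D = m \<Longrightarrow> card (cut Y e) < card Y" using fin Y(3) unfolding cut_def by (simp add: card_Diff1_less del: card_Diff_insert)
    qed
    have ma: "m \<le> a D" and mb: "m \<le> b D" unfolding m_def by auto
    note ca = cut[OF Z a DZ(1) ma] and cb = cut[OF Z' b DZ(2) mb]
    have "card (cut Z a) + card (cut Z' b) < card Z + card Z'"
    proof (cases "a D = m")
      case True
      then show ?thesis using ca(5) cb(4) by linarith
    next
      case False
      then have "b D = m" unfolding m_def by (simp add: min_def split: if_splits)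
      then show ?thesis using ca(4) cb(5) by linarith
    qed
    moreover have "(\<Sum>D\<in>cut Z a. red a D *\<^sub>R rho_gen T D) + c *\<^sub>R ones T =
        (\<Sum>D\<in>cut Z' b. red b D *\<^sub>R rho_gen T D) + c' *\<^sub>R ones T"
      unfolding ca(3) cb(3) using less.prems(5) by (simp add: algebra_simps)
    ultimately have eq: "cut Z a = cut Z' b" "\<forall>D\<in>cut Z a. red a D = red b D"
      using less.hyps[OF _ ca(1) cb(1) ca(2) cb(2)] by blast+
    \<comment> \<open>By the induction hypothesis \<open>D\<close> survives in both cut chains or in
      neither, and by the choice of \<open>m\<close> it is missing from one. So both weights equal
      \<open>m\<close>.\<close>
    have iff: "D \<in> cut Z a \<longleftrightarrow> a D \<noteq> m" "D \<in> cut Z' b \<longleftrightarrow> b D \<noteq> m" unfolding cut_def using DZ by auto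
    have ab: "a D = m" "b D = m"
      using iff eq(1) unfolding m_def by (auto simp: min_def split: if_splits)
    then have "Z - {D} = Z' - {D}" using eq(1) unfolding cut_def by simp
    then have "Z = Z'" using DZ by blast
    moreover have "a D' = b D'" if "D' \<in> Z" for D'
    proof (cases "D' = D")
      case True
      then show ?thesis using ab by simp
    next
      case False
      then have "D' \<in> cut Z a" using that unfolding cut_def by simp
      from bspec[OF eq(2) this] show ?thesis using False unfolding red_def by simp
    qed
    ultimately show ?thesis by blast
  qed
qed

end

section \<open>The velocity fans\<close>

lemma lattice_basis_unit_vectors:
  fixes T :: "'v ptree"
  shows "lattice_basis (Zm T) ((\<lambda>p. Poly_Mapping.single p 1) ` coords T)"
proof -
  define e :: "nat \<times> nat \<Rightarrow> coordvec" where "e p = Poly_Mapping.single p 1" for p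
  have fin: "finite (coords T)" unfolding coords_def by simp
  have inj: "inj_on e (coords T)"
    unfolding e_def inj_on_def by (metis lookup_single_eq lookup_single_not_eq zero_neq_one)
  have comb: "int_comb (e ` coords T) c = (\<Sum>p\<in>coords T. of_int (c (e p)) *\<^sub>R e p)" for c
    unfolding int_comb_def by (simp add: sum.reindex[OF inj])
  have look: "Poly_Mapping.lookup (int_comb (e ` coords T) c) p = (if p \<in> coords T then of_int (c (e p)) else 0)" for c p
  proof -
    have "Poly_Mapping.lookup (int_comb (e ` coords T) c) p = (\<Sum>p'\<in>coords T. of_int (c (e p')) * Poly_Mapping.lookup (e p') p)"
      unfolding comb by (simp add: lookup_sum lookup_scaleR)
    also have "\<dots> = (\<Sum>p'\<in>coords T. if p' = p then of_int (c (e p')) else 0)"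
      by (intro sum.cong) (auto simp: e_def lookup_single when_def)
    finally show ?thesis using fin by simp
  qed
  have "Zm T = range (int_comb (e ` coords T))"
  proof (intro equalityI subsetI)
    fix x assume x: "x \<in> Zm T"
    define c where "c y = \<lfloor>Poly_Mapping.lookup x (inv_into (coords T) e y)\<rfloor>" for y
    have "Poly_Mapping.lookup x p = Poly_Mapping.lookup (int_comb (e ` coords T) c) p" for p
    proof (cases "p \<in> coords T")
      case True
      have "Poly_Mapping.lookup x p \<in> \<int>" using x unfolding Zm_def by blast
      then obtain n where n: "Poly_Mapping.lookup x p = of_int n" by (rule Ints_cases)
      then have "Poly_Mapping.lookup x p = of_int (c (e p))"
        using inv_into_f_f[OF inj True] unfolding c_def by simp
      then show ?thesis using look True by simp
    next
      case False
      then have "Poly_Mapping.lookup x p = 0" using x unfolding Zm_def Rm_def by (auto simp: in_keys_iff)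
      then show ?thesis using look False by simp
    qed
    then have "x = int_comb (e ` coords T) c" by (rule poly_mapping_eqI)
    then show "x \<in> range (int_comb (e ` coords T))" by blast
  next
    fix x assume "x \<in> range (int_comb (e ` coords T))"
    then obtain c where "x = int_comb (e ` coords T) c" by blast
    then show "x \<in> Zm T" unfolding Zm_def Rm_def by (auto simp: look in_keys_iff split: if_splits)
  qed
  moreover have "c b = 0" if "int_comb (e ` coords T) c = 0" "b \<in> e ` coords T" for c b
    using that look[of c] by (metis (mono_tags, lifting) imageE lookup_zero of_int_eq_0_iff)
  ultimately show ?thesis
    unfolding lattice_basis_iff e_def[symmetric] using fin by blast
qed

text \<open>Without coordinates \<open>ones T\<close> would be zero and every real multiple of it a
  lattice point.\<close>

lemma Zm_scaleR_ones:
  assumes "coords T \<noteq> {}" "c *\<^sub>R ones T \<in> Zm T"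
  shows "c \<in> \<int>"
proof -
  obtain k i where "(k, i) \<in> coords T" using assms(1) by auto
  then have "Poly_Mapping.lookup (c *\<^sub>R ones T) (k, i) = c"
    unfolding ones_def by (simp add: lookup_scaleR mk_vec.rep_eq)
  moreover have "Poly_Mapping.lookup (c *\<^sub>R ones T) (k, i) \<in> \<int>" using assms(2) unfolding Zm_def by blast
  ultimately show ?thesis by simp
qed

text \<open>The kernel of \<open>q\<close> meets the lattice exactly in the integral multiples of
  the basis vector \<open>ones T\<close>, so the images of the other basis vectors stay
  independent.\<close>

lemma quotient_lattice_basis:
  fixes q :: "coordvec \<Rightarrow> 'q::real_vector"
  assumes q: "quotient_by_ones T q" and ne: "coords T \<noteq> {}"
    and B: "lattice_basis (Zm T) B" "ones T \<in> B"
  shows "lattice_basis (q ` Zm T) (q ` (B - {ones T}))"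
proof -
  define B' where "B' = B - {ones T}"
  have lin: "linear q" and ker: "{x \<in> Rm T. q x = 0} = range (\<lambda>c. c *\<^sub>R ones T)"
    using q unfolding quotient_by_ones_def by auto
  have q1: "q (ones T) = 0" using ker by (metis (mono_tags, lifting) mem_Collect_eq rangeI scaleR_one)
  have fin: "finite B" and Z: "Zm T = range (int_comb B)"
    and ind: "\<And>c x. int_comb B c = 0 \<Longrightarrow> x \<in> B \<Longrightarrow> c x = 0"
    using B(1) unfolding lattice_basis_iff by blast+
  have finB': "finite B'" unfolding B'_def using fin by simp
  have split: "int_comb B c = of_int (c (ones T)) *\<^sub>R ones T + int_comb B' c" for c
    unfolding B'_def by (rule int_comb_remove[OF fin B(2)])
  have zero: "c x = 0" if "q (int_comb B' c) = 0" "x \<in> B'" for c x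
  proof -
    have inZ: "int_comb B' c \<in> Zm T"
    proof -
      have "int_comb B' (c(ones T := 0)) = int_comb B' c"
        by (rule int_comb_cong) (auto simp: B'_def)
      then have "int_comb B' c = int_comb B (c(ones T := 0))" unfolding split by simp
      then show ?thesis unfolding Z by blast
    qed
    then have "int_comb B' c \<in> {x \<in> Rm T. q x = 0}" using that(1) unfolding Zm_def by blast
    then obtain r where r: "int_comb B' c = r *\<^sub>R ones T" unfolding ker by blast
    \<comment> \<open>Integrality allows \<open>- r\<close> to serve as the coefficient of
      \<open>ones T\<close> in an integral relation among the basis vectors.\<close>
    then have "r \<in> \<int>" using Zm_scaleR_ones[OF ne] inZ by metis
    then obtain m where m: "r = of_int m" by (rule Ints_cases)
    have "int_comb B (c(ones T := - m)) = of_int (- m) *\<^sub>R ones T + int_comb B' (c(ones T := - m))"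
      unfolding split by simp
    also have "int_comb B' (c(ones T := - m)) = int_comb B' c"
      by (rule int_comb_cong) (auto simp: B'_def)
    also have "of_int (- m) *\<^sub>R ones T + int_comb B' c = 0" unfolding r m by simp
    finally have "(c(ones T := - m)) x = 0" using ind that(2) B'_def by blast
    then show ?thesis using that(2) B'_def by auto
  qed
  have inj: "inj_on q B'"
  proof (rule inj_onI, rule ccontr)
    fix b b' assume b: "b \<in> B'" "b' \<in> B'" "q b = q b'" "b \<noteq> b'"
    have "int_comb B' (\<lambda>x. (if x = b then 1 else 0) + (if x = b' then - 1 else 0)) = b - b'"
      using int_comb_indicator[OF finB' b(1), of 1] int_comb_indicator[OF finB' b(2), of "- 1"]
      by (simp flip: int_comb_add)
    then have "q (int_comb B' (\<lambda>x. (if x = b then 1 else 0) + (if x = b' then - 1 else 0))) = 0"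
      using lin b(3) by (simp add: linear_diff)
    from zero[OF this b(1)] show False using b(4) by simp
  qed
  have qcomb': "int_comb (q ` B') c = q (int_comb B' (\<lambda>b. c (q b)))" for c
  proof -
    have "int_comb (q ` B') c = (\<Sum>b\<in>B'. of_int (c (q b)) *\<^sub>R q b)"
      unfolding int_comb_def by (simp add: sum.reindex[OF inj])
    then show ?thesis by (simp add: linear_int_comb[OF lin])
  qed
  have qcomb: "q (int_comb B' c) = int_comb (q ` B') (\<lambda>y. c (inv_into B' q y))" for c
    unfolding qcomb' by (intro arg_cong[where f = q] int_comb_cong) (simp add: inv_into_f_f[OF inj])
  have "q ` Zm T = range (int_comb (q ` B'))"
  proof (intro equalityI subsetI)
    fix y assume "y \<in> q ` Zm T"
    then obtain c where "y = q (int_comb B c)" unfolding Z by blast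
    then have "y = q (int_comb B' c)"
      unfolding split using lin q1 by (simp add: linear_add linear_scale)
    then show "y \<in> range (int_comb (q ` B'))" using qcomb by blast
  next
    fix y assume "y \<in> range (int_comb (q ` B'))"
    then obtain c where y: "y = q (int_comb B' (\<lambda>b. c (q b)))" using qcomb' by auto
    define c' where "c' = (\<lambda>b. c (q b))(ones T := 0)"
    have "int_comb B' c' = int_comb B' (\<lambda>b. c (q b))"
      by (rule int_comb_cong) (auto simp: B'_def c'_def)
    then have "int_comb B c' = int_comb B' (\<lambda>b. c (q b))" unfolding split by (simp add: c'_def)
    then have "y = q (int_comb B c')" using y by simp
    then show "y \<in> q ` Zm T" unfolding Z by blast
  qed
  moreover have "c y = 0" if "int_comb (q ` B') c = 0" "y \<in> q ` B'" for c y
    using zero[of "\<lambda>b. c (q b)"] that qcomb' by auto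
  ultimately show ?thesis
    unfolding lattice_basis_iff B'_def[symmetric] using finB' by blast
qed

section \<open>Chains of generalized collisions and simplices of collisions\<close>

context plane_tree
begin

lemma finite_collisions: "finite {C. collision T C}"
proof -
  define BR where "BR = {A :: 'v set list. set A \<subseteq> Pow (verts T) \<and> length A \<le> Suc (depth T)}"
  have finBR: "finite BR" unfolding BR_def using finite_lists_length_le[of "Pow (verts T)"] finite_verts by simp
  have "inj_on (\<lambda>C :: 'v bracketing. (brs C, prec C)) {C. collision T C}"
    by (rule inj_onI) (simp add: bracketing.equality)
  moreover have "(\<lambda>C. (brs C, prec C)) ` {C. collision T C} \<subseteq> Pow BR \<times> Pow (BR \<times> BR)"
  proof
    fix y assume "y \<in> (\<lambda>C. (brs C, prec C)) ` {C. collision T C}"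
    then obtain C where C: "collision T C" "y = (brs C, prec C)" by blast
    interpret tree_collision T C using tree_collisionI C(1) .
    have "A \<in> BR" if A: "A \<in> brs C" for A
    proof -
      obtain k where k: "k \<le> depth T" "is_bracket T k A" using bracket A by blast
      have "set A \<subseteq> Pow (verts T)"
      proof
        fix X assume "X \<in> set A"
        then obtain i where "i < length A" "X = A ! i" by (metis in_set_conv_nth)
        then have "X \<subseteq> level T i" using k(2) unfolding is_bracket_def by auto
        then show "X \<in> Pow (verts T)" using level_verts by blast
      qed
      then show ?thesis unfolding BR_def using k(1) bracket_length[OF k(2)] by simp
    qed
    then have "brs C \<subseteq> BR" by blast
    moreover have "prec C \<subseteq> brs C \<times> brs C" using prec_brs by auto
    ultimately show "y \<in> Pow BR \<times> Pow (BR \<times> BR)" unfolding C(2) by blast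
  qed
  ultimately show ?thesis
    using finBR by (meson finite_Pow_iff finite_SigmaI inj_on_finite)
qed

lemma finite_Order: "finite (Order_cplx T)"
proof (rule finite_subset)
  show "Order_cplx T \<subseteq> Pow (Pow {C. collision T C})"
    using gen_collisionD Order_gen by blast
qed (use finite_collisions in simp)

lemma Delta_iff: "Y \<in> Delta T \<longleftrightarrow> (\<exists>Cs. Y = set Cs \<and> distinct Cs \<and> (\<forall>C\<in>set Cs. collision T C) \<and>
    sorted_wrt (\<lambda>C1 C2. separated T C1 C2 \<or> arrow T C1 C2) Cs)"
  unfolding Delta_def sorted_wrt_iff_nth_less by auto

lemma Delta_collision: "Y \<in> Delta T \<Longrightarrow> C \<in> Y \<Longrightarrow> collision T C"
  unfolding Delta_iff by blast

lemma Delta_finite: "Y \<in> Delta T \<Longrightarrow> finite Y"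
  unfolding Delta_iff by blast

lemma finite_Delta: "finite (Delta T)"
proof (rule finite_subset)
  show "Delta T \<subseteq> Pow {C. collision T C}" using Delta_collision by blast
qed (use finite_collisions in simp)

lemma Delta_subset:
  assumes "Y \<in> Delta T" "Y' \<subseteq> Y"
  shows "Y' \<in> Delta T"
proof -
  obtain Cs where Cs: "Y = set Cs" "distinct Cs" "\<forall>C\<in>set Cs. collision T C"
    "sorted_wrt (\<lambda>C1 C2. separated T C1 C2 \<or> arrow T C1 C2) Cs"
    using assms(1) unfolding Delta_iff by blast
  have "Y' = set (filter (\<lambda>C. C \<in> Y') Cs)" using assms(2) Cs(1) by auto
  moreover have "distinct (filter (\<lambda>C. C \<in> Y') Cs)" "\<forall>C\<in>set (filter (\<lambda>C. C \<in> Y') Cs). collision T C"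
    using Cs by auto
  moreover have "sorted_wrt (\<lambda>C1 C2. separated T C1 C2 \<or> arrow T C1 C2) (filter (\<lambda>C. C \<in> Y') Cs)"
    using Cs(4) by (rule sorted_wrt_filter)
  ultimately show ?thesis unfolding Delta_iff by blast
qed

lemma Delta_pair:
  assumes "Y \<in> Delta T" "C1 \<in> Y" "C2 \<in> Y" "C1 \<noteq> C2"
  shows "separated T C1 C2 \<or> arrow T C1 C2 \<or> arrow T C2 C1"
proof -
  obtain Cs where Cs: "Y = set Cs" "sorted_wrt (\<lambda>C1 C2. separated T C1 C2 \<or> arrow T C1 C2) Cs"
    using assms(1) unfolding Delta_iff by blast
  obtain i where i: "i < length Cs" "C1 = Cs ! i" using assms(2) Cs(1) by (metis in_set_conv_nth)
  obtain j where j: "j < length Cs" "C2 = Cs ! j" using assms(3) Cs(1) by (metis in_set_conv_nth)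
  have "i < j \<or> j < i" using i j assms(4) by (metis linorder_neqE_nat)
  then show ?thesis
    using sorted_wrt_nth_less[OF Cs(2), of i j] sorted_wrt_nth_less[OF Cs(2), of j i] i j separated_sym by auto
qed

text \<open>A least member of the chain is listed in front, leaving out those of its collisions that
  occur again later.\<close>

lemma Delta_Union:
  assumes "Z \<in> Order_cplx T"
  shows "\<Union>Z \<in> Delta T"
  using assms
proof (induction "card Z" arbitrary: Z rule: less_induct)
  case less
  show ?case
  proof (cases "Z = {}")
    case True
    then show ?thesis unfolding Delta_iff by (intro exI[of _ "[]"]) auto
  next
    case False
    obtain D where D: "D \<in> Z" "\<forall>D'\<in>Z. gen_le T D D'" using Order_least[OF less.prems False] by blast
    have "card (Z - {D}) < card Z" using D(1) Order_finite[OF less.prems] by (simp add: card_Diff1_less del: card_Diff_insert)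
    then have "\<Union>(Z - {D}) \<in> Delta T" using less.hyps Order_subset[OF less.prems, of "Z - {D}"] by blast
    then obtain Cs where Cs: "\<Union>(Z - {D}) = set Cs" "distinct Cs" "\<forall>C\<in>set Cs. collision T C"
      "sorted_wrt (\<lambda>C1 C2. separated T C1 C2 \<or> arrow T C1 C2) Cs" unfolding Delta_iff by blast
    have gD: "gen_collision T D" using Order_gen[OF less.prems D(1)] .
    have "finite (D - set Cs)" using gD unfolding gen_collision_def by simp
    then obtain Ds where Ds: "set Ds = D - set Cs" "distinct Ds" using finite_distinct_list by blast
    \<comment> \<open>\<open>C\<close> has an arrow to some \<open>C3\<close> in a family containing
      \<open>C2\<close>. Either \<open>C3\<close> is \<open>C2\<close>, or \<open>C3\<close> is
      separated from \<open>C2\<close> and \<open>C\<close>, having the smaller block, inherits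
      this.\<close>
    have "separated T C C2 \<or> arrow T C C2" if C: "C \<in> D" and C2: "C2 \<in> set Cs" for C C2
    proof -
      obtain D2 where D2: "D2 \<in> Z" "C2 \<in> D2" using C2 Cs(1) by blast
      have g2: "gen_collision T D2" using Order_gen[OF less.prems D2(1)] .
      obtain C3 where C3: "C3 \<in> D2" "arrow T C C3" using D(2) D2(1) C unfolding gen_le_def by blast
      show ?thesis
      proof (cases "C3 = C2")
        case True
        then show ?thesis using C3(2) by simp
      next
        case False
        then have "separated T C3 C2" using g2 C3(1) D2(2) unfolding gen_collision_def by blast
        then show ?thesis
          using contained_separated[OF gen_collisionD[OF gD C] gen_collisionD[OF g2 C3(1)] arrow_contained[OF C3(2)]] by blast
      qed
    qed
    moreover have "sorted_wrt (\<lambda>C1 C2. separated T C1 C2 \<or> arrow T C1 C2) Ds"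
      unfolding sorted_wrt_iff_nth_less
    proof (intro allI impI)
      fix i j assume ij: "i < j" "j < length Ds"
      then have "Ds ! i \<in> D" "Ds ! j \<in> D" "Ds ! i \<noteq> Ds ! j"
        using Ds nth_mem[of i Ds] nth_mem[of j Ds] by (auto simp: nth_eq_iff_index_eq)
      then show "separated T (Ds ! i) (Ds ! j) \<or> arrow T (Ds ! i) (Ds ! j)"
        using gD unfolding gen_collision_def by blast
    qed
    ultimately have "sorted_wrt (\<lambda>C1 C2. separated T C1 C2 \<or> arrow T C1 C2) (Ds @ Cs)"
      using Cs(4) Ds(1) by (auto simp: sorted_wrt_append)
    moreover have "distinct (Ds @ Cs)" using Ds Cs(2) by auto
    moreover have "\<forall>C\<in>set (Ds @ Cs). collision T C" using Ds(1) Cs(3) gen_collisionD[OF gD] by auto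
    moreover have "\<Union>Z = set (Ds @ Cs)"
    proof -
      have "\<Union>Z = D \<union> \<Union>(Z - {D})" using D(1) by blast
      then show ?thesis using Ds(1) Cs(1) by auto
    qed
    ultimately show ?thesis unfolding Delta_iff by blast
  qed
qed

text \<open>Two members of a simplex are separated or joined by an arrow. Containment rules out
  separation, and an arrow the other way would make them equal.\<close>

lemma Delta_contained_arrow:
  assumes Y: "Y \<in> Delta T" "C1 \<in> Y" "C2 \<in> Y" and c: "contained T C1 C2"
  shows "arrow T C1 C2"
proof (cases "C1 = C2")
  case True
  then show ?thesis using arrow_refl Delta_collision Y by blast
next
  case False
  note col = Delta_collision[OF Y(1,2)] Delta_collision[OF Y(1,3)]
  have "C2 = C1" if "arrow T C2 C1" using arrow_antisym[OF col(2,1) that c] .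
  then show ?thesis
    using Delta_pair[OF Y False] contained_not_separated[OF col c] False by blast
qed

text \<open>Maximality refers to containment because that relation is transitive; arrows are
  regained from membership in a common simplex.\<close>

lemma Delta_maximal:
  assumes Y: "Y \<in> Delta T"
  defines "R \<equiv> {C \<in> Y. \<forall>C'\<in>Y. contained T C C' \<longrightarrow> C' = C}"
  shows "C \<in> Y \<Longrightarrow> \<exists>C'\<in>R. arrow T C C'" and "R \<noteq> {} \<Longrightarrow> gen_collision T R"
proof -
  have fin: "finite Y" using Delta_finite Y .
  show "C \<in> Y \<Longrightarrow> \<exists>C'\<in>R. arrow T C C'"
  proof -
    assume C: "C \<in> Y"
    define above where "above C = {C' \<in> Y. contained T C C'}" for C
    have self: "contained T C C" if "C \<in> Y" for C
      using arrow_contained arrow_refl Delta_collision[OF Y that] by blast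
    \<comment> \<open>A member with fewest members above it is maximal, since anything strictly
      above it has fewer.\<close>
    obtain C' where C': "C' \<in> above C" "\<And>C''. C'' \<in> above C \<Longrightarrow> card (above C') \<le> card (above C'')"
      using ex_has_least_nat[of "\<lambda>x. x \<in> above C" C "\<lambda>x. card (above x)"] self[OF C] C unfolding above_def by blast
    have C'Y: "C' \<in> Y" "contained T C C'" using C'(1) unfolding above_def by auto
    have "C'' = C'" if C'': "C'' \<in> Y" "contained T C' C''" for C''
    proof (rule ccontr)
      assume ne: "C'' \<noteq> C'"
      have "C' \<notin> above C''"
      proof
        assume "C' \<in> above C''"
        then have "contained T C'' C'" unfolding above_def by blast
        then have "C' = C''"
          using arrow_antisym[OF Delta_collision[OF Y C'Y(1)] Delta_collision[OF Y C''(1)]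
            Delta_contained_arrow[OF Y C'Y(1) C'']] by blast
        then show False using ne by simp
      qed
      moreover have "C' \<in> above C'" using self C'Y unfolding above_def by blast
      moreover have "above C'' \<subseteq> above C'" unfolding above_def using contained_trans[OF C''(2)] by blast
      ultimately have "above C'' \<subset> above C'" by blast
      then have "card (above C'') < card (above C')"
        using fin unfolding above_def by (intro psubset_card_mono) auto
      moreover have "C'' \<in> above C" unfolding above_def using C''(1) contained_trans[OF C'Y(2) C''(2)] by blast
      ultimately show False using C'(2)[of C''] by simp
    qed
    then have "C' \<in> R" unfolding R_def using C'Y(1) by blast
    then show ?thesis using Delta_contained_arrow[OF Y C C'Y] by blast
  qed
  assume "R \<noteq> {}"
  moreover have "separated T C1 C2" if "C1 \<in> R" "C2 \<in> R" "C1 \<noteq> C2" for C1 C2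
  proof -
    have "C1 \<in> Y" "C2 \<in> Y" "\<not> arrow T C1 C2" "\<not> arrow T C2 C1"
      using that arrow_contained[of T C1 C2] arrow_contained[of T C2 C1] unfolding R_def by auto
    then show ?thesis using Delta_pair[OF Y _ _ that(3)] by blast
  qed
  ultimately show "gen_collision T R"
    unfolding gen_collision_def using fin Delta_collision[OF Y] unfolding R_def by auto
qed

text \<open>Peeling off the maximal collisions, each time with the smallest of their weights, turns a
  weighted simplex of \<open>Delta T\<close> into a weighted chain.\<close>

lemma Delta_decomposition:
  assumes "Y \<in> Delta T" "\<forall>C\<in>Y. 0 < (l C :: real)"
  shows "\<exists>Z m. Z \<in> Order_cplx T \<and> (\<forall>D\<in>Z. 0 < m D) \<and> \<Union>Z = Y \<and> (\<forall>C\<in>Y. l C = (\<Sum>D\<in>{D \<in> Z. C \<in> D}. m D))"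
  using assms
proof (induction "card Y" arbitrary: Y l rule: less_induct)
  case less
  note Y = less.prems(1) and l = less.prems(2)
  show ?case
  proof (cases "Y = {}")
    case True
    then show ?thesis by (intro exI[of _ "{}"]) (auto simp: Order_cplx_def)
  next
    case False
    have fin: "finite Y" using Delta_finite Y .
    define R where "R = {C \<in> Y. \<forall>C'\<in>Y. contained T C C' \<longrightarrow> C' = C}"
    have up: "\<And>C. C \<in> Y \<Longrightarrow> \<exists>C'\<in>R. arrow T C C'" using Delta_maximal(1)[OF Y] unfolding R_def .
    have Rne: "R \<noteq> {}" using up False by blast
    have gR: "gen_collision T R" using Delta_maximal(2)[OF Y] Rne unfolding R_def by simp
    have RY: "R \<subseteq> Y" unfolding R_def by blast
    have finR: "finite R" using finite_subset[OF RY fin] .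
    define e where "e = Min (l ` R)"
    have ein: "e \<in> l ` R" unfolding e_def using finR Rne by (intro Min_in) auto
    then obtain C0 where C0: "C0 \<in> R" "l C0 = e" by auto
    have epos: "e > 0" using C0 RY l by auto
    have ele: "e \<le> l C" if "C \<in> R" for C unfolding e_def using finR that by simp
    \<comment> \<open>Collisions whose weight is used up leave the simplex; \<open>C0\<close> is one
      of them, so \<open>Y1\<close> is smaller.\<close>
    define Y1 where "Y1 = Y - {C \<in> R. l C = e}"
    define l1 where "l1 C = (if C \<in> R then l C - e else l C)" for C
    have sub1: "Y1 \<subseteq> Y" unfolding Y1_def by blast
    have C01: "C0 \<notin> Y1" unfolding Y1_def using C0 by blast
    have "Y1 \<subset> Y" using sub1 C01 C0(1) RY by blast
    then have "card Y1 < card Y" using fin by (simp add: psubset_card_mono)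
    moreover have "Y1 \<in> Delta T" using Delta_subset[OF Y sub1] .
    moreover have "\<forall>C\<in>Y1. 0 < l1 C"
    proof
      fix C assume C: "C \<in> Y1"
      show "0 < l1 C"
      proof (cases "C \<in> R")
        case True
        then have "l C \<noteq> e" using C unfolding Y1_def by blast
        then show ?thesis using ele[OF True] True unfolding l1_def by simp
      next
        case False
        then show ?thesis using l C sub1 unfolding l1_def by auto
      qed
    qed
    ultimately have "\<exists>Z m. Z \<in> Order_cplx T \<and> (\<forall>D\<in>Z. 0 < m D) \<and> \<Union>Z = Y1 \<and>
        (\<forall>C\<in>Y1. l1 C = (\<Sum>D\<in>{D \<in> Z. C \<in> D}. m D))"
      by (rule less.hyps)
    then obtain Z1 m1 where Z1: "Z1 \<in> Order_cplx T" "\<forall>D\<in>Z1. 0 < m1 D" "\<Union>Z1 = Y1"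
      "\<forall>C\<in>Y1. l1 C = (\<Sum>D\<in>{D \<in> Z1. C \<in> D}. m1 D)" by blast
    have finZ1: "finite Z1" using Order_finite Z1(1) .
    have RZ1: "R \<notin> Z1" using C0(1) C01 Z1(3) by blast
    define m where "m = m1(R := e)"
    \<comment> \<open>Every remaining collision has an arrow to a maximal one, so the new family
      tops the whole chain.\<close>
    have le: "gen_le T D R" if "D \<in> Z1" for D
      unfolding gen_le_def using up that Z1(3) sub1 by blast
    have "insert R Z1 \<in> Order_cplx T"
      unfolding Order_cplx_def using finZ1 gR Order_gen[OF Z1(1)] le gen_le_refl[OF gR] Order_linear[OF Z1(1)] by auto
    moreover have "\<forall>D\<in>insert R Z1. 0 < m D" unfolding m_def using epos Z1(2) by auto
    moreover have "\<Union>(insert R Z1) = Y" using Z1(3) RY unfolding Y1_def by auto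
    moreover have "l C = (\<Sum>D\<in>{D \<in> insert R Z1. C \<in> D}. m D)" if C: "C \<in> Y" for C
    proof -
      have s1: "(\<Sum>D\<in>{D \<in> Z1. C \<in> D}. m D) = (\<Sum>D\<in>{D \<in> Z1. C \<in> D}. m1 D)"
        using RZ1 unfolding m_def by (intro sum.cong) auto
      have s2: "(\<Sum>D\<in>{D \<in> Z1. C \<in> D}. m1 D) = (if C \<in> R then l C - e else l C)"
      proof (cases "C \<in> Y1")
        case True
        then show ?thesis using Z1(4) unfolding l1_def by auto
      next
        case False
        then have empty: "{D \<in> Z1. C \<in> D} = {}" using Z1(3) by blast
        have "C \<in> R" "l C = e" using False C unfolding Y1_def by auto
        then show ?thesis by (simp only: empty sum.empty) simp
      qed
      show ?thesis
      proof (cases "C \<in> R")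
        case True
        then have "{D \<in> insert R Z1. C \<in> D} = insert R {D \<in> Z1. C \<in> D}" by blast
        then have "(\<Sum>D\<in>{D \<in> insert R Z1. C \<in> D}. m D) = m R + (\<Sum>D\<in>{D \<in> Z1. C \<in> D}. m D)"
          using RZ1 finZ1 by simp
        then show ?thesis using s1 s2 True unfolding m_def by simp
      next
        case False
        then have "{D \<in> insert R Z1. C \<in> D} = {D \<in> Z1. C \<in> D}" by blast
        then show ?thesis using s1 s2 False by simp
      qed
    qed
    ultimately show ?thesis by blast
  qed
qed

section \<open>Unitriangularity of the generators of a chain\<close>

lemma rho_Zm: "rho T C \<in> Zm T"
  unfolding Zm_def using rho_Rm by (auto simp: rho_def mk_vec.rep_eq)

lemma ones_Zm: "ones T \<in> Zm T"
  unfolding Zm_def using ones_Rm by (auto simp: ones_def mk_vec.rep_eq)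

lemma rho_gen_Zm: "rho_gen T D \<in> Zm T"
proof -
  have "Poly_Mapping.lookup (rho_gen T D) p \<in> \<int>" for p
    unfolding rho_gen_def lookup_sum using rho_Zm unfolding Zm_def by (intro Ints_sum) blast
  then show ?thesis unfolding Zm_def using rho_gen_Rm by blast
qed

lemma gsum_Ints: "x \<in> Zm T \<Longrightarrow> gsum k v x \<in> \<int>"
  unfolding gsum_def Zm_def by (intro Ints_sum) blast

text \<open>A branching vertex makes the next level have at least two vertices.\<close>

lemma coords_nonempty:
  assumes "\<not> is_path_tree T"
  shows "coords T \<noteq> {}"
proof -
  obtain u where u: "u \<in> verts T" "\<not> length (ch T u) \<le> 1" using assms unfolding is_path_tree_def by blast
  define k where "k = Suc (vdepth T u)"
  have sub: "set (ch T u) \<subseteq> level T k" unfolding k_def using level_SucI[OF vdepth_level[OF u(1)]] by blast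
  have "card (set (ch T u)) = length (ch T u)" using distinct_card[OF distinct_ch[OF u(1)]] .
  then have "2 \<le> card (level T k)" using card_mono[OF finite_level sub] u(2) by linarith
  moreover have "0 < length (ch T u)" using u(2) by linarith
  then have "ch T u ! 0 \<in> level T k" using subsetD[OF sub nth_mem] by blast
  then have "k \<le> depth T" by (rule level_le_depth)
  ultimately have "(k, 1) \<in> coords T" unfolding coords_def k_def by auto
  then show ?thesis by blast
qed

text \<open>Insertion runs from coarse to fine: \<open>ones T\<close> is innermost and the finest
  member comes last, so its functional has to vanish on \<open>ones T\<close> and on all coarser
  members.\<close>

lemma Order_unitriangular:
  assumes np: "\<not> is_path_tree T"
  shows "Z \<in> Order_cplx T \<Longrightarrow> unitriangular (Zm T) (insert (ones T) (rho_gen T ` Z))"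
proof (induction "card Z" arbitrary: Z rule: less_induct)
  case less
  show ?case
  proof (cases "Z = {}")
    case True
    obtain k i where ki: "(k, i) \<in> coords T" using coords_nonempty[OF np] by auto
    have "linear (\<lambda>x :: coordvec. Poly_Mapping.lookup x (k, i))"
      by (rule linearI) (simp_all add: lookup_add lookup_scaleR)
    moreover have "\<forall>x\<in>Zm T. Poly_Mapping.lookup x (k, i) \<in> \<int>" unfolding Zm_def by blast
    moreover have "Poly_Mapping.lookup (ones T) (k, i) = 1" using ki unfolding ones_def by (simp add: lookup_mk_vec)
    ultimately have "unitriangular (Zm T) {ones T}"
      using unitriangular.insert[OF unitriangular.empty ones_Zm] by blast
    then show ?thesis using True by simp
  next
    case False
    note Z = less.prems
    obtain D where D: "D \<in> Z" "\<forall>D'\<in>Z. gen_le T D D'" using Order_least[OF Z False] by blast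
    note sep = gen_separated[OF Order_gen[OF Z]]
    have sepD: "separated_family T D" using sep D(1) .
    define Z' where "Z' = Z - {D}"
    have Z'O: "Z' \<in> Order_cplx T" unfolding Z'_def by (rule Order_subset[OF Z]) blast
    have "card Z' < card Z" unfolding Z'_def using D(1) Order_finite[OF Z] by (simp add: card_Diff1_less del: card_Diff_insert)
    then have IH: "unitriangular (Zm T) (insert (ones T) (rho_gen T ` Z'))" using less.hyps Z'O by blast
    \<comment> \<open>Comparison with the empty family, whose positions are the original ones, gives
      a pair adjacent in \<open>T\<close> and merged by \<open>D\<close>, hence by the whole
      chain.\<close>
    have gle: "gen_le T {} D" unfolding gen_le_def by blast
    have "{} \<noteq> D" using gen_nonempty[OF Order_gen[OF Z D(1)]] by blast
    then obtain k0 u0 v0 where 0: "u0 \<in> level T (Suc k0)" "v0 \<in> level T (Suc k0)"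
      "pD {} v0 = pD {} u0 + 1" "pD D u0 = pD D v0"
      using pD_merged_pair[OF empty_separated sepD gle] by blast
    have pos0: "real (pos T v0) - real (pos T u0) = 1"
      using 0(3) unfolding separated_family.dD_def[OF empty_separated] by simp
    have merged0: "pD D' u0 = pD D' v0" if "D' \<in> Z" for D'
      using pD_coarsens[OF sepD sep[OF that] _ 0(1,2,4)] D(2) that by blast
    \<comment> \<open>A normalizing functional with value 1 on all generators and on
      \<open>ones T\<close>, since its pair has original distance 1 and is merged
      everywhere.\<close>
    define g where "g x = gsum (Suc k0) v0 x - gsum (Suc k0) u0 x" for x
    have g: "g (rho_gen T D') = 1" if "D' \<in> Z" for D'
      using gsum_diff_rho_gen[OF sep[OF that] 0(2,1)] merged0[OF that] pos0 unfolding g_def by simp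
    have g1: "g (ones T) = 1"
      using gsum_diff_ones[OF 0(2,1)] pos0 unfolding g_def by simp
    \<comment> \<open>A pair adjacent after contracting \<open>D\<close> and merged by all coarser
      members.\<close>
    obtain k u v where uv: "u \<in> level T (Suc k)" "v \<in> level T (Suc k)" "pD D v = pD D u + 1"
      "\<And>D'. D' \<in> Z' \<Longrightarrow> pD D' u = pD D' v"
    proof (cases "Z' = {}")
      case True
      obtain k u v where "u \<in> level T (Suc k)" "v \<in> level T (Suc k)" "pD D v = pD D u + 1"
        using pD_merged_pair_top[OF sepD] separated_family.dD_nonconstant[OF sepD gen_nonempty[OF Order_gen[OF Z D(1)]]]
        by blast
      then show thesis using True by (intro that[of u k v]) auto
    next
      case False
      obtain D2 where D2: "D2 \<in> Z'" "\<forall>D'\<in>Z'. gen_le T D2 D'" using Order_least[OF Z'O False] by blast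
      have D2Z: "D2 \<in> Z" "D \<noteq> D2" using D2(1) unfolding Z'_def by auto
      have le2: "gen_le T D D2" using D(2) D2Z(1) by blast
      obtain k u v where uv: "u \<in> level T (Suc k)" "v \<in> level T (Suc k)" "pD D v = pD D u + 1" "pD D2 u = pD D2 v"
        using pD_merged_pair[OF sepD sep[OF D2Z(1)] le2 D2Z(2)] by blast
      have "pD D' u = pD D' v" if D': "D' \<in> Z'" for D'
      proof -
        have "D' \<in> Z" "gen_le T D2 D'" using D' D2(2) unfolding Z'_def by auto
        then show ?thesis using pD_coarsens[OF sep[OF D2Z(1)] sep[of D'] _ uv(1,2,4)] by blast
      qed
      then show thesis using uv by (intro that[of u k v]) auto
    qed
    \<comment> \<open>Scaling \<open>g\<close> by the original distance \<open>dl\<close> cancels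
      the original positions. What is left is the difference of contracted positions: 1 for
      \<open>D\<close>, 0 for the coarser members, and 0 for \<open>ones T\<close>.\<close>
    define dl where "dl = real (pos T v) - real (pos T u)"
    define f where "f x = dl * g x - (gsum (Suc k) v x - gsum (Suc k) u x)" for x
    have frho: "f (rho_gen T D') = real_of_int (pD D' v) - real_of_int (pD D' u)" if "D' \<in> Z" for D'
      using gsum_diff_rho_gen[OF sep[OF that] uv(2,1)] g[OF that] unfolding f_def dl_def by simp
    have "f (rho_gen T D) = 1" using frho[OF D(1)] uv(3) by simp
    moreover have "f (rho_gen T D') = 0" if "D' \<in> Z'" for D'
      using frho[of D'] uv(4)[OF that] that unfolding Z'_def by simp
    moreover have "f (ones T) = 0"
      using gsum_diff_ones[OF uv(2,1)] g1 unfolding f_def dl_def by simp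
    moreover have "linear f"
      unfolding f_def g_def
      by (rule linearI) (simp_all add: linear_add[OF linear_gsum] linear_scale[OF linear_gsum] algebra_simps)
    moreover have "\<forall>x\<in>Zm T. f x \<in> \<int>"
      unfolding f_def g_def dl_def using gsum_Ints by (auto intro!: Ints_diff Ints_mult)
    ultimately have "unitriangular (Zm T) (insert (rho_gen T D) (insert (ones T) (rho_gen T ` Z')))"
      by (intro unitriangular.insert[OF IH rho_gen_Zm, of f]) auto
    moreover have "insert (rho_gen T D) (insert (ones T) (rho_gen T ` Z')) = insert (ones T) (rho_gen T ` Z)"
      unfolding Z'_def using D(1) by auto
    ultimately show ?thesis by simp
  qed
qed

end

section \<open>The two systems of rays in the quotient\<close>

locale velocity = plane_tree T for T :: "'v ptree" +
  fixes q :: "coordvec \<Rightarrow> 'q::real_vector"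
  assumes not_path: "\<not> is_path_tree T" and quotient: "quotient_by_ones T q"
begin

lemma linear_q: "linear q"
  using quotient unfolding quotient_by_ones_def by blast

lemma kernel_q: "x \<in> Rm T \<Longrightarrow> q x = 0 \<Longrightarrow> \<exists>c. x = c *\<^sub>R ones T"
  using quotient unfolding quotient_by_ones_def by blast

lemma q_ones: "q (ones T) = 0"
proof -
  have "1 *\<^sub>R ones T \<in> {x \<in> Rm T. q x = 0}" using quotient unfolding quotient_by_ones_def by blast
  then show ?thesis by simp
qed

lemma q_sum: "q (\<Sum>i\<in>I. a i *\<^sub>R r i) = (\<Sum>i\<in>I. a i *\<^sub>R q (r i))"
  by (simp add: linear_sum[OF linear_q] linear_scale[OF linear_q])

text \<open>Adding the line through \<open>ones T\<close> is invisible after \<open>q\<close>, and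
  linear maps commute with generated cones.\<close>

lemma q_tau: "q ` tau T G = convex_cone hull (q ` G)"
proof -
  have "q ` tau T G = q ` (convex_cone hull G)"
  proof (intro equalityI subsetI)
    fix y assume "y \<in> q ` tau T G"
    then obtain x c where x: "x \<in> convex_cone hull G" "y = q (x + c *\<^sub>R ones T)" unfolding tau_def by blast
    then have "y = q x" using q_ones by (simp add: linear_add[OF linear_q] linear_scale[OF linear_q])
    then show "y \<in> q ` (convex_cone hull G)" using x(1) by blast
  next
    fix y assume "y \<in> q ` (convex_cone hull G)"
    then obtain x where x: "x \<in> convex_cone hull G" "y = q (x + 0 *\<^sub>R ones T)" by auto
    then show "y \<in> q ` tau T G" unfolding tau_def by blast
  qed
  then show ?thesis using convex_cone_hull_linear_image[OF linear_q] by metis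
qed

end

text \<open>Equal images under \<open>q\<close> mean equality up to a multiple of
  \<open>ones T\<close>, the form in which \<open>Order_unique\<close> was proved.\<close>

sublocale velocity \<subseteq> O: simplicial_rays "Order_cplx T" "\<lambda>D. q (rho_gen T D)"
proof
  show "finite (Order_cplx T)" by (rule finite_Order)
  show "{} \<in> Order_cplx T" unfolding Order_cplx_def by simp
  fix Z assume "Z \<in> Order_cplx T"
  then show "finite Z" by (rule Order_finite)
next
  fix Z Z' assume "Z \<in> Order_cplx T" "Z' \<subseteq> Z"
  then show "Z' \<in> Order_cplx T" by (rule Order_subset)
next
  fix a b :: "_ \<Rightarrow> real"
  assume a: "\<forall>i. 0 \<le> a i" and b: "\<forall>i. 0 \<le> b i"
    and Z: "{i. a i \<noteq> 0} \<in> Order_cplx T" and Z': "{i. b i \<noteq> 0} \<in> Order_cplx T"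
    and eq: "(\<Sum>i | a i \<noteq> 0. a i *\<^sub>R q (rho_gen T i)) = (\<Sum>i | b i \<noteq> 0. b i *\<^sub>R q (rho_gen T i))"
  define x where "x = (\<Sum>i | a i \<noteq> 0. a i *\<^sub>R rho_gen T i)"
  define y where "y = (\<Sum>i | b i \<noteq> 0. b i *\<^sub>R rho_gen T i)"
  have "x \<in> Rm T" "y \<in> Rm T"
    unfolding x_def y_def by (auto intro!: subspace_sum[OF subspace_Rm] subspace_scale[OF subspace_Rm] rho_gen_Rm)
  then have "x - y \<in> Rm T" by (rule subspace_diff[OF subspace_Rm])
  moreover have "q (x - y) = 0"
    unfolding x_def y_def using eq by (simp add: linear_diff[OF linear_q] q_sum)
  ultimately obtain c where "x - y = c *\<^sub>R ones T" using kernel_q by blast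
  then have "x + 0 *\<^sub>R ones T = y + c *\<^sub>R ones T" by (simp add: algebra_simps)
  note eq' = this[unfolded x_def y_def]
  have "\<forall>i\<in>{i. a i \<noteq> 0}. 0 < a i" "\<forall>i\<in>{i. b i \<noteq> 0}. 0 < b i" using a b by (auto simp: order_less_le)
  from Order_unique[OF not_path Z Z' this eq']
  have "{i. a i \<noteq> 0} = {i. b i \<noteq> 0}" "\<forall>i\<in>{i. a i \<noteq> 0}. a i = b i" by auto
  then show "a = b" by (intro ext) (metis (mono_tags, lifting) mem_Collect_eq)
qed

context velocity
begin

lemma q_rho_gen: "q (rho_gen T D) = (\<Sum>C\<in>D. q (rho T C))"
  unfolding rho_gen_def by (simp add: linear_sum[OF linear_q])

text \<open>Double counting of the pairs formed by a collision and a member of the chain containing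
  it.\<close>

lemma chain_sum:
  assumes Z: "finite Z" "\<Union>Z = Y" "finite Y" and l: "\<forall>C\<in>Y. l C = (\<Sum>D\<in>{D \<in> Z. C \<in> D}. m D)"
  shows "(\<Sum>D\<in>Z. m D *\<^sub>R q (rho_gen T D)) = (\<Sum>C\<in>Y. l C *\<^sub>R q (rho T C))"
proof -
  have "(\<Sum>C\<in>Y. l C *\<^sub>R q (rho T C)) = (\<Sum>C\<in>Y. \<Sum>D\<in>{D \<in> Z. C \<in> D}. m D *\<^sub>R q (rho T C))"
    using l by (intro sum.cong) (auto simp: scaleR_sum_left)
  also have "\<dots> = (\<Sum>C\<in>Y. \<Sum>D\<in>Z. if C \<in> D then m D *\<^sub>R q (rho T C) else 0)"
    by (intro sum.cong refl sum.inter_filter Z(1))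
  also have "\<dots> = (\<Sum>D\<in>Z. \<Sum>C\<in>Y. if C \<in> D then m D *\<^sub>R q (rho T C) else 0)"
    by (rule sum.swap)
  also have "\<dots> = (\<Sum>D\<in>Z. m D *\<^sub>R q (rho_gen T D))"
  proof (rule sum.cong)
    fix D assume D: "D \<in> Z"
    have "(\<Sum>C\<in>Y. if C \<in> D then m D *\<^sub>R q (rho T C) else 0) = (\<Sum>C\<in>{C \<in> Y. C \<in> D}. m D *\<^sub>R q (rho T C))"
      by (rule sum.inter_filter[OF Z(3), symmetric])
    also have "{C \<in> Y. C \<in> D} = D" using D Z(2) by blast
    finally show "(\<Sum>C\<in>Y. if C \<in> D then m D *\<^sub>R q (rho T C) else 0) = m D *\<^sub>R q (rho_gen T D)"
      unfolding q_rho_gen by (simp add: scaleR_sum_right)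
  qed simp
  finally show ?thesis by simp
qed

lemma Delta_chain:
  assumes a: "\<forall>C. 0 \<le> a C" "{C. a C \<noteq> 0} \<in> Delta T"
  obtains Z m where "Z \<in> Order_cplx T" "\<forall>D\<in>Z. 0 < m D" "\<forall>D. D \<notin> Z \<longrightarrow> m D = 0" "\<Union>Z = {C. a C \<noteq> 0}"
    "\<forall>C\<in>{C. a C \<noteq> 0}. a C = (\<Sum>D\<in>{D \<in> Z. C \<in> D}. m D)"
    "(\<Sum>D\<in>Z. m D *\<^sub>R q (rho_gen T D)) = (\<Sum>C | a C \<noteq> 0. a C *\<^sub>R q (rho T C))"
proof -
  have "\<forall>C\<in>{C. a C \<noteq> 0}. 0 < a C" using a(1) by (auto simp: order_less_le)
  from Delta_decomposition[OF a(2) this]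
  obtain Z m where Z: "Z \<in> Order_cplx T" "\<forall>D\<in>Z. 0 < m D" "\<Union>Z = {C. a C \<noteq> 0}"
    "\<forall>C\<in>{C. a C \<noteq> 0}. a C = (\<Sum>D\<in>{D \<in> Z. C \<in> D}. m D)" by blast
  define m' where "m' D = (if D \<in> Z then m D else 0)" for D
  have m': "\<forall>C\<in>{C. a C \<noteq> 0}. a C = (\<Sum>D\<in>{D \<in> Z. C \<in> D}. m' D)"
    using Z(4) unfolding m'_def by simp
  show thesis
  proof (rule that[OF Z(1) _ _ Z(3) m' chain_sum[OF Order_finite[OF Z(1)] Z(3) Delta_finite[OF a(2)] m']])
    show "\<forall>D\<in>Z. 0 < m' D" "\<forall>D. D \<notin> Z \<longrightarrow> m' D = 0" using Z(2) unfolding m'_def by auto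
  qed
qed

end

text \<open>Both representations turn into weighted chains with the same sum, so the chains agree,
  and with them the coefficients, which are sums of chain weights.\<close>

sublocale velocity \<subseteq> Y: simplicial_rays "Delta T" "\<lambda>C. q (rho T C)"
proof
  show "finite (Delta T)" by (rule finite_Delta)
  show "{} \<in> Delta T" unfolding Delta_iff by (intro exI[of _ "[]"]) auto
  fix Y assume "Y \<in> Delta T"
  then show "finite Y" by (rule Delta_finite)
next
  fix Y Y' assume "Y \<in> Delta T" "Y' \<subseteq> Y"
  then show "Y' \<in> Delta T" by (rule Delta_subset)
next
  fix a b :: "_ \<Rightarrow> real"
  assume a: "\<forall>i. 0 \<le> a i" and b: "\<forall>i. 0 \<le> b i"
    and Y: "{i. a i \<noteq> 0} \<in> Delta T" and Y': "{i. b i \<noteq> 0} \<in> Delta T"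
    and eq: "(\<Sum>i | a i \<noteq> 0. a i *\<^sub>R q (rho T i)) = (\<Sum>i | b i \<noteq> 0. b i *\<^sub>R q (rho T i))"
  obtain Z m where Z: "Z \<in> Order_cplx T" "\<forall>D\<in>Z. 0 < m D" "\<forall>D. D \<notin> Z \<longrightarrow> m D = 0" "\<Union>Z = {C. a C \<noteq> 0}"
    "\<forall>C\<in>{C. a C \<noteq> 0}. a C = (\<Sum>D\<in>{D \<in> Z. C \<in> D}. m D)"
    "(\<Sum>D\<in>Z. m D *\<^sub>R q (rho_gen T D)) = (\<Sum>C | a C \<noteq> 0. a C *\<^sub>R q (rho T C))"
    using Delta_chain[OF a Y] .
  obtain Z' m' where Z': "Z' \<in> Order_cplx T" "\<forall>D\<in>Z'. 0 < m' D" "\<forall>D. D \<notin> Z' \<longrightarrow> m' D = 0" "\<Union>Z' = {C. b C \<noteq> 0}"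
    "\<forall>C\<in>{C. b C \<noteq> 0}. b C = (\<Sum>D\<in>{D \<in> Z'. C \<in> D}. m' D)"
    "(\<Sum>D\<in>Z'. m' D *\<^sub>R q (rho_gen T D)) = (\<Sum>C | b C \<noteq> 0. b C *\<^sub>R q (rho T C))"
    using Delta_chain[OF b Y'] .
  have nonneg: "\<forall>D. 0 \<le> m D" "\<forall>D. 0 \<le> m' D" using Z(2,3) Z'(2,3) by (metis less_imp_le order_refl)+
  have mm: "m = m'"
    by (rule O.unique_rep_in[OF Z(1) Z'(1) nonneg Z(3) Z'(3)]) (simp add: Z(6) Z'(6) eq)
  have supp: "D \<in> Z \<longleftrightarrow> m D \<noteq> 0" "D \<in> Z' \<longleftrightarrow> m' D \<noteq> 0" for D using Z(2,3) Z'(2,3) by (metis less_irrefl)+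
  have ZZ: "Z = Z'" using supp mm by (intro set_eqI) simp
  show "a = b"
  proof
    fix C
    show "a C = b C"
    proof (cases "C \<in> \<Union>Z")
      case True
      then have "C \<in> {C. a C \<noteq> 0}" "C \<in> {C. b C \<noteq> 0}" unfolding Z(4)[symmetric] Z'(4)[symmetric] ZZ by auto
      then have "a C = (\<Sum>D\<in>{D \<in> Z. C \<in> D}. m D)" "b C = (\<Sum>D\<in>{D \<in> Z'. C \<in> D}. m' D)"
        using Z(5) Z'(5) by blast+
      then show ?thesis unfolding ZZ mm by simp
    next
      case False
      then show ?thesis using Z(4) Z'(4) ZZ by auto
    qed
  qed
qed

section \<open>Triangulation, smoothness and flagness\<close>

context velocity
begin

lemma permutahedral_eq: "permutahedral_fan T q = O.fan"
  unfolding permutahedral_fan_def O.fan_def O.spanned_def q_tau image_image by (simp add: Setcompr_eq_image)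

lemma triangulated_eq: "triangulated_velocity_fan T q = Y.fan"
  unfolding triangulated_velocity_fan_def Y.fan_def Y.spanned_def q_tau image_image by (simp add: Setcompr_eq_image)

lemma chain_in_simplex:
  assumes "Y \<in> Delta T" "Z \<in> Order_cplx T" "\<Union>Z \<subseteq> Y"
  shows "O.spanned Z \<subseteq> Y.spanned Y"
  unfolding O.spanned_def
proof (rule hull_minimal)
  show "convex_cone (Y.spanned Y)" by (rule Y.spanned_convex_cone)
  show "(\<lambda>D. q (rho_gen T D)) ` Z \<subseteq> Y.spanned Y"
  proof
    fix y assume "y \<in> (\<lambda>D. q (rho_gen T D)) ` Z"
    then obtain D where D: "D \<in> Z" "y = q (rho_gen T D)" by blast
    have DY: "D \<subseteq> Y" using D(1) assms(3) by blast
    have "(\<Sum>C\<in>D. 1 *\<^sub>R q (rho T C)) \<in> Y.spanned D"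
      by (rule Y.spannedI[OF Delta_subset[OF assms(1) DY]]) simp
    then have "y \<in> Y.spanned D" unfolding D(2) q_rho_gen by simp
    then show "y \<in> Y.spanned Y" using Y.spanned_mono[OF DY] by blast
  qed
qed

text \<open>Decomposing the coefficients of a point gives a chain whose union is their support and
  hence lies in \<open>Y\<close>.\<close>

lemma simplex_is_union:
  assumes "Y \<in> Delta T"
  shows "Y.spanned Y = \<Union>{O.spanned Z | Z. Z \<in> Order_cplx T \<and> \<Union>Z \<subseteq> Y}"
proof (intro equalityI subsetI)
  fix x assume "x \<in> Y.spanned Y"
  then obtain a where a: "\<forall>i. 0 \<le> a i" "\<forall>i. i \<notin> Y \<longrightarrow> a i = 0" "x = (\<Sum>i\<in>Y. a i *\<^sub>R q (rho T i))"
    by (rule Y.spannedE[OF assms])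
  have sub: "{C. a C \<noteq> 0} \<subseteq> Y" using a(2) by auto
  obtain Z m where Z: "Z \<in> Order_cplx T" "\<forall>D\<in>Z. 0 < m D" "\<forall>D. D \<notin> Z \<longrightarrow> m D = 0" "\<Union>Z = {C. a C \<noteq> 0}"
    "\<forall>C\<in>{C. a C \<noteq> 0}. a C = (\<Sum>D\<in>{D \<in> Z. C \<in> D}. m D)"
    "(\<Sum>D\<in>Z. m D *\<^sub>R q (rho_gen T D)) = (\<Sum>C | a C \<noteq> 0. a C *\<^sub>R q (rho T C))"
    using Delta_chain[OF a(1) Delta_subset[OF assms sub]] .
  have "x = (\<Sum>C | a C \<noteq> 0. a C *\<^sub>R q (rho T C))"
    unfolding a(3) using sub Delta_finite[OF assms] by (intro sum.mono_neutral_right) auto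
  then have x: "x = (\<Sum>D\<in>Z. m D *\<^sub>R q (rho_gen T D))" using Z(6) by simp
  have "\<forall>D. 0 \<le> m D" using Z(2,3) by (metis less_imp_le order_refl)
  then have "x \<in> O.spanned Z" unfolding x using O.spannedI[OF Z(1)] by blast
  then show "x \<in> \<Union>{O.spanned Z | Z. Z \<in> Order_cplx T \<and> \<Union>Z \<subseteq> Y}" using Z(1,4) sub by auto
next
  fix x assume "x \<in> \<Union>{O.spanned Z | Z. Z \<in> Order_cplx T \<and> \<Union>Z \<subseteq> Y}"
  then show "x \<in> Y.spanned Y" using chain_in_simplex[OF assms] by auto
qed

lemma triangulation: "is_triangulation_of O.fan Y.fan"
  unfolding is_triangulation_of_def
proof (intro conjI ballI)
  show "is_fan Y.fan" by (rule Y.simplicial_fan(1))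
  show "is_fan O.fan" by (rule O.simplicial_fan(1))
  show "\<Union>O.fan = \<Union>Y.fan"
  proof (intro equalityI subsetI)
    fix x assume "x \<in> \<Union>O.fan"
    then obtain Z where Z: "Z \<in> Order_cplx T" "x \<in> O.spanned Z" unfolding O.fan_def by blast
    have "x \<in> Y.spanned (\<Union>Z)" using chain_in_simplex[OF Delta_Union[OF Z(1)] Z(1) order_refl] Z(2) by blast
    then show "x \<in> \<Union>Y.fan" unfolding Y.fan_def using Delta_Union[OF Z(1)] by blast
  next
    fix x assume "x \<in> \<Union>Y.fan"
    then obtain Y where Y: "Y \<in> Delta T" "x \<in> Y.spanned Y" unfolding Y.fan_def by blast
    then show "x \<in> \<Union>O.fan" unfolding simplex_is_union[OF Y(1)] O.fan_def by auto
  qed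
  fix \<sigma> assume "\<sigma> \<in> O.fan"
  then show "simplicial_cone \<sigma>" using O.simplicial_fan(2) by blast
next
  fix \<sigma> assume "\<sigma> \<in> Y.fan"
  then obtain Y where Y: "Y \<in> Delta T" "\<sigma> = Y.spanned Y" unfolding Y.fan_def by blast
  define S where "S = {O.spanned Z | Z. Z \<in> Order_cplx T \<and> \<Union>Z \<subseteq> Y}"
  have "S \<subseteq> O.fan" unfolding S_def O.fan_def by auto
  moreover have "\<sigma> = \<Union>S" unfolding Y(2) S_def by (rule simplex_is_union[OF Y(1)])
  ultimately show "\<exists>S\<subseteq>O.fan. \<sigma> = \<Union>S" by (intro exI conjI)
qed

lemma smooth: "smooth_fan (q ` Zm T) O.fan"
  unfolding smooth_fan_def
proof
  fix \<sigma> assume "\<sigma> \<in> O.fan"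
  then obtain Z where Z: "Z \<in> Order_cplx T" "\<sigma> = O.spanned Z" unfolding O.fan_def by blast
  obtain B where B: "lattice_basis (Zm T) B" "insert (ones T) (rho_gen T ` Z) \<subseteq> B"
    using unitriangular_extends[OF Order_unitriangular[OF not_path Z(1)] lattice_basis_unit_vectors]
    by (elim exE conjE)
  have "lattice_basis (q ` Zm T) (q ` (B - {ones T}))"
    using quotient_lattice_basis[OF quotient coords_nonempty[OF not_path] B(1)] B(2) by blast
  moreover have "\<sigma> = convex_cone hull ((\<lambda>D. q (rho_gen T D)) ` Z)" unfolding Z(2) O.spanned_def ..
  moreover have "(\<lambda>D. q (rho_gen T D)) ` Z \<subseteq> q ` (B - {ones T})"
  proof
    fix y assume "y \<in> (\<lambda>D. q (rho_gen T D)) ` Z"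
    then obtain D where D: "D \<in> Z" "y = q (rho_gen T D)" by blast
    \<comment> \<open>The vector dropped from the basis has image zero, so it is none of the
      generators.\<close>
    have "q (rho_gen T D) \<noteq> 0" using O.ray_nonzero[OF O.simplex_sing[OF Z(1) D(1)]] .
    then have "rho_gen T D \<noteq> ones T" using q_ones by metis
    then show "y \<in> q ` (B - {ones T})" using D B(2) by blast
  qed
  ultimately show "\<exists>G B. \<sigma> = convex_cone hull G \<and> G \<subseteq> B \<and> lattice_basis (q ` Zm T) B"
    by (intro exI conjI)
qed

text \<open>Chains are defined by pairwise comparability, so the order complex is a clique complex
  by its form.\<close>

lemma flag: "flag_fan O.fan"
proof (rule O.flag_fanI)
  fix X assume X: "finite X" "\<And>i j. i \<in> X \<Longrightarrow> j \<in> X \<Longrightarrow> {i, j} \<in> Order_cplx T"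
  have "gen_collision T D" if "D \<in> X" for D using Order_gen[OF X(2)[OF that that]] by blast
  moreover have "gen_le T D D' \<or> gen_le T D' D" if "D \<in> X" "D' \<in> X" for D D'
    using Order_linear[OF X(2)[OF that], of D D'] by blast
  ultimately show "X \<in> Order_cplx T" unfolding Order_cplx_def using X(1) by blast
qed

end

theorem proposition5p48:
  fixes T :: "'v ptree" and q :: "coordvec \<Rightarrow> 'q::real_vector"
  assumes "rooted_plane_tree T" and "depth T \<ge> 1" and "\<not> is_path_tree T"
    and "quotient_by_ones T q"
  shows "is_triangulation_of (permutahedral_fan T q) (triangulated_velocity_fan T q) \<and>
    smooth_fan (q ` Zm T) (permutahedral_fan T q) \<and>
    flag_fan (permutahedral_fan T q)"
proof -
  interpret velocity T q by unfold_locales (use assms in auto)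
  show ?thesis
    unfolding permutahedral_eq triangulated_eq using triangulation smooth flag by blast
qed

end
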